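(* Let $X$ be a second-countable locally compact Hausdorff space, let $T\colon\mathbb N^k\curvearrowright X$ be an action by local homeomorphisms, and let $\pi\colon X\times\mathbb T^k\to\operatorname{Prim}(C^*(G_T))$ be the map $\pi(x,z)=\ker(\pi_{(x,z)})$. Let $A\subseteq\operatorname{Prim}(C^*(G_T))$ be an open subset. Suppose that $(x,z)\in\pi^{-1}(A)$ and that $\mathcal B=(B_\alpha)_{\alpha\in\mathcal J_x}$ is a family of open bisections of $G_T$ such that $\alpha\in B_\alpha\subseteq c^{-1}(c(\alpha))$ for each $\alpha\in\mathcal J_x$. Then there exist an open neighbourhood $U\subseteq B_x\cap X$ of $x$ and an open neighbourhood $V\subseteq\mathbb T^k$ of $z$ such that the $\mathcal B$-saturation $(U\times V)\cdot(\mathcal B^{\mathrm{ess}})^\perp$ of $U\times V$ is contained in $\pi^{-1}(A)$.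
   Context: Conventions: $\mathbb N$ contains $0$; for $z\in\mathbb T^k$, $n\in\mathbb Z^k$, $z^n=\prod_i z_i^{n_i}$. An action $T\colon\mathbb N^k\curvearrowright X$ by local homeomorphisms is a monoid homomorphism $n\mapsto T^n$ from $\mathbb N^k$ to the monoid of local homeomorphisms $X\to X$. Its Deaconu--Renault groupoid is $G_T=\{(x,p-q,y): x,y\in X,\ p,q\in\mathbb N^k,\ T^p(x)=T^q(y)\}$ with $r(x,m,y)=x$, $s(x,m,y)=y$, $(x,m,y)(y,n,w)=(x,m+n,w)$, $(x,m,y)^{-1}=(y,-m,x)$, unit space identified with $X$ via $x\leftrightarrow(x,0,x)$, and topology with basis the sets $\{(x,p-q,y):x\in U,\ y\in V,\ T^p(x)=T^q(y)\}$ for $U,V\subseteq X$ open and $p,q\in\mathbb N^k$; it is a locally compact Hausdorff étale groupoid. The canonical cocycle is $c(x,m,y)=m$. Write $(G_T)_x=s^{-1}(x)$ and $[x]=\{r(\gamma):\gamma\in(G_T)_x\}$ (the orbit), with closure $\overline{[x]}$ in $X$. $C^*(G_T)$ is the full groupoid $C^*$-algebra. An open bisection is an open subset of the groupoid on which $r$ and $s$ restrict to homeomorphisms onto open sets. Representations: for $(x,z)\in X\times\mathbb T^k$, $\pi_{(x,z)}$ is the irreducible representation of $C^*(G_T)$ on $\ell^2([x])$ with $\pi_{(x,z)}(f)e_y=\sum_{\gamma\in(G_T)_y}z^{c(\gamma)}f(\gamma)e_{r(\gamma)}$ for $f\in C_c(G_T)$, $y\in[x]$. The map $\pi(x,z)=\ker(\pi_{(x,z)})$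 is known to be surjective onto $\operatorname{Prim}(C^*(G_T))$, which carries the hull-kernel topology. Isotropy: for an étale groupoid $G$, $\mathcal I(G)=\{\gamma:r(\gamma)=s(\gamma)\}$, with fibres $\mathcal I(G)_x$, and $\mathcal I^\circ(G)$ is its topological interior in $G$. For $Y\subseteq G^{(0)}$, $G|_Y=\{\gamma:r(\gamma),s(\gamma)\in Y\}$ with the subspace topology. The essential isotropy at $x$ is $\mathcal I^{\mathrm{ess}}_x=\mathcal I^\circ(G|_{\overline{[x]}})\cap\mathcal I(G)_x$, and $\mathcal I^{\mathrm{ess}}=\bigsqcup_x\mathcal I^{\mathrm{ess}}_x$. $\mathcal J=\overline{\mathcal I^{\mathrm{ess}}}$ denotes the smallest closed subgroupoid of $G$ containing $\mathcal I^{\mathrm{ess}}$, and $\mathcal J_x=\mathcal J\cap\mathcal I(G)_x$. Here $G=G_T$. The unit $x$ itself is an element of $\mathcal J_x$, with corresponding bisection $B_x$. For a family $\mathcal B$ of bisections, $\mathcal B^{\mathrm{ess}}=(\bigcup\mathcal B)\cap\mathcal I^{\mathrm{ess}}$, $\mathcal B^{\mathrm{ess}}_y$ is its fibre over $y\in X$, $(\mathcal B^{\mathrm{ess}})^\perp=\{(y,w)\in s(\mathcal B^{\mathrm{ess}})\times\mathbb T^k:w^{c(\gamma)}=1\text{ for all }\gamma\in\mathcal B^{\mathrm{ess}}_y\}$, and for $W\subseteq s(\mathcal B^{\mathrm{ess}})\times\mathbb T^k$ the $\mathcal B$-saturation of $W$ is $W\cdot(\mathcal B^{\mathrm{ess}})^\perp=\{(y,vw):(y,v)\in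 W,\ (y,w)\in(\mathcal B^{\mathrm{ess}})^\perp\}$. *)

theory Defs
  imports "HOL-Analysis.Analysis"
begin

section \<open>Operators on Hilbert spaces\<close>

text \<open>Every complex Hilbert space is unitarily equivalent to \<open>\<ell>\<^sup>2(S)\<close>, where \<open>S\<close> indexes an
  orthonormal basis.  Vectors of \<open>\<ell>\<^sup>2(S)\<close> are functions on the whole index type that vanish off \<open>S\<close>.\<close>

definition ell2 :: "'i set \<Rightarrow> ('i \<Rightarrow> complex) set" where
  "ell2 S = {\<xi>. (\<forall>i. i \<notin> S \<longrightarrow> \<xi> i = 0) \<and> (\<lambda>i. (cmod (\<xi> i))\<^sup>2) summable_on S}"

definition ell2_inner :: "('i \<Rightarrow> complex) \<Rightarrow> ('i \<Rightarrow> complex) \<Rightarrow> complex" where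
  "ell2_inner \<xi> \<eta> = (\<Sum>\<^sub>\<infinity>i. \<xi> i * cnj (\<eta> i))"

definition ell2_norm :: "('i \<Rightarrow> complex) \<Rightarrow> real" where
  "ell2_norm \<xi> = sqrt (\<Sum>\<^sub>\<infinity>i. (cmod (\<xi> i))\<^sup>2)"

definition bounded_operator :: "'i set \<Rightarrow> (('i \<Rightarrow> complex) \<Rightarrow> ('i \<Rightarrow> complex)) \<Rightarrow> bool" where
  "bounded_operator S a \<longleftrightarrow>
     (\<forall>\<xi>\<in>ell2 S. a \<xi> \<in> ell2 S) \<and>
     (\<forall>\<xi>\<in>ell2 S. \<forall>\<eta>\<in>ell2 S. a (\<lambda>i. \<xi> i + \<eta> i) = (\<lambda>i. a \<xi> i + a \<eta> i)) \<and>
     (\<forall>c. \<forall>\<xi>\<in>ell2 S. a (\<lambda>i. c * \<xi> i) = (\<lambda>i. c * a \<xi> i)) \<and>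
     (\<exists>C. \<forall>\<xi>\<in>ell2 S. ell2_norm (a \<xi>) \<le> C * ell2_norm \<xi>)"

definition operator_norm :: "'i set \<Rightarrow> (('i \<Rightarrow> complex) \<Rightarrow> ('i \<Rightarrow> complex)) \<Rightarrow> real" where
  "operator_norm S a = Sup {ell2_norm (a \<xi>) | \<xi>. \<xi> \<in> ell2 S \<and> ell2_norm \<xi> \<le> 1}"

definition closed_ell2_subspace :: "'i set \<Rightarrow> ('i \<Rightarrow> complex) set \<Rightarrow> bool" where
  "closed_ell2_subspace S M \<longleftrightarrow>
     M \<subseteq> ell2 S \<and> (\<lambda>i. 0) \<in> M \<and>
     (\<forall>\<xi>\<in>M. \<forall>\<eta>\<in>M. (\<lambda>i. \<xi> i + \<eta> i) \<in> M) \<and>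
     (\<forall>c. \<forall>\<xi>\<in>M. (\<lambda>i. c * \<xi> i) \<in> M) \<and>
     (\<forall>u. \<forall>\<xi>\<in>ell2 S. (\<forall>n. u n \<in> M) \<and> (\<lambda>n. ell2_norm (\<lambda>i. u n i - \<xi> i)) \<longlonglongrightarrow> 0 \<longrightarrow> \<xi> \<in> M)"


section \<open>Star-algebras, representations and the enveloping C*-algebra\<close>

record 'a star_algebra =
  sa_carrier :: "'a set"
  sa_add :: "'a \<Rightarrow> 'a \<Rightarrow> 'a"
  sa_scale :: "complex \<Rightarrow> 'a \<Rightarrow> 'a"
  sa_mult :: "'a \<Rightarrow> 'a \<Rightarrow> 'a"
  sa_star :: "'a \<Rightarrow> 'a"

record 'a normed_star_algebra = "'a star_algebra" +
  sa_norm :: "'a \<Rightarrow> real"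

definition sa_diff :: "('a, 'm) star_algebra_scheme \<Rightarrow> 'a \<Rightarrow> 'a \<Rightarrow> 'a" where
  "sa_diff A a b = sa_add A a (sa_scale A (-1) b)"

definition star_representation ::
    "('a, 'm) star_algebra_scheme \<Rightarrow> 'i set \<Rightarrow> ('a \<Rightarrow> ('i \<Rightarrow> complex) \<Rightarrow> ('i \<Rightarrow> complex)) \<Rightarrow> bool" where
  "star_representation A S L \<longleftrightarrow>
     (\<forall>a\<in>sa_carrier A. bounded_operator S (L a)) \<and>
     (\<forall>a\<in>sa_carrier A. \<forall>b\<in>sa_carrier A. \<forall>\<xi>\<in>ell2 S.
        L (sa_add A a b) \<xi> = (\<lambda>i. L a \<xi> i + L b \<xi> i)) \<and>
     (\<forall>c. \<forall>a\<in>sa_carrier A. \<forall>\<xi>\<in>ell2 S. L (sa_scale A c a) \<xi> = (\<lambda>i. c * L a \<xi> i)) \<and>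
     (\<forall>a\<in>sa_carrier A. \<forall>b\<in>sa_carrier A. \<forall>\<xi>\<in>ell2 S. L (sa_mult A a b) \<xi> = L a (L b \<xi>)) \<and>
     (\<forall>a\<in>sa_carrier A. \<forall>\<xi>\<in>ell2 S. \<forall>\<eta>\<in>ell2 S.
        ell2_inner (L (sa_star A a) \<xi>) \<eta> = ell2_inner \<xi> (L a \<eta>))"

definition representation_kernel ::
    "('a, 'm) star_algebra_scheme \<Rightarrow> 'i set \<Rightarrow> ('a \<Rightarrow> ('i \<Rightarrow> complex) \<Rightarrow> ('i \<Rightarrow> complex)) \<Rightarrow> 'a set" where
  "representation_kernel A S L = {a \<in> sa_carrier A. \<forall>\<xi>\<in>ell2 S. L a \<xi> = (\<lambda>i. 0)}"

definition irreducible_representation ::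
    "('a, 'm) star_algebra_scheme \<Rightarrow> 'i set \<Rightarrow> ('a \<Rightarrow> ('i \<Rightarrow> complex) \<Rightarrow> ('i \<Rightarrow> complex)) \<Rightarrow> bool" where
  "irreducible_representation A S L \<longleftrightarrow>
     star_representation A S L \<and>
     representation_kernel A S L \<noteq> sa_carrier A \<and>
     (\<forall>M. closed_ell2_subspace S M \<and> (\<forall>a\<in>sa_carrier A. \<forall>\<xi>\<in>M. L a \<xi> \<in> M)
        \<longrightarrow> M = {\<lambda>i. 0} \<or> M = ell2 S)"

text \<open>The universal C*-seminorm is the supremum over all representations by bounded operators; for
  the convolution algebra of an etale groupoid it is finite.  Index sets are taken inside the type
  of the elements of the algebra. This loses nothing: the supremum is determined by cyclic
  representations, and a cyclic representation of a nonzero algebra \<open>A\<close> has Hilbert-space dimension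
  at most the cardinality of \<open>A\<close>.  The same remark applies to irreducible representations and
  primitive ideals below.\<close>

definition universal_norm :: "('a, 'm) star_algebra_scheme \<Rightarrow> 'a \<Rightarrow> real" where
  "universal_norm A a =
     Sup {operator_norm S (L a) | (S :: 'a set) L. star_representation A S L}"

text \<open>The enveloping C*-algebra is the (Hausdorff) completion in the universal seminorm, realised
  as Cauchy sequences modulo null sequences.\<close>

definition universal_Cauchy :: "('a, 'm) star_algebra_scheme \<Rightarrow> (nat \<Rightarrow> 'a) set" where
  "universal_Cauchy A = {u. (\<forall>n. u n \<in> sa_carrier A) \<and>
     (\<forall>e>0. \<exists>N. \<forall>m\<ge>N. \<forall>n\<ge>N. universal_norm A (sa_diff A (u m) (u n)) < e)}"

definition universal_equiv :: "('a, 'm) star_algebra_scheme \<Rightarrow> ((nat \<Rightarrow> 'a) \<times> (nat \<Rightarrow> 'a)) set" where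
  "universal_equiv A = {(u, v). u \<in> universal_Cauchy A \<and> v \<in> universal_Cauchy A \<and>
     (\<lambda>n. universal_norm A (sa_diff A (u n) (v n))) \<longlonglongrightarrow> 0}"

definition universal_class :: "('a, 'm) star_algebra_scheme \<Rightarrow> (nat \<Rightarrow> 'a) \<Rightarrow> (nat \<Rightarrow> 'a) set" where
  "universal_class A u = universal_equiv A `` {u}"

definition enveloping_cstar ::
    "('a, 'm) star_algebra_scheme \<Rightarrow> (nat \<Rightarrow> 'a) set normed_star_algebra" where
  "enveloping_cstar A =
     \<lparr> sa_carrier = universal_Cauchy A // universal_equiv A,
       sa_add = (\<lambda>P Q. \<Union>u\<in>P. \<Union>v\<in>Q. universal_class A (\<lambda>n. sa_add A (u n) (v n))),
       sa_scale = (\<lambda>c P. \<Union>u\<in>P. universal_class A (\<lambda>n. sa_scale A c (u n))),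
       sa_mult = (\<lambda>P Q. \<Union>u\<in>P. \<Union>v\<in>Q. universal_class A (\<lambda>n. sa_mult A (u n) (v n))),
       sa_star = (\<lambda>P. \<Union>u\<in>P. universal_class A (\<lambda>n. sa_star A (u n))),
       sa_norm = (\<lambda>P. THE r. \<forall>u\<in>P. (\<lambda>n. universal_norm A (u n)) \<longlonglongrightarrow> r) \<rparr>"

definition to_enveloping :: "('a, 'm) star_algebra_scheme \<Rightarrow> 'a \<Rightarrow> (nat \<Rightarrow> 'a) set" where
  "to_enveloping A a = universal_class A (\<lambda>n. a)"


section \<open>Primitive ideals\<close>

definition closed_ideal :: "('a, 'm) normed_star_algebra_scheme \<Rightarrow> 'a set \<Rightarrow> bool" where
  "closed_ideal A I \<longleftrightarrow>
     I \<subseteq> sa_carrier A \<and> I \<noteq> {} \<and>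
     (\<forall>a\<in>I. \<forall>b\<in>I. sa_add A a b \<in> I) \<and>
     (\<forall>c. \<forall>a\<in>I. sa_scale A c a \<in> I) \<and>
     (\<forall>a\<in>I. \<forall>b\<in>sa_carrier A. sa_mult A a b \<in> I \<and> sa_mult A b a \<in> I) \<and>
     (\<forall>u. \<forall>a\<in>sa_carrier A. (\<forall>n. u n \<in> I) \<and> (\<lambda>n. sa_norm A (sa_diff A (u n) a)) \<longlonglongrightarrow> 0 \<longrightarrow> a \<in> I)"

definition Prim :: "('a, 'm) star_algebra_scheme \<Rightarrow> 'a set set" where
  "Prim A = {representation_kernel A S L | (S :: 'a set) L. irreducible_representation A S L}"

text \<open>The generating sets are the complements of the hulls of closed ideals; they already
  constitute the whole hull-kernel topology.\<close>

definition hull_kernel_topology :: "('a, 'm) normed_star_algebra_scheme \<Rightarrow> 'a set topology" where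
  "hull_kernel_topology A = topology_generated_by {{P \<in> Prim A. \<not> I \<subseteq> P} | I. closed_ideal A I}"


section \<open>Actions by local homeomorphisms and Deaconu--Renault groupoids\<close>

definition local_homeomorphism :: "('x::topological_space \<Rightarrow> 'x) \<Rightarrow> bool" where
  "local_homeomorphism f \<longleftrightarrow>
     (\<forall>x. \<exists>U g. open U \<and> x \<in> U \<and> open (f ` U) \<and> homeomorphism U (f ` U) f g)"

definition local_homeo_action :: "(nat^'k \<Rightarrow> 'x::topological_space \<Rightarrow> 'x) \<Rightarrow> bool" where
  "local_homeo_action T \<longleftrightarrow>
     T 0 = id \<and> (\<forall>m n. T (m + n) = T m \<circ> T n) \<and> (\<forall>n. local_homeomorphism (T n))"

type_synonym ('x, 'k) arrow = "'x \<times> (int^'k) \<times> 'x"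

definition rng :: "('x, 'k::finite) arrow \<Rightarrow> 'x" where "rng \<gamma> = fst \<gamma>"
definition cocycle :: "('x, 'k::finite) arrow \<Rightarrow> int^'k" where "cocycle \<gamma> = fst (snd \<gamma>)"
definition src :: "('x, 'k::finite) arrow \<Rightarrow> 'x" where "src \<gamma> = snd (snd \<gamma>)"
definition unit_arrow :: "'x \<Rightarrow> ('x, 'k::finite) arrow" where "unit_arrow x = (x, 0, x)"

definition arrow_inv :: "('x, 'k::finite) arrow \<Rightarrow> ('x, 'k::finite) arrow" where
  "arrow_inv \<gamma> = (src \<gamma>, - cocycle \<gamma>, rng \<gamma>)"

text \<open>Meaningful only when \<open>src \<gamma> = rng \<eta>\<close>.\<close>
definition arrow_mult :: "('x, 'k::finite) arrow \<Rightarrow> ('x, 'k::finite) arrow \<Rightarrow> ('x, 'k::finite) arrow" where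
  "arrow_mult \<gamma> \<eta> = (rng \<gamma>, cocycle \<gamma> + cocycle \<eta>, src \<eta>)"

definition nat_diff :: "nat^'k \<Rightarrow> nat^'k \<Rightarrow> int^'k" where
  "nat_diff p q = (\<chi> i. int (p $ i) - int (q $ i))"

definition DR_basic ::
    "(nat^'k \<Rightarrow> 'x \<Rightarrow> 'x) \<Rightarrow> 'x set \<Rightarrow> nat^'k \<Rightarrow> nat^'k \<Rightarrow> 'x set \<Rightarrow> ('x, 'k::finite) arrow set" where
  "DR_basic T U p q V = {(x, nat_diff p q, y) | x y. x \<in> U \<and> y \<in> V \<and> T p x = T q y}"

text \<open>A groupoid of arrows is represented by its topology; the underlying set is the \<open>topspace\<close>.\<close>

definition DR_groupoid ::
    "(nat^'k \<Rightarrow> 'x::topological_space \<Rightarrow> 'x) \<Rightarrow> ('x, 'k::finite) arrow topology" where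
  "DR_groupoid T = topology_generated_by {DR_basic T U p q V | U p q V. open U \<and> open V}"

lemma topspace_DR_groupoid:
  "topspace (DR_groupoid T) = {(x, nat_diff p q, y) | x p q y. T p x = T q y}"
proof -
  have "topspace (DR_groupoid T) = \<Union> {DR_basic T U p q V | U p q V. open U \<and> open V}"
    by (simp add: DR_groupoid_def)
  also have "\<dots> = {(x, nat_diff p q, y) | x p q y. T p x = T q y}"
  proof (intro equalityI subsetI)
    fix \<gamma> assume "\<gamma> \<in> {(x, nat_diff p q, y) | x p q y. T p x = T q y}"
    then obtain x p q y where "\<gamma> = (x, nat_diff p q, y)" "T p x = T q y" by blast
    then have "\<gamma> \<in> DR_basic T UNIV p q UNIV" by (simp add: DR_basic_def)
    then show "\<gamma> \<in> \<Union> {DR_basic T U p q V | U p q V. open U \<and> open V}" by blast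
  qed (auto simp: DR_basic_def)
  finally show ?thesis .
qed

definition orbit :: "('x, 'k::finite) arrow topology \<Rightarrow> 'x \<Rightarrow> 'x set" where
  "orbit G x = rng ` {\<gamma> \<in> topspace G. src \<gamma> = x}"

definition open_bisection :: "('x::topological_space, 'k::finite) arrow topology \<Rightarrow> ('x, 'k::finite) arrow set \<Rightarrow> bool" where
  "open_bisection G B \<longleftrightarrow>
     openin G B \<and> open (rng ` B) \<and> open (src ` B) \<and>
     homeomorphic_map (subtopology G B) (top_of_set (rng ` B)) rng \<and>
     homeomorphic_map (subtopology G B) (top_of_set (src ` B)) src"


section \<open>Isotropy\<close>

definition isotropy :: "('x, 'k::finite) arrow topology \<Rightarrow> ('x, 'k::finite) arrow set" where
  "isotropy G = {\<gamma> \<in> topspace G. rng \<gamma> = src \<gamma>}"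

definition isotropy_at :: "('x, 'k::finite) arrow topology \<Rightarrow> 'x \<Rightarrow> ('x, 'k::finite) arrow set" where
  "isotropy_at G x = {\<gamma> \<in> isotropy G. src \<gamma> = x}"

definition interior_isotropy :: "('x, 'k::finite) arrow topology \<Rightarrow> ('x, 'k::finite) arrow set" where
  "interior_isotropy G = G interior_of isotropy G"

definition reduction :: "('x, 'k::finite) arrow topology \<Rightarrow> 'x set \<Rightarrow> ('x, 'k::finite) arrow topology" where
  "reduction G Y = subtopology G {\<gamma>. rng \<gamma> \<in> Y \<and> src \<gamma> \<in> Y}"

definition essential_isotropy_at ::
    "('x::topological_space, 'k::finite) arrow topology \<Rightarrow> 'x \<Rightarrow> ('x, 'k::finite) arrow set" where
  "essential_isotropy_at G x =
     interior_isotropy (reduction G (closure (orbit G x))) \<inter> isotropy_at G x"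

definition essential_isotropy ::
    "('x::topological_space, 'k::finite) arrow topology \<Rightarrow> ('x, 'k::finite) arrow set" where
  "essential_isotropy G = (\<Union>x. essential_isotropy_at G x)"

definition subgroupoid :: "('x, 'k::finite) arrow topology \<Rightarrow> ('x, 'k::finite) arrow set \<Rightarrow> bool" where
  "subgroupoid G H \<longleftrightarrow>
     H \<subseteq> topspace G \<and>
     (\<forall>\<gamma>\<in>H. arrow_inv \<gamma> \<in> H) \<and>
     (\<forall>\<gamma>\<in>H. \<forall>\<eta>\<in>H. src \<gamma> = rng \<eta> \<longrightarrow> arrow_mult \<gamma> \<eta> \<in> H)"

definition closed_essential_isotropy ::
    "('x::topological_space, 'k::finite) arrow topology \<Rightarrow> ('x, 'k::finite) arrow set" where
  "closed_essential_isotropy G =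
     \<Inter> {H. subgroupoid G H \<and> closedin G H \<and> essential_isotropy G \<subseteq> H}"

definition closed_essential_isotropy_at ::
    "('x::topological_space, 'k::finite) arrow topology \<Rightarrow> 'x \<Rightarrow> ('x, 'k::finite) arrow set" where
  "closed_essential_isotropy_at G x = closed_essential_isotropy G \<inter> isotropy_at G x"


section \<open>The C*-algebra of the groupoid and the representations \<open>\<pi>\<^bsub>(x,z)\<^esub>\<close>\<close>

text \<open>Elements of \<open>C\<^sub>c(G)\<close> are extended by zero outside \<open>G\<close>.  All infinite sums below have only
  finitely many nonzero terms because \<open>G\<close> is etale.\<close>

definition convolution_algebra ::
    "('x, 'k::finite) arrow topology \<Rightarrow> (('x, 'k::finite) arrow \<Rightarrow> complex) star_algebra" where
  "convolution_algebra G =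
     \<lparr> sa_carrier = {f. continuous_map G euclidean f \<and> (\<forall>\<gamma>. \<gamma> \<notin> topspace G \<longrightarrow> f \<gamma> = 0) \<and>
                        compactin G (G closure_of {\<gamma> \<in> topspace G. f \<gamma> \<noteq> 0})},
       sa_add = (\<lambda>f g \<gamma>. f \<gamma> + g \<gamma>),
       sa_scale = (\<lambda>c f \<gamma>. c * f \<gamma>),
       sa_mult = (\<lambda>f g \<gamma>. \<Sum>\<^sub>\<infinity>(\<alpha>, \<beta>) \<in> {(\<alpha>, \<beta>). \<alpha> \<in> topspace G \<and> \<beta> \<in> topspace G \<and>
                                src \<alpha> = rng \<beta> \<and> arrow_mult \<alpha> \<beta> = \<gamma>}. f \<alpha> * g \<beta>),
       sa_star = (\<lambda>f \<gamma>. cnj (f (arrow_inv \<gamma>))) \<rparr>"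

abbreviation groupoid_cstar ::
    "('x, 'k::finite) arrow topology \<Rightarrow> (nat \<Rightarrow> ('x, 'k::finite) arrow \<Rightarrow> complex) set normed_star_algebra" where
  "groupoid_cstar G \<equiv> enveloping_cstar (convolution_algebra G)"

definition torus :: "(complex^'k) set" where
  "torus = {z. \<forall>i. cmod (z $ i) = 1}"

definition character :: "complex^'k \<Rightarrow> int^'k \<Rightarrow> complex" where
  "character z n = (\<Prod>i\<in>UNIV. (z $ i) powi (n $ i))"

text \<open>A representation of \<open>C\<^sup>*(G)\<close> is determined by its values on \<open>C\<^sub>c(G)\<close> and on basis vectors, so the
  choice below is unique on the carrier and on \<open>\<ell>\<^sup>2([x])\<close>.  Here \<open>indicator {y}\<close> is \<open>e\<^sub>y\<close>.\<close>

definition orbit_representation ::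
    "('x, 'k::finite) arrow topology \<Rightarrow> 'x \<Rightarrow> complex^'k
      \<Rightarrow> (nat \<Rightarrow> ('x, 'k::finite) arrow \<Rightarrow> complex) set \<Rightarrow> ('x \<Rightarrow> complex) \<Rightarrow> ('x \<Rightarrow> complex)" where
  "orbit_representation G x z =
     (SOME L. star_representation (groupoid_cstar G) (orbit G x) L \<and>
        (\<forall>f\<in>sa_carrier (convolution_algebra G). \<forall>y\<in>orbit G x.
           L (to_enveloping (convolution_algebra G) f) (indicator {y}) =
           (\<lambda>w. \<Sum>\<^sub>\<infinity>\<gamma> \<in> {\<gamma> \<in> topspace G. src \<gamma> = y}.
                  character z (cocycle \<gamma>) * f \<gamma> * indicator {rng \<gamma>} w)))"

definition orbit_kernel ::
    "('x, 'k::finite) arrow topology \<Rightarrow> 'x \<times> (complex^'k) \<Rightarrow> (nat \<Rightarrow> ('x, 'k::finite) arrow \<Rightarrow> complex) set set" where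
  "orbit_kernel G = (\<lambda>(x, z).
     representation_kernel (groupoid_cstar G) (orbit G x) (orbit_representation G x z))"

definition orbit_kernel_preimage ::
    "('x, 'k::finite) arrow topology \<Rightarrow> (nat \<Rightarrow> ('x, 'k::finite) arrow \<Rightarrow> complex) set set set
      \<Rightarrow> ('x \<times> (complex^'k)) set" where
  "orbit_kernel_preimage G A = {(x, z). z \<in> torus \<and> orbit_kernel G (x, z) \<in> A}"


section \<open>Saturations\<close>

text \<open>A family \<open>(B\<^sub>\<alpha>)\<close> with \<open>\<alpha>\<close> ranging over \<open>D\<close> is given as a function \<open>B\<close> together with \<open>D\<close>.\<close>

definition family_ess :: "('x::topological_space, 'k::finite) arrow topology \<Rightarrow> ('x, 'k::finite) arrow set
      \<Rightarrow> (('x, 'k::finite) arrow \<Rightarrow> ('x, 'k::finite) arrow set) \<Rightarrow> ('x, 'k::finite) arrow set" where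
  "family_ess G D B = (\<Union>\<alpha>\<in>D. B \<alpha>) \<inter> essential_isotropy G"

definition annihilator :: "('x, 'k::finite) arrow set \<Rightarrow> ('x \<times> (complex^'k)) set" where
  "annihilator E = {(y, w). y \<in> src ` E \<and> w \<in> torus \<and>
     (\<forall>\<gamma>\<in>E. src \<gamma> = y \<longrightarrow> character w (cocycle \<gamma>) = 1)}"

definition saturation ::
    "('x \<times> (complex^'k)) set \<Rightarrow> ('x, 'k::finite) arrow set \<Rightarrow> ('x \<times> (complex^'k)) set" where
  "saturation W E = {(y, v * w) | y v w. (y, v) \<in> W \<and> (y, w) \<in> annihilator E}"

end

theory Submission
  imports Defs
begin

text \<open>
  The hull-kernel topology is generated by the sets of primitive ideals that do not contain a given closed
  ideal \<open>I\<close>. So let \<open>I\<close> not be contained in the kernel of \<open>\<pi>\<^bsub>(x,z)\<^esub>\<close>. Then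
  some \<open>a\<close> in \<open>I\<close> has \<open>\<langle>\<pi>\<^bsub>(x,z)\<^esub>(a) e\<^sub>x, e\<^sub>x\<rangle> \<noteq> 0\<close>
  (\<open>diagonal_coefficient_nonzero\<close>), and a function \<open>f\<close> in \<open>C\<^sub>c(G)\<close> approximates \<open>a\<close> in norm. It is
  therefore enough to approximate the number \<open>\<langle>\<pi>\<^bsub>(x,z)\<^esub>(f) e\<^sub>x, e\<^sub>x\<rangle>\<close>, for one function
  \<open>f\<close>, by vector functionals of \<open>\<pi>\<^bsub>(y,u)\<^esub>\<close>, for all \<open>(y, u)\<close> in the saturation of a
  neighbourhood of \<open>(x, z)\<close>. This is \<open>orbit_functional_approx\<close>.

  The isotropy arrows of \<open>x\<close> of bounded degree extend to bisections that move a point near \<open>x\<close> to other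
  points near \<open>x\<close>. Starting from a point \<open>y\<^sub>0\<close> of the orbit of \<open>y\<close>, they produce finite subsets of this
  orbit whose size grows polynomially with the bound on the degree. Hence one of them, \<open>S\<close>, at a stage
  bounded independently of \<open>y\<close>, is almost invariant under the finitely many degrees that \<open>f\<close> sees near
  \<open>x\<close>; this is the amenability of \<open>\<int>\<^sup>k\<close> in its most elementary form. A normalised sum of the
  basis vectors of \<open>S\<close>, with phases \<open>(u / z) ^ m\<close> at the point reached in degree \<open>m\<close>, imitates the basis vector
  at \<open>x\<close>, provided \<open>u ^ h\<close> is close to \<open>z ^ h\<close> whenever \<open>y\<^sub>0\<close> has isotropy of bounded degree \<open>h\<close> near
  \<open>x\<close> (\<open>almost_invariant_vector\<close>).

  That is what the essential isotropy provides. Within the orbit closure of \<open>y\<close>, the points fixed by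
  degree \<open>h\<close> form a closed set, so for finitely many degrees one can choose \<open>y\<^sub>0\<close> in the orbit, near \<open>y\<close>, with all
  its isotropy of these degrees interior (\<open>generic_orbit_point\<close>). Conjugating along the orbit gives
  \<open>(y, h, y)\<close> in the essential isotropy (\<open>essential_isotropy_transport\<close>). If \<open>(x, h, x)\<close> were not in
  \<open>J\<close>, then, \<open>J\<close> being closed, no such arrow would exist for \<open>y\<close> close to \<open>x\<close>. So \<open>(x, h, x)\<close> is in
  \<open>J\<close>, and for \<open>y\<close> close to \<open>x\<close> the arrow \<open>(y, h, y)\<close> is in the bisection given at \<open>(x, h, x)\<close>. With
  \<open>u = v w\<close> as in the definition of the saturation, \<open>w ^ h = 1\<close>, and \<open>u ^ h = v ^ h\<close> is close to
  \<open>z ^ h\<close>.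

  The analytic background is that \<open>C\<^sub>c(G)\<close> has a finite universal seminorm, because functions supported in
  bisections are bounded by their suprema in every representation (\<open>bis_supported_bound\<close>) and
  span; that its representations extend to the enveloping algebra (\<open>extend_representation\<close>), on which every
  representation is contractive (\<open>enveloping_contractive\<close>); and that the orbit
  representations are irreducible (\<open>invariant_subspace\<close>), so that their kernels are points of the primitive
  ideal space.
\<close>

section \<open>Square-summable families\<close>

lemma ell2_iff:
  "\<xi> \<in> ell2 S \<longleftrightarrow> (\<forall>i. i \<notin> S \<longrightarrow> \<xi> i = 0) \<and> (\<lambda>i. (cmod (\<xi> i))\<^sup>2) summable_on UNIV"
proof -
  have "(\<lambda>i. (cmod (\<xi> i))\<^sup>2) summable_on S \<longleftrightarrow> (\<lambda>i. (cmod (\<xi> i))\<^sup>2) summable_on UNIV"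
    if "\<forall>i. i \<notin> S \<longrightarrow> \<xi> i = 0"
    using that by (intro summable_on_cong_neutral) auto
  then show ?thesis by (auto simp: ell2_def)
qed

lemma ell2_outside: "\<xi> \<in> ell2 S \<Longrightarrow> i \<notin> S \<Longrightarrow> \<xi> i = 0"
  by (simp add: ell2_def)

lemma ell2_summable: "\<xi> \<in> ell2 S \<Longrightarrow> (\<lambda>i. (cmod (\<xi> i))\<^sup>2) summable_on UNIV"
  by (simp add: ell2_iff)

lemma ell2_norm_nonneg [simp]: "0 \<le> ell2_norm \<xi>"
  by (simp add: ell2_norm_def infsum_nonneg)

lemma L2_set_le_ell2_norm:
  assumes "\<xi> \<in> ell2 S" "finite F"
  shows "L2_set (\<lambda>i. cmod (\<xi> i)) F \<le> ell2_norm \<xi>"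
  unfolding L2_set_def ell2_norm_def
  by (intro real_sqrt_le_mono finite_sum_le_infsum ell2_summable[OF assms(1)]) (use assms in auto)

text \<open>Finite sections determine membership and norm; this is how the inequalities below
  are transferred from finite sums.\<close>

lemma ell2_normI:
  assumes "\<And>i. i \<notin> S \<Longrightarrow> \<xi> i = 0" and "\<And>F. finite F \<Longrightarrow> L2_set (\<lambda>i. cmod (\<xi> i)) F \<le> C"
  shows "\<xi> \<in> ell2 S" and "ell2_norm \<xi> \<le> C"
proof -
  have C: "0 \<le> C" using assms(2)[of "{}"] by simp
  have b: "(\<Sum>i\<in>F. (cmod (\<xi> i))\<^sup>2) \<le> C\<^sup>2" if "finite F" for F
    using power_mono[OF assms(2)[OF that], of 2] unfolding L2_set_def by (simp add: sum_nonneg)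
  have s: "(\<lambda>i. (cmod (\<xi> i))\<^sup>2) summable_on UNIV"
    by (intro nonneg_bdd_above_summable_on) (auto intro!: bdd_aboveI[of _ "C\<^sup>2"] b)
  show "\<xi> \<in> ell2 S" using s assms(1) by (simp add: ell2_iff)
  have "infsum (\<lambda>i. (cmod (\<xi> i))\<^sup>2) UNIV \<le> C\<^sup>2"
    by (rule infsum_le_finite_sums[OF s]) (use b in auto)
  then show "ell2_norm \<xi> \<le> C" unfolding ell2_norm_def using C
    using real_le_lsqrt by blast
qed

lemma ell2_zero [simp]: "(\<lambda>i. 0) \<in> ell2 S" and ell2_norm_zero [simp]: "ell2_norm (\<lambda>i. 0) = 0"
  by (simp_all add: ell2_def ell2_norm_def)

lemma ell2_add:
  assumes "\<xi> \<in> ell2 S" "\<eta> \<in> ell2 S"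
  shows "(\<lambda>i. \<xi> i + \<eta> i) \<in> ell2 S" and "ell2_norm (\<lambda>i. \<xi> i + \<eta> i) \<le> ell2_norm \<xi> + ell2_norm \<eta>"
proof -
  have *: "L2_set (\<lambda>i. cmod (\<xi> i + \<eta> i)) F \<le> ell2_norm \<xi> + ell2_norm \<eta>" if "finite F" for F
  proof -
    have "L2_set (\<lambda>i. cmod (\<xi> i + \<eta> i)) F \<le> L2_set (\<lambda>i. cmod (\<xi> i) + cmod (\<eta> i)) F"
      by (intro L2_set_mono norm_triangle_ineq) auto
    also have "\<dots> \<le> L2_set (\<lambda>i. cmod (\<xi> i)) F + L2_set (\<lambda>i. cmod (\<eta> i)) F"
      by (rule L2_set_triangle_ineq)
    also have "\<dots> \<le> ell2_norm \<xi> + ell2_norm \<eta>"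
      by (intro add_mono L2_set_le_ell2_norm[OF assms(1) that] L2_set_le_ell2_norm[OF assms(2) that])
    finally show ?thesis .
  qed
  have o: "i \<notin> S \<Longrightarrow> \<xi> i + \<eta> i = 0" for i
    by (simp add: ell2_outside[OF assms(1)] ell2_outside[OF assms(2)])
  show "(\<lambda>i. \<xi> i + \<eta> i) \<in> ell2 S" by (rule ell2_normI(1)[OF o *])
  show "ell2_norm (\<lambda>i. \<xi> i + \<eta> i) \<le> ell2_norm \<xi> + ell2_norm \<eta>" by (rule ell2_normI(2)[OF o *])
qed

lemma ell2_scale [simp]: "\<xi> \<in> ell2 S \<Longrightarrow> (\<lambda>i. c * \<xi> i) \<in> ell2 S"
  by (auto simp: ell2_iff norm_mult power_mult_distrib intro: summable_on_cmult_right)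

lemma ell2_norm_scale: "ell2_norm (\<lambda>i. c * \<xi> i) = cmod c * ell2_norm \<xi>"
  unfolding ell2_norm_def
  by (simp add: norm_mult power_mult_distrib infsum_cmult_right' real_sqrt_mult)

lemma ell2_norm_minus: "ell2_norm (\<lambda>i. - \<xi> i) = ell2_norm \<xi>"
  by (simp add: ell2_norm_def)

lemma ell2_norm_minus_commute: "ell2_norm (\<lambda>i. \<xi> i - \<eta> i) = ell2_norm (\<lambda>i. \<eta> i - \<xi> i)"
  by (simp add: ell2_norm_def norm_minus_commute)

lemma ell2_diff:
  assumes "\<xi> \<in> ell2 S" "\<eta> \<in> ell2 S"
  shows "(\<lambda>i. \<xi> i - \<eta> i) \<in> ell2 S" and "ell2_norm (\<lambda>i. \<xi> i - \<eta> i) \<le> ell2_norm \<xi> + ell2_norm \<eta>"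
  using ell2_add[OF assms(1) ell2_scale[OF assms(2), of "-1"]] ell2_norm_scale[of "-1" \<eta>]
  by simp_all

lemma ell2_diff_triangle:
  assumes "\<xi> \<in> ell2 S" "\<eta> \<in> ell2 S" "\<zeta> \<in> ell2 S"
  shows "ell2_norm (\<lambda>i. \<xi> i - \<zeta> i) \<le> ell2_norm (\<lambda>i. \<xi> i - \<eta> i) + ell2_norm (\<lambda>i. \<eta> i - \<zeta> i)"
  using ell2_add(2)[OF ell2_diff(1)[OF assms(1,2)] ell2_diff(1)[OF assms(2,3)]] by simp

lemma ell2_norm_le_diff:
  assumes "\<xi> \<in> ell2 S" "\<eta> \<in> ell2 S"
  shows "ell2_norm \<xi> \<le> ell2_norm \<eta> + ell2_norm (\<lambda>i. \<xi> i - \<eta> i)"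
  using ell2_add(2)[OF assms(2) ell2_diff(1)[OF assms]] by simp

lemma cmod_le_ell2_norm: "\<xi> \<in> ell2 S \<Longrightarrow> cmod (\<xi> i) \<le> ell2_norm \<xi>"
  using L2_set_le_ell2_norm[of \<xi> S "{i}"] by simp

lemma ell2_norm_eq_0: "\<xi> \<in> ell2 S \<Longrightarrow> ell2_norm \<xi> = 0 \<Longrightarrow> \<xi> = (\<lambda>i. 0)"
  using cmod_le_ell2_norm[of \<xi> S] by force

lemma ell2_inner_summable:
  assumes "\<xi> \<in> ell2 S" "\<eta> \<in> ell2 S"
  shows "(\<lambda>i. cmod (\<xi> i * cnj (\<eta> i))) summable_on UNIV"
    and "(\<Sum>\<^sub>\<infinity>i. cmod (\<xi> i * cnj (\<eta> i))) \<le> ell2_norm \<xi> * ell2_norm \<eta>"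
proof -
  have *: "(\<Sum>i\<in>F. cmod (\<xi> i * cnj (\<eta> i))) \<le> ell2_norm \<xi> * ell2_norm \<eta>" if "finite F" for F
  proof -
    have "(\<Sum>i\<in>F. cmod (\<xi> i * cnj (\<eta> i))) = (\<Sum>i\<in>F. \<bar>cmod (\<xi> i)\<bar> * \<bar>cmod (\<eta> i)\<bar>)"
      by (simp add: norm_mult)
    also have "\<dots> \<le> L2_set (\<lambda>i. cmod (\<xi> i)) F * L2_set (\<lambda>i. cmod (\<eta> i)) F"
      by (rule L2_set_mult_ineq)
    also have "\<dots> \<le> ell2_norm \<xi> * ell2_norm \<eta>"
      by (intro mult_mono L2_set_le_ell2_norm[OF assms(1) that] L2_set_le_ell2_norm[OF assms(2) that]) auto
    finally show ?thesis .
  qed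
  show s: "(\<lambda>i. cmod (\<xi> i * cnj (\<eta> i))) summable_on UNIV"
    by (intro nonneg_bdd_above_summable_on)
       (auto intro!: bdd_aboveI[of _ "ell2_norm \<xi> * ell2_norm \<eta>"] *)
  show "(\<Sum>\<^sub>\<infinity>i. cmod (\<xi> i * cnj (\<eta> i))) \<le> ell2_norm \<xi> * ell2_norm \<eta>"
    by (rule infsum_le_finite_sums[OF s]) (use * in auto)
qed

lemma ell2_Cauchy_Schwarz:
  assumes "\<xi> \<in> ell2 S" "\<eta> \<in> ell2 S"
  shows "cmod (ell2_inner \<xi> \<eta>) \<le> ell2_norm \<xi> * ell2_norm \<eta>"
  using norm_infsum_bound[OF ell2_inner_summable(1)[OF assms]] ell2_inner_summable(2)[OF assms]
  unfolding ell2_inner_def by linarith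

lemma ell2_inner_add_left:
  assumes "\<xi> \<in> ell2 S" "\<eta> \<in> ell2 S" "\<zeta> \<in> ell2 S"
  shows "ell2_inner (\<lambda>i. \<xi> i + \<eta> i) \<zeta> = ell2_inner \<xi> \<zeta> + ell2_inner \<eta> \<zeta>"
  unfolding ell2_inner_def distrib_right
  using ell2_inner_summable(1)[OF assms(1,3)] ell2_inner_summable(1)[OF assms(2,3)]
  by (intro infsum_add) (auto dest: abs_summable_summable)

lemma ell2_inner_scale_left: "ell2_inner (\<lambda>i. c * \<xi> i) \<zeta> = c * ell2_inner \<xi> \<zeta>"
  unfolding ell2_inner_def by (simp add: mult.assoc infsum_cmult_right')

lemma ell2_inner_cnj: "ell2_inner \<xi> \<eta> = cnj (ell2_inner \<eta> \<xi>)"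
proof -
  have "(\<Sum>\<^sub>\<infinity>i. \<xi> i * cnj (\<eta> i)) = (\<Sum>\<^sub>\<infinity>i. cnj (\<eta> i * cnj (\<xi> i)))"
    by (intro infsum_cong) simp
  then show ?thesis by (simp only: ell2_inner_def infsum_cnj)
qed

lemma ell2_inner_diff_left:
  assumes "\<xi> \<in> ell2 S" "\<eta> \<in> ell2 S" "\<zeta> \<in> ell2 S"
  shows "ell2_inner (\<lambda>i. \<xi> i - \<eta> i) \<zeta> = ell2_inner \<xi> \<zeta> - ell2_inner \<eta> \<zeta>"
  using ell2_inner_add_left[OF assms(1) ell2_scale[OF assms(2), of "-1"] assms(3)]
    ell2_inner_scale_left[of "-1" \<eta> \<zeta>] by simp

lemma ell2_inner_add_right:
  assumes "\<xi> \<in> ell2 S" "\<eta> \<in> ell2 S" "\<zeta> \<in> ell2 S"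
  shows "ell2_inner \<zeta> (\<lambda>i. \<xi> i + \<eta> i) = ell2_inner \<zeta> \<xi> + ell2_inner \<zeta> \<eta>"
  using ell2_inner_add_left[OF assms] ell2_inner_cnj by (metis complex_cnj_add)

lemma ell2_inner_diff_right:
  assumes "\<xi> \<in> ell2 S" "\<eta> \<in> ell2 S" "\<zeta> \<in> ell2 S"
  shows "ell2_inner \<zeta> (\<lambda>i. \<xi> i - \<eta> i) = ell2_inner \<zeta> \<xi> - ell2_inner \<zeta> \<eta>"
  using ell2_inner_diff_left[OF assms] ell2_inner_cnj by (metis complex_cnj_diff)

lemma ell2_inner_scale_right: "ell2_inner \<zeta> (\<lambda>i. c * \<xi> i) = cnj c * ell2_inner \<zeta> \<xi>"
  using ell2_inner_scale_left ell2_inner_cnj by (metis complex_cnj_mult)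

lemma ell2_inner_self:
  assumes "\<xi> \<in> ell2 S"
  shows "ell2_inner \<xi> \<xi> = complex_of_real ((ell2_norm \<xi>)\<^sup>2)"
proof -
  have "ell2_inner \<xi> \<xi> = (\<Sum>\<^sub>\<infinity>i. complex_of_real ((cmod (\<xi> i))\<^sup>2))"
    unfolding ell2_inner_def complex_norm_square ..
  also have "\<dots> = complex_of_real (\<Sum>\<^sub>\<infinity>i. (cmod (\<xi> i))\<^sup>2)"
    by (intro infsumI has_sum_of_real has_sum_infsum ell2_summable[OF assms])
  also have "\<dots> = complex_of_real ((ell2_norm \<xi>)\<^sup>2)"
    by (simp add: ell2_norm_def infsum_nonneg)
  finally show ?thesis .
qed

lemma ell2_norm_sq_le_inner:
  assumes "\<xi> \<in> ell2 S" "\<eta> \<in> ell2 S" "ell2_inner \<xi> \<xi> = ell2_inner \<eta> \<zeta>" "\<zeta> \<in> ell2 S"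
  shows "(ell2_norm \<xi>)\<^sup>2 \<le> ell2_norm \<eta> * ell2_norm \<zeta>"
proof -
  have "(ell2_norm \<xi>)\<^sup>2 = cmod (ell2_inner \<eta> \<zeta>)"
    unfolding assms(3)[symmetric] ell2_inner_self[OF assms(1)] norm_of_real by simp
  then show ?thesis using ell2_Cauchy_Schwarz[OF assms(2,4)] by simp
qed

lemma ell2_basis [simp]: "i \<in> S \<Longrightarrow> indicator {i} \<in> ell2 S"
proof -
  assume "i \<in> S"
  moreover have "L2_set (\<lambda>j. cmod (indicator {i} j)) F \<le> 1" if "finite F" for F :: "'a set"
  proof -
    have "(\<Sum>j\<in>F. (cmod (indicator {i} j))\<^sup>2) = (\<Sum>j\<in>F. if j = i then 1 else 0)"
      by (intro sum.cong) (auto simp: indicator_def)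
    also have "\<dots> \<le> 1" using that by simp
    finally show ?thesis unfolding L2_set_def by simp
  qed
  ultimately show ?thesis by (intro ell2_normI(1)[where C=1]) (auto simp: indicator_def)
qed

text \<open>The coordinates of a vector are its inner products with the basis, which is why operators are
  compared below on basis vectors.\<close>

lemma ell2_inner_basis_right [simp]: "ell2_inner \<xi> (indicator {i}) = \<xi> i"
proof -
  have "ell2_inner \<xi> (indicator {i}) = (\<Sum>\<^sub>\<infinity>j\<in>{i}. \<xi> j * cnj (indicator {i} j))"
    unfolding ell2_inner_def by (rule infsum_cong_neutral) (auto simp: indicator_def)
  then show ?thesis by simp
qed

lemma ell2_norm_basis [simp]: "ell2_norm (indicator {i} :: 'i \<Rightarrow> complex) = 1"
proof -
  have "complex_of_real ((ell2_norm (indicator {i} :: 'i \<Rightarrow> complex))\<^sup>2) = 1"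
    unfolding ell2_inner_self[OF ell2_basis[OF UNIV_I], symmetric] ell2_inner_basis_right by simp
  then have "(ell2_norm (indicator {i} :: 'i \<Rightarrow> complex))\<^sup>2 = 1"
    unfolding of_real_eq_1_iff .
  then show ?thesis
    using ell2_norm_nonneg[of "indicator {i} :: 'i \<Rightarrow> complex"] unfolding power2_eq_1_iff by linarith
qed

lemma ell2_complete:
  assumes mem: "\<And>n. u n \<in> ell2 S"
    and Cauchy: "\<And>e. 0 < e \<Longrightarrow> \<exists>N. \<forall>m\<ge>N. \<forall>n\<ge>N. ell2_norm (\<lambda>i. u m i - u n i) \<le> e"
  shows "\<exists>\<zeta>\<in>ell2 S. (\<lambda>n. ell2_norm (\<lambda>i. u n i - \<zeta> i)) \<longlonglongrightarrow> 0"
proof -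
  have "Cauchy (\<lambda>n. u n i)" for i
  proof (rule metric_CauchyI)
    fix e :: real assume "0 < e"
    then obtain N where N: "\<forall>m\<ge>N. \<forall>n\<ge>N. ell2_norm (\<lambda>i. u m i - u n i) \<le> e/2"
      using Cauchy[of "e/2"] by auto
    have "dist (u m i) (u n i) < e" if "m \<ge> N" "n \<ge> N" for m n
      using cmod_le_ell2_norm[OF ell2_diff(1)[OF mem[of m] mem[of n]], of i] N that \<open>0 < e\<close>
      by (fastforce simp: dist_norm)
    then show "\<exists>N. \<forall>m\<ge>N. \<forall>n\<ge>N. dist (u m i) (u n i) < e" by blast
  qed
  then have "\<forall>i. \<exists>l. (\<lambda>n. u n i) \<longlonglongrightarrow> l" by (simp add: Cauchy_convergent_iff convergent_def)
  then obtain \<zeta> where \<zeta>: "\<And>i. (\<lambda>n. u n i) \<longlonglongrightarrow> \<zeta> i" by metis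
  have z: "\<zeta> i = 0" if "i \<notin> S" for i
  proof -
    have "(\<lambda>n. u n i) = (\<lambda>n. 0)" using ell2_outside[OF mem that] by simp
    with \<zeta>[of i] show ?thesis by (simp add: LIMSEQ_const_iff)
  qed
  have close: "\<exists>N. \<forall>n\<ge>N. (\<lambda>i. u n i - \<zeta> i) \<in> ell2 S \<and> ell2_norm (\<lambda>i. u n i - \<zeta> i) \<le> e"
    if "0 < e" for e
  proof -
    obtain N where N: "\<And>m n. m\<ge>N \<Longrightarrow> n\<ge>N \<Longrightarrow> ell2_norm (\<lambda>i. u m i - u n i) \<le> e"
      using Cauchy[OF \<open>0 < e\<close>] by blast
    have b: "L2_set (\<lambda>i. cmod (u n i - \<zeta> i)) F \<le> e" if "n \<ge> N" "finite F" for n F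
    proof (rule Lim_bounded)
      show "(\<lambda>m. L2_set (\<lambda>i. cmod (u n i - u m i)) F) \<longlonglongrightarrow> L2_set (\<lambda>i. cmod (u n i - \<zeta> i)) F"
        unfolding L2_set_def by (intro tendsto_intros \<zeta>)
      show "\<forall>m\<ge>N. L2_set (\<lambda>i. cmod (u n i - u m i)) F \<le> e"
        using L2_set_le_ell2_norm[OF ell2_diff(1)[OF mem mem] \<open>finite F\<close>] N[OF \<open>n \<ge> N\<close>]
        by (meson order_trans)
    qed
    have "(\<lambda>i. u n i - \<zeta> i) \<in> ell2 S \<and> ell2_norm (\<lambda>i. u n i - \<zeta> i) \<le> e" if "n \<ge> N" for n
    proof -
      have "u n i - \<zeta> i = 0" if "i \<notin> S" for i using z[OF that] ell2_outside[OF mem that] by simp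
      then show ?thesis using ell2_normI[of S, OF _ b[OF \<open>n \<ge> N\<close>]] by blast
    qed
    then show ?thesis by blast
  qed
  obtain n where "(\<lambda>i. u n i - \<zeta> i) \<in> ell2 S" using close[of 1] by fastforce
  from ell2_diff(1)[OF mem[of n] this] have "\<zeta> \<in> ell2 S" by simp
  moreover have "(\<lambda>n. ell2_norm (\<lambda>i. u n i - \<zeta> i)) \<longlonglongrightarrow> 0"
  proof (rule LIMSEQ_I)
    fix r :: real assume "0 < r"
    then obtain N where "\<forall>n\<ge>N. ell2_norm (\<lambda>i. u n i - \<zeta> i) \<le> r/2" using close[of "r/2"] by auto
    then show "\<exists>N. \<forall>n\<ge>N. norm (ell2_norm (\<lambda>i. u n i - \<zeta> i) - 0) < r"
      using \<open>0 < r\<close> by (intro exI[of _ N]) fastforce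
  qed
  ultimately show ?thesis by blast
qed

text \<open>Norm convergence inside \<open>\<ell>\<^sup>2(S)\<close>, with membership built in: norms of functions that are not
  square-summable carry no information.\<close>

definition ell2_lim :: "'i set \<Rightarrow> (nat \<Rightarrow> 'i \<Rightarrow> complex) \<Rightarrow> ('i \<Rightarrow> complex) \<Rightarrow> bool" where
  "ell2_lim S u \<zeta> \<longleftrightarrow> (\<forall>n. u n \<in> ell2 S) \<and> \<zeta> \<in> ell2 S \<and> (\<lambda>n. ell2_norm (\<lambda>i. u n i - \<zeta> i)) \<longlonglongrightarrow> 0"

lemma ell2_limI:
  assumes "\<And>n. u n \<in> ell2 S" "\<zeta> \<in> ell2 S" "\<And>n. ell2_norm (\<lambda>i. u n i - \<zeta> i) \<le> b n" "b \<longlonglongrightarrow> 0"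
  shows "ell2_lim S u \<zeta>"
  unfolding ell2_lim_def
  using assms tendsto_sandwich[of "\<lambda>_. 0" "\<lambda>n. ell2_norm (\<lambda>i. u n i - \<zeta> i)" sequentially b 0]
  by auto

lemma ell2_lim_unique:
  assumes "ell2_lim S u \<zeta>" "ell2_lim S v \<zeta>'" "(\<lambda>n. ell2_norm (\<lambda>i. u n i - v n i)) \<longlonglongrightarrow> 0"
  shows "\<zeta> = \<zeta>'"
proof -
  have m: "\<And>n. u n \<in> ell2 S" "\<And>n. v n \<in> ell2 S" "\<zeta> \<in> ell2 S" "\<zeta>' \<in> ell2 S"
    using assms by (auto simp: ell2_lim_def)
  have "ell2_norm (\<lambda>i. \<zeta> i - \<zeta>' i) \<le>
      ell2_norm (\<lambda>i. u n i - \<zeta> i) + ell2_norm (\<lambda>i. u n i - v n i) + ell2_norm (\<lambda>i. v n i - \<zeta>' i)" for n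
    using ell2_diff_triangle[OF m(3) m(1) m(4), of n] ell2_diff_triangle[OF m(1) m(2) m(4), of n n]
    by (simp add: ell2_norm_minus_commute[of \<zeta>])
  moreover have "(\<lambda>n. ell2_norm (\<lambda>i. u n i - \<zeta> i) + ell2_norm (\<lambda>i. u n i - v n i)
      + ell2_norm (\<lambda>i. v n i - \<zeta>' i)) \<longlonglongrightarrow> 0 + 0 + 0"
    using assms by (intro tendsto_add) (auto simp: ell2_lim_def)
  ultimately have "ell2_norm (\<lambda>i. \<zeta> i - \<zeta>' i) \<le> 0"
    by (intro Lim_bounded2[where N=0]) auto
  then have "ell2_norm (\<lambda>i. \<zeta> i - \<zeta>' i) = 0" by (simp add: order_antisym)
  from ell2_norm_eq_0[OF ell2_diff(1)[OF m(3,4)] this] show ?thesis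
    by (auto simp: fun_eq_iff)
qed

lemma ell2_lim_const: "\<zeta> \<in> ell2 S \<Longrightarrow> ell2_lim S (\<lambda>n. \<zeta>) \<zeta>"
  by (simp add: ell2_lim_def)

lemma ell2_lim_add:
  assumes "ell2_lim S u \<zeta>" "ell2_lim S v \<eta>"
  shows "ell2_lim S (\<lambda>n i. u n i + v n i) (\<lambda>i. \<zeta> i + \<eta> i)"
proof -
  have m: "\<And>n. u n \<in> ell2 S" "\<And>n. v n \<in> ell2 S" "\<zeta> \<in> ell2 S" "\<eta> \<in> ell2 S"
    using assms by (auto simp: ell2_lim_def)
  show ?thesis
  proof (rule ell2_limI)
    show "ell2_norm (\<lambda>i. u n i + v n i - (\<zeta> i + \<eta> i))
        \<le> ell2_norm (\<lambda>i. u n i - \<zeta> i) + ell2_norm (\<lambda>i. v n i - \<eta> i)" for n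
      using ell2_add(2)[OF ell2_diff(1)[OF m(1,3)] ell2_diff(1)[OF m(2,4)], of n n]
      by (simp add: algebra_simps)
    have "(\<lambda>n. ell2_norm (\<lambda>i. u n i - \<zeta> i) + ell2_norm (\<lambda>i. v n i - \<eta> i)) \<longlonglongrightarrow> 0 + 0"
      using assms by (intro tendsto_add) (auto simp: ell2_lim_def)
    then show "(\<lambda>n. ell2_norm (\<lambda>i. u n i - \<zeta> i) + ell2_norm (\<lambda>i. v n i - \<eta> i)) \<longlonglongrightarrow> 0" by simp
  qed (use m in \<open>auto intro: ell2_add\<close>)
qed

lemma ell2_lim_scale:
  assumes "ell2_lim S u \<zeta>"
  shows "ell2_lim S (\<lambda>n i. c * u n i) (\<lambda>i. c * \<zeta> i)"
proof -
  have e: "(\<lambda>i. c * u n i - c * \<zeta> i) = (\<lambda>i. c * (u n i - \<zeta> i))" for n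
    by (simp add: right_diff_distrib)
  have "(\<lambda>n. cmod c * ell2_norm (\<lambda>i. u n i - \<zeta> i)) \<longlonglongrightarrow> cmod c * 0"
    using assms by (intro tendsto_mult_left) (simp add: ell2_lim_def)
  then show ?thesis using assms by (simp add: ell2_lim_def e ell2_norm_scale)
qed

lemma ell2_lim_inner_left:
  assumes "ell2_lim S u \<zeta>" "\<eta> \<in> ell2 S"
  shows "(\<lambda>n. ell2_inner (u n) \<eta>) \<longlonglongrightarrow> ell2_inner \<zeta> \<eta>"
proof -
  have m: "\<And>n. u n \<in> ell2 S" "\<zeta> \<in> ell2 S" using assms by (auto simp: ell2_lim_def)
  have "(\<lambda>n. ell2_norm (\<lambda>i. u n i - \<zeta> i) * ell2_norm \<eta>) \<longlonglongrightarrow> 0 * ell2_norm \<eta>"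
    using assms by (intro tendsto_mult_right) (simp add: ell2_lim_def)
  then have t: "(\<lambda>n. ell2_norm (\<lambda>i. u n i - \<zeta> i) * ell2_norm \<eta>) \<longlonglongrightarrow> 0" by simp
  have "norm (ell2_inner (u n) \<eta> - ell2_inner \<zeta> \<eta>)
        \<le> ell2_norm (\<lambda>i. u n i - \<zeta> i) * ell2_norm \<eta>" for n
    using ell2_Cauchy_Schwarz[OF ell2_diff(1)[OF m] assms(2)]
    by (simp add: ell2_inner_diff_left[OF m assms(2)])
  then have "(\<lambda>n. ell2_inner (u n) \<eta> - ell2_inner \<zeta> \<eta>) \<longlonglongrightarrow> 0"
    by (rule Lim_null_comparison[OF always_eventually[OF allI] t])
  then show ?thesis by (rule LIM_zero_cancel)
qed

lemma ell2_lim_inner_right: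
  assumes "ell2_lim S u \<zeta>" "\<eta> \<in> ell2 S"
  shows "(\<lambda>n. ell2_inner \<eta> (u n)) \<longlonglongrightarrow> ell2_inner \<eta> \<zeta>"
  using tendsto_cnj[OF ell2_lim_inner_left[OF assms]] by (simp flip: ell2_inner_cnj)

lemma ell2_lim_norm_le:
  assumes "ell2_lim S u \<zeta>" "\<And>n. n \<ge> N \<Longrightarrow> ell2_norm (u n) \<le> C"
  shows "ell2_norm \<zeta> \<le> C"
proof -
  have m: "\<And>n. u n \<in> ell2 S" "\<zeta> \<in> ell2 S" using assms by (auto simp: ell2_lim_def)
  have t: "(\<lambda>n. C + ell2_norm (\<lambda>i. u n i - \<zeta> i)) \<longlonglongrightarrow> C + 0"
    using assms by (intro tendsto_add tendsto_const) (simp add: ell2_lim_def)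
  have "ell2_norm \<zeta> \<le> C + ell2_norm (\<lambda>i. u n i - \<zeta> i)" if "n \<ge> N" for n
    using ell2_norm_le_diff[OF m(2) m(1), of n] assms(2)[OF that]
      ell2_norm_minus_commute[of \<zeta> "u n"] by linarith
  then have "\<forall>n\<ge>N. ell2_norm \<zeta> \<le> C + ell2_norm (\<lambda>i. u n i - \<zeta> i)" by blast
  from Lim_bounded2[OF t this] show ?thesis by simp
qed

section \<open>Star-representations\<close>

lemma bounded_operatorD:
  assumes "bounded_operator S a" "\<xi> \<in> ell2 S"
  shows "a \<xi> \<in> ell2 S"
    and "\<eta> \<in> ell2 S \<Longrightarrow> a (\<lambda>i. \<xi> i + \<eta> i) = (\<lambda>i. a \<xi> i + a \<eta> i)"
    and "a (\<lambda>i. c * \<xi> i) = (\<lambda>i. c * a \<xi> i)"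
  using assms by (auto simp: bounded_operator_def)

lemma bounded_operator_diff:
  assumes "bounded_operator S a" "\<xi> \<in> ell2 S" "\<eta> \<in> ell2 S"
  shows "a (\<lambda>i. \<xi> i - \<eta> i) = (\<lambda>i. a \<xi> i - a \<eta> i)"
  using bounded_operatorD(2)[OF assms(1,2) ell2_scale[OF assms(3), of "-1"]]
    bounded_operatorD(3)[OF assms(1,3), of "-1"] by simp

text \<open>A bounded operator has finite operator norm, so the supremum defining it is not a default
  value; homogeneity passes from the unit ball to all vectors.\<close>

lemma operator_norm_bound:
  assumes "bounded_operator S a" "\<xi> \<in> ell2 S"
  shows "ell2_norm (a \<xi>) \<le> operator_norm S a * ell2_norm \<xi>"
proof -
  let ?N = "{ell2_norm (a \<xi>) | \<xi>. \<xi> \<in> ell2 S \<and> ell2_norm \<xi> \<le> 1}"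
  obtain C where C: "\<And>\<xi>. \<xi> \<in> ell2 S \<Longrightarrow> ell2_norm (a \<xi>) \<le> C * ell2_norm \<xi>"
    using assms(1) unfolding bounded_operator_def by blast
  have "ell2_norm (a \<xi>) \<le> \<bar>C\<bar>" if "\<xi> \<in> ell2 S" "ell2_norm \<xi> \<le> 1" for \<xi>
  proof -
    have "C * ell2_norm \<xi> \<le> \<bar>C\<bar> * 1" using that(2) by (intro mult_mono) auto
    with C[OF that(1)] show ?thesis by simp
  qed
  then have bdd: "bdd_above ?N" by (intro bdd_aboveI[of _ "\<bar>C\<bar>"]) blast
  show ?thesis
  proof (cases "ell2_norm \<xi> = 0")
    case True
    then show ?thesis using C[OF assms(2)] by (simp add: True)
  next
    case False
    define c where "c = complex_of_real (1 / ell2_norm \<xi>)"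
    have c: "cmod c * ell2_norm \<xi> = 1" using False by (simp add: c_def norm_divide)
    have "ell2_norm (a (\<lambda>i. c * \<xi> i)) \<le> operator_norm S a"
      unfolding operator_norm_def
      by (rule cSup_upper[OF _ bdd]) (use assms(2) c in \<open>auto simp: ell2_norm_scale intro!: exI[of _ "\<lambda>i. c * \<xi> i"]\<close>)
    then have "cmod c * ell2_norm (a \<xi>) \<le> operator_norm S a"
      using bounded_operatorD(3)[OF assms] by (simp add: ell2_norm_scale)
    then have "cmod c * ell2_norm (a \<xi>) * ell2_norm \<xi> \<le> operator_norm S a * ell2_norm \<xi>"
      by (intro mult_right_mono) auto
    moreover have "cmod c * ell2_norm (a \<xi>) * ell2_norm \<xi> = (cmod c * ell2_norm \<xi>) * ell2_norm (a \<xi>)"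
      by (simp only: mult_ac)
    ultimately show ?thesis unfolding c by simp
  qed
qed

lemma operator_norm_le:
  assumes "\<And>\<xi>. \<xi> \<in> ell2 S \<Longrightarrow> ell2_norm (a \<xi>) \<le> C * ell2_norm \<xi>" "0 \<le> C"
  shows "operator_norm S a \<le> C"
  unfolding operator_norm_def
proof (rule cSup_least)
  show "{ell2_norm (a \<xi>) |\<xi>. \<xi> \<in> ell2 S \<and> ell2_norm \<xi> \<le> 1} \<noteq> {}"
  proof -
    have "(\<lambda>i. 0) \<in> ell2 S \<and> ell2_norm (\<lambda>i. 0 :: complex) \<le> 1" by simp
    then show ?thesis by blast
  qed
  fix r assume "r \<in> {ell2_norm (a \<xi>) |\<xi>. \<xi> \<in> ell2 S \<and> ell2_norm \<xi> \<le> 1}"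
  then obtain \<xi> where "r = ell2_norm (a \<xi>)" "\<xi> \<in> ell2 S" "ell2_norm \<xi> \<le> 1" by blast
  then show "r \<le> C" using assms(1)[of \<xi>] mult_left_mono[of "ell2_norm \<xi>" 1 C] assms(2) by simp
qed

lemma operator_norm_nonneg:
  assumes "bounded_operator S a"
  shows "0 \<le> operator_norm S a"
proof (cases "\<exists>\<xi>\<in>ell2 S. ell2_norm \<xi> \<noteq> 0")
  case True
  then obtain \<xi> where x: "\<xi> \<in> ell2 S" "ell2_norm \<xi> > 0"
    by (auto simp: less_le)
  then have "0 \<le> operator_norm S a * ell2_norm \<xi>"
    using operator_norm_bound[OF assms x(1)] ell2_norm_nonneg[of "a \<xi>"] by linarith
  then show ?thesis using x(2) by (simp add: zero_le_mult_iff)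
next
  case False
  have "ell2_norm (a \<xi>) = 0" if "\<xi> \<in> ell2 S" for \<xi>
    using bounded_operatorD(1)[OF assms that] False by blast
  then have "{ell2_norm (a \<xi>) |\<xi>. \<xi> \<in> ell2 S \<and> ell2_norm \<xi> \<le> 1} = {0}"
  proof -
    have "(\<lambda>i. 0) \<in> ell2 S \<and> ell2_norm (\<lambda>i. 0 :: complex) \<le> 1" by simp
    then show ?thesis using \<open>\<And>\<xi>. \<xi> \<in> ell2 S \<Longrightarrow> ell2_norm (a \<xi>) = 0\<close> by fastforce
  qed
  then show ?thesis by (simp add: operator_norm_def)
qed

context
  fixes A :: "('a, 'm) star_algebra_scheme" and S :: "'i set"
    and L :: "'a \<Rightarrow> ('i \<Rightarrow> complex) \<Rightarrow> ('i \<Rightarrow> complex)"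
  assumes L: "star_representation A S L"
begin

lemma star_rep_bounded: "a \<in> sa_carrier A \<Longrightarrow> bounded_operator S (L a)"
  using L by (simp add: star_representation_def)

lemma star_rep_mem: "a \<in> sa_carrier A \<Longrightarrow> \<xi> \<in> ell2 S \<Longrightarrow> L a \<xi> \<in> ell2 S"
  using star_rep_bounded bounded_operatorD(1) by blast

lemma star_rep_add: "a \<in> sa_carrier A \<Longrightarrow> b \<in> sa_carrier A \<Longrightarrow> \<xi> \<in> ell2 S \<Longrightarrow>
    L (sa_add A a b) \<xi> = (\<lambda>i. L a \<xi> i + L b \<xi> i)"
  and star_rep_scale: "a \<in> sa_carrier A \<Longrightarrow> \<xi> \<in> ell2 S \<Longrightarrow> L (sa_scale A c a) \<xi> = (\<lambda>i. c * L a \<xi> i)"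
  and star_rep_mult: "a \<in> sa_carrier A \<Longrightarrow> b \<in> sa_carrier A \<Longrightarrow> \<xi> \<in> ell2 S \<Longrightarrow>
    L (sa_mult A a b) \<xi> = L a (L b \<xi>)"
  and star_rep_star: "a \<in> sa_carrier A \<Longrightarrow> \<xi> \<in> ell2 S \<Longrightarrow> \<eta> \<in> ell2 S \<Longrightarrow>
    ell2_inner (L (sa_star A a) \<xi>) \<eta> = ell2_inner \<xi> (L a \<eta>)"
  using L by (simp_all add: star_representation_def)

lemma star_rep_star': "a \<in> sa_carrier A \<Longrightarrow> \<xi> \<in> ell2 S \<Longrightarrow> \<eta> \<in> ell2 S \<Longrightarrow>
    ell2_inner (L a \<xi>) \<eta> = ell2_inner \<xi> (L (sa_star A a) \<eta>)"
  using star_rep_star[of a \<eta> \<xi>] by (metis ell2_inner_cnj)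

text \<open>Matrix coefficients with respect to the basis recover the operator from the adjoint, so two
  representations that agree on basis vectors agree everywhere.\<close>

lemma star_rep_coord: "a \<in> sa_carrier A \<Longrightarrow> \<xi> \<in> ell2 S \<Longrightarrow> i \<in> S \<Longrightarrow>
    L a \<xi> i = ell2_inner \<xi> (L (sa_star A a) (indicator {i}))"
  using star_rep_star'[of a \<xi> "indicator {i}"] by simp

lemma star_rep_diff_vec: "a \<in> sa_carrier A \<Longrightarrow> \<xi> \<in> ell2 S \<Longrightarrow> \<eta> \<in> ell2 S \<Longrightarrow>
    L a (\<lambda>i. \<xi> i - \<eta> i) = (\<lambda>i. L a \<xi> i - L a \<eta> i)"
  using bounded_operator_diff star_rep_bounded by blast

end

text \<open>Nothing but closure of the carrier is required of the operations: all
  identities and estimates in the enveloping algebra are verified inside representations.\<close>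

locale pre_cstar =
  fixes A :: "('a, 'm) star_algebra_scheme"
  assumes carrier_nonempty: "sa_carrier A \<noteq> {}"
    and add_closed [simp]: "a \<in> sa_carrier A \<Longrightarrow> b \<in> sa_carrier A \<Longrightarrow> sa_add A a b \<in> sa_carrier A"
    and scale_closed [simp]: "a \<in> sa_carrier A \<Longrightarrow> sa_scale A c a \<in> sa_carrier A"
    and mult_closed [simp]: "a \<in> sa_carrier A \<Longrightarrow> b \<in> sa_carrier A \<Longrightarrow> sa_mult A a b \<in> sa_carrier A"
    and star_closed [simp]: "a \<in> sa_carrier A \<Longrightarrow> sa_star A a \<in> sa_carrier A"
    and representations_bounded: "a \<in> sa_carrier A \<Longrightarrow> \<exists>C. \<forall>(S :: 'a set) L. star_representation A S L \<longrightarrow>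
          (\<forall>\<xi>\<in>ell2 S. ell2_norm (L a \<xi>) \<le> C * ell2_norm \<xi>)"
begin

lemma diff_closed [simp]: "a \<in> sa_carrier A \<Longrightarrow> b \<in> sa_carrier A \<Longrightarrow> sa_diff A a b \<in> sa_carrier A"
  by (simp add: sa_diff_def)

lemma star_rep_diff:
  assumes "star_representation A S L" "a \<in> sa_carrier A" "b \<in> sa_carrier A" "\<xi> \<in> ell2 S"
  shows "L (sa_diff A a b) \<xi> = (\<lambda>i. L a \<xi> i - L b \<xi> i)"
  using assms by (simp add: sa_diff_def star_rep_add[OF assms(1)] star_rep_scale[OF assms(1)])

abbreviation N where "N \<equiv> universal_norm A"

lemma operator_norm_le_universal_norm:
  fixes S :: "'a set"
  assumes "star_representation A S L" "a \<in> sa_carrier A"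
  shows "operator_norm S (L a) \<le> N a"
  unfolding universal_norm_def
proof (rule cSup_upper)
  obtain C where C: "\<And>(S :: 'a set) L. star_representation A S L \<Longrightarrow>
          (\<forall>\<xi>\<in>ell2 S. ell2_norm (L a \<xi>) \<le> C * ell2_norm \<xi>)"
    using representations_bounded[OF assms(2)] by blast
  have "operator_norm S (L a) \<le> \<bar>C\<bar>" if "star_representation A S L" for S :: "'a set" and L
  proof (rule operator_norm_le)
    fix \<xi> assume "\<xi> \<in> ell2 S"
    with C[OF that] have "ell2_norm (L a \<xi>) \<le> C * ell2_norm \<xi>" by blast
    also have "\<dots> \<le> \<bar>C\<bar> * ell2_norm \<xi>" by (intro mult_right_mono) auto
    finally show "ell2_norm (L a \<xi>) \<le> \<bar>C\<bar> * ell2_norm \<xi>" .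
  qed simp
  then show "bdd_above {operator_norm S (L a) |(S :: 'a set) L. star_representation A S L}"
    by (intro bdd_aboveI[of _ "\<bar>C\<bar>"]) blast
qed (use assms in blast)

lemma universal_norm_bound:
  fixes S :: "'a set"
  assumes "star_representation A S L" "a \<in> sa_carrier A" "\<xi> \<in> ell2 S"
  shows "ell2_norm (L a \<xi>) \<le> N a * ell2_norm \<xi>"
proof -
  have "ell2_norm (L a \<xi>) \<le> operator_norm S (L a) * ell2_norm \<xi>"
    by (rule operator_norm_bound[OF star_rep_bounded[OF assms(1,2)] assms(3)])
  also have "\<dots> \<le> N a * ell2_norm \<xi>"
    by (intro mult_right_mono operator_norm_le_universal_norm assms) auto
  finally show ?thesis .
qed

text \<open>Without it the set of norms defining the universal seminorm might be empty.\<close>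

lemma zero_representation: "star_representation A S (\<lambda>a \<xi> i. 0)"
  by (auto simp: star_representation_def bounded_operator_def ell2_inner_def
      intro!: exI[of _ 0])

lemma universal_norm_nonneg:
  assumes "a \<in> sa_carrier A" shows "0 \<le> N a"
  using operator_norm_nonneg[OF star_rep_bounded[OF zero_representation, of a "{} :: 'a set"]]
    operator_norm_le_universal_norm[OF zero_representation, of a "{}"] assms by fastforce

lemma universal_norm_le:
  assumes "\<And>(S :: 'a set) L \<xi>. star_representation A S L \<Longrightarrow> \<xi> \<in> ell2 S \<Longrightarrow>
      ell2_norm (L a \<xi>) \<le> C * ell2_norm \<xi>" "0 \<le> C"
  shows "N a \<le> C"
  unfolding universal_norm_def
proof (rule cSup_least)
  show "{operator_norm S (L a) |(S :: 'a set) L. star_representation A S L} \<noteq> {}"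
    using zero_representation by blast
qed (use assms in \<open>auto intro!: operator_norm_le\<close>)

lemma universal_norm_add:
  assumes "a \<in> sa_carrier A" "b \<in> sa_carrier A"
  shows "N (sa_add A a b) \<le> N a + N b"
proof (rule universal_norm_le)
  fix S :: "'a set" and L \<xi> assume L: "star_representation A S L" and x: "\<xi> \<in> ell2 S"
  have "ell2_norm (L (sa_add A a b) \<xi>) \<le> ell2_norm (L a \<xi>) + ell2_norm (L b \<xi>)"
    unfolding star_rep_add[OF L assms x]
    by (rule ell2_add(2)[OF star_rep_mem[OF L assms(1) x] star_rep_mem[OF L assms(2) x]])
  also have "\<dots> \<le> N a * ell2_norm \<xi> + N b * ell2_norm \<xi>"
    by (intro add_mono universal_norm_bound[OF L] assms x)
  finally show "ell2_norm (L (sa_add A a b) \<xi>) \<le> (N a + N b) * ell2_norm \<xi>"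
    by (simp add: distrib_right)
qed (use assms in \<open>simp add: universal_norm_nonneg\<close>)

lemma universal_norm_scale:
  assumes "a \<in> sa_carrier A"
  shows "N (sa_scale A c a) \<le> cmod c * N a"
proof (rule universal_norm_le)
  fix S :: "'a set" and L \<xi> assume L: "star_representation A S L" and x: "\<xi> \<in> ell2 S"
  show "ell2_norm (L (sa_scale A c a) \<xi>) \<le> cmod c * N a * ell2_norm \<xi>"
    unfolding star_rep_scale[OF L assms x] ell2_norm_scale mult.assoc
    by (intro mult_left_mono universal_norm_bound[OF L] assms x) auto
qed (use assms in \<open>simp add: universal_norm_nonneg\<close>)

lemma universal_norm_mult:
  assumes "a \<in> sa_carrier A" "b \<in> sa_carrier A"
  shows "N (sa_mult A a b) \<le> N a * N b"
proof (rule universal_norm_le)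
  fix S :: "'a set" and L \<xi> assume L: "star_representation A S L" and x: "\<xi> \<in> ell2 S"
  have "ell2_norm (L a (L b \<xi>)) \<le> N a * ell2_norm (L b \<xi>)"
    by (intro universal_norm_bound[OF L] assms star_rep_mem[OF L] x)
  also have "\<dots> \<le> N a * (N b * ell2_norm \<xi>)"
    by (intro mult_left_mono universal_norm_bound[OF L] universal_norm_nonneg assms x)
  finally show "ell2_norm (L (sa_mult A a b) \<xi>) \<le> N a * N b * ell2_norm \<xi>"
    by (simp add: star_rep_mult[OF L assms x] mult.assoc)
qed (use assms in \<open>simp add: universal_norm_nonneg\<close>)

lemma universal_norm_star:
  assumes "a \<in> sa_carrier A"
  shows "N (sa_star A a) \<le> N a"
proof (rule universal_norm_le)
  fix S :: "'a set" and L \<xi> assume L: "star_representation A S L" and x: "\<xi> \<in> ell2 S"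
  let ?y = "L (sa_star A a) \<xi>"
  have y: "?y \<in> ell2 S" "L a ?y \<in> ell2 S" using assms x by (simp_all add: star_rep_mem[OF L])
  have "(ell2_norm ?y)\<^sup>2 \<le> ell2_norm \<xi> * ell2_norm (L a ?y)"
    by (rule ell2_norm_sq_le_inner[OF y(1) x _ y(2)]) (rule star_rep_star[OF L assms x y(1)])
  also have "\<dots> \<le> ell2_norm \<xi> * (N a * ell2_norm ?y)"
    by (intro mult_left_mono universal_norm_bound[OF L] assms y) auto
  finally have "ell2_norm ?y * ell2_norm ?y \<le> (N a * ell2_norm \<xi>) * ell2_norm ?y"
    by (simp add: power2_eq_square mult_ac)
  then show "ell2_norm ?y \<le> N a * ell2_norm \<xi>"
    using universal_norm_nonneg[OF assms]
    by (cases "ell2_norm ?y = 0") (auto simp: mult_le_cancel_right order_less_le)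
qed (use assms in \<open>simp add: universal_norm_nonneg\<close>)

text \<open>Elements with the same image in every representation have the same seminorm. This replaces
  every use of an algebraic law in \<open>A\<close> itself.\<close>

lemma universal_norm_dominated:
  assumes "\<And>(S :: 'a set) L \<xi>. star_representation A S L \<Longrightarrow> \<xi> \<in> ell2 S \<Longrightarrow> L a \<xi> = L b \<xi>"
    and "b \<in> sa_carrier A"
  shows "N a \<le> N b"
  by (rule universal_norm_le) (use assms universal_norm_bound universal_norm_nonneg in auto)

lemma universal_norm_diff_commute:
  assumes "a \<in> sa_carrier A" "b \<in> sa_carrier A"
  shows "N (sa_diff A a b) = N (sa_diff A b a)"
proof -
  have "N (sa_diff A a b) \<le> N (sa_diff A b a)" if "a \<in> sa_carrier A" "b \<in> sa_carrier A" for a b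
  proof -
    have "N (sa_diff A a b) \<le> N (sa_scale A (-1) (sa_diff A b a))"
      by (rule universal_norm_dominated)
         (use that in \<open>auto simp: star_rep_diff star_rep_scale\<close>)
    also have "\<dots> \<le> N (sa_diff A b a)" using universal_norm_scale[of "sa_diff A b a" "-1"] that by simp
    finally show ?thesis .
  qed
  from this[OF assms] this[OF assms(2,1)] show ?thesis by simp
qed

lemma universal_norm_diff_self:
  assumes "a \<in> sa_carrier A" shows "N (sa_diff A a a) = 0"
proof (rule antisym)
  show "N (sa_diff A a a) \<le> 0"
    by (rule universal_norm_le) (simp_all add: star_rep_diff assms)
qed (simp add: universal_norm_nonneg assms)

lemma universal_norm_diff_triangle:
  assumes "a \<in> sa_carrier A" "b \<in> sa_carrier A" "c \<in> sa_carrier A"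
  shows "N (sa_diff A a c) \<le> N (sa_diff A a b) + N (sa_diff A b c)"
proof -
  have "N (sa_diff A a c) \<le> N (sa_add A (sa_diff A a b) (sa_diff A b c))"
    by (rule universal_norm_dominated) (use assms in \<open>auto simp: star_rep_diff star_rep_add\<close>)
  also have "\<dots> \<le> N (sa_diff A a b) + N (sa_diff A b c)"
    by (rule universal_norm_add) (use assms in auto)
  finally show ?thesis .
qed

lemma universal_norm_le_diff:
  assumes "a \<in> sa_carrier A" "b \<in> sa_carrier A"
  shows "N a \<le> N b + N (sa_diff A a b)"
proof -
  have "N a \<le> N (sa_add A b (sa_diff A a b))"
    by (rule universal_norm_dominated) (use assms in \<open>auto simp: star_rep_diff star_rep_add\<close>)
  also have "\<dots> \<le> N b + N (sa_diff A a b)"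
    by (rule universal_norm_add) (use assms in auto)
  finally show ?thesis .
qed

lemma universal_norm_add_diff:
  assumes "a \<in> sa_carrier A" "b \<in> sa_carrier A" "a' \<in> sa_carrier A" "b' \<in> sa_carrier A"
  shows "N (sa_diff A (sa_add A a b) (sa_add A a' b')) \<le> N (sa_diff A a a') + N (sa_diff A b b')"
proof -
  have "N (sa_diff A (sa_add A a b) (sa_add A a' b')) \<le> N (sa_add A (sa_diff A a a') (sa_diff A b b'))"
    by (rule universal_norm_dominated) (use assms in \<open>auto simp: star_rep_diff star_rep_add\<close>)
  also have "\<dots> \<le> N (sa_diff A a a') + N (sa_diff A b b')"
    by (rule universal_norm_add) (use assms in auto)
  finally show ?thesis .
qed

lemma universal_norm_scale_diff:
  assumes "a \<in> sa_carrier A" "a' \<in> sa_carrier A"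
  shows "N (sa_diff A (sa_scale A c a) (sa_scale A c a')) \<le> cmod c * N (sa_diff A a a')"
proof -
  have "N (sa_diff A (sa_scale A c a) (sa_scale A c a')) \<le> N (sa_scale A c (sa_diff A a a'))"
    by (rule universal_norm_dominated)
       (use assms in \<open>auto simp: star_rep_diff star_rep_scale algebra_simps\<close>)
  also have "\<dots> \<le> cmod c * N (sa_diff A a a')"
    by (rule universal_norm_scale) (use assms in auto)
  finally show ?thesis .
qed

text \<open>Inside a representation \<open>ab - a'b' = (a - a')b + a'(b - b')\<close>.\<close>

lemma universal_norm_mult_diff:
  assumes "a \<in> sa_carrier A" "b \<in> sa_carrier A" "a' \<in> sa_carrier A" "b' \<in> sa_carrier A"
  shows "N (sa_diff A (sa_mult A a b) (sa_mult A a' b')) \<le> N (sa_diff A a a') * N b + N a' * N (sa_diff A b b')"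
proof -
  have "N (sa_diff A (sa_mult A a b) (sa_mult A a' b'))
      \<le> N (sa_add A (sa_mult A (sa_diff A a a') b) (sa_mult A a' (sa_diff A b b')))"
    by (rule universal_norm_dominated)
      (use assms in \<open>auto simp: star_rep_diff star_rep_add star_rep_mult star_rep_mem star_rep_diff_vec\<close>)
  also have "\<dots> \<le> N (sa_mult A (sa_diff A a a') b) + N (sa_mult A a' (sa_diff A b b'))"
    by (rule universal_norm_add) (use assms in auto)
  also have "\<dots> \<le> N (sa_diff A a a') * N b + N a' * N (sa_diff A b b')"
    by (intro add_mono universal_norm_mult) (use assms in auto)
  finally show ?thesis .
qed

text \<open>The two sides are elements with the same image in each representation because both have the
  same matrix coefficients.\<close>

lemma universal_norm_star_diff:
  assumes "a \<in> sa_carrier A" "a' \<in> sa_carrier A"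
  shows "N (sa_diff A (sa_star A a) (sa_star A a')) \<le> N (sa_diff A a a')"
proof -
  have "N (sa_diff A (sa_star A a) (sa_star A a')) \<le> N (sa_star A (sa_diff A a a'))"
  proof (rule universal_norm_dominated)
    fix S :: "'a set" and L \<xi> assume L: "star_representation A S L" and x: "\<xi> \<in> ell2 S"
    have "L (sa_diff A (sa_star A a) (sa_star A a')) \<xi> i = L (sa_star A (sa_diff A a a')) \<xi> i" for i
    proof (cases "i \<in> S")
      case True
      let ?e = "indicator {i}"
      have "L (sa_diff A (sa_star A a) (sa_star A a')) \<xi> i
          = ell2_inner (L (sa_star A a) \<xi>) ?e - ell2_inner (L (sa_star A a') \<xi>) ?e"
        using assms x by (simp add: star_rep_diff[OF L])
      also have "\<dots> = ell2_inner \<xi> (L a ?e) - ell2_inner \<xi> (L a' ?e)"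
        using assms x True by (simp add: star_rep_star[OF L] del: ell2_inner_basis_right)
      also have "\<dots> = ell2_inner \<xi> (L (sa_diff A a a') ?e)"
        using assms x True
        by (simp add: star_rep_diff[OF L] ell2_inner_diff_right[of _ S] star_rep_mem[OF L])
      also have "\<dots> = ell2_inner (L (sa_star A (sa_diff A a a')) \<xi>) ?e"
        using assms x True by (simp add: star_rep_star[OF L] del: ell2_inner_basis_right)
      finally show ?thesis by simp
    next
      case False
      have "L (sa_diff A (sa_star A a) (sa_star A a')) \<xi> \<in> ell2 S" "L (sa_star A (sa_diff A a a')) \<xi> \<in> ell2 S"
        using assms x by (simp_all add: star_rep_mem[OF L])
      then show ?thesis using ell2_outside False by metis
    qed
    then show "L (sa_diff A (sa_star A a) (sa_star A a')) \<xi> = L (sa_star A (sa_diff A a a')) \<xi>"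
      by blast
  qed (use assms in auto)
  also have "\<dots> \<le> N (sa_diff A a a')"
    by (rule universal_norm_star) (use assms in auto)
  finally show ?thesis .
qed

end

section \<open>The enveloping C*-algebra\<close>

context pre_cstar
begin

abbreviation Cau where "Cau \<equiv> universal_Cauchy A"
abbreviation cls where "cls \<equiv> universal_class A"
abbreviation \<B> where "\<B> \<equiv> enveloping_cstar A"

lemma CauI:
  assumes "\<And>n. u n \<in> sa_carrier A"
    and "\<And>e. 0 < e \<Longrightarrow> \<exists>M. \<forall>m\<ge>M. \<forall>n\<ge>M. N (sa_diff A (u m) (u n)) < e"
  shows "u \<in> Cau"
  using assms by (auto simp: universal_Cauchy_def)

lemma Cau_carrier: "u \<in> Cau \<Longrightarrow> u n \<in> sa_carrier A"
  by (simp add: universal_Cauchy_def)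

lemma CauD: "u \<in> Cau \<Longrightarrow> 0 < e \<Longrightarrow> \<exists>M. \<forall>m\<ge>M. \<forall>n\<ge>M. N (sa_diff A (u m) (u n)) < e"
  by (simp add: universal_Cauchy_def)

lemma Cau_const: "a \<in> sa_carrier A \<Longrightarrow> (\<lambda>n. a) \<in> Cau"
  by (rule CauI) (auto simp: universal_norm_diff_self)

lemma Cau_bounded:
  assumes "u \<in> Cau" obtains C where "0 < C" "\<And>n. N (u n) \<le> C"
proof -
  obtain M where M: "\<forall>m\<ge>M. \<forall>n\<ge>M. N (sa_diff A (u m) (u n)) < 1" using CauD[OF assms, of 1] by auto
  have c: "\<And>n. u n \<in> sa_carrier A" by (rule Cau_carrier[OF assms])
  define C where "C = (\<Sum>n\<le>M. N (u n)) + 1"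
  have "N (u n) \<le> C" for n
  proof (cases "n \<le> M")
    case True
    then have "N (u n) \<le> (\<Sum>n\<le>M. N (u n))" by (intro member_le_sum) (auto simp: universal_norm_nonneg c)
    then show ?thesis by (simp add: C_def)
  next
    case False
    have "N (u n) \<le> N (u M) + N (sa_diff A (u n) (u M))" by (rule universal_norm_le_diff) (rule c)+
    also have "N (sa_diff A (u n) (u M)) \<le> 1" using M False by (simp add: less_imp_le)
    also have "N (u M) \<le> (\<Sum>n\<le>M. N (u n))" by (intro member_le_sum) (auto simp: universal_norm_nonneg c)
    finally show ?thesis by (simp add: C_def)
  qed
  moreover have "0 < C" by (simp add: C_def sum_nonneg universal_norm_nonneg c add_nonneg_pos)
  ultimately show ?thesis using that by blast
qed

lemma equiv_universal: "equiv Cau (universal_equiv A)"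
proof (rule equivI)
  show "universal_equiv A \<subseteq> Cau \<times> Cau" by (auto simp: universal_equiv_def)
  show "refl_on Cau (universal_equiv A)"
    by (auto simp: refl_on_def universal_equiv_def universal_norm_diff_self Cau_carrier)
  show "sym (universal_equiv A)"
    by (rule symI) (auto simp: universal_equiv_def universal_norm_diff_commute Cau_carrier)
  show "trans (universal_equiv A)"
  proof (rule transI)
    fix u v w assume uv: "(u, v) \<in> universal_equiv A" and vw: "(v, w) \<in> universal_equiv A"
    then have c: "u \<in> Cau" "v \<in> Cau" "w \<in> Cau" by (auto simp: universal_equiv_def)
    have "(\<lambda>n. N (sa_diff A (u n) (v n)) + N (sa_diff A (v n) (w n))) \<longlonglongrightarrow> 0 + 0"
      using uv vw by (intro tendsto_add) (auto simp: universal_equiv_def)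
    then have t: "(\<lambda>n. N (sa_diff A (u n) (v n)) + N (sa_diff A (v n) (w n))) \<longlonglongrightarrow> 0" by simp
    have "norm (N (sa_diff A (u n) (w n))) \<le> N (sa_diff A (u n) (v n)) + N (sa_diff A (v n) (w n))" for n
      using universal_norm_diff_triangle universal_norm_nonneg[of "sa_diff A (u n) (w n)"] c
      by (simp add: Cau_carrier)
    then have "(\<lambda>n. N (sa_diff A (u n) (w n))) \<longlonglongrightarrow> 0"
      by (rule Lim_null_comparison[OF always_eventually[OF allI] t])
    then show "(u, w) \<in> universal_equiv A" using c by (simp add: universal_equiv_def)
  qed
qed

lemma cls_eqI:
  assumes "u \<in> Cau" "v \<in> Cau" "\<And>n. N (sa_diff A (u n) (v n)) \<le> b n" "b \<longlonglongrightarrow> 0"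
  shows "cls u = cls v"
proof -
  have "norm (N (sa_diff A (u n) (v n))) \<le> b n" for n
    using assms(3) universal_norm_nonneg[of "sa_diff A (u n) (v n)"] assms(1,2) by (simp add: Cau_carrier)
  then have "(\<lambda>n. N (sa_diff A (u n) (v n))) \<longlonglongrightarrow> 0"
    by (rule Lim_null_comparison[OF always_eventually[OF allI] assms(4)])
  then have "(u, v) \<in> universal_equiv A" using assms by (simp add: universal_equiv_def)
  then show ?thesis unfolding universal_class_def by (rule equiv_class_eq[OF equiv_universal])
qed

lemma cls_memD:
  assumes "v \<in> cls u"
  shows "u \<in> Cau" "v \<in> Cau" "cls v = cls u" "(\<lambda>n. N (sa_diff A (u n) (v n))) \<longlonglongrightarrow> 0"
proof -
  have "(u, v) \<in> universal_equiv A" using assms by (simp add: universal_class_def)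
  then show "u \<in> Cau" "v \<in> Cau" "(\<lambda>n. N (sa_diff A (u n) (v n))) \<longlonglongrightarrow> 0"
    by (auto simp: universal_equiv_def)
  show "cls v = cls u" unfolding universal_class_def
    using \<open>(u, v) \<in> universal_equiv A\<close> equiv_class_eq[OF equiv_universal] by metis
qed

lemma cls_self: "u \<in> Cau \<Longrightarrow> u \<in> cls u"
  unfolding universal_class_def by (rule equiv_class_self[OF equiv_universal])

lemma carrier_B: "sa_carrier \<B> = cls ` Cau"
  by (auto simp: enveloping_cstar_def quotient_def universal_class_def)

lemma cls_carrier [simp]: "u \<in> Cau \<Longrightarrow> cls u \<in> sa_carrier \<B>"
  by (simp add: carrier_B)

lemma Cau_combine:
  assumes "\<And>n. w n \<in> sa_carrier A" "u \<in> Cau" "v \<in> Cau" "0 < C" "0 < D"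
    and "\<And>m n. N (sa_diff A (w m) (w n)) \<le> C * N (sa_diff A (u m) (u n)) + D * N (sa_diff A (v m) (v n))"
  shows "w \<in> Cau"
proof (rule CauI)
  fix e :: real assume "0 < e"
  then have e: "0 < e / (2 * C)" "0 < e / (2 * D)" using assms by auto
  obtain M1 M2 where M1: "\<forall>m\<ge>M1. \<forall>n\<ge>M1. N (sa_diff A (u m) (u n)) < e / (2*C)"
    and M2: "\<forall>m\<ge>M2. \<forall>n\<ge>M2. N (sa_diff A (v m) (v n)) < e / (2*D)"
    using CauD[OF assms(2) e(1)] CauD[OF assms(3) e(2)] by blast
  have "N (sa_diff A (w m) (w n)) < e" if "m \<ge> max M1 M2" "n \<ge> max M1 M2" for m n
  proof -
    have "C * N (sa_diff A (u m) (u n)) < C * (e / (2*C))" "D * N (sa_diff A (v m) (v n)) < D * (e / (2*D))"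
      using M1 M2 that assms(4,5) by (intro mult_strict_left_mono; simp)+
    then show ?thesis using assms(6)[of m n] assms(4,5) by (simp add: field_simps)
  qed
  then show "\<exists>M. \<forall>m\<ge>M. \<forall>n\<ge>M. N (sa_diff A (w m) (w n)) < e" by blast
qed (rule assms(1))

lemma Cau_add: "u \<in> Cau \<Longrightarrow> v \<in> Cau \<Longrightarrow> (\<lambda>n. sa_add A (u n) (v n)) \<in> Cau"
  using Cau_combine[of "\<lambda>n. sa_add A (u n) (v n)" u v 1 1] universal_norm_add_diff Cau_carrier by simp

lemma Cau_scale: "u \<in> Cau \<Longrightarrow> (\<lambda>n. sa_scale A c (u n)) \<in> Cau"
proof (rule Cau_combine[of _ u u "cmod c + 1" 1])
  fix m n assume u: "u \<in> Cau"
  have "N (sa_diff A (sa_scale A c (u m)) (sa_scale A c (u n))) \<le> cmod c * N (sa_diff A (u m) (u n))"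
    using universal_norm_scale_diff Cau_carrier[OF u] by simp
  then show "N (sa_diff A (sa_scale A c (u m)) (sa_scale A c (u n)))
    \<le> (cmod c + 1) * N (sa_diff A (u m) (u n)) + 1 * N (sa_diff A (u m) (u n))"
    using universal_norm_nonneg[of "sa_diff A (u m) (u n)"] Cau_carrier[OF u] by (simp add: distrib_right)
qed (auto simp: Cau_carrier add_nonneg_pos)

lemma Cau_star: "u \<in> Cau \<Longrightarrow> (\<lambda>n. sa_star A (u n)) \<in> Cau"
proof (rule Cau_combine[of _ u u 1 1])
  fix m n assume u: "u \<in> Cau"
  have "N (sa_diff A (sa_star A (u m)) (sa_star A (u n))) \<le> N (sa_diff A (u m) (u n))"
    using universal_norm_star_diff Cau_carrier[OF u] by simp
  then show "N (sa_diff A (sa_star A (u m)) (sa_star A (u n)))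
    \<le> 1 * N (sa_diff A (u m) (u n)) + 1 * N (sa_diff A (u m) (u n))"
    using universal_norm_nonneg[of "sa_diff A (u m) (u n)"] Cau_carrier[OF u] by simp
qed (auto simp: Cau_carrier)

lemma Cau_mult: 
  assumes u: "u \<in> Cau" and v: "v \<in> Cau" shows "(\<lambda>n. sa_mult A (u n) (v n)) \<in> Cau"
proof -
  obtain C D where C: "0 < C" "\<And>n. N (u n) \<le> C" and D: "0 < D" "\<And>n. N (v n) \<le> D"
    using Cau_bounded[OF u] Cau_bounded[OF v] by metis
  show ?thesis
  proof (rule Cau_combine[OF _ u v D(1) C(1)])
    fix m n
    have "N (sa_diff A (sa_mult A (u m) (v m)) (sa_mult A (u n) (v n)))
        \<le> N (sa_diff A (u m) (u n)) * N (v m) + N (u n) * N (sa_diff A (v m) (v n))"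
      by (rule universal_norm_mult_diff) (simp_all add: Cau_carrier[OF u] Cau_carrier[OF v])
    also have "\<dots> \<le> N (sa_diff A (u m) (u n)) * D + C * N (sa_diff A (v m) (v n))"
      by (rule add_mono[OF mult_left_mono[OF D(2)] mult_right_mono[OF C(2)]])
         (simp_all add: universal_norm_nonneg Cau_carrier[OF u] Cau_carrier[OF v])
    finally show "N (sa_diff A (sa_mult A (u m) (v m)) (sa_mult A (u n) (v n)))
        \<le> D * N (sa_diff A (u m) (u n)) + C * N (sa_diff A (v m) (v n))" by (simp add: mult.commute)
  qed (use u v in \<open>auto simp: Cau_carrier\<close>)
qed

text \<open>The operations of the enveloping algebra are unions over representatives; they are read off
  from any one representative once the result is known not to depend on it.\<close>

lemma UN_cls_const:
  assumes "u \<in> Cau" "\<And>v. v \<in> cls u \<Longrightarrow> F v = X"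
  shows "(\<Union>v\<in>cls u. F v) = X"
  using assms(2) cls_self[OF assms(1)] by auto

lemma B_add:
  assumes "u \<in> Cau" "v \<in> Cau"
  shows "sa_add \<B> (cls u) (cls v) = cls (\<lambda>n. sa_add A (u n) (v n))"
proof -
  have *: "cls (\<lambda>n. sa_add A (u' n) (v' n)) = cls (\<lambda>n. sa_add A (u n) (v n))"
    if "u' \<in> cls u" "v' \<in> cls v" for u' v'
  proof (rule cls_eqI[symmetric])
    have c: "u' \<in> Cau" "v' \<in> Cau" using that cls_memD by blast+
    show "(\<lambda>n. sa_add A (u' n) (v' n)) \<in> Cau" "(\<lambda>n. sa_add A (u n) (v n)) \<in> Cau"
      by (intro Cau_add c assms)+
    show "N (sa_diff A (sa_add A (u n) (v n)) (sa_add A (u' n) (v' n)))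
        \<le> N (sa_diff A (u n) (u' n)) + N (sa_diff A (v n) (v' n))" for n
      by (rule universal_norm_add_diff) (simp_all add: Cau_carrier[OF c(1)] Cau_carrier[OF c(2)] Cau_carrier[OF assms(1)] Cau_carrier[OF assms(2)])
    show "(\<lambda>n. N (sa_diff A (u n) (u' n)) + N (sa_diff A (v n) (v' n))) \<longlonglongrightarrow> 0"
      using tendsto_add[OF cls_memD(4)[OF that(1)] cls_memD(4)[OF that(2)]] by simp
  qed
  have "(\<Union>v'\<in>cls v. cls (\<lambda>n. sa_add A (u' n) (v' n))) = cls (\<lambda>n. sa_add A (u n) (v n))" if "u' \<in> cls u" for u'
    by (rule UN_cls_const[OF assms(2) *[OF that]])
  then have "(\<Union>u'\<in>cls u. \<Union>v'\<in>cls v. cls (\<lambda>n. sa_add A (u' n) (v' n))) = cls (\<lambda>n. sa_add A (u n) (v n))"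
    by (rule UN_cls_const[OF assms(1)])
  then show ?thesis by (simp add: enveloping_cstar_def)
qed

lemma B_mult:
  assumes "u \<in> Cau" "v \<in> Cau"
  shows "sa_mult \<B> (cls u) (cls v) = cls (\<lambda>n. sa_mult A (u n) (v n))"
proof -
  obtain C D where C: "0 < C" "\<And>n. N (u n) \<le> C" and D: "0 < D" "\<And>n. N (v n) \<le> D"
    using Cau_bounded[OF assms(1)] Cau_bounded[OF assms(2)] by metis
  have *: "cls (\<lambda>n. sa_mult A (u' n) (v' n)) = cls (\<lambda>n. sa_mult A (u n) (v n))"
    if "u' \<in> cls u" "v' \<in> cls v" for u' v'
  proof -
    have c: "u' \<in> Cau" "v' \<in> Cau" using that cls_memD by blast+
    obtain C' where C': "0 < C'" "\<And>n. N (u' n) \<le> C'" using Cau_bounded[OF c(1)] by metis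
    show ?thesis
    proof (rule cls_eqI[symmetric])
    show "(\<lambda>n. sa_mult A (u' n) (v' n)) \<in> Cau" "(\<lambda>n. sa_mult A (u n) (v n)) \<in> Cau"
      by (intro Cau_mult c assms)+
    show "N (sa_diff A (sa_mult A (u n) (v n)) (sa_mult A (u' n) (v' n)))
        \<le> N (sa_diff A (u n) (u' n)) * D + C' * N (sa_diff A (v n) (v' n))" for n
    proof -
      have "N (sa_diff A (sa_mult A (u n) (v n)) (sa_mult A (u' n) (v' n)))
          \<le> N (sa_diff A (u n) (u' n)) * N (v n) + N (u' n) * N (sa_diff A (v n) (v' n))"
        by (rule universal_norm_mult_diff) (simp_all add: Cau_carrier[OF c(1)] Cau_carrier[OF c(2)] Cau_carrier[OF assms(1)] Cau_carrier[OF assms(2)])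
      also have "\<dots> \<le> N (sa_diff A (u n) (u' n)) * D + C' * N (sa_diff A (v n) (v' n))"
        by (rule add_mono[OF mult_left_mono[OF D(2)] mult_right_mono[OF C'(2)]])
           (simp_all add: universal_norm_nonneg Cau_carrier[OF c(1)] Cau_carrier[OF assms(1)]
              Cau_carrier[OF c(2)] Cau_carrier[OF assms(2)])
      finally show ?thesis .
    qed
    show "(\<lambda>n. N (sa_diff A (u n) (u' n)) * D + C' * N (sa_diff A (v n) (v' n))) \<longlonglongrightarrow> 0"
      using tendsto_add[OF tendsto_mult_right[OF cls_memD(4)[OF that(1)], of D]
          tendsto_mult_left[OF cls_memD(4)[OF that(2)], of C']] by simp
    qed
  qed
  have "(\<Union>v'\<in>cls v. cls (\<lambda>n. sa_mult A (u' n) (v' n))) = cls (\<lambda>n. sa_mult A (u n) (v n))" if "u' \<in> cls u" for u'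
    by (rule UN_cls_const[OF assms(2) *[OF that]])
  then have "(\<Union>u'\<in>cls u. \<Union>v'\<in>cls v. cls (\<lambda>n. sa_mult A (u' n) (v' n))) = cls (\<lambda>n. sa_mult A (u n) (v n))"
    by (rule UN_cls_const[OF assms(1)])
  then show ?thesis by (simp add: enveloping_cstar_def)
qed

lemma B_scale:
  assumes "u \<in> Cau"
  shows "sa_scale \<B> c (cls u) = cls (\<lambda>n. sa_scale A c (u n))"
proof -
  have "cls (\<lambda>n. sa_scale A c (u' n)) = cls (\<lambda>n. sa_scale A c (u n))" if "u' \<in> cls u" for u'
  proof (rule cls_eqI[symmetric])
    have c: "u' \<in> Cau" using that cls_memD by blast+
    show "(\<lambda>n. sa_scale A c (u' n)) \<in> Cau" "(\<lambda>n. sa_scale A c (u n)) \<in> Cau"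
      by (intro Cau_scale c assms)+
    show "N (sa_diff A (sa_scale A c (u n)) (sa_scale A c (u' n))) \<le> cmod c * N (sa_diff A (u n) (u' n))" for n
      by (rule universal_norm_scale_diff) (simp_all add: Cau_carrier[OF c] Cau_carrier[OF assms])
    show "(\<lambda>n. cmod c * N (sa_diff A (u n) (u' n))) \<longlonglongrightarrow> 0"
      using tendsto_mult_left[OF cls_memD(4)[OF that(1)], of "cmod c"] by simp
  qed
  then have "(\<Union>u'\<in>cls u. cls (\<lambda>n. sa_scale A c (u' n))) = cls (\<lambda>n. sa_scale A c (u n))"
    by (rule UN_cls_const[OF assms(1)])
  then show ?thesis by (simp add: enveloping_cstar_def)
qed

lemma B_star:
  assumes "u \<in> Cau"
  shows "sa_star \<B> (cls u) = cls (\<lambda>n. sa_star A (u n))"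
proof -
  have "cls (\<lambda>n. sa_star A (u' n)) = cls (\<lambda>n. sa_star A (u n))" if "u' \<in> cls u" for u'
  proof (rule cls_eqI[symmetric])
    have c: "u' \<in> Cau" using that cls_memD by blast+
    show "(\<lambda>n. sa_star A (u' n)) \<in> Cau" "(\<lambda>n. sa_star A (u n)) \<in> Cau"
      by (intro Cau_star c assms)+
    show "N (sa_diff A (sa_star A (u n)) (sa_star A (u' n))) \<le> N (sa_diff A (u n) (u' n))" for n
      by (rule universal_norm_star_diff) (simp_all add: Cau_carrier[OF c] Cau_carrier[OF assms])
    show "(\<lambda>n. N (sa_diff A (u n) (u' n))) \<longlonglongrightarrow> 0"
      by (rule cls_memD(4)[OF that(1)])
  qed
  then have "(\<Union>u'\<in>cls u. cls (\<lambda>n. sa_star A (u' n))) = cls (\<lambda>n. sa_star A (u n))"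
    by (rule UN_cls_const[OF assms(1)])
  then show ?thesis by (simp add: enveloping_cstar_def)
qed

lemma to_enveloping_carrier [simp]: "a \<in> sa_carrier A \<Longrightarrow> to_enveloping A a \<in> sa_carrier \<B>"
  by (simp add: to_enveloping_def Cau_const)

lemma carrier_BE:
  assumes "P \<in> sa_carrier \<B>" obtains u where "u \<in> Cau" "P = cls u"
  using assms by (auto simp: carrier_B)

lemma B_closed:
  "P \<in> sa_carrier \<B> \<Longrightarrow> Q \<in> sa_carrier \<B> \<Longrightarrow> sa_add \<B> P Q \<in> sa_carrier \<B>"
  "P \<in> sa_carrier \<B> \<Longrightarrow> Q \<in> sa_carrier \<B> \<Longrightarrow> sa_mult \<B> P Q \<in> sa_carrier \<B>"
  "P \<in> sa_carrier \<B> \<Longrightarrow> sa_scale \<B> c P \<in> sa_carrier \<B>"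
  "P \<in> sa_carrier \<B> \<Longrightarrow> sa_star \<B> P \<in> sa_carrier \<B>"
  by (auto elim!: carrier_BE simp: B_add B_mult B_scale B_star Cau_add Cau_mult Cau_scale Cau_star)

lemma star_rep_to_enveloping:
  assumes "star_representation \<B> S L"
  shows "star_representation A S (\<lambda>a. L (to_enveloping A a))"
proof -
  have e: "a \<in> sa_carrier A \<Longrightarrow> b \<in> sa_carrier A \<Longrightarrow>
      to_enveloping A (sa_add A a b) = sa_add \<B> (to_enveloping A a) (to_enveloping A b)"
    "a \<in> sa_carrier A \<Longrightarrow> b \<in> sa_carrier A \<Longrightarrow>
      to_enveloping A (sa_mult A a b) = sa_mult \<B> (to_enveloping A a) (to_enveloping A b)"
    "a \<in> sa_carrier A \<Longrightarrow> to_enveloping A (sa_scale A c a) = sa_scale \<B> c (to_enveloping A a)"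
    "a \<in> sa_carrier A \<Longrightarrow> to_enveloping A (sa_star A a) = sa_star \<B> (to_enveloping A a)"
    for a b c
    by (simp_all add: to_enveloping_def B_add B_mult B_scale B_star Cau_const)
  show ?thesis
    unfolding star_representation_def
    by (simp add: e star_rep_bounded[OF assms] star_rep_add[OF assms] star_rep_mult[OF assms]
        star_rep_scale[OF assms] star_rep_star[OF assms])
qed

end

section \<open>Automatic contractivity and extension of representations\<close>

context pre_cstar
begin

lemma cls_shift:
  assumes "u \<in> Cau"
  shows "(\<lambda>n. u (n + k)) \<in> Cau" "cls (\<lambda>n. u (n + k)) = cls u"
proof -
  have c: "\<And>n. u n \<in> sa_carrier A" by (rule Cau_carrier[OF assms])
  show 1: "(\<lambda>n. u (n + k)) \<in> Cau"
  proof (rule CauI)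
    fix e :: real assume "0 < e"
    from CauD[OF assms this] obtain M where "\<forall>m\<ge>M. \<forall>n\<ge>M. N (sa_diff A (u m) (u n)) < e" by blast
    then show "\<exists>M. \<forall>m\<ge>M. \<forall>n\<ge>M. N (sa_diff A (u (m + k)) (u (n + k))) < e"
      by (intro exI[of _ M]) simp
  qed (rule c)
  have "(\<lambda>n. N (sa_diff A (u (n + k)) (u n))) \<longlonglongrightarrow> 0"
  proof (rule LIMSEQ_I)
    fix e :: real assume "0 < e"
    from CauD[OF assms this] obtain M where "\<forall>m\<ge>M. \<forall>n\<ge>M. N (sa_diff A (u m) (u n)) < e" by blast
    then show "\<exists>M. \<forall>n\<ge>M. norm (N (sa_diff A (u (n + k)) (u n)) - 0) < e"
      by (intro exI[of _ M]) (simp add: universal_norm_nonneg c)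
  qed
  then show "cls (\<lambda>n. u (n + k)) = cls u" by (rule cls_eqI[OF 1 assms order_refl])
qed

text \<open>The step \<open>v \<mapsto> (h + v\<^sup>2) / 2\<close>, whose fixed points satisfy
  \<open>(1 - v)\<^sup>2 = 1 - h\<close>. No unit is adjoined, and the start \<open>0 \<cdot> h 0\<close> serves as zero.\<close>

primrec sqrt_iterate :: "(nat \<Rightarrow> 'a) \<Rightarrow> nat \<Rightarrow> 'a" where
  "sqrt_iterate h 0 = sa_scale A 0 (h 0)"
| "sqrt_iterate h (Suc n) = sa_scale A (1/2) (sa_add A (h n) (sa_mult A (sqrt_iterate h n) (sqrt_iterate h n)))"

text \<open>With \<open>s = 1 - sqrt (1 - \<rho>)\<close> the map \<open>v \<mapsto> (h + v\<^sup>2) / 2\<close> preserves the ball of radius \<open>s < 1\<close> and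
  contracts it by the factor \<open>s\<close>, so that following a Cauchy sequence \<open>h\<close> it produces a Cauchy
  sequence, whose limit \<open>g\<close> satisfies \<open>(1 - g)\<^sup>2 = 1 - h\<close>.\<close>

lemma sqrt_iterate_Cau:
  assumes h: "h \<in> Cau" and \<rho>: "\<And>n. N (h n) \<le> \<rho>" "\<rho> < 1"
  shows "sqrt_iterate h \<in> Cau"
proof -
  let ?v = "sqrt_iterate h"
  have hc: "h n \<in> sa_carrier A" for n by (rule Cau_carrier[OF h])
  have vc: "?v n \<in> sa_carrier A" for n by (induction n) (simp_all add: hc)
  have \<rho>0: "0 \<le> \<rho>" using \<rho>(1)[of 0] universal_norm_nonneg[OF hc, of 0] by linarith
  define s where "s = 1 - sqrt (1 - \<rho>)"
  have s: "0 \<le> s" "s < 1" using \<rho>0 \<rho>(2) by (auto simp: s_def)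
  have "(sqrt (1 - \<rho>))\<^sup>2 = 1 - \<rho>" using \<rho>(2) by simp
  then have s2: "\<rho> + s * s = 2 * s" by (simp add: s_def power2_eq_square algebra_simps)
  have vs: "N (?v n) \<le> s" for n
  proof (induction n)
    case 0
    show ?case using universal_norm_scale[OF hc, of 0 0] s by simp
  next
    case (Suc n)
    have "N (?v (Suc n)) \<le> 1/2 * N (sa_add A (h n) (sa_mult A (?v n) (?v n)))"
      using universal_norm_scale[of "sa_add A (h n) (sa_mult A (?v n) (?v n))" "1/2"]
      by (simp add: hc vc)
    also have "N (sa_add A (h n) (sa_mult A (?v n) (?v n))) \<le> N (h n) + N (sa_mult A (?v n) (?v n))"
      by (rule universal_norm_add) (simp_all add: hc vc)
    also have "N (sa_mult A (?v n) (?v n)) \<le> N (?v n) * N (?v n)"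
      by (rule universal_norm_mult) (simp_all add: vc)
    also have "N (?v n) * N (?v n) \<le> s * s"
      by (rule mult_mono[OF Suc Suc]) (simp_all add: s universal_norm_nonneg vc)
    finally show ?case using \<rho>(1)[of n] s2 by simp
  qed
  have step: "N (sa_diff A (?v (Suc m)) (?v (Suc n)))
      \<le> 1/2 * N (sa_diff A (h m) (h n)) + s * N (sa_diff A (?v m) (?v n))" for m n
  proof -
    let ?D = "N (sa_diff A (?v m) (?v n))"
    have D0: "0 \<le> ?D" by (simp add: universal_norm_nonneg vc)
    let ?a = "sa_add A (h m) (sa_mult A (?v m) (?v m))" and ?b = "sa_add A (h n) (sa_mult A (?v n) (?v n))"
    have "N (sa_diff A (?v (Suc m)) (?v (Suc n))) \<le> cmod (1/2) * N (sa_diff A ?a ?b)"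
      unfolding sqrt_iterate.simps by (rule universal_norm_scale_diff) (simp_all add: hc vc)
    also have "\<dots> = 1/2 * N (sa_diff A ?a ?b)" by simp
    also have "N (sa_diff A ?a ?b) \<le> N (sa_diff A (h m) (h n))
        + N (sa_diff A (sa_mult A (?v m) (?v m)) (sa_mult A (?v n) (?v n)))"
      by (rule universal_norm_add_diff) (simp_all add: hc vc)
    also have "N (sa_diff A (sa_mult A (?v m) (?v m)) (sa_mult A (?v n) (?v n)))
        \<le> ?D * N (?v m) + N (?v n) * ?D"
      by (rule universal_norm_mult_diff) (simp_all add: vc)
    also have "\<dots> \<le> ?D * s + s * ?D"
      by (rule add_mono[OF mult_left_mono[OF vs D0] mult_right_mono[OF vs D0]])
    finally show ?thesis by simp
  qed
  show ?thesis
  proof (rule CauI)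
    fix e :: real assume e: "0 < e"
    define d where "d = e / 2"
    have d: "0 < d" using e by (simp add: d_def)
    then have "0 < 2 * d * (1 - s)" using s by simp
    from CauD[OF h this] obtain M where
      M: "\<forall>m\<ge>M. \<forall>n\<ge>M. N (sa_diff A (h m) (h n)) < 2 * d * (1 - s)" by blast
    have *: "\<forall>m\<ge>M+k. \<forall>n\<ge>M+k. N (sa_diff A (?v m) (?v n)) \<le> 4 * s ^ k + d" for k
    proof (induction k)
      case 0
      have "N (sa_diff A (?v m) (?v n)) \<le> 4" for m n
      proof -
        have "N (sa_diff A (?v m) (?v n)) \<le> N (?v m) + cmod (-1) * N (?v n)"
          unfolding sa_diff_def
          using universal_norm_add[of "?v m" "sa_scale A (-1) (?v n)"] universal_norm_scale[of "?v n" "-1"]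
          by (simp add: vc)
        then show ?thesis using vs[of m] vs[of n] s by simp
      qed
      then show ?case using d by (simp add: add_increasing2)
    next
      case (Suc k)
      show ?case
      proof (intro allI impI)
        fix m n assume mn: "M + Suc k \<le> m" "M + Suc k \<le> n"
        then obtain m' n' where m': "m = Suc m'" "n = Suc n'" by (metis Suc_le_D add_Suc_right)
        with mn have le: "M + k \<le> m'" "M + k \<le> n'" by auto
        then have "N (sa_diff A (h m') (h n')) < 2 * d * (1 - s)" using M by simp
        moreover have "s * N (sa_diff A (?v m') (?v n')) \<le> s * (4 * s ^ k + d)"
          using Suc le s by (intro mult_left_mono) auto
        ultimately have "N (sa_diff A (?v m) (?v n)) \<le> 1/2 * (2 * d * (1 - s)) + s * (4 * s ^ k + d)"
          using step[of m' n'] unfolding m' by linarith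
        then show "N (sa_diff A (?v m) (?v n)) \<le> 4 * s ^ Suc k + d" by (simp add: algebra_simps)
      qed
    qed
    have "(\<lambda>k. 4 * s ^ k) \<longlonglongrightarrow> 4 * 0"
      using s by (intro tendsto_mult_left LIMSEQ_power_zero) auto
    from order_tendstoD(2)[OF this, of d] have "\<forall>\<^sub>F k in sequentially. 4 * s ^ k < d" using d by simp
    then obtain k where "4 * s ^ k < d" by (auto simp: eventually_sequentially)
    with *[of k] show "\<exists>M. \<forall>m\<ge>M. \<forall>n\<ge>M. N (sa_diff A (?v m) (?v n)) < e"
      by (intro exI[of _ "M + k"]) (fastforce simp: d_def)
  qed (rule vc)
qed

text \<open>If \<open>P\<close> has norm below \<open>d\<close>, then \<open>h = P\<^sup>* P / d\<^sup>2\<close> has norm below one, and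
  \<open>1 - h\<close> has a self-adjoint square root \<open>1 - g\<close>. The identity is stated for \<open>g\<close>, because the algebra
  may have no unit.\<close>

lemma enveloping_square_root:
  assumes u: "u \<in> Cau" and e: "\<And>n. N (u n) \<le> e" "e < d"
  obtains g where "g \<in> sa_carrier \<B>" "sa_star \<B> g = g"
    "sa_add \<B> (sa_scale \<B> (1/d\<^sup>2) (sa_mult \<B> (sa_star \<B> (cls u)) (cls u))) (sa_mult \<B> g g) = sa_scale \<B> 2 g"
proof -
  have uc: "u n \<in> sa_carrier A" for n by (rule Cau_carrier[OF u])
  have e0: "0 \<le> e" using e(1)[of 0] universal_norm_nonneg[OF uc, of 0] by linarith
  then have d: "0 < d" using e(2) by linarith
  define \<kappa> where "\<kappa> = complex_of_real (1/d\<^sup>2)"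
  have \<kappa>: "cnj \<kappa> = \<kappa>" "cmod \<kappa> = 1/d\<^sup>2" by (simp_all add: \<kappa>_def norm_divide norm_power)
  define h where "h n = sa_scale A \<kappa> (sa_mult A (sa_star A (u n)) (u n))" for n
  have h: "h \<in> Cau" unfolding h_def by (intro Cau_scale Cau_mult Cau_star u)
  have hc: "h n \<in> sa_carrier A" for n by (rule Cau_carrier[OF h])
  have \<rho>: "N (h n) \<le> e\<^sup>2 / d\<^sup>2" for n
  proof -
    have "N (h n) \<le> 1/d\<^sup>2 * N (sa_mult A (sa_star A (u n)) (u n))"
      unfolding h_def \<kappa>(2)[symmetric] by (rule universal_norm_scale) (simp add: uc)
    also have "N (sa_mult A (sa_star A (u n)) (u n)) \<le> N (sa_star A (u n)) * N (u n)"
      by (rule universal_norm_mult) (simp_all add: uc)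
    also have "\<dots> \<le> e * e"
      using universal_norm_star[OF uc, of n] e(1)[of n] universal_norm_nonneg[OF uc, of n] e0
      by (intro mult_mono) auto
    finally show ?thesis using d by (simp add: power2_eq_square divide_right_mono mult_left_mono)
  qed
  have "e\<^sup>2 / d\<^sup>2 < 1" using e(2) e0 d by (simp add: power_strict_mono)
  from sqrt_iterate_Cau[OF h \<rho> this] have v: "sqrt_iterate h \<in> Cau" .
  let ?v = "sqrt_iterate h"
  have vc: "?v n \<in> sa_carrier A" for n by (rule Cau_carrier[OF v])
  have sym: "ell2_inner (L (?v n) \<xi>) \<eta> = ell2_inner \<xi> (L (?v n) \<eta>)"
    if L: "star_representation A S L" and "\<xi> \<in> ell2 S" "\<eta> \<in> ell2 S" for S :: "'a set" and L \<xi> \<eta> n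
    using that(2,3)
  proof (induction n arbitrary: \<xi> \<eta>)
    case 0
    then show ?case by (simp add: star_rep_scale[OF L] hc ell2_inner_def)
  next
    case (Suc n)
    note m = star_rep_mem[OF L]
    have hs: "ell2_inner (L (h n) \<xi>) \<eta> = ell2_inner \<xi> (L (h n) \<eta>)"
      using Suc.prems uc by (simp add: h_def star_rep_scale[OF L] star_rep_mult[OF L] m ell2_inner_scale_left
          ell2_inner_scale_right star_rep_star[OF L] star_rep_star'[OF L, symmetric] \<kappa>)
    have eq: "L (?v (Suc n)) \<zeta> = (\<lambda>i. (1/2) * (L (h n) \<zeta> i + L (?v n) (L (?v n) \<zeta>) i))" if "\<zeta> \<in> ell2 S" for \<zeta>
      using that by (simp add: star_rep_scale[OF L] star_rep_add[OF L] star_rep_mult[OF L] hc vc)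
    show ?case
      unfolding eq[OF Suc.prems(1)] eq[OF Suc.prems(2)] ell2_inner_scale_left ell2_inner_scale_right
      using Suc by (simp add: ell2_inner_add_left[of _ S] ell2_inner_add_right[of _ S] m hc vc hs)
  qed
  show ?thesis
  proof (rule that[of "cls ?v"])
    show "cls ?v \<in> sa_carrier \<B>" using v by simp
    have "N (sa_diff A (sa_star A (?v n)) (?v n)) \<le> 0" for n
    proof (rule universal_norm_le)
      fix S :: "'a set" and L \<xi> assume L: "star_representation A S L" and x: "\<xi> \<in> ell2 S"
      have "L (sa_star A (?v n)) \<xi> i = L (?v n) \<xi> i" for i
      proof (cases "i \<in> S")
        case True
        show ?thesis
          using star_rep_star[OF L vc x ell2_basis[OF True], of n] sym[OF L x ell2_basis[OF True], of n]
          unfolding ell2_inner_basis_right by (metis (no_types))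
      next
        case False
        then show ?thesis
          using ell2_outside[OF star_rep_mem[OF L _ x], of "sa_star A (?v n)" i]
            ell2_outside[OF star_rep_mem[OF L _ x], of "?v n" i] vc by simp
      qed
      then show "ell2_norm (L (sa_diff A (sa_star A (?v n)) (?v n)) \<xi>) \<le> 0 * ell2_norm \<xi>"
        by (simp add: star_rep_diff[OF L] vc x)
    qed simp
    then show "sa_star \<B> (cls ?v) = cls ?v"
      unfolding B_star[OF v] by (rule cls_eqI[OF Cau_star[OF v] v _ tendsto_const])
    have hB: "sa_scale \<B> (1/d\<^sup>2) (sa_mult \<B> (sa_star \<B> (cls u)) (cls u)) = cls h"
      unfolding h_def \<kappa>_def[symmetric] by (simp add: B_star B_mult B_scale Cau_star Cau_mult u)
    have "cls (\<lambda>n. sa_add A (h n) (sa_mult A (?v n) (?v n))) = cls (\<lambda>n. sa_scale A 2 (?v (n + 1)))"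
    proof (rule cls_eqI[OF Cau_add[OF h Cau_mult[OF v v]] Cau_scale[OF cls_shift(1)[OF v]] _ tendsto_const])
      show "N (sa_diff A (sa_add A (h n) (sa_mult A (?v n) (?v n))) (sa_scale A 2 (?v (n + 1)))) \<le> 0" for n
        by (rule universal_norm_le)
           (simp_all add: star_rep_diff star_rep_scale star_rep_add star_rep_mult hc vc add_divide_distrib)
    qed
    also have "\<dots> = sa_scale \<B> 2 (cls ?v)"
      using B_scale[OF cls_shift(1)[OF v], of 2 1] cls_shift(2)[OF v, of 1] by simp
    finally show "sa_add \<B> (sa_scale \<B> (1/d\<^sup>2) (sa_mult \<B> (sa_star \<B> (cls u)) (cls u)))
        (sa_mult \<B> (cls ?v) (cls ?v)) = sa_scale \<B> 2 (cls ?v)"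
      unfolding hB by (simp add: B_mult[OF v v] B_add[OF h Cau_mult[OF v v]])
  qed
qed

text \<open>Representations of the enveloping algebra are not assumed to be continuous. Since
  \<open>1 - P\<^sup>* P / d\<^sup>2\<close> is a square, it is positive in each of them, which is the estimate
  \<open>\<parallel>L P \<xi>\<parallel> \<le> d \<parallel>\<xi>\<parallel>\<close>.\<close>

lemma enveloping_contractive:
  assumes L: "star_representation \<B> S L" and u: "u \<in> Cau" and x: "\<xi> \<in> ell2 S"
    and e: "\<And>n. n \<ge> k \<Longrightarrow> N (u n) \<le> e"
  shows "ell2_norm (L (cls u) \<xi>) \<le> e * ell2_norm \<xi>"
proof -
  let ?u = "\<lambda>n. u (n + k)" and ?P = "cls u"
  note m = star_rep_mem[OF L]
  have P: "?P \<in> sa_carrier \<B>" using u by simp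
  have bound: "ell2_norm (L ?P \<xi>) \<le> d * ell2_norm \<xi>" if "e < d" for d
  proof -
    have "0 \<le> e" using e[of k] universal_norm_nonneg[OF Cau_carrier[OF u], of k] by linarith
    then have d: "0 < d" using that by linarith
    obtain g where g: "g \<in> sa_carrier \<B>" "sa_star \<B> g = g"
      "sa_add \<B> (sa_scale \<B> (1/d\<^sup>2) (sa_mult \<B> (sa_star \<B> ?P) ?P)) (sa_mult \<B> g g) = sa_scale \<B> 2 g"
      using enveloping_square_root[OF cls_shift(1)[OF u, of k], of e d] e \<open>e < d\<close>
      unfolding cls_shift(2)[OF u, of k] by (metis le_add2)
    let ?y = "L g \<xi>"
    note cl = B_closed
    have y: "?y \<in> ell2 S" using g(1) x by (rule m)
    have Px: "L ?P \<xi> \<in> ell2 S" using P x by (rule m)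
    have sP: "sa_star \<B> ?P \<in> sa_carrier \<B>" using P by (simp add: cl)
    have "(\<lambda>i. (1/d\<^sup>2) * L (sa_star \<B> ?P) (L ?P \<xi>) i + L g ?y i) = (\<lambda>i. 2 * ?y i)"
      using arg_cong[OF g(3), of "\<lambda>a. L a \<xi>"] g(1) P sP x
      by (simp add: star_rep_add[OF L] star_rep_scale[OF L] star_rep_mult[OF L] cl)
    then have "ell2_inner (\<lambda>i. (1/d\<^sup>2) * L (sa_star \<B> ?P) (L ?P \<xi>) i + L g ?y i) \<xi> = 2 * ell2_inner ?y \<xi>"
      by (simp add: ell2_inner_scale_left)
    moreover have "ell2_inner (\<lambda>i. (1/d\<^sup>2) * L (sa_star \<B> ?P) (L ?P \<xi>) i + L g ?y i) \<xi>
        = (1/d\<^sup>2) * ell2_inner (L (sa_star \<B> ?P) (L ?P \<xi>)) \<xi> + ell2_inner (L g ?y) \<xi>"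
      by (subst ell2_inner_add_left[OF ell2_scale[OF m[OF sP Px]] m[OF g(1) y] x])
         (simp only: ell2_inner_scale_left)
    moreover have "ell2_inner (L (sa_star \<B> ?P) (L ?P \<xi>)) \<xi> = (ell2_norm (L ?P \<xi>))\<^sup>2"
      using star_rep_star[OF L P Px x] ell2_inner_self[OF Px] by simp
    moreover have "ell2_inner (L g ?y) \<xi> = (ell2_norm ?y)\<^sup>2"
      using star_rep_star'[OF L g(1) y x] ell2_inner_self[OF y] g(2) by simp
    ultimately have "complex_of_real ((ell2_norm (L ?P \<xi>))\<^sup>2 / d\<^sup>2 + (ell2_norm ?y)\<^sup>2) = 2 * ell2_inner ?y \<xi>"
      by simp
    then have "(ell2_norm (L ?P \<xi>))\<^sup>2 / d\<^sup>2 + (ell2_norm ?y)\<^sup>2 = cmod (2 * ell2_inner ?y \<xi>)"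
      by (metis norm_of_real abs_of_nonneg add_nonneg_nonneg zero_le_power2 divide_nonneg_nonneg)
    also have "\<dots> \<le> 2 * (ell2_norm ?y * ell2_norm \<xi>)"
      using ell2_Cauchy_Schwarz[OF y x] by (simp add: norm_mult)
    finally have "(ell2_norm (L ?P \<xi>))\<^sup>2 / d\<^sup>2 \<le> (ell2_norm \<xi>)\<^sup>2"
      using zero_le_power2[of "ell2_norm ?y - ell2_norm \<xi>"] by (simp add: power2_diff)
    then have "(ell2_norm (L ?P \<xi>))\<^sup>2 \<le> (d * ell2_norm \<xi>)\<^sup>2"
      using d by (simp add: power_mult_distrib pos_divide_le_eq mult.commute)
    then show ?thesis using d by (simp add: power2_le_iff_abs_le abs_le_square_iff[symmetric])
  qed
  show ?thesis
  proof (rule tendsto_le[OF sequentially_bot])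
    have "(\<lambda>n. (e + 1 / real (Suc n)) * ell2_norm \<xi>) \<longlonglongrightarrow> (e + 0) * ell2_norm \<xi>"
      by (intro tendsto_mult_right tendsto_add tendsto_const LIMSEQ_inverse_real_of_nat[unfolded inverse_eq_divide])
    then show "(\<lambda>n. (e + 1 / real (Suc n)) * ell2_norm \<xi>) \<longlonglongrightarrow> e * ell2_norm \<xi>" by simp
    show "(\<lambda>n. ell2_norm (L ?P \<xi>)) \<longlonglongrightarrow> ell2_norm (L ?P \<xi>)" by simp
    show "\<forall>\<^sub>F n in sequentially. ell2_norm (L ?P \<xi>) \<le> (e + 1 / real (Suc n)) * ell2_norm \<xi>"
      by (intro always_eventually allI bound) simp
  qed
qed

text \<open>One element of the dense subalgebra approximates a given element of the enveloping algebra in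
  all representations at once.\<close>

lemma enveloping_approx:
  assumes L: "star_representation \<B> S L" and u: "u \<in> Cau" and x: "\<xi> \<in> ell2 S" and a: "a \<in> sa_carrier A"
    and e: "\<And>n. n \<ge> k \<Longrightarrow> N (sa_diff A (u n) a) \<le> e"
  shows "ell2_norm (\<lambda>i. L (cls u) \<xi> i - L (to_enveloping A a) \<xi> i) \<le> e * ell2_norm \<xi>"
proof -
  let ?w = "\<lambda>n. sa_add A (u n) (sa_scale A (-1) a)"
  have w: "?w \<in> Cau" by (intro Cau_add u Cau_scale Cau_const a)
  have "cls ?w = sa_add \<B> (cls u) (sa_scale \<B> (-1) (to_enveloping A a))"
    by (simp add: to_enveloping_def B_scale[OF Cau_const[OF a]] B_add[OF u Cau_scale[OF Cau_const[OF a]]])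
  then have "L (cls ?w) \<xi> = (\<lambda>i. L (cls u) \<xi> i - L (to_enveloping A a) \<xi> i)"
    using u a x by (simp add: star_rep_add[OF L] star_rep_scale[OF L] B_closed)
  moreover have "ell2_norm (L (cls ?w) \<xi>) \<le> e * ell2_norm \<xi>"
    by (rule enveloping_contractive[OF L w x, of k]) (use e in \<open>simp add: sa_diff_def\<close>)
  ultimately show ?thesis by simp
qed

text \<open>The operators \<open>L (u n)\<close> of a Cauchy sequence converge pointwise by completeness of \<open>\<ell>\<^sup>2\<close>, and
  algebraic identities survive the limit.\<close>

lemma extend_representation:
  fixes L :: "'a \<Rightarrow> ('i \<Rightarrow> complex) \<Rightarrow> ('i \<Rightarrow> complex)"
  assumes L: "star_representation A S L"
    and bound: "\<And>a \<xi>. a \<in> sa_carrier A \<Longrightarrow> \<xi> \<in> ell2 S \<Longrightarrow> ell2_norm (L a \<xi>) \<le> N a * ell2_norm \<xi>"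
  obtains L' where "star_representation \<B> S L'"
    "\<And>a \<xi>. a \<in> sa_carrier A \<Longrightarrow> \<xi> \<in> ell2 S \<Longrightarrow> L' (to_enveloping A a) \<xi> = L a \<xi>"
proof -
  note m = star_rep_mem[OF L]
  have diff: "ell2_norm (\<lambda>i. L a \<xi> i - L b \<xi> i) \<le> N (sa_diff A a b) * ell2_norm \<xi>"
    if "a \<in> sa_carrier A" "b \<in> sa_carrier A" "\<xi> \<in> ell2 S" for a b \<xi>
    using bound[of "sa_diff A a b" \<xi>] that by (simp add: star_rep_diff[OF L])
  have ex: "\<exists>\<zeta>. ell2_lim S (\<lambda>n. L (u n) \<xi>) \<zeta>" if u: "u \<in> Cau" and x: "\<xi> \<in> ell2 S" for u \<xi>
  proof -
    have "\<exists>\<zeta>\<in>ell2 S. (\<lambda>n. ell2_norm (\<lambda>i. L (u n) \<xi> i - \<zeta> i)) \<longlonglongrightarrow> 0"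
    proof (rule ell2_complete)
      show "L (u n) \<xi> \<in> ell2 S" for n using m[OF Cau_carrier[OF u] x] .
      fix e :: real assume e: "0 < e"
      let ?c = "ell2_norm \<xi> + 1"
      have c: "0 < ?c" by (simp add: add_nonneg_pos)
      obtain M where M: "\<forall>m\<ge>M. \<forall>n\<ge>M. N (sa_diff A (u m) (u n)) < e / ?c"
        using CauD[OF u, of "e / ?c"] e c by auto
      have "ell2_norm (\<lambda>i. L (u a) \<xi> i - L (u b) \<xi> i) \<le> e" if "a \<ge> M" "b \<ge> M" for a b
      proof -
        have "ell2_norm (\<lambda>i. L (u a) \<xi> i - L (u b) \<xi> i) \<le> N (sa_diff A (u a) (u b)) * ell2_norm \<xi>"
          by (rule diff[OF Cau_carrier[OF u] Cau_carrier[OF u] x])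
        also have "\<dots> \<le> e / ?c * ?c"
          using M that e c by (intro mult_mono) (auto intro: less_imp_le)
        finally show ?thesis using c by simp
      qed
      then show "\<exists>M. \<forall>a\<ge>M. \<forall>b\<ge>M. ell2_norm (\<lambda>i. L (u a) \<xi> i - L (u b) \<xi> i) \<le> e" by blast
    qed
    then show ?thesis using m[OF Cau_carrier[OF u] x] by (auto simp: ell2_lim_def)
  qed
  define L' where "L' P \<xi> = (SOME \<zeta>. \<exists>u\<in>P. ell2_lim S (\<lambda>n. L (u n) \<xi>) \<zeta>)" for P \<xi>
  have L': "ell2_lim S (\<lambda>n. L (u n) \<xi>) (L' (cls u) \<xi>)" if u: "u \<in> Cau" and x: "\<xi> \<in> ell2 S" for u \<xi>
  proof -
    obtain \<zeta> where z: "ell2_lim S (\<lambda>n. L (u n) \<xi>) \<zeta>" using ex[OF u x] by blast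
    then have "\<exists>v\<in>cls u. ell2_lim S (\<lambda>n. L (v n) \<xi>) (L' (cls u) \<xi>)"
      unfolding L'_def using cls_self[OF u] by (intro someI[where P="\<lambda>\<zeta>. \<exists>v\<in>cls u. ell2_lim S (\<lambda>n. L (v n) \<xi>) \<zeta>"]) blast
    then obtain v where v: "v \<in> cls u" "ell2_lim S (\<lambda>n. L (v n) \<xi>) (L' (cls u) \<xi>)" by blast
    have "norm (ell2_norm (\<lambda>i. L (u n) \<xi> i - L (v n) \<xi> i)) \<le> N (sa_diff A (u n) (v n)) * ell2_norm \<xi>" for n
      using diff[OF Cau_carrier[OF u] Cau_carrier[OF cls_memD(2)[OF v(1)]] x] by simp
    moreover have "(\<lambda>n. N (sa_diff A (u n) (v n)) * ell2_norm \<xi>) \<longlonglongrightarrow> 0"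
      using tendsto_mult_right[OF cls_memD(4)[OF v(1)], of "ell2_norm \<xi>"] by simp
    ultimately have "(\<lambda>n. ell2_norm (\<lambda>i. L (u n) \<xi> i - L (v n) \<xi> i)) \<longlonglongrightarrow> 0"
      by (rule Lim_null_comparison[OF always_eventually[OF allI]])
    from ell2_lim_unique[OF z v(2) this] show ?thesis using z by simp
  qed
  have L'_eq: "L' (cls u) \<xi> = \<zeta>" if "u \<in> Cau" "\<xi> \<in> ell2 S" "ell2_lim S (\<lambda>n. L (u n) \<xi>) \<zeta>" for u \<xi> \<zeta>
    by (rule ell2_lim_unique[OF L'[OF that(1,2)] that(3)]) simp
  have L'm: "L' (cls u) \<xi> \<in> ell2 S" if "u \<in> Cau" "\<xi> \<in> ell2 S" for u \<xi>
    using L'[OF that] by (simp add: ell2_lim_def)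
  have nb: "\<exists>C. \<forall>\<xi>\<in>ell2 S. ell2_norm (L' (cls u) \<xi>) \<le> C * ell2_norm \<xi>" if u: "u \<in> Cau" for u
  proof -
    obtain C where C: "0 < C" "\<And>n. N (u n) \<le> C" using Cau_bounded[OF u] by metis
    have "ell2_norm (L' (cls u) \<xi>) \<le> C * ell2_norm \<xi>" if x: "\<xi> \<in> ell2 S" for \<xi>
    proof (rule ell2_lim_norm_le[OF L'[OF u x]])
      show "ell2_norm (L (u n) \<xi>) \<le> C * ell2_norm \<xi>" for n
        using bound[OF Cau_carrier[OF u] x, of n] mult_right_mono[OF C(2)[of n] ell2_norm_nonneg[of \<xi>]]
        by linarith
    qed
    then show ?thesis by blast
  qed
  have bop: "bounded_operator S (L' (cls u))" if u: "u \<in> Cau" for u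
    unfolding bounded_operator_def
  proof (intro conjI ballI allI nb[OF u])
    fix \<xi> \<eta> c assume x: "\<xi> \<in> ell2 S"
    show "L' (cls u) \<xi> \<in> ell2 S" by (rule L'm[OF u x])
    show "L' (cls u) (\<lambda>i. c * \<xi> i) = (\<lambda>i. c * L' (cls u) \<xi> i)"
    proof (rule L'_eq[OF u ell2_scale[OF x]])
      show "ell2_lim S (\<lambda>n. L (u n) (\<lambda>i. c * \<xi> i)) (\<lambda>i. c * L' (cls u) \<xi> i)"
        using ell2_lim_scale[OF L'[OF u x], of c]
        by (simp add: bounded_operatorD(3)[OF star_rep_bounded[OF L Cau_carrier[OF u]] x])
    qed
    assume y: "\<eta> \<in> ell2 S"
    show "L' (cls u) (\<lambda>i. \<xi> i + \<eta> i) = (\<lambda>i. L' (cls u) \<xi> i + L' (cls u) \<eta> i)"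
    proof (rule L'_eq[OF u ell2_add(1)[OF x y]])
      show "ell2_lim S (\<lambda>n. L (u n) (\<lambda>i. \<xi> i + \<eta> i)) (\<lambda>i. L' (cls u) \<xi> i + L' (cls u) \<eta> i)"
        using ell2_lim_add[OF L'[OF u x] L'[OF u y]]
        by (simp add: bounded_operatorD(2)[OF star_rep_bounded[OF L Cau_carrier[OF u]] x y])
    qed
  qed
  have rep: "star_representation \<B> S L'"
    unfolding star_representation_def carrier_B ball_simps
  proof (intro conjI ballI allI bop)
    fix u \<xi> c assume u: "u \<in> Cau" and x: "\<xi> \<in> ell2 S"
    note uc = Cau_carrier[OF u]
    show "L' (sa_scale \<B> c (cls u)) \<xi> = (\<lambda>i. c * L' (cls u) \<xi> i)"
      unfolding B_scale[OF u]
    proof (rule L'_eq[OF Cau_scale[OF u] x])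
      show "ell2_lim S (\<lambda>n. L (sa_scale A c (u n)) \<xi>) (\<lambda>i. c * L' (cls u) \<xi> i)"
        using ell2_lim_scale[OF L'[OF u x], of c] by (simp add: star_rep_scale[OF L uc x])
    qed
    fix \<eta> assume y: "\<eta> \<in> ell2 S"
    show "ell2_inner (L' (sa_star \<B> (cls u)) \<xi>) \<eta> = ell2_inner \<xi> (L' (cls u) \<eta>)"
      unfolding B_star[OF u]
    proof (rule LIMSEQ_unique)
      show "(\<lambda>n. ell2_inner (L (sa_star A (u n)) \<xi>) \<eta>) \<longlonglongrightarrow> ell2_inner (L' (cls (\<lambda>n. sa_star A (u n))) \<xi>) \<eta>"
        by (rule ell2_lim_inner_left[OF L'[OF Cau_star[OF u] x] y])
      show "(\<lambda>n. ell2_inner (L (sa_star A (u n)) \<xi>) \<eta>) \<longlonglongrightarrow> ell2_inner \<xi> (L' (cls u) \<eta>)"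
        using ell2_lim_inner_right[OF L'[OF u y] x] by (simp add: star_rep_star[OF L uc x y])
    qed
  next
    fix u v \<xi> assume u: "u \<in> Cau" and v: "v \<in> Cau" and x: "\<xi> \<in> ell2 S"
    note uc = Cau_carrier[OF u] and vc = Cau_carrier[OF v]
    show "L' (sa_add \<B> (cls u) (cls v)) \<xi> = (\<lambda>i. L' (cls u) \<xi> i + L' (cls v) \<xi> i)"
      unfolding B_add[OF u v]
    proof (rule L'_eq[OF Cau_add[OF u v] x])
      show "ell2_lim S (\<lambda>n. L (sa_add A (u n) (v n)) \<xi>) (\<lambda>i. L' (cls u) \<xi> i + L' (cls v) \<xi> i)"
        using ell2_lim_add[OF L'[OF u x] L'[OF v x]] by (simp add: star_rep_add[OF L uc vc x])
    qed
    show "L' (sa_mult \<B> (cls u) (cls v)) \<xi> = L' (cls u) (L' (cls v) \<xi>)"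
      unfolding B_mult[OF u v]
    proof (rule ell2_lim_unique[OF L'[OF Cau_mult[OF u v] x] L'[OF u L'm[OF v x]]])
      obtain C where C: "0 < C" "\<And>n. N (u n) \<le> C" using Cau_bounded[OF u] by metis
      let ?y = "L' (cls v) \<xi>"
      have y: "?y \<in> ell2 S" by (rule L'm[OF v x])
      have vx: "L (v n) \<xi> \<in> ell2 S" for n by (rule m[OF vc x])
      have "norm (ell2_norm (\<lambda>i. L (sa_mult A (u n) (v n)) \<xi> i - L (u n) ?y i))
          \<le> C * ell2_norm (\<lambda>i. L (v n) \<xi> i - ?y i)" for n
      proof -
        have "ell2_norm (L (u n) (\<lambda>i. L (v n) \<xi> i - ?y i)) \<le> N (u n) * ell2_norm (\<lambda>i. L (v n) \<xi> i - ?y i)"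
          by (rule bound[OF uc ell2_diff(1)[OF vx y]])
        also have "\<dots> \<le> C * ell2_norm (\<lambda>i. L (v n) \<xi> i - ?y i)"
          by (intro mult_right_mono C) simp
        finally show ?thesis by (simp add: star_rep_mult[OF L uc vc x] star_rep_diff_vec[OF L uc vx y])
      qed
      moreover have "(\<lambda>n. C * ell2_norm (\<lambda>i. L (v n) \<xi> i - ?y i)) \<longlonglongrightarrow> 0"
        using tendsto_mult_left[of _ 0 _ C] L'[OF v x] by (fastforce simp: ell2_lim_def)
      ultimately show "(\<lambda>n. ell2_norm (\<lambda>i. L (sa_mult A (u n) (v n)) \<xi> i - L (u n) ?y i)) \<longlonglongrightarrow> 0"
        by (rule Lim_null_comparison[OF always_eventually[OF allI]])
    qed
  qed
  moreover have "L' (to_enveloping A a) \<xi> = L a \<xi>" if "a \<in> sa_carrier A" "\<xi> \<in> ell2 S" for a \<xi>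
    unfolding to_enveloping_def
    by (rule L'_eq[OF Cau_const[OF that(1)] that(2) ell2_lim_const[OF m[OF that]]])
  ultimately show ?thesis using that by blast
qed

end

section \<open>Change of the index set\<close>

text \<open>Extension by zero along an injective change of index set.\<close>

definition push :: "('i \<Rightarrow> 'j) \<Rightarrow> ('i \<Rightarrow> complex) \<Rightarrow> 'j \<Rightarrow> complex" where
  "push g \<xi> j = (if j \<in> range g then \<xi> (inv g j) else 0)"

definition transport ::
    "('i \<Rightarrow> 'j) \<Rightarrow> ('a \<Rightarrow> ('i \<Rightarrow> complex) \<Rightarrow> ('i \<Rightarrow> complex)) \<Rightarrow> 'a \<Rightarrow> ('j \<Rightarrow> complex) \<Rightarrow> ('j \<Rightarrow> complex)" where
  "transport g L a \<xi> = push g (L a (\<lambda>i. \<xi> (g i)))"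

context
  fixes g :: "'i \<Rightarrow> 'j"
  assumes g: "inj g"
begin

lemma push_apply [simp]: "push g \<xi> (g i) = \<xi> i"
  by (simp add: push_def g)

lemma push_outside: "j \<notin> range g \<Longrightarrow> push g \<xi> j = 0"
  by (simp add: push_def)

lemma infsum_range:
  assumes "\<And>j. j \<notin> range g \<Longrightarrow> F j = 0"
  shows "infsum F UNIV = infsum (\<lambda>i. F (g i)) UNIV"
    and "F summable_on UNIV \<longleftrightarrow> (\<lambda>i. F (g i)) summable_on UNIV"
proof -
  have "infsum F UNIV = infsum F (range g)"
    using assms by (intro infsum_cong_neutral) auto
  also have "\<dots> = infsum (\<lambda>i. F (g i)) UNIV"
    by (simp add: infsum_reindex[OF g] o_def)
  finally show "infsum F UNIV = infsum (\<lambda>i. F (g i)) UNIV" .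
  have "F summable_on UNIV \<longleftrightarrow> F summable_on (range g)"
    using assms by (intro summable_on_cong_neutral) auto
  also have "\<dots> \<longleftrightarrow> (\<lambda>i. F (g i)) summable_on UNIV"
    by (simp add: summable_on_reindex[OF g] o_def)
  finally show "F summable_on UNIV \<longleftrightarrow> (\<lambda>i. F (g i)) summable_on UNIV" .
qed

lemma ell2_range: "\<xi> \<in> ell2 (g ` S) \<Longrightarrow> j \<notin> range g \<Longrightarrow> \<xi> j = 0"
  by (rule ell2_outside[of \<xi> "g ` S"]) auto

lemma push_pull: "\<xi> \<in> ell2 (g ` S) \<Longrightarrow> push g (\<lambda>i. \<xi> (g i)) = \<xi>"
proof (rule ext)
  fix j assume x: "\<xi> \<in> ell2 (g ` S)"
  show "push g (\<lambda>i. \<xi> (g i)) j = \<xi> j"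
  proof (cases "j \<in> range g")
    case True then show ?thesis by (auto simp: push_apply)
  next
    case False then show ?thesis using ell2_range[OF x] by (simp add: push_outside)
  qed
qed

lemma pull_ell2:
  assumes "\<xi> \<in> ell2 (g ` S)"
  shows "(\<lambda>i. \<xi> (g i)) \<in> ell2 S"
proof -
  have "(\<lambda>i. (cmod (\<xi> (g i)))\<^sup>2) summable_on UNIV"
    using infsum_range(2)[of "\<lambda>j. (cmod (\<xi> j))\<^sup>2"] ell2_range[OF assms] ell2_summable[OF assms] by simp
  moreover have "\<xi> (g i) = 0" if "i \<notin> S" for i
    using ell2_outside[OF assms, of "g i"] that g by (auto dest: injD)
  ultimately show ?thesis by (simp add: ell2_iff)
qed

lemma push_ell2:
  assumes "\<xi> \<in> ell2 S"
  shows "push g \<xi> \<in> ell2 (g ` S)"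
proof -
  have "(\<lambda>j. (cmod (push g \<xi> j))\<^sup>2) summable_on UNIV"
    using infsum_range(2)[of "\<lambda>j. (cmod (push g \<xi> j))\<^sup>2"] ell2_summable[OF assms]
    by (simp add: push_outside)
  moreover have "push g \<xi> j = 0" if "j \<notin> g ` S" for j
  proof (cases "j \<in> range g")
    case True
    then obtain i where "j = g i" by blast
    then show ?thesis using that ell2_outside[OF assms, of i] by auto
  qed (simp add: push_outside)
  ultimately show ?thesis by (simp add: ell2_iff)
qed

lemma norm_push [simp]: "ell2_norm (push g \<xi>) = ell2_norm \<xi>"
  using infsum_range(1)[of "\<lambda>j. (cmod (push g \<xi> j))\<^sup>2"] by (simp add: ell2_norm_def push_outside)

lemma inner_push: "ell2_inner (push g \<xi>) \<eta> = ell2_inner \<xi> (\<lambda>i. \<eta> (g i))"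
  using infsum_range(1)[of "\<lambda>j. push g \<xi> j * cnj (\<eta> j)"] by (simp add: ell2_inner_def push_outside)

lemma inner_push': "ell2_inner \<eta> (push g \<xi>) = ell2_inner (\<lambda>i. \<eta> (g i)) \<xi>"
  by (metis inner_push ell2_inner_cnj)

lemma norm_pull: "\<xi> \<in> ell2 (g ` S) \<Longrightarrow> ell2_norm (\<lambda>i. \<xi> (g i)) = ell2_norm \<xi>"
  using norm_push[of "\<lambda>i. \<xi> (g i)"] by (simp add: push_pull)

lemma push_add: "push g (\<lambda>i. \<xi> i + \<eta> i) = (\<lambda>j. push g \<xi> j + push g \<eta> j)"
  and push_scale: "push g (\<lambda>i. c * \<xi> i) = (\<lambda>j. c * push g \<xi> j)"
  and push_diff: "push g (\<lambda>i. \<xi> i - \<eta> i) = (\<lambda>j. push g \<xi> j - push g \<eta> j)"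
  and push_zero: "push g (\<lambda>i. 0) = (\<lambda>j. 0)"
  by (auto simp: push_def)

lemma transport_bounded_operator:
  assumes "bounded_operator S (L a)"
  shows "bounded_operator (g ` S) (transport g L a)"
proof -
  obtain C where C: "\<forall>\<xi>\<in>ell2 S. ell2_norm (L a \<xi>) \<le> C * ell2_norm \<xi>"
    using assms unfolding bounded_operator_def by blast
  show ?thesis
    unfolding bounded_operator_def transport_def
  proof (intro conjI ballI allI exI[of _ C])
    fix \<xi> \<eta> c assume x: "\<xi> \<in> ell2 (g ` S)"
    note px = pull_ell2[OF x]
    show "push g (L a (\<lambda>i. \<xi> (g i))) \<in> ell2 (g ` S)"
      by (intro push_ell2 bounded_operatorD(1)[OF assms] px)
    show "push g (L a (\<lambda>i. c * \<xi> (g i))) = (\<lambda>j. c * push g (L a (\<lambda>i. \<xi> (g i))) j)"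
      by (simp only: bounded_operatorD(3)[OF assms px] push_scale)
    show "ell2_norm (push g (L a (\<lambda>i. \<xi> (g i)))) \<le> C * ell2_norm \<xi>"
      using C px norm_pull[OF x] by fastforce
    assume y: "\<eta> \<in> ell2 (g ` S)"
    show "push g (L a (\<lambda>i. \<xi> (g i) + \<eta> (g i))) = (\<lambda>j. push g (L a (\<lambda>i. \<xi> (g i))) j + push g (L a (\<lambda>i. \<eta> (g i))) j)"
      by (simp only: bounded_operatorD(2)[OF assms px pull_ell2[OF y]] push_add)
  qed
qed

lemma transport_representation:
  assumes L: "star_representation A S L"
  shows "star_representation A (g ` S) (transport g L)"
  unfolding star_representation_def
proof (intro conjI ballI allI)
  fix a assume a: "a \<in> sa_carrier A"
  show "bounded_operator (g ` S) (transport g L a)"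
    by (rule transport_bounded_operator[where L=L and a=a, OF star_rep_bounded[OF L a]])
  fix \<xi> assume x: "\<xi> \<in> ell2 (g ` S)"
  note px = pull_ell2[OF x]
  show "transport g L (sa_scale A c a) \<xi> = (\<lambda>i. c * transport g L a \<xi> i)" for c
    by (simp add: transport_def star_rep_scale[OF L a px] push_scale)
  show "ell2_inner (transport g L (sa_star A a) \<xi>) \<eta> = ell2_inner \<xi> (transport g L a \<eta>)"
    if y: "\<eta> \<in> ell2 (g ` S)" for \<eta>
    using pull_ell2[OF y] px by (simp add: transport_def inner_push inner_push' star_rep_star[OF L a])
  fix b assume b: "b \<in> sa_carrier A"
  show "transport g L (sa_add A a b) \<xi> = (\<lambda>i. transport g L a \<xi> i + transport g L b \<xi> i)"
    by (simp add: transport_def star_rep_add[OF L a b px] push_add)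
  show "transport g L (sa_mult A a b) \<xi> = transport g L a (transport g L b \<xi>)"
    by (simp add: transport_def star_rep_mult[OF L a b px])
qed

lemma transport_kernel:
  assumes L: "star_representation A S L"
  shows "representation_kernel A (g ` S) (transport g L) = representation_kernel A S L"
proof -
  have "(\<forall>\<xi>\<in>ell2 (g ` S). transport g L a \<xi> = (\<lambda>i. 0)) \<longleftrightarrow> (\<forall>\<xi>\<in>ell2 S. L a \<xi> = (\<lambda>i. 0))"
    if a: "a \<in> sa_carrier A" for a
  proof (intro iffI ballI)
    fix \<xi> assume *: "\<forall>\<xi>\<in>ell2 (g ` S). transport g L a \<xi> = (\<lambda>i. 0)" and x: "\<xi> \<in> ell2 S"
    have "transport g L a (push g \<xi>) = (\<lambda>i. 0)" using * push_ell2[OF x] by blast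
    then have "push g (L a \<xi>) (g i) = 0" for i by (simp add: transport_def)
    then show "L a \<xi> = (\<lambda>i. 0)" by auto
  next
    fix \<xi> assume *: "\<forall>\<xi>\<in>ell2 S. L a \<xi> = (\<lambda>i. 0)" and x: "\<xi> \<in> ell2 (g ` S)"
    have "L a (\<lambda>i. \<xi> (g i)) = (\<lambda>i. 0)" using * pull_ell2[OF x] by blast
    then show "transport g L a \<xi> = (\<lambda>i. 0)" by (simp add: transport_def push_zero)
  qed
  then show ?thesis by (auto simp: representation_kernel_def)
qed

text \<open>Closed invariant subspaces correspond under extension by zero.\<close>

lemma transport_irreducible:
  assumes "irreducible_representation A S L"
  shows "irreducible_representation A (g ` S) (transport g L)"
proof -
  have L: "star_representation A S L" and nd: "representation_kernel A S L \<noteq> sa_carrier A"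
    and irr: "\<And>M. closed_ell2_subspace S M \<Longrightarrow> (\<forall>a\<in>sa_carrier A. \<forall>\<xi>\<in>M. L a \<xi> \<in> M)
        \<Longrightarrow> M = {\<lambda>i. 0} \<or> M = ell2 S"
    using assms by (auto simp: irreducible_representation_def)
  have "M = {\<lambda>i. 0} \<or> M = ell2 (g ` S)"
    if M: "closed_ell2_subspace (g ` S) M" and inv: "\<forall>a\<in>sa_carrier A. \<forall>\<xi>\<in>M. transport g L a \<xi> \<in> M" for M
  proof -
    define M' where "M' = {\<xi>. \<xi> \<in> ell2 S \<and> push g \<xi> \<in> M}"
    have sub: "M \<subseteq> ell2 (g ` S)" using M by (simp add: closed_ell2_subspace_def)
    have "closed_ell2_subspace S M'"
      unfolding closed_ell2_subspace_def
    proof (intro conjI ballI allI impI)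
      show "M' \<subseteq> ell2 S" by (auto simp: M'_def)
      show "(\<lambda>i. 0) \<in> M'" using M by (simp add: M'_def push_zero closed_ell2_subspace_def)
      show "(\<lambda>i. \<xi> i + \<eta> i) \<in> M'" if "\<xi> \<in> M'" "\<eta> \<in> M'" for \<xi> \<eta>
        using that M by (simp add: M'_def push_add ell2_add closed_ell2_subspace_def)
      show "(\<lambda>i. c * \<xi> i) \<in> M'" if "\<xi> \<in> M'" for c \<xi>
        using that M by (simp add: M'_def push_scale closed_ell2_subspace_def)
      fix u \<xi> assume x: "\<xi> \<in> ell2 S" and u: "(\<forall>n. u n \<in> M') \<and> (\<lambda>n. ell2_norm (\<lambda>i. u n i - \<xi> i)) \<longlonglongrightarrow> 0"
      have e: "ell2_norm (\<lambda>j. push g (u n) j - push g \<xi> j) = ell2_norm (\<lambda>i. u n i - \<xi> i)" for n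
        using norm_push[of "\<lambda>i. u n i - \<xi> i"] by (simp add: push_diff)
      have "(\<forall>n. push g (u n) \<in> M) \<and> (\<lambda>n. ell2_norm (\<lambda>j. push g (u n) j - push g \<xi> j)) \<longlonglongrightarrow> 0"
        unfolding e using u by (simp add: M'_def)
      moreover have cl: "\<zeta> \<in> M" if "\<zeta> \<in> ell2 (g ` S)"
        "(\<forall>n. v n \<in> M) \<and> (\<lambda>n. ell2_norm (\<lambda>i. v n i - \<zeta> i)) \<longlonglongrightarrow> 0" for v \<zeta>
        using M that unfolding closed_ell2_subspace_def by blast
      ultimately have "push g \<xi> \<in> M" by (intro cl[OF push_ell2[OF x], of "\<lambda>n. push g (u n)"])
      then show "\<xi> \<in> M'" using x by (simp add: M'_def)
    qed
    moreover have "\<forall>a\<in>sa_carrier A. \<forall>\<xi>\<in>M'. L a \<xi> \<in> M'"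
    proof (intro ballI)
      fix a \<xi> assume a: "a \<in> sa_carrier A" and x: "\<xi> \<in> M'"
      then have "transport g L a (push g \<xi>) \<in> M" using inv by (simp add: M'_def)
      then show "L a \<xi> \<in> M'" using a x star_rep_mem[OF L a] by (simp add: M'_def transport_def)
    qed
    ultimately have "M' = {\<lambda>i. 0} \<or> M' = ell2 S" by (rule irr)
    then show ?thesis
    proof
      assume 0: "M' = {\<lambda>i. 0}"
      have "\<xi> = (\<lambda>i. 0)" if "\<xi> \<in> M" for \<xi>
      proof -
        have x: "\<xi> \<in> ell2 (g ` S)" using that sub by blast
        then have "(\<lambda>i. \<xi> (g i)) \<in> M'" using that by (simp add: M'_def pull_ell2 push_pull)
        then have "(\<lambda>i. \<xi> (g i)) = (\<lambda>i. 0)" using 0 by blast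
        then have "push g (\<lambda>i. \<xi> (g i)) = (\<lambda>j. 0)" by (simp add: push_zero)
        then show ?thesis using push_pull[OF x] by simp
      qed
      moreover have "(\<lambda>i. 0) \<in> M" using M by (simp add: closed_ell2_subspace_def)
      ultimately show ?thesis by blast
    next
      assume 1: "M' = ell2 S"
      have "\<xi> \<in> M" if x: "\<xi> \<in> ell2 (g ` S)" for \<xi>
      proof -
        have "(\<lambda>i. \<xi> (g i)) \<in> M'" using pull_ell2[OF x] 1 by simp
        then show ?thesis by (simp add: M'_def push_pull[OF x])
      qed
      then show ?thesis using sub by blast
    qed
  qed
  then show ?thesis
    using transport_representation[OF L] transport_kernel[OF L] nd
    by (auto simp: irreducible_representation_def)
qed

end

text \<open>Primitive ideals are defined with index sets inside the type of the algebra; any injection into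
  that type moves an irreducible representation there without changing its kernel.\<close>

lemma kernel_in_Prim:
  fixes g :: "'i \<Rightarrow> 'a" and A :: "('a, 'm) star_algebra_scheme" and S :: "'i set"
  assumes "inj g" "irreducible_representation A S L"
  shows "representation_kernel A S L \<in> Prim A"
proof -
  have "star_representation A S L" using assms(2) by (simp add: irreducible_representation_def)
  from transport_kernel[OF assms(1) this] transport_irreducible[OF assms]
  show ?thesis unfolding Prim_def by blast
qed

lemma (in pre_cstar) universal_norm_bound_index:
  fixes g :: "'i \<Rightarrow> 'a" and S :: "'i set"
  assumes g: "inj g" and L: "star_representation A S L" and a: "a \<in> sa_carrier A" and x: "\<xi> \<in> ell2 S"
  shows "ell2_norm (L a \<xi>) \<le> N a * ell2_norm \<xi>"
  using universal_norm_bound[OF transport_representation[OF g L] a push_ell2[OF g x]]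
  by (simp add: transport_def norm_push[OF g] push_apply[OF g])

section \<open>The topology of the Deaconu--Renault groupoid\<close>

lemma arrow_simps [simp]:
  "rng (x, m, y) = x" "cocycle (x, m, y) = m" "src (x, m, y) = y"
  "arrow_inv (x, m, y) = (y, - m, x)" "arrow_mult (x, m, y) (u, n, w) = (x, m + n, w)"
  by (simp_all add: rng_def cocycle_def src_def arrow_inv_def arrow_mult_def)

lemma nat_diff_eq_iff: "nat_diff p q = nat_diff p' q' \<longleftrightarrow> p + q' = p' + q"
proof -
  have "int a - int b = int c - int d \<longleftrightarrow> a + d = c + b" for a b c d by linarith
  then show ?thesis by (simp add: nat_diff_def vec_eq_iff)
qed

lemma nat_diff_add: "nat_diff p q + nat_diff r s = nat_diff (p + r) (q + s)"
  by (simp add: nat_diff_def vec_eq_iff)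

lemma nat_diff_minus: "- nat_diff p q = nat_diff q p"
  by (simp add: nat_diff_def vec_eq_iff)

lemma nat_diff_0 [simp]: "nat_diff p p = 0"
  by (simp add: nat_diff_def vec_eq_iff)

lemma continuous_map_binop:
  assumes "continuous_map X euclidean f" "continuous_map X euclidean g"
    and h: "continuous_on UNIV (\<lambda>(a, b). h a b)"
  shows "continuous_map X euclidean (\<lambda>x. h (f x) (g x))"
proof -
  have 1: "continuous_map X (prod_topology euclidean euclidean) (\<lambda>x. (f x, g x))"
    unfolding continuous_map_paired using assms by blast
  have 2: "continuous_map (prod_topology euclidean euclidean) euclidean (\<lambda>(a, b). h a b)"
    using h by simp
  show ?thesis using continuous_map_compose[OF 1 2] by (simp add: o_def)
qed

lemma Hausdorff_euclidean_t2: "Hausdorff_space (euclidean :: 'a::t2_space topology)"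
  unfolding Hausdorff_space_def disjnt_def by (auto dest!: hausdorff)

locale DR =
  fixes T :: "nat^'k::finite \<Rightarrow> 'x::{t2_space, second_countable_topology} \<Rightarrow> 'x"
  assumes lc: "locally_compact_space (euclidean :: 'x topology)"
    and act: "local_homeo_action T"
begin

abbreviation G where "G \<equiv> DR_groupoid T"
abbreviation Z where "Z \<equiv> DR_basic T"

lemma T_add: "T (m + n) x = T m (T n x)" and T_zero [simp]: "T 0 x = x"
  using act by (auto simp: local_homeo_action_def)

lemma T_local:
  obtains U g where "open U" "x \<in> U" "open (T n ` U)" "homeomorphism U (T n ` U) (T n) g"
  using act unfolding local_homeo_action_def local_homeomorphism_def by meson

lemma T_inj_nhd:
  obtains U where "open U" "x \<in> U" "inj_on (T n) U"
proof -
  obtain U g where "open U" "x \<in> U" "homeomorphism U (T n ` U) (T n) g" using T_local by metis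
  then have "inj_on (T n) U" by (auto simp: homeomorphism_def intro: inj_on_inverseI)
  then show ?thesis using that \<open>open U\<close> \<open>x \<in> U\<close> by blast
qed

lemma T_cont: "continuous_on UNIV (T n)"
proof -
  have "isCont (T n) x" for x
  proof -
    obtain U g where "open U" "x \<in> U" "homeomorphism U (T n ` U) (T n) g" using T_local by metis
    then show ?thesis using continuous_on_eq_continuous_at by (auto simp: homeomorphism_def)
  qed
  then show ?thesis by (simp add: continuous_at_imp_continuous_on)
qed

lemma open_vimage_T: "open U \<Longrightarrow> open (T n -` U)"
  using T_cont by (simp add: continuous_on_open_vimage)

lemma open_image_T:
  assumes "open V" shows "open (T n ` V)"
proof (subst open_subopen, intro ballI)
  fix y assume "y \<in> T n ` V"
  then obtain x where x: "x \<in> V" "y = T n x" by blast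
  obtain U g where U: "open U" "x \<in> U" "open (T n ` U)" "homeomorphism U (T n ` U) (T n) g"
    using T_local by metis
  have "openin (top_of_set U) (U \<inter> V)" using assms by (simp add: openin_open_Int)
  then have "openin (top_of_set (T n ` U)) (T n ` (U \<inter> V))"
    by (rule homeomorphism_imp_open_map[OF U(4)])
  then have "open (T n ` (U \<inter> V))" using U(3) by (simp add: openin_open_eq)
  then show "\<exists>A. open A \<and> y \<in> A \<and> A \<subseteq> T n ` V" using x U(2) by blast
qed

lemma arrow_iff: "(x, m, y) \<in> topspace G \<longleftrightarrow> (\<exists>p q. m = nat_diff p q \<and> T p x = T q y)"
  by (auto simp: topspace_DR_groupoid)

lemma arrowE:
  assumes "\<gamma> \<in> topspace G"
  obtains x p q y where "\<gamma> = (x, nat_diff p q, y)" "T p x = T q y"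
  using assms by (auto simp: topspace_DR_groupoid)

lemma mem_Z: "(x, m, y) \<in> Z U p q V \<longleftrightarrow> m = nat_diff p q \<and> x \<in> U \<and> y \<in> V \<and> T p x = T q y"
  by (auto simp: DR_basic_def)

lemma Z_mono: "U \<subseteq> U' \<Longrightarrow> V \<subseteq> V' \<Longrightarrow> Z U p q V \<subseteq> Z U' p q V'"
  by (auto simp: DR_basic_def)

lemma openin_Z: "open U \<Longrightarrow> open V \<Longrightarrow> openin G (Z U p q V)"
  unfolding DR_groupoid_def by (rule topology_generated_by_Basis) blast

lemma Z_subset: "Z U p q V \<subseteq> topspace G"
  by (fastforce simp: DR_basic_def arrow_iff)

text \<open>Two pairs of exponents with the same difference impose the same relation near a given pair of
  points: by the choice of a common multiple of the exponents, the relations differ by an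
  application of one of the maps \<open>T e\<close>, which is injective near the common value.\<close>

lemma exponents_comparable:
  assumes "T P x = T Q y" "nat_diff P Q = nat_diff P' Q'"
  obtains U V where "open U" "open V" "x \<in> U" "y \<in> V"
    "\<And>x' y'. x' \<in> U \<Longrightarrow> y' \<in> V \<Longrightarrow> T P' x' = T Q' y' \<Longrightarrow> T P x' = T Q y'"
proof -
  obtain N where N: "open N" "T P x \<in> N" "inj_on (T P') N" using T_inj_nhd by metis
  have eq: "P + Q' = P' + Q" using assms(2) by (simp add: nat_diff_eq_iff)
  have "T P x' = T Q y'" if "x' \<in> T P -` N" "y' \<in> T Q -` N" "T P' x' = T Q' y'" for x' y'
  proof -
    have "T P' (T P x') = T P (T P' x')" by (metis T_add add.commute)
    also have "\<dots> = T (P + Q') y'" by (simp add: T_add that(3))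
    also have "\<dots> = T P' (T Q y')" by (simp add: eq T_add)
    finally show ?thesis using N(3) that(1,2) by (auto dest: inj_onD)
  qed
  then show ?thesis
    using that[of "T P -` N" "T Q -` N"] N assms(1) by (simp add: open_vimage_T)
qed

text \<open>All basic neighbourhoods of an arrow can be taken with one and the same pair of exponents, so
  that near an arrow the groupoid looks like the fibre product of two maps on \<open>X\<close>.\<close>

lemma basic_nhd:
  assumes "openin G W" "(x, nat_diff p q, y) \<in> W" "T p x = T q y"
  shows "\<exists>U V. open U \<and> open V \<and> x \<in> U \<and> y \<in> V \<and> Z U p q V \<subseteq> W"
proof -
  have "generate_topology_on {Z U p q V | U p q V. open U \<and> open V} W"
    using assms(1) unfolding DR_groupoid_def by (rule openin_topology_generated_by)
  then show ?thesis using assms(2)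
  proof (induction W rule: generate_topology_on.induct)
    case Empty then show ?case by simp
  next
    case (Int a b)
    then obtain U V U' V' where "open U" "open V" "x \<in> U" "y \<in> V" "Z U p q V \<subseteq> a"
      "open U'" "open V'" "x \<in> U'" "y \<in> V'" "Z U' p q V' \<subseteq> b" by blast
    then show ?case
      by (intro exI[of _ "U \<inter> U'"] exI[of _ "V \<inter> V'"]) (auto simp: DR_basic_def)
  next
    case (UN K)
    then obtain k where "k \<in> K" "(x, nat_diff p q, y) \<in> k" by blast
    with UN.IH[of k] show ?case by blast
  next
    case (Basis s)
    then obtain U p' q' V where s: "s = Z U p' q' V" "open U" "open V" by blast
    then have *: "nat_diff p q = nat_diff p' q'" "x \<in> U" "y \<in> V" "T p' x = T q' y"
      using Basis by (auto simp: mem_Z)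
    obtain U' V' where U': "open U'" "open V'" "x \<in> U'" "y \<in> V'"
      "\<And>x' y'. x' \<in> U' \<Longrightarrow> y' \<in> V' \<Longrightarrow> T p x' = T q y' \<Longrightarrow> T p' x' = T q' y'"
      using exponents_comparable[OF *(4) *(1)[symmetric]] by metis
    have "Z (U \<inter> U') p q (V \<inter> V') \<subseteq> s"
      using U'(5) *(1) by (auto simp: s DR_basic_def)
    moreover have "open (U \<inter> U')" "open (V \<inter> V')" "x \<in> U \<inter> U'" "y \<in> V \<inter> V'"
      using U' s(2,3) *(2,3) by auto
    ultimately show ?case by blast
  qed
qed

lemma openin_GI:
  assumes "\<And>x p q y. (x, nat_diff p q, y) \<in> W \<Longrightarrow> T p x = T q y \<Longrightarrow>
      \<exists>U V. open U \<and> open V \<and> x \<in> U \<and> y \<in> V \<and> Z U p q V \<subseteq> W" "W \<subseteq> topspace G"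
  shows "openin G W"
proof (subst openin_subopen, intro ballI)
  fix \<gamma> assume \<gamma>: "\<gamma> \<in> W"
  then obtain x p q y where g: "\<gamma> = (x, nat_diff p q, y)" "T p x = T q y"
    using assms(2) arrowE by blast
  then obtain U V where "open U" "open V" "x \<in> U" "y \<in> V" "Z U p q V \<subseteq> W"
    using assms(1)[of x p q y] \<gamma> unfolding g(1) by metis
  then show "\<exists>S. openin G S \<and> \<gamma> \<in> S \<and> S \<subseteq> W"
    using g by (intro exI[of _ "Z U p q V"]) (auto simp: openin_Z mem_Z)
qed

lemma open_rng_src_preimage:
  assumes "open U" "open V"
  shows "openin G {\<gamma> \<in> topspace G. rng \<gamma> \<in> U \<and> src \<gamma> \<in> V \<and> cocycle \<gamma> \<in> M}"
proof (rule openin_GI)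
  fix x p q y assume "(x, nat_diff p q, y) \<in> {\<gamma> \<in> topspace G. rng \<gamma> \<in> U \<and> src \<gamma> \<in> V \<and> cocycle \<gamma> \<in> M}"
  then show "\<exists>U' V'. open U' \<and> open V' \<and> x \<in> U' \<and> y \<in> V' \<and>
      Z U' p q V' \<subseteq> {\<gamma> \<in> topspace G. rng \<gamma> \<in> U \<and> src \<gamma> \<in> V \<and> cocycle \<gamma> \<in> M}"
    using assms Z_subset[of U p q V] by - (rule exI[of _ U], rule exI[of _ V], auto simp: mem_Z)
qed auto

lemma continuous_rng: "continuous_map G euclidean rng"
  unfolding continuous_map using open_rng_src_preimage[of _ UNIV UNIV] by auto

lemma continuous_src: "continuous_map G euclidean src"
  unfolding continuous_map using open_rng_src_preimage[of UNIV _ UNIV] by auto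

text \<open>In a basic set the range of an arrow is constrained only by a condition that is open because
  the maps \<open>T p\<close> are open.\<close>

lemma open_rng_image:
  assumes "openin G W" shows "open (rng ` W)"
proof (subst open_subopen, intro ballI)
  fix x assume "x \<in> rng ` W"
  then obtain \<gamma> where "\<gamma> \<in> W" "x = rng \<gamma>" by blast
  then obtain p q y where g: "(x, nat_diff p q, y) \<in> W" "T p x = T q y"
    using openin_subset[OF assms] by (auto elim!: arrowE[of \<gamma>])
  then obtain U V where U: "open U" "open V" "x \<in> U" "y \<in> V" "Z U p q V \<subseteq> W"
    using basic_nhd[OF assms g] by metis
  have "U \<inter> T p -` (T q ` V) \<subseteq> rng ` W"
  proof
    fix x' assume "x' \<in> U \<inter> T p -` (T q ` V)"
    then obtain y' where "y' \<in> V" "T p x' = T q y'" "x' \<in> U" by blast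
    then have "(x', nat_diff p q, y') \<in> W" using U(5) by (auto simp: mem_Z)
    then show "x' \<in> rng ` W" by force
  qed
  moreover have "open (U \<inter> T p -` (T q ` V))" using U by (intro open_Int open_vimage_T open_image_T)
  moreover have "x \<in> U \<inter> T p -` (T q ` V)" using U g by force
  ultimately show "\<exists>A. open A \<and> x \<in> A \<and> A \<subseteq> rng ` W" by blast
qed

lemma open_src_image:
  assumes "openin G W" shows "open (src ` W)"
proof (subst open_subopen, intro ballI)
  fix y assume "y \<in> src ` W"
  then obtain \<gamma> where "\<gamma> \<in> W" "y = src \<gamma>" by blast
  then obtain p q x where g: "(x, nat_diff p q, y) \<in> W" "T p x = T q y"
    using openin_subset[OF assms] by (auto elim!: arrowE[of \<gamma>])
  then obtain U V where U: "open U" "open V" "x \<in> U" "y \<in> V" "Z U p q V \<subseteq> W"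
    using basic_nhd[OF assms g] by metis
  have "V \<inter> T q -` (T p ` U) \<subseteq> src ` W"
  proof
    fix y' assume "y' \<in> V \<inter> T q -` (T p ` U)"
    then obtain x' where "x' \<in> U" "T p x' = T q y'" "y' \<in> V" by force
    then have "(x', nat_diff p q, y') \<in> W" using U(5) by (auto simp: mem_Z)
    then show "y' \<in> src ` W" by force
  qed
  moreover have "open (V \<inter> T q -` (T p ` U))" using U by (intro open_Int open_vimage_T open_image_T)
  moreover have "y \<in> V \<inter> T q -` (T p ` U)" using U g by force
  ultimately show "\<exists>A. open A \<and> y \<in> A \<and> A \<subseteq> src ` W" by blast
qed

lemma Hausdorff_G: "Hausdorff_space G"
  unfolding Hausdorff_space_def
proof (intro allI impI, elim conjE)
  fix \<gamma> \<eta> assume g: "\<gamma> \<in> topspace G" "\<eta> \<in> topspace G" "\<gamma> \<noteq> \<eta>"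
  let ?S = "\<lambda>U V M. {\<gamma> \<in> topspace G. rng \<gamma> \<in> U \<and> src \<gamma> \<in> V \<and> cocycle \<gamma> \<in> M}"
  have "rng \<gamma> \<noteq> rng \<eta> \<or> src \<gamma> \<noteq> src \<eta> \<or> cocycle \<gamma> \<noteq> cocycle \<eta>"
    using g(3) by (cases \<gamma>; cases \<eta>) auto
  then consider "rng \<gamma> \<noteq> rng \<eta>" | "src \<gamma> \<noteq> src \<eta>" | "cocycle \<gamma> \<noteq> cocycle \<eta>" by blast
  then show "\<exists>U V. openin G U \<and> openin G V \<and> \<gamma> \<in> U \<and> \<eta> \<in> V \<and> disjnt U V"
  proof cases
    case 1
    then obtain U V where "open U" "open V" "rng \<gamma> \<in> U" "rng \<eta> \<in> V" "U \<inter> V = {}"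
      using hausdorff by metis
    then show ?thesis using g open_rng_src_preimage[of U UNIV UNIV] open_rng_src_preimage[of V UNIV UNIV]
      by (intro exI[of _ "?S U UNIV UNIV"] exI[of _ "?S V UNIV UNIV"]) (auto simp: disjnt_def)
  next
    case 2
    then obtain U V where "open U" "open V" "src \<gamma> \<in> U" "src \<eta> \<in> V" "U \<inter> V = {}"
      using hausdorff by metis
    then show ?thesis using g open_rng_src_preimage[of UNIV U UNIV] open_rng_src_preimage[of UNIV V UNIV]
      by (intro exI[of _ "?S UNIV U UNIV"] exI[of _ "?S UNIV V UNIV"]) (auto simp: disjnt_def)
  next
    case 3
    then show ?thesis using g open_rng_src_preimage[of UNIV UNIV "{cocycle \<gamma>}"]
        open_rng_src_preimage[of UNIV UNIV "{cocycle \<eta>}"]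
      by - (rule exI[of _ "?S UNIV UNIV {cocycle \<gamma>}"], rule exI[of _ "?S UNIV UNIV {cocycle \<eta>}"],
          auto simp: disjnt_def)
  qed
qed

text \<open>Openness of \<open>rng\<close> and \<open>src\<close> turns these two injectivity conditions into homeomorphisms onto open
  sets.\<close>

definition bis :: "('x, 'k) arrow set \<Rightarrow> bool" where
  "bis D \<longleftrightarrow> openin G D \<and> inj_on rng D \<and> inj_on src D"

lemma bis_subset: "bis D \<Longrightarrow> D \<subseteq> topspace G"
  by (auto simp: bis_def openin_subset)

lemma bis_src_eq: "bis D \<Longrightarrow> \<gamma> \<in> D \<Longrightarrow> \<eta> \<in> D \<Longrightarrow> src \<gamma> = src \<eta> \<Longrightarrow> \<gamma> = \<eta>"
  and bis_rng_eq: "bis D \<Longrightarrow> \<gamma> \<in> D \<Longrightarrow> \<eta> \<in> D \<Longrightarrow> rng \<gamma> = rng \<eta> \<Longrightarrow> \<gamma> = \<eta>"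
  by (auto simp: bis_def dest: inj_onD)

text \<open>Shrinking a basic set until \<open>T p\<close> and \<open>T q\<close> are injective makes each arrow determined by its
  source, and by its range.\<close>

lemma chart:
  assumes "openin G W" "(x, nat_diff p q, y) \<in> W" "T p x = T q y"
  obtains U V where "open U" "open V" "x \<in> U" "y \<in> V" "Z U p q V \<subseteq> W" "bis (Z U p q V)"
    "inj_on (T p) U" "inj_on (T q) V"
proof -
  obtain U V where U: "open U" "open V" "x \<in> U" "y \<in> V" "Z U p q V \<subseteq> W"
    using basic_nhd[OF assms] by metis
  obtain U' where U': "open U'" "x \<in> U'" "inj_on (T p) U'" using T_inj_nhd by metis
  obtain V' where V': "open V'" "y \<in> V'" "inj_on (T q) V'" using T_inj_nhd by metis
  have inj: "inj_on (T p) (U \<inter> U')" "inj_on (T q) (V \<inter> V')"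
    using U'(3) V'(3) by (auto intro: inj_on_subset)
  have "bis (Z (U \<inter> U') p q (V \<inter> V'))"
    unfolding bis_def
  proof (intro conjI inj_onI)
    show "openin G (Z (U \<inter> U') p q (V \<inter> V'))" using U U' V' by (simp add: openin_Z open_Int)
    show "\<gamma> = \<eta>" if "\<gamma> \<in> Z (U \<inter> U') p q (V \<inter> V')" "\<eta> \<in> Z (U \<inter> U') p q (V \<inter> V')" "rng \<gamma> = rng \<eta>" for \<gamma> \<eta>
      using that inj_onD[OF inj(2)] by (auto simp: DR_basic_def)
    show "\<gamma> = \<eta>" if "\<gamma> \<in> Z (U \<inter> U') p q (V \<inter> V')" "\<eta> \<in> Z (U \<inter> U') p q (V \<inter> V')" "src \<gamma> = src \<eta>" for \<gamma> \<eta>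
      using that inj_onD[OF inj(1)] by (auto simp: DR_basic_def)
  qed
  moreover have "Z (U \<inter> U') p q (V \<inter> V') \<subseteq> W"
    using U(5) Z_mono[of "U \<inter> U'" U "V \<inter> V'" V p q] by auto
  ultimately show ?thesis using that[of "U \<inter> U'" "V \<inter> V'"] U U' V' inj by auto
qed

lemma bis_nhd:
  assumes "openin G W" "\<gamma> \<in> W" obtains D where "bis D" "\<gamma> \<in> D" "D \<subseteq> W"
proof -
  obtain x p q y where g: "\<gamma> = (x, nat_diff p q, y)" "T p x = T q y"
    using assms openin_subset arrowE by (metis subsetD)
  then obtain U V where "open U" "open V" "x \<in> U" "y \<in> V" "Z U p q V \<subseteq> W" "bis (Z U p q V)"
    using chart[OF assms(1)] assms(2) by metis
  then show ?thesis using that[of "Z U p q V"] g by (simp add: mem_Z)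
qed

lemma bis_homeomorphic_rng:
  assumes "bis D"
  shows "homeomorphic_map (subtopology G D) (top_of_set (rng ` D)) rng"
proof (rule bijective_open_imp_homeomorphic_map)
  have D: "openin G D" "topspace (subtopology G D) = D"
    using assms bis_subset[OF assms] by (auto simp: bis_def)
  show "continuous_map (subtopology G D) (top_of_set (rng ` D)) rng"
    using continuous_rng D(2) by (auto simp: continuous_map_in_subtopology continuous_map_from_subtopology)
  show "open_map (subtopology G D) (top_of_set (rng ` D)) rng"
    unfolding open_map_def
  proof (intro allI impI)
    fix U assume "openin (subtopology G D) U"
    then have "openin G U" "U \<subseteq> D" using D(1) by (auto simp: openin_open_subtopology)
    then show "openin (top_of_set (rng ` D)) (rng ` U)"
      using open_rng_image by (intro open_subset) auto
  qed
  show "rng ` topspace (subtopology G D) = topspace (top_of_set (rng ` D))" using D by simp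
  show "inj_on rng (topspace (subtopology G D))" using D assms by (simp add: bis_def)
qed

text \<open>A bisection is homeomorphic, by the range map, to an open subset of \<open>X\<close>.\<close>

lemma locally_compact_G: "locally_compact_space G"
  unfolding locally_compact_space_def
proof
  fix \<gamma> assume \<gamma>: "\<gamma> \<in> topspace G"
  then obtain D where D: "bis D" "\<gamma> \<in> D" using bis_nhd[OF openin_topspace] by metis
  then have oD: "openin G D" by (simp add: bis_def)
  have "locally_compact_space (top_of_set (rng ` D))"
    by (rule locally_compact_space_open_subset)
       (use lc Hausdorff_euclidean_t2 open_rng_image[OF oD] in auto)
  then have lD: "locally_compact_space (subtopology G D)"
    using homeomorphic_map_imp_homeomorphic_space[OF bis_homeomorphic_rng[OF D(1)]]
    by (rule homeomorphic_locally_compact_spaceD[OF _ homeomorphic_space_sym[THEN iffD1]])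
  have "\<gamma> \<in> topspace (subtopology G D)" using D \<gamma> by simp
  then obtain U K where "openin (subtopology G D) U" "compactin (subtopology G D) K" "\<gamma> \<in> U" "U \<subseteq> K"
    using lD[unfolded locally_compact_space_def] by metis
  then show "\<exists>U K. openin G U \<and> compactin G K \<and> \<gamma> \<in> U \<and> U \<subseteq> K"
    using oD by (auto simp: openin_open_subtopology compactin_subtopology)
qed

lemma regular_G: "regular_space G"
  by (rule locally_compact_Hausdorff_imp_regular_space[OF locally_compact_G Hausdorff_G])

lemma compact_nhd:
  assumes "openin G W" "\<gamma> \<in> W"
  obtains U K where "openin G U" "compactin G K" "\<gamma> \<in> U" "U \<subseteq> K" "K \<subseteq> W"
  using locally_compact_regular_space_neighbourhood_base[of G] locally_compact_G regular_G assms
  unfolding neighbourhood_base_of by metis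

lemma bump:
  assumes "openin G W" "\<gamma> \<in> W"
  obtains b :: "('x, 'k) arrow \<Rightarrow> real" and K where "continuous_map G euclideanreal b"
    "\<And>\<eta>. 0 \<le> b \<eta>" "\<And>\<eta>. b \<eta> \<le> 1" "b \<gamma> = 1" "compactin G K" "K \<subseteq> W" "\<And>\<eta>. b \<eta> \<noteq> 0 \<Longrightarrow> \<eta> \<in> K"
proof -
  obtain U K where U: "openin G U" "compactin G K" "\<gamma> \<in> U" "U \<subseteq> K" "K \<subseteq> W"
    using compact_nhd[OF assms] by metis
  have "closedin G (topspace G - U)" using U by blast
  moreover have "\<gamma> \<in> topspace G - (topspace G - U)" using U openin_subset by blast
  ultimately obtain f :: "('x, 'k) arrow \<Rightarrow> real" where
    f: "continuous_map G (top_of_set {0..1}) f" "f \<gamma> = 0" "f ` (topspace G - U) \<subseteq> {1}"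
    using locally_compact_regular_imp_completely_regular_space[OF locally_compact_G] Hausdorff_G
    unfolding completely_regular_space_def by metis
  have f01: "f \<eta> \<in> {0..1}" if "\<eta> \<in> topspace G" for \<eta>
    using f(1) that by (auto simp: continuous_map_in_subtopology)
  have fc: "continuous_map G euclideanreal f" using f(1) by (simp add: continuous_map_in_subtopology)
  define b where "b \<eta> = (if \<eta> \<in> topspace G then 1 - f \<eta> else 0)" for \<eta>
  show ?thesis
  proof (rule that)
    have "continuous_map G euclideanreal (\<lambda>\<eta>. 1 - f \<eta>)"
      using fc by (intro continuous_map_diff) auto
    then show "continuous_map G euclideanreal b"
      by (rule continuous_map_eq) (simp add: b_def)
    show "0 \<le> b \<eta>" "b \<eta> \<le> 1" for \<eta> using f01[of \<eta>] by (auto simp: b_def)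
    show "b \<gamma> = 1" using f(2) U(1,3) openin_subset by (auto simp: b_def)
    show "compactin G K" "K \<subseteq> W" by fact+
    show "\<eta> \<in> K" if "b \<eta> \<noteq> 0" for \<eta>
      using that f(3) U(4) by (auto simp: b_def split: if_splits)
  qed
qed

section \<open>Compactly supported functions\<close>

abbreviation Cc where "Cc \<equiv> sa_carrier (convolution_algebra G)"

text \<open>As \<open>G\<close> is Hausdorff, vanishing off some compact set is the same as having compact support.\<close>

lemma Cc_iff:
  "f \<in> Cc \<longleftrightarrow> continuous_map G euclidean f \<and> (\<exists>K. compactin G K \<and> (\<forall>\<gamma>. f \<gamma> \<noteq> 0 \<longrightarrow> \<gamma> \<in> K))"
proof
  assume f: "f \<in> Cc"
  let ?K = "G closure_of {\<gamma> \<in> topspace G. f \<gamma> \<noteq> 0}"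
  have "\<gamma> \<in> ?K" if "f \<gamma> \<noteq> 0" for \<gamma>
  proof -
    have "\<forall>\<gamma>. \<gamma> \<notin> topspace G \<longrightarrow> f \<gamma> = 0" using f by (simp add: convolution_algebra_def)
    then have "\<gamma> \<in> {\<gamma> \<in> topspace G. f \<gamma> \<noteq> 0}" using that by blast
    then show ?thesis using closure_of_subset[of "{\<gamma> \<in> topspace G. f \<gamma> \<noteq> 0}" G] by blast
  qed
  then show "continuous_map G euclidean f \<and> (\<exists>K. compactin G K \<and> (\<forall>\<gamma>. f \<gamma> \<noteq> 0 \<longrightarrow> \<gamma> \<in> K))"
    using f by (auto simp: convolution_algebra_def intro!: exI[of _ ?K])
next
  assume f: "continuous_map G euclidean f \<and> (\<exists>K. compactin G K \<and> (\<forall>\<gamma>. f \<gamma> \<noteq> 0 \<longrightarrow> \<gamma> \<in> K))"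
  then obtain K where K: "compactin G K" "\<forall>\<gamma>. f \<gamma> \<noteq> 0 \<longrightarrow> \<gamma> \<in> K" by blast
  have "closedin G K" by (rule compactin_imp_closedin[OF Hausdorff_G K(1)])
  then have "G closure_of {\<gamma> \<in> topspace G. f \<gamma> \<noteq> 0} \<subseteq> K" using K by (intro closure_of_minimal) auto
  then have "compactin G (G closure_of {\<gamma> \<in> topspace G. f \<gamma> \<noteq> 0})"
    by (rule closed_compactin[OF K(1)]) simp
  then show "f \<in> Cc" using f K compactin_subset_topspace[OF K(1)] by (auto simp: convolution_algebra_def)
qed

lemma Cc_continuous: "f \<in> Cc \<Longrightarrow> continuous_map G euclidean f"
  by (simp add: Cc_iff)

lemma Cc_outside: "f \<in> Cc \<Longrightarrow> f \<gamma> \<noteq> 0 \<Longrightarrow> \<gamma> \<in> topspace G"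
  using compactin_subset_topspace unfolding Cc_iff by blast

lemma CcI:
  assumes "continuous_map G euclidean f" "compactin G K" "\<And>\<gamma>. f \<gamma> \<noteq> 0 \<Longrightarrow> \<gamma> \<in> K"
  shows "f \<in> Cc"
  using assms by (auto simp: Cc_iff)

lemma Cc_add: "f \<in> Cc \<Longrightarrow> g \<in> Cc \<Longrightarrow> (\<lambda>\<gamma>. f \<gamma> + g \<gamma>) \<in> Cc"
proof -
  assume f: "f \<in> Cc" and g: "g \<in> Cc"
  obtain K L where "compactin G K" "\<forall>\<gamma>. f \<gamma> \<noteq> 0 \<longrightarrow> \<gamma> \<in> K" "compactin G L" "\<forall>\<gamma>. g \<gamma> \<noteq> 0 \<longrightarrow> \<gamma> \<in> L"
    using f g by (auto simp: Cc_iff)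
  moreover have "continuous_map G euclidean (\<lambda>\<gamma>. f \<gamma> + g \<gamma>)"
    using Cc_continuous[OF f] Cc_continuous[OF g] by (rule continuous_map_binop[where h="(+)"])
      (auto simp: case_prod_beta intro!: continuous_intros)
  ultimately show ?thesis
    by (intro CcI[where K="K \<union> L"] compactin_Un) (auto, force)
qed

lemma Cc_mult_left:
  assumes "f \<in> Cc" "continuous_map G euclidean h"
  shows "(\<lambda>\<gamma>. f \<gamma> * h \<gamma>) \<in> Cc"
proof -
  obtain K where "compactin G K" "\<forall>\<gamma>. f \<gamma> \<noteq> 0 \<longrightarrow> \<gamma> \<in> K" using assms by (auto simp: Cc_iff)
  moreover have "continuous_map G euclidean (\<lambda>\<gamma>. f \<gamma> * h \<gamma>)"
    using Cc_continuous[OF assms(1)] assms(2) by (rule continuous_map_binop[where h="(*)"])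
      (auto simp: case_prod_beta intro!: continuous_intros)
  ultimately show ?thesis by (intro CcI[where K=K]) auto
qed

lemma Cc_scale: "f \<in> Cc \<Longrightarrow> (\<lambda>\<gamma>. c * f \<gamma>) \<in> Cc"
  using Cc_mult_left[of f "\<lambda>_. c"] by (simp add: mult.commute)

lemma Cc_zero: "(\<lambda>\<gamma>. 0) \<in> Cc"
  by (rule CcI[where K="{}"]) auto

lemma Cc_bounded:
  assumes "f \<in> Cc" obtains M where "0 < M" "\<And>\<gamma>. cmod (f \<gamma>) \<le> M"
proof -
  obtain K where K: "compactin G K" "\<forall>\<gamma>. f \<gamma> \<noteq> 0 \<longrightarrow> \<gamma> \<in> K" using assms by (auto simp: Cc_iff)
  have "compact (f ` K)" using image_compactin[OF K(1) Cc_continuous[OF assms]] by simp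
  then obtain M where "\<forall>y\<in>f ` K. cmod y \<le> M" using compact_imp_bounded bounded_iff by blast
  then have "cmod (f \<gamma>) \<le> max M 1" for \<gamma> using K(2) by (cases "f \<gamma> = 0") fastforce+
  then show ?thesis using that[of "max M 1"] by auto
qed

definition bis_supported :: "(('x, 'k) arrow \<Rightarrow> complex) \<Rightarrow> bool" where
  "bis_supported f \<longleftrightarrow> f \<in> Cc \<and> (\<exists>D K. bis D \<and> compactin G K \<and> K \<subseteq> D \<and> (\<forall>\<gamma>. f \<gamma> \<noteq> 0 \<longrightarrow> \<gamma> \<in> K))"

text \<open>A partition of unity subordinate to a cover of the support by bisections reduces statements about
  \<open>C\<^sub>c(G)\<close> to functions supported in a bisection.\<close>

lemma Cc_induct [consumes 1, case_names bis add]: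
  assumes f: "f \<in> Cc"
    and P_bis: "\<And>f. bis_supported f \<Longrightarrow> P f"
    and P_add: "\<And>f g. f \<in> Cc \<Longrightarrow> g \<in> Cc \<Longrightarrow> P f \<Longrightarrow> P g \<Longrightarrow> P (\<lambda>\<gamma>. f \<gamma> + g \<gamma>)"
  shows "P f"
proof -
  obtain K where K: "compactin G K" "\<forall>\<gamma>. f \<gamma> \<noteq> 0 \<longrightarrow> \<gamma> \<in> K" using f by (auto simp: Cc_iff)
  define Q where "Q = (\<lambda>\<gamma> (b :: ('x, 'k) arrow \<Rightarrow> real, L, D). continuous_map G euclideanreal b \<and>
      (\<forall>\<eta>. 0 \<le> b \<eta>) \<and> b \<gamma> = 1 \<and> bis D \<and> compactin G L \<and> L \<subseteq> D \<and> (\<forall>\<eta>. b \<eta> \<noteq> 0 \<longrightarrow> \<eta> \<in> L))"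
  have "\<exists>t. Q \<gamma> t" if \<gamma>: "\<gamma> \<in> topspace G" for \<gamma>
  proof -
    obtain D where D: "bis D" "\<gamma> \<in> D" using bis_nhd[OF openin_topspace \<gamma>] by metis
    then have "openin G D" by (simp add: bis_def)
    from bump[OF this D(2)] obtain b :: "('x, 'k) arrow \<Rightarrow> real" and L where
      "continuous_map G euclideanreal b" "\<And>\<eta>. 0 \<le> b \<eta>" "b \<gamma> = 1"
      "compactin G L" "L \<subseteq> D" "\<And>\<eta>. b \<eta> \<noteq> 0 \<Longrightarrow> \<eta> \<in> L" by metis
    then have "Q \<gamma> (b, L, D)" using D(1) by (simp add: Q_def)
    then show ?thesis by blast
  qed
  then obtain t where t: "\<And>\<gamma>. \<gamma> \<in> topspace G \<Longrightarrow> Q \<gamma> (t \<gamma>)" by metis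
  define b L D where "b \<gamma> = fst (t \<gamma>)" and "L \<gamma> = fst (snd (t \<gamma>))" and "D \<gamma> = snd (snd (t \<gamma>))" for \<gamma>
  have b: "\<And>\<gamma>. \<gamma> \<in> topspace G \<Longrightarrow> continuous_map G euclideanreal (b \<gamma>)"
       "\<And>\<gamma> \<eta>. \<gamma> \<in> topspace G \<Longrightarrow> 0 \<le> b \<gamma> \<eta>" "\<And>\<gamma>. \<gamma> \<in> topspace G \<Longrightarrow> b \<gamma> \<gamma> = 1"
       "\<And>\<gamma>. \<gamma> \<in> topspace G \<Longrightarrow> bis (D \<gamma>)" "\<And>\<gamma>. \<gamma> \<in> topspace G \<Longrightarrow> compactin G (L \<gamma>)"
       "\<And>\<gamma>. \<gamma> \<in> topspace G \<Longrightarrow> L \<gamma> \<subseteq> D \<gamma>" "\<And>\<gamma> \<eta>. \<gamma> \<in> topspace G \<Longrightarrow> b \<gamma> \<eta> \<noteq> 0 \<Longrightarrow> \<eta> \<in> L \<gamma>"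
    using t unfolding Q_def b_def L_def D_def case_prod_beta by (simp_all del: split_paired_All)
  have KG: "K \<subseteq> topspace G" using K(1) by (rule compactin_subset_topspace)
  define O' where "O' \<gamma> = {\<eta> \<in> topspace G. b \<gamma> \<eta> \<in> {1/2<..}}" for \<gamma>
  have "openin G (O' \<gamma>)" if "\<gamma> \<in> topspace G" for \<gamma>
    unfolding O'_def by (rule openin_continuous_map_preimage[OF b(1)[OF that]]) (simp flip: open_openin)
  moreover have "K \<subseteq> \<Union>(O' ` K)" using KG b(3) by (force simp: O'_def)
  ultimately obtain \<F> where "finite \<F>" "\<F> \<subseteq> O' ` K" "K \<subseteq> \<Union>\<F>"
    using K(1) KG unfolding compactin_def by (smt (verit, ccfv_threshold) imageE subset_iff)
  then obtain F where F: "finite F" "F \<subseteq> K" "K \<subseteq> \<Union>(O' ` F)" by (metis finite_subset_image)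
  have FG: "j \<in> topspace G" if "j \<in> F" for j using that F(2) KG by blast
  define s where "s \<eta> = (\<Sum>j\<in>F. b j \<eta>)" for \<eta>
  define h where "h j \<eta> = complex_of_real (b j \<eta> / max (s \<eta>) (1/2))" for j \<eta>
  have sc: "continuous_map G euclideanreal s"
    unfolding s_def by (intro continuous_map_sum F(1) b(1) FG)
  have hc: "continuous_map G euclidean (h j)" if "j \<in> F" for j
  proof -
    have "continuous_on UNIV (\<lambda>(a :: real, t :: real). complex_of_real (a / max t (1/2)))"
      by (simp add: case_prod_beta) (intro continuous_intros; auto simp: max_def)
    then show ?thesis
      unfolding h_def using continuous_map_binop[OF b(1)[OF FG[OF that]] sc] by simp
  qed
  define fj where "fj j \<eta> = f \<eta> * h j \<eta>" for j \<eta>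
  have fjc: "fj j \<in> Cc" if "j \<in> F" for j
    unfolding fj_def by (rule Cc_mult_left[OF f hc[OF that]])
  have fjP: "P (fj j)" if "j \<in> F" for j
  proof (rule P_bis)
    have "\<eta> \<in> L j" if "fj j \<eta> \<noteq> 0" for \<eta>
      using that b(7)[OF FG[OF \<open>j \<in> F\<close>]] by (auto simp: fj_def h_def)
    then show "bis_supported (fj j)"
      unfolding bis_supported_def using fjc[OF that] b(4-6)[OF FG[OF that]] by blast
  qed
  have "(\<lambda>\<eta>. \<Sum>j\<in>F'. fj j \<eta>) \<in> Cc \<and> P (\<lambda>\<eta>. \<Sum>j\<in>F'. fj j \<eta>)" if "F' \<subseteq> F" for F'
    using finite_subset[OF that F(1)] that
  proof (induction F' rule: finite_induct)
    case empty
    have "bis {}" by (simp add: bis_def)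
    then have "bis_supported (\<lambda>\<gamma>. 0)"
      unfolding bis_supported_def using Cc_zero by (auto intro!: exI[of _ "{}"])
    then show ?case using P_bis Cc_zero by simp
  next
    case (insert j F')
    then show ?case using fjc fjP P_add[of "fj j" "\<lambda>\<eta>. \<Sum>j\<in>F'. fj j \<eta>"] Cc_add[of "fj j"] by simp
  qed
  moreover have "(\<lambda>\<eta>. \<Sum>j\<in>F. fj j \<eta>) = f"
  proof
    fix \<eta>
    have e: "(\<Sum>j\<in>F. fj j \<eta>) = f \<eta> * complex_of_real (s \<eta> / max (s \<eta>) (1/2))"
      by (simp add: fj_def h_def s_def sum_distrib_left[symmetric] sum_divide_distrib[symmetric] flip: of_real_sum)
    show "(\<Sum>j\<in>F. fj j \<eta>) = f \<eta>"
    proof (cases "f \<eta> = 0")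
      case False
      then have "\<eta> \<in> K" using K(2) by blast
      then obtain j where j: "j \<in> F" "\<eta> \<in> O' j" using F(3) by blast
      have "b j \<eta> \<le> s \<eta>" unfolding s_def by (rule member_le_sum[OF j(1) b(2)[OF FG] F(1)]) simp
      then have "1/2 < s \<eta>" using j(2) by (auto simp: O'_def)
      then show ?thesis using e by (simp add: max_def)
    qed (simp add: e)
  qed
  ultimately show ?thesis by (metis order_refl)
qed

lemma bis_supported_Cc: "bis_supported f \<Longrightarrow> f \<in> Cc"
  by (simp add: bis_supported_def)

lemma bis_bump:
  assumes "bis D" "\<gamma> \<in> D"
  obtains f where "bis_supported f" "f \<gamma> = 1" "\<And>\<eta>. f \<eta> \<noteq> 0 \<Longrightarrow> \<eta> \<in> D" "\<And>\<eta>. cmod (f \<eta>) \<le> 1"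
proof -
  have "openin G D" using assms by (simp add: bis_def)
  from bump[OF this assms(2)] obtain b :: "('x, 'k) arrow \<Rightarrow> real" and K where
    b: "continuous_map G euclideanreal b" "\<And>\<eta>. 0 \<le> b \<eta>" "\<And>\<eta>. b \<eta> \<le> 1" "b \<gamma> = 1"
      "compactin G K" "K \<subseteq> D" "\<And>\<eta>. b \<eta> \<noteq> 0 \<Longrightarrow> \<eta> \<in> K" by metis
  have "continuous_map G euclidean (\<lambda>\<eta>. complex_of_real (b \<eta>))"
    using continuous_map_binop[OF b(1) b(1), of "\<lambda>a _. complex_of_real a"]
    by (simp add: case_prod_beta continuous_intros)
  then have "(\<lambda>\<eta>. complex_of_real (b \<eta>)) \<in> Cc" using b by (intro CcI[where K=K]) auto
  then have "bis_supported (\<lambda>\<eta>. complex_of_real (b \<eta>))"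
    unfolding bis_supported_def using assms(1) b(5-7)
    by - (rule conjI, assumption, rule exI[of _ D], rule exI[of _ K], simp)
  then show ?thesis
    by (rule that) (use b in auto)
qed

end

section \<open>The convolution algebra\<close>

lemma arrow_inv_simps [simp]:
  "rng (arrow_inv \<gamma>) = src \<gamma>" "src (arrow_inv \<gamma>) = rng \<gamma>" "cocycle (arrow_inv \<gamma>) = - cocycle \<gamma>"
  "arrow_inv (arrow_inv \<gamma>) = \<gamma>"
  "rng (arrow_mult \<alpha> \<beta>) = rng \<alpha>" "src (arrow_mult \<alpha> \<beta>) = src \<beta>"
  "cocycle (arrow_mult \<alpha> \<beta>) = cocycle \<alpha> + cocycle \<beta>"
  by (cases \<gamma>; cases \<alpha>; cases \<beta>; simp)+

lemma arrow_eqI: "rng \<alpha> = rng \<beta> \<Longrightarrow> cocycle \<alpha> = cocycle \<beta> \<Longrightarrow> src \<alpha> = src \<beta> \<Longrightarrow> \<alpha> = \<beta>"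
  by (cases \<alpha>; cases \<beta>) simp

lemma mem_inv_image: "\<gamma> \<in> arrow_inv ` D \<longleftrightarrow> arrow_inv \<gamma> \<in> D"
  by (metis arrow_inv_simps(4) image_iff)

abbreviation diagonal :: "(('x, 'k::finite) arrow \<Rightarrow> complex) \<Rightarrow> bool" where
  "diagonal h \<equiv> (\<forall>\<gamma>. h \<gamma> \<noteq> 0 \<longrightarrow> \<gamma> = unit_arrow (rng \<gamma>))"

context DR
begin

lemma inv_topspace:
  assumes "\<gamma> \<in> topspace G" shows "arrow_inv \<gamma> \<in> topspace G"
proof -
  obtain x p q y where "\<gamma> = (x, nat_diff p q, y)" "T p x = T q y" using assms arrowE by metis
  then have "arrow_inv \<gamma> = (y, nat_diff q p, x)" "T q y = T p x" by (simp_all add: nat_diff_minus)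
  then show ?thesis using arrow_iff by metis
qed

lemma mult_topspace:
  assumes "\<alpha> \<in> topspace G" "\<beta> \<in> topspace G" "src \<alpha> = rng \<beta>"
  shows "arrow_mult \<alpha> \<beta> \<in> topspace G"
proof -
  obtain x a b w where a: "\<alpha> = (x, nat_diff a b, w)" "T a x = T b w" using assms(1) arrowE by metis
  obtain w' c d y where b: "\<beta> = (w', nat_diff c d, y)" "T c w' = T d y" using assms(2) arrowE by metis
  have "T (a + c) x = T (b + d) y"
    using a b assms(3) by (metis T_add add.commute arrow_simps(1,3))
  then show ?thesis using a b assms(3) by (auto simp: arrow_iff nat_diff_add)
qed

lemma unit_topspace [simp]: "unit_arrow x \<in> topspace G"
  unfolding unit_arrow_def arrow_iff by (intro exI[of _ 0]) simp

text \<open>With exponents \<open>(a, b)\<close> and \<open>(c, d)\<close> for the factors, the exponents \<open>(a + c, b + d)\<close>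
  serve for the product.\<close>

lemma mult_nhd:
  assumes "openin G W" "\<alpha> \<in> topspace G" "\<beta> \<in> topspace G" "src \<alpha> = rng \<beta>" "arrow_mult \<alpha> \<beta> \<in> W"
  obtains A B where "openin G A" "openin G B" "\<alpha> \<in> A" "\<beta> \<in> B"
    "\<And>\<alpha>' \<beta>'. \<alpha>' \<in> A \<Longrightarrow> \<beta>' \<in> B \<Longrightarrow> src \<alpha>' = rng \<beta>' \<Longrightarrow> arrow_mult \<alpha>' \<beta>' \<in> W"
proof -
  obtain x a b w where a: "\<alpha> = (x, nat_diff a b, w)" "T a x = T b w" using assms(2) arrowE by metis
  obtain w' c d y where b: "\<beta> = (w', nat_diff c d, y)" "T c w' = T d y" using assms(3) arrowE by metis
  have comp: "T (a + c) x = T (b + d) y" if "T a x = T b w" "T c w = T d y" for x w y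
    using that by (metis T_add add.commute)
  have W: "(x, nat_diff (a + c) (b + d), y) \<in> W" "T (a + c) x = T (b + d) y"
    using a b assms(4,5) comp by (simp_all add: nat_diff_add)
  obtain U V where U: "open U" "open V" "x \<in> U" "y \<in> V" "Z U (a + c) (b + d) V \<subseteq> W"
    using basic_nhd[OF assms(1) W] by metis
  show ?thesis
  proof (rule that[of "Z U a b UNIV" "Z UNIV c d V"])
    show "openin G (Z U a b UNIV)" "openin G (Z UNIV c d V)" using U by (simp_all add: openin_Z)
    show "\<alpha> \<in> Z U a b UNIV" "\<beta> \<in> Z UNIV c d V" using a b U by (simp_all add: mem_Z)
    fix \<alpha>' \<beta>' assume *: "\<alpha>' \<in> Z U a b UNIV" "\<beta>' \<in> Z UNIV c d V" "src \<alpha>' = rng \<beta>'"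
    obtain x' m w' y' n where e: "\<alpha>' = (x', m, w')" "\<beta>' = (w', n, y')"
      using *(3) by (cases \<alpha>'; cases \<beta>') auto
    have "arrow_mult \<alpha>' \<beta>' \<in> Z U (a + c) (b + d) V"
      using * comp[of x' w' y'] by (simp add: e mem_Z nat_diff_add)
    then show "arrow_mult \<alpha>' \<beta>' \<in> W" using U by blast
  qed
qed

lemma continuous_inv: "continuous_map G G arrow_inv"
  unfolding continuous_map
proof (intro conjI allI impI)
  show "arrow_inv ` topspace G \<subseteq> topspace G" using inv_topspace by blast
  fix W assume W: "openin G W"
  show "openin G {\<gamma> \<in> topspace G. arrow_inv \<gamma> \<in> W}"
  proof (rule openin_GI)
    fix x p q y assume *: "(x, nat_diff p q, y) \<in> {\<gamma> \<in> topspace G. arrow_inv \<gamma> \<in> W}" "T p x = T q y"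
    then have "(y, nat_diff q p, x) \<in> W" by (simp add: nat_diff_minus)
    from basic_nhd[OF W this *(2)[symmetric]] obtain V U where
      U: "open V" "open U" "y \<in> V" "x \<in> U" "Z V q p U \<subseteq> W" by metis
    have "Z U p q V \<subseteq> {\<gamma> \<in> topspace G. arrow_inv \<gamma> \<in> W}"
    proof
      fix \<gamma> assume g: "\<gamma> \<in> Z U p q V"
      then have "arrow_inv \<gamma> \<in> Z V q p U" by (auto simp: DR_basic_def nat_diff_minus)
      then show "\<gamma> \<in> {\<gamma> \<in> topspace G. arrow_inv \<gamma> \<in> W}" using g U(5) Z_subset by blast
    qed
    then show "\<exists>U V. open U \<and> open V \<and> x \<in> U \<and> y \<in> V \<and> Z U p q V \<subseteq> {\<gamma> \<in> topspace G. arrow_inv \<gamma> \<in> W}"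
      using U by blast
  qed auto
qed

lemma openin_inv_image:
  assumes "openin G W" shows "openin G (arrow_inv ` W)"
proof -
  have "arrow_inv ` W = {\<gamma> \<in> topspace G. arrow_inv \<gamma> \<in> W}"
    using openin_subset[OF assms] inv_topspace by (auto simp: mem_inv_image)
  then show ?thesis using openin_continuous_map_preimage[OF continuous_inv assms] by simp
qed

lemma bis_inv: "bis D \<Longrightarrow> bis (arrow_inv ` D)"
  unfolding bis_def
  by (auto simp: openin_inv_image inj_on_def)

text \<open>The arrow of \<open>D\<close> with source \<open>x\<close>, arbitrary unless \<open>x\<close> is in \<open>src ` D\<close>.\<close>

definition sec :: "('x, 'k) arrow set \<Rightarrow> 'x \<Rightarrow> ('x, 'k) arrow" where
  "sec D x = (THE \<alpha>. \<alpha> \<in> D \<and> src \<alpha> = x)"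

lemma sec_eq: "bis D \<Longrightarrow> \<alpha> \<in> D \<Longrightarrow> sec D (src \<alpha>) = \<alpha>"
  unfolding sec_def by (rule the_equality) (auto intro: bis_src_eq)

lemma sec_mem: "bis D \<Longrightarrow> x \<in> src ` D \<Longrightarrow> sec D x \<in> D" "bis D \<Longrightarrow> x \<in> src ` D \<Longrightarrow> src (sec D x) = x"
  using sec_eq by auto

definition left_dom :: "('x, 'k) arrow set \<Rightarrow> ('x, 'k) arrow set" where
  "left_dom D = {\<beta> \<in> topspace G. rng \<beta> \<in> src ` D}"

lemma openin_left_dom: "bis D \<Longrightarrow> openin G (left_dom D)"
  using open_rng_src_preimage[of "src ` D" UNIV UNIV] open_src_image[of D]
  by (simp add: left_dom_def bis_def)

lemma continuous_sec:
  assumes "bis D"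
  shows "continuous_map (subtopology G (left_dom D)) G (\<lambda>\<beta>. sec D (rng \<beta>))"
  unfolding continuous_map
proof (intro conjI allI impI)
  have D: "openin G D" using assms by (simp add: bis_def)
  have ts: "topspace (subtopology G (left_dom D)) = left_dom D" by (auto simp: left_dom_def)
  show "(\<lambda>\<beta>. sec D (rng \<beta>)) ` topspace (subtopology G (left_dom D)) \<subseteq> topspace G"
    unfolding ts
  proof (rule image_subsetI)
    fix \<beta> assume "\<beta> \<in> left_dom D"
    then show "sec D (rng \<beta>) \<in> topspace G"
      using sec_mem(1)[OF assms] bis_subset[OF assms] unfolding left_dom_def by blast
  qed
  fix W assume W: "openin G W"
  have "{\<beta> \<in> left_dom D. sec D (rng \<beta>) \<in> W} = {\<beta> \<in> topspace G. rng \<beta> \<in> src ` (D \<inter> W)}"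
  proof (intro equalityI subsetI)
    fix \<beta> assume "\<beta> \<in> {\<beta> \<in> left_dom D. sec D (rng \<beta>) \<in> W}"
    then show "\<beta> \<in> {\<beta> \<in> topspace G. rng \<beta> \<in> src ` (D \<inter> W)}"
      using sec_mem[OF assms, of "rng \<beta>"] by (force simp: left_dom_def)
  next
    fix \<beta> assume "\<beta> \<in> {\<beta> \<in> topspace G. rng \<beta> \<in> src ` (D \<inter> W)}"
    then show "\<beta> \<in> {\<beta> \<in> left_dom D. sec D (rng \<beta>) \<in> W}"
      using sec_eq[OF assms] by (auto simp: left_dom_def)
  qed
  moreover have "openin G {\<beta> \<in> topspace G. rng \<beta> \<in> src ` (D \<inter> W)}"
    using open_rng_src_preimage[of "src ` (D \<inter> W)" UNIV UNIV] open_src_image[of "D \<inter> W"] D W by auto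
  ultimately show "openin (subtopology G (left_dom D))
      {\<beta> \<in> topspace (subtopology G (left_dom D)). sec D (rng \<beta>) \<in> W}"
    unfolding ts by (simp add: openin_open_subtopology openin_left_dom[OF assms]) (auto simp: left_dom_def)
qed

text \<open>An open bisection acts on the groupoid by left multiplication.\<close>

lemma continuous_left_mult:
  assumes "bis D"
  shows "continuous_map (subtopology G (left_dom D)) G (\<lambda>\<beta>. arrow_mult (sec D (rng \<beta>)) \<beta>)"
  unfolding continuous_map
proof (intro conjI allI impI)
  have ts: "topspace (subtopology G (left_dom D)) = left_dom D" by (auto simp: left_dom_def)
  note sm = sec_mem[OF assms]
  have DG: "D \<subseteq> topspace G" by (rule bis_subset[OF assms])
  show "(\<lambda>\<beta>. arrow_mult (sec D (rng \<beta>)) \<beta>) ` topspace (subtopology G (left_dom D)) \<subseteq> topspace G"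
    unfolding ts
  proof (rule image_subsetI)
    fix \<beta> assume "\<beta> \<in> left_dom D"
    then have "\<beta> \<in> topspace G" "rng \<beta> \<in> src ` D" by (simp_all add: left_dom_def)
    then show "arrow_mult (sec D (rng \<beta>)) \<beta> \<in> topspace G"
      using sm DG by (intro mult_topspace) blast+
  qed
  fix W assume W: "openin G W"
  let ?P = "{\<beta> \<in> left_dom D. arrow_mult (sec D (rng \<beta>)) \<beta> \<in> W}"
  have "openin G ?P"
  proof (subst openin_subopen, intro ballI)
    fix \<beta> assume "\<beta> \<in> ?P"
    then have b: "\<beta> \<in> topspace G" "rng \<beta> \<in> src ` D" "arrow_mult (sec D (rng \<beta>)) \<beta> \<in> W"
      by (auto simp: left_dom_def)
    let ?a = "sec D (rng \<beta>)"
    have a: "?a \<in> D" "src ?a = rng \<beta>" using sm b by auto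
    have aG: "?a \<in> topspace G" using a(1) DG by blast
    obtain A B where A: "openin G A" "openin G B" "?a \<in> A" "\<beta> \<in> B"
      "\<And>\<alpha>' \<beta>'. \<alpha>' \<in> A \<Longrightarrow> \<beta>' \<in> B \<Longrightarrow> src \<alpha>' = rng \<beta>' \<Longrightarrow> arrow_mult \<alpha>' \<beta>' \<in> W"
      by (rule mult_nhd[OF W aG b(1) a(2) b(3)]) (rule that, assumption+)
    let ?S = "B \<inter> {\<beta> \<in> topspace G. rng \<beta> \<in> src ` (D \<inter> A)}"
    have "open (src ` (D \<inter> A))" using open_src_image[of "D \<inter> A"] A(1) assms by (simp add: bis_def openin_Int)
    then have "openin G ?S" using open_rng_src_preimage[of "src ` (D \<inter> A)" UNIV UNIV] A(2) by auto
    moreover have "rng \<beta> \<in> src ` (D \<inter> A)" using A(3) a by (metis IntI imageI)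
    then have "\<beta> \<in> ?S" using A(4) b(1) by blast
    moreover have "?S \<subseteq> ?P"
    proof
      fix \<beta>' assume s: "\<beta>' \<in> ?S"
      then obtain \<alpha>' where "\<alpha>' \<in> D" "\<alpha>' \<in> A" "rng \<beta>' = src \<alpha>'" by auto
      then show "\<beta>' \<in> ?P" using sec_eq[OF assms, of \<alpha>'] A(5)[of \<alpha>' \<beta>'] s by (auto simp: left_dom_def)
    qed
    ultimately show "\<exists>S. openin G S \<and> \<beta> \<in> S \<and> S \<subseteq> ?P" by blast
  qed
  then show "openin (subtopology G (left_dom D))
      {\<beta> \<in> topspace (subtopology G (left_dom D)). arrow_mult (sec D (rng \<beta>)) \<beta> \<in> W}"
    unfolding ts by (simp add: openin_open_subtopology openin_left_dom[OF assms])
qed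

abbreviation conv where "conv \<equiv> sa_mult (convolution_algebra G)"
abbreviation star where "star \<equiv> sa_star (convolution_algebra G)"

lemma convolution_algebra_simps [simp]:
  "sa_add (convolution_algebra G) f g = (\<lambda>\<gamma>. f \<gamma> + g \<gamma>)"
  "sa_scale (convolution_algebra G) c f = (\<lambda>\<gamma>. c * f \<gamma>)"
  "star f = (\<lambda>\<gamma>. cnj (f (arrow_inv \<gamma>)))"
  by (simp_all add: convolution_algebra_def)

lemma Cc_finite_rng: "f \<in> Cc \<Longrightarrow> finite {\<gamma>. f \<gamma> \<noteq> 0 \<and> rng \<gamma> = x}"
proof (induction f rule: Cc_induct)
  case (bis f)
  then obtain D where D: "bis D" "\<And>\<gamma>. f \<gamma> \<noteq> 0 \<Longrightarrow> \<gamma> \<in> D" unfolding bis_supported_def by blast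
  show ?case
  proof (cases "\<exists>\<alpha>. f \<alpha> \<noteq> 0 \<and> rng \<alpha> = x")
    case True
    then obtain \<alpha> where "f \<alpha> \<noteq> 0" "rng \<alpha> = x" by blast
    then have "{\<gamma>. f \<gamma> \<noteq> 0 \<and> rng \<gamma> = x} \<subseteq> {\<alpha>}" using bis_rng_eq[OF D(1)] D(2) by blast
    then show ?thesis by (rule finite_subset) simp
  next
    case False then have "{\<gamma>. f \<gamma> \<noteq> 0 \<and> rng \<gamma> = x} = {}" by blast
    then show ?thesis by (metis finite.emptyI)
  qed
next
  case (add f g)
  have "{\<gamma>. f \<gamma> + g \<gamma> \<noteq> 0 \<and> rng \<gamma> = x} \<subseteq> {\<gamma>. f \<gamma> \<noteq> 0 \<and> rng \<gamma> = x} \<union> {\<gamma>. g \<gamma> \<noteq> 0 \<and> rng \<gamma> = x}" by auto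
  then show ?case by (rule finite_subset) (use add in simp)
qed

lemma conv_unfold: "conv f g \<gamma> = (\<Sum>\<^sub>\<infinity>(\<alpha>, \<beta>) \<in> {(\<alpha>, \<beta>). \<alpha> \<in> topspace G \<and> \<beta> \<in> topspace G \<and>
    src \<alpha> = rng \<beta> \<and> arrow_mult \<alpha> \<beta> = \<gamma>}. f \<alpha> * g \<beta>)"
  by (simp add: convolution_algebra_def)

lemma conv_outside: "\<gamma> \<notin> topspace G \<Longrightarrow> conv f g \<gamma> = 0"
proof -
  assume g: "\<gamma> \<notin> topspace G"
  have e: "{(\<alpha>, \<beta>). \<alpha> \<in> topspace G \<and> \<beta> \<in> topspace G \<and> src \<alpha> = rng \<beta> \<and> arrow_mult \<alpha> \<beta> = \<gamma>} = {}"
    using g mult_topspace by blast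
  show ?thesis unfolding conv_unfold e by (rule infsum_empty)
qed

text \<open>A factorisation \<open>\<gamma> = \<alpha> \<beta>\<close> is determined by \<open>\<alpha>\<close>, so the sum over
  factorisations runs over the finitely many arrows of the support with the range of \<open>\<gamma>\<close>.\<close>

lemma conv_eq:
  assumes f: "f \<in> Cc" and \<gamma>: "\<gamma> \<in> topspace G"
    and F: "finite F" "{\<alpha>. f \<alpha> \<noteq> 0 \<and> rng \<alpha> = rng \<gamma>} \<subseteq> F" "F \<subseteq> {\<alpha>. rng \<alpha> = rng \<gamma>}"
  shows "conv f g \<gamma> = (\<Sum>\<alpha>\<in>F. f \<alpha> * g (arrow_mult (arrow_inv \<alpha>) \<gamma>))"
proof -
  let ?P = "{(\<alpha>, \<beta>). \<alpha> \<in> topspace G \<and> \<beta> \<in> topspace G \<and> src \<alpha> = rng \<beta> \<and> arrow_mult \<alpha> \<beta> = \<gamma>}"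
  let ?A = "{\<alpha> \<in> topspace G. rng \<alpha> = rng \<gamma>}"
  have bij: "bij_betw (\<lambda>\<alpha>. (\<alpha>, arrow_mult (arrow_inv \<alpha>) \<gamma>)) ?A ?P"
  proof (rule bij_betwI[where g=fst])
    show "(\<lambda>\<alpha>. (\<alpha>, arrow_mult (arrow_inv \<alpha>) \<gamma>)) \<in> ?A \<rightarrow> ?P"
      using \<gamma> by (auto intro!: mult_topspace inv_topspace arrow_eqI)
    show "fst \<in> ?P \<rightarrow> ?A" by auto
    show "(fst p, arrow_mult (arrow_inv (fst p)) \<gamma>) = p" if "p \<in> ?P" for p
      using that by (auto intro!: arrow_eqI)
  qed simp
  have "conv f g \<gamma> = (\<Sum>\<^sub>\<infinity>(\<alpha>, \<beta>)\<in>?P. f \<alpha> * g \<beta>)" by (rule conv_unfold)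
  also have "\<dots> = (\<Sum>\<^sub>\<infinity>\<alpha>\<in>?A. f \<alpha> * g (arrow_mult (arrow_inv \<alpha>) \<gamma>))"
    using infsum_reindex_bij_betw[OF bij, of "\<lambda>(\<alpha>, \<beta>). f \<alpha> * g \<beta>"] by simp
  also have "\<dots> = (\<Sum>\<^sub>\<infinity>\<alpha>\<in>F. f \<alpha> * g (arrow_mult (arrow_inv \<alpha>) \<gamma>))"
  proof (rule infsum_cong_neutral)
    show "f \<alpha> * g (arrow_mult (arrow_inv \<alpha>) \<gamma>) = 0" if "\<alpha> \<in> F - ?A" for \<alpha>
      using that F(3) Cc_outside[OF f, of \<alpha>] by fastforce
    show "f \<alpha> * g (arrow_mult (arrow_inv \<alpha>) \<gamma>) = 0" if "\<alpha> \<in> ?A - F" for \<alpha>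
      using that F(2) by fastforce
  qed simp
  also have "\<dots> = (\<Sum>\<alpha>\<in>F. f \<alpha> * g (arrow_mult (arrow_inv \<alpha>) \<gamma>))" using F by simp
  finally show ?thesis .
qed

lemma conv_add_left:
  assumes "f \<in> Cc" "f' \<in> Cc"
  shows "conv (\<lambda>\<gamma>. f \<gamma> + f' \<gamma>) g = (\<lambda>\<gamma>. conv f g \<gamma> + conv f' g \<gamma>)"
proof
  fix \<gamma> show "conv (\<lambda>\<gamma>. f \<gamma> + f' \<gamma>) g \<gamma> = conv f g \<gamma> + conv f' g \<gamma>"
  proof (cases "\<gamma> \<in> topspace G")
    case True
    let ?F = "{\<alpha>. f \<alpha> \<noteq> 0 \<and> rng \<alpha> = rng \<gamma>} \<union> {\<alpha>. f' \<alpha> \<noteq> 0 \<and> rng \<alpha> = rng \<gamma>}"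
    have F: "finite ?F" using Cc_finite_rng[OF assms(1)] Cc_finite_rng[OF assms(2)] by simp
    have s: "{\<alpha>. f \<alpha> + f' \<alpha> \<noteq> 0 \<and> rng \<alpha> = rng \<gamma>} \<subseteq> ?F" "?F \<subseteq> {\<alpha>. rng \<alpha> = rng \<gamma>}" by auto
    show ?thesis
      unfolding conv_eq[OF Cc_add[OF assms] True F s] conv_eq[OF assms(1) True F Un_upper1 s(2)]
        conv_eq[OF assms(2) True F Un_upper2 s(2)]
      by (simp add: distrib_right sum.distrib)
  qed (simp add: conv_outside)
qed

lemma conv_bis:
  assumes f: "f \<in> Cc" and D: "bis D" "\<And>\<gamma>. f \<gamma> \<noteq> 0 \<Longrightarrow> \<gamma> \<in> D" and "\<alpha> \<in> D" "\<gamma> \<in> topspace G" "rng \<alpha> = rng \<gamma>"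
  shows "conv f g \<gamma> = f \<alpha> * g (arrow_mult (arrow_inv \<alpha>) \<gamma>)"
proof -
  have "{\<beta>. f \<beta> \<noteq> 0 \<and> rng \<beta> = rng \<gamma>} \<subseteq> {\<alpha>}"
  proof
    fix \<beta> assume "\<beta> \<in> {\<beta>. f \<beta> \<noteq> 0 \<and> rng \<beta> = rng \<gamma>}"
    then have "\<beta> \<in> D" "rng \<beta> = rng \<alpha>" using D(2) assms(6) by simp_all
    then show "\<beta> \<in> {\<alpha>}" using bis_rng_eq[OF D(1) _ assms(4)] by simp
  qed
  then show ?thesis using conv_eq[OF f assms(5), of "{\<alpha>}" g] assms(6) by simp
qed

lemma conv_bis_0:
  assumes f: "f \<in> Cc" and "\<And>\<alpha>. f \<alpha> \<noteq> 0 \<Longrightarrow> rng \<alpha> \<noteq> rng \<gamma>"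
  shows "conv f g \<gamma> = 0"
proof (cases "\<gamma> \<in> topspace G")
  case True
  have "{\<alpha>. f \<alpha> \<noteq> 0 \<and> rng \<alpha> = rng \<gamma>} \<subseteq> {}" using assms(2) by blast
  from conv_eq[OF f True _ this, of g] show ?thesis by simp
qed (simp add: conv_outside)

text \<open>Convolution with a function supported in a bisection \<open>D\<close> multiplies by a continuous function and
  translates by the inverse of \<open>D\<close>. Away from the range of the support the result vanishes; the two
  descriptions cover \<open>G\<close> by open sets.\<close>

lemma conv_closed_bis:
  assumes "bis_supported f" "g \<in> Cc"
  shows "conv f g \<in> Cc"
proof -
  obtain D K where D: "bis D" "compactin G K" "K \<subseteq> D" "\<And>\<gamma>. f \<gamma> \<noteq> 0 \<Longrightarrow> \<gamma> \<in> K" and f: "f \<in> Cc"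
    using assms(1) unfolding bis_supported_def by blast
  obtain L where L: "compactin G L" "\<And>\<gamma>. g \<gamma> \<noteq> 0 \<Longrightarrow> \<gamma> \<in> L" using assms(2) unfolding Cc_iff by blast
  have fD: "f \<gamma> \<noteq> 0 \<Longrightarrow> \<gamma> \<in> D" for \<gamma> using D by blast
  let ?D' = "arrow_inv ` D"
  note D' = bis_inv[OF D(1)]
  let ?O1 = "left_dom ?D'" and ?O2 = "{\<gamma> \<in> topspace G. rng \<gamma> \<in> - (rng ` K)}"
  have "closed (rng ` K)" using image_compactin[OF D(2) continuous_rng] by (simp add: compact_imp_closed)
  then have O2: "openin G ?O2" using open_rng_src_preimage[of "- (rng ` K)" UNIV UNIV] by (simp only: open_Compl open_UNIV) simp
  have ts: "topspace (subtopology G ?O1) = ?O1" by (auto simp: left_dom_def)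
  have c1: "continuous_map (subtopology G ?O1) euclidean (conv f g)"
  proof -
    have 1: "continuous_map (subtopology G ?O1) euclidean (\<lambda>\<gamma>. f (arrow_inv (sec ?D' (rng \<gamma>))))"
      using continuous_map_compose[OF continuous_map_compose[OF continuous_sec[OF D'] continuous_inv] Cc_continuous[OF f]]
      by (simp add: o_def)
    have 2: "continuous_map (subtopology G ?O1) euclidean (\<lambda>\<gamma>. g (arrow_mult (sec ?D' (rng \<gamma>)) \<gamma>))"
      using continuous_map_compose[OF continuous_left_mult[OF D'] Cc_continuous[OF assms(2)]]
      by (simp add: o_def)
    have "continuous_map (subtopology G ?O1) euclidean
        (\<lambda>\<gamma>. f (arrow_inv (sec ?D' (rng \<gamma>))) * g (arrow_mult (sec ?D' (rng \<gamma>)) \<gamma>))"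
      by (rule continuous_map_binop[OF 1 2, where h="(*)"]) (auto simp: case_prod_beta intro!: continuous_intros)
    then show ?thesis
    proof (rule continuous_map_eq)
      fix \<gamma> assume "\<gamma> \<in> topspace (subtopology G ?O1)"
      then have g: "\<gamma> \<in> topspace G" "rng \<gamma> \<in> src ` ?D'" unfolding ts by (auto simp: left_dom_def)
      let ?a = "arrow_inv (sec ?D' (rng \<gamma>))"
      have "?a \<in> D" "rng ?a = rng \<gamma>" using sec_mem[OF D' g(2)] by (simp_all add: mem_inv_image)
      then show "f ?a * g (arrow_mult (sec ?D' (rng \<gamma>)) \<gamma>) = conv f g \<gamma>"
        using conv_bis[OF f D(1) fD _ g(1), of ?a g] by simp
    qed
  qed
  have c2: "continuous_map (subtopology G ?O2) euclidean (conv f g)"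
  proof (rule continuous_map_eq[where f="\<lambda>_. 0"])
    fix \<gamma> assume "\<gamma> \<in> topspace (subtopology G ?O2)"
    then have "rng \<gamma> \<notin> rng ` K" by auto
    then show "0 = conv f g \<gamma>" by (intro conv_bis_0[OF f, symmetric]) (metis D(4) imageI)
  qed simp
  have cont: "continuous_map G euclidean (conv f g)"
  proof (rule pasting_lemma[where I="{True, False}" and T="\<lambda>b. if b then ?O1 else ?O2" and f="\<lambda>_. conv f g"])
    show "openin G (if i then ?O1 else ?O2)" for i using O2 openin_left_dom[OF D'] by simp
    show "continuous_map (subtopology G (if i then ?O1 else ?O2)) euclidean (conv f g)" for i
      using c1 c2 by simp
    show "\<exists>j. j \<in> {True, False} \<and> \<gamma> \<in> (if j then ?O1 else ?O2) \<and> conv f g \<gamma> = conv f g \<gamma>"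
      if "\<gamma> \<in> topspace G" for \<gamma>
    proof (cases "rng \<gamma> \<in> rng ` K")
      case True
      then obtain \<alpha> where "\<alpha> \<in> K" "rng \<gamma> = src (arrow_inv \<alpha>)" by auto
      then have "rng \<gamma> \<in> src ` ?D'" using D(3) by blast
      then show ?thesis using that by (intro exI[of _ True]) (simp add: left_dom_def)
    next
      case False then show ?thesis using that by (intro exI[of _ False]) simp
    qed
  qed auto
  let ?L = "L \<inter> {\<beta> \<in> topspace G. rng \<beta> \<in> src ` K}"
  have "closed (src ` K)" using image_compactin[OF D(2) continuous_src] by (simp add: compact_imp_closed)
  then have "closedin G {\<beta> \<in> topspace G. rng \<beta> \<in> src ` K}"
    using closedin_continuous_map_preimage[OF continuous_rng] by simp
  then have Lc: "compactin G ?L" using L(1) by (rule compact_Int_closedin[rotated])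
  have "?L \<subseteq> left_dom D" using D(3) by (auto simp: left_dom_def)
  then have "compactin (subtopology G (left_dom D)) ?L"
    unfolding compactin_subtopology using Lc by blast
  from image_compactin[OF this continuous_left_mult[OF D(1)]]
  have M: "compactin G ((\<lambda>\<beta>. arrow_mult (sec D (rng \<beta>)) \<beta>) ` ?L)" .
  show ?thesis
  proof (rule CcI[OF cont M])
    fix \<gamma> assume nz: "conv f g \<gamma> \<noteq> 0"
    then have g: "\<gamma> \<in> topspace G" using conv_outside by blast
    obtain \<alpha> where a: "f \<alpha> \<noteq> 0" "rng \<alpha> = rng \<gamma>" using conv_bis_0[OF f] nz by blast
    then have aK: "\<alpha> \<in> K" "\<alpha> \<in> D" using D by blast+
    let ?b = "arrow_mult (arrow_inv \<alpha>) \<gamma>"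
    have "g ?b \<noteq> 0" using conv_bis[OF f D(1) fD aK(2) g a(2), of g] nz by auto
    then have "?b \<in> L" "?b \<in> topspace G" using L(2) Cc_outside[OF assms(2)] by blast+
    then have "?b \<in> ?L" using aK by auto
    moreover have "\<gamma> = arrow_mult (sec D (rng ?b)) ?b"
      using sec_eq[OF D(1) aK(2)] a by (auto intro!: arrow_eqI)
    ultimately show "\<gamma> \<in> (\<lambda>\<beta>. arrow_mult (sec D (rng \<beta>)) \<beta>) ` ?L" by blast
  qed
qed

lemma conv_closed: "f \<in> Cc \<Longrightarrow> g \<in> Cc \<Longrightarrow> conv f g \<in> Cc"
proof (induction f rule: Cc_induct)
  case (bis f) then show ?case by (rule conv_closed_bis)
next
  case (add f f') then show ?case using conv_add_left[OF add(1,2)] Cc_add by simp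
qed

lemma star_closed: 
  assumes f: "f \<in> Cc" shows "star f \<in> Cc"
proof -
  obtain K where K: "compactin G K" "\<forall>\<gamma>. f \<gamma> \<noteq> 0 \<longrightarrow> \<gamma> \<in> K" using f by (auto simp: Cc_iff)
  have "continuous_map G euclidean (\<lambda>\<gamma>. f (arrow_inv \<gamma>))"
    using continuous_map_compose[OF continuous_inv Cc_continuous[OF f]] by (simp add: o_def)
  from continuous_map_binop[OF this this, of "\<lambda>a b. cnj a"]
  have c: "continuous_map G euclidean (star f)"
    by (simp add: case_prod_beta continuous_intros)
  show ?thesis
    by (rule CcI[OF c image_compactin[OF K(1) continuous_inv]]) (use K(2) in \<open>auto simp: mem_inv_image\<close>)
qed

lemma conv_diagonal:
  assumes h: "h \<in> Cc" "diagonal h" and \<gamma>: "\<gamma> \<in> topspace G"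
  shows "conv h g \<gamma> = h (unit_arrow (rng \<gamma>)) * g \<gamma>"
proof -
  have s: "{\<alpha>. h \<alpha> \<noteq> 0 \<and> rng \<alpha> = rng \<gamma>} \<subseteq> {unit_arrow (rng \<gamma>)}"
  proof
    fix \<beta> assume b: "\<beta> \<in> {\<alpha>. h \<alpha> \<noteq> 0 \<and> rng \<alpha> = rng \<gamma>}"
    then have "\<beta> = unit_arrow (rng \<beta>)" using h(2) by blast
    then show "\<beta> \<in> {unit_arrow (rng \<gamma>)}" using b by simp
  qed
  have "arrow_mult (arrow_inv (unit_arrow (rng \<gamma>))) \<gamma> = \<gamma>"
    by (rule arrow_eqI) (simp_all add: unit_arrow_def)
  then show ?thesis using conv_eq[OF h(1) \<gamma> _ s, of g] by (simp add: unit_arrow_def)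
qed

lemma unit_arrow_simps [simp]:
  "rng (unit_arrow x) = x" "src (unit_arrow x) = x" "cocycle (unit_arrow x) = 0"
  "arrow_inv (unit_arrow x) = unit_arrow x"
  by (simp_all add: unit_arrow_def)

lemma star_diagonal_real:
  assumes "diagonal h" "\<And>\<gamma>. h \<gamma> \<in> \<real>"
  shows "star h = h"
proof
  fix \<gamma> :: "('x, 'k) arrow"
  show "star h \<gamma> = h \<gamma>"
  proof (cases "\<gamma> = unit_arrow (rng \<gamma>)")
    case True
    then have "arrow_inv \<gamma> = \<gamma>" by (metis unit_arrow_simps(4))
    then show ?thesis using assms(2)[of \<gamma>] by (simp add: Reals_cnj_iff)
  next
    case False
    have "arrow_inv \<gamma> \<noteq> unit_arrow (rng (arrow_inv \<gamma>))"
      using False by (metis arrow_inv_simps(1,2,4) unit_arrow_simps(1,4))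
    then have "h (arrow_inv \<gamma>) = 0" "h \<gamma> = 0" using False assms(1) by blast+
    then show ?thesis by simp
  qed
qed

text \<open>Nonnegative diagonal functions are squares, hence positive in every representation; applied to
  \<open>h (M - h)\<close> this bounds a diagonal function by its supremum, and applied to
  \<open>f\<^sup>* f\<close> it bounds functions supported in a bisection.\<close>

lemma diagonal_positive:
  assumes L: "star_representation (convolution_algebra G) S L"
    and h: "h \<in> Cc" "diagonal h" "\<And>\<gamma>. h \<gamma> = complex_of_real (r \<gamma>)" "\<And>\<gamma>. 0 \<le> r \<gamma>" and x: "\<xi> \<in> ell2 S"
  shows "0 \<le> Re (ell2_inner (L h \<xi>) \<xi>)"
proof -
  define k where "k \<gamma> = complex_of_real (sqrt (cmod (h \<gamma>)))" for \<gamma>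
  have "continuous_map G euclidean k"
    unfolding k_def using continuous_map_binop[OF Cc_continuous[OF h(1)] Cc_continuous[OF h(1)],
        of "\<lambda>a b. complex_of_real (sqrt (cmod a))"]
    by (simp add: case_prod_beta continuous_intros)
  moreover obtain K where "compactin G K" "\<forall>\<gamma>. h \<gamma> \<noteq> 0 \<longrightarrow> \<gamma> \<in> K" using h(1) by (auto simp: Cc_iff)
  ultimately have k: "k \<in> Cc" by (intro CcI[where K=K]) (auto simp: k_def)
  have kd: "diagonal k" using h(2) by (simp add: k_def del: split_paired_All)
  have ks: "star k = k" by (rule star_diagonal_real[OF kd]) (simp add: k_def)
  have kk: "conv k k = h"
  proof
    fix \<gamma> show "conv k k \<gamma> = h \<gamma>"
    proof (cases "\<gamma> = unit_arrow (rng \<gamma>)")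
      case True
      then have g: "\<gamma> \<in> topspace G" by (metis unit_topspace)
      have "conv k k \<gamma> = k \<gamma> * k \<gamma>" using conv_diagonal[OF k kd g, of k] True by simp
      also have "\<dots> = h \<gamma>" using h(4)[of \<gamma>] by (simp add: k_def h(3) flip: of_real_mult)
      finally show ?thesis .
    next
      case False
      then have "h \<gamma> = 0" "k \<gamma> = 0" using h(2) kd by blast+
      then show ?thesis using conv_diagonal[OF k kd, of \<gamma> k] conv_outside by (cases "\<gamma> \<in> topspace G") auto
    qed
  qed
  have kx: "L k \<xi> \<in> ell2 S" by (rule star_rep_mem[OF L k x])
  have "ell2_inner (L h \<xi>) \<xi> = ell2_inner (L k (L k \<xi>)) \<xi>"
    using star_rep_mult[OF L k k x] kk by simp
  also have "\<dots> = ell2_inner (L k \<xi>) (L k \<xi>)"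
    using star_rep_star'[OF L k kx x] unfolding ks .
  finally show ?thesis by (simp add: ell2_inner_self[OF kx])
qed

lemma diagonal_bound:
  assumes L: "star_representation (convolution_algebra G) S L"
    and h: "h \<in> Cc" "diagonal h" "\<And>\<gamma>. h \<gamma> = complex_of_real (r \<gamma>)" "\<And>\<gamma>. 0 \<le> r \<gamma>" "\<And>\<gamma>. r \<gamma> \<le> M"
    and x: "\<xi> \<in> ell2 S"
  shows "ell2_norm (L h \<xi>) \<le> M * ell2_norm \<xi>"
proof -
  let ?k = "\<lambda>\<gamma>. complex_of_real M * h \<gamma> + (-1) * (conv h h \<gamma>)"
  have hh: "conv h h \<in> Cc" by (rule conv_closed[OF h(1) h(1)])
  have k: "?k \<in> Cc" by (rule Cc_add[OF Cc_scale[OF h(1)] Cc_scale[OF hh]])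
  have M0: "0 \<le> M" using h(4)[of undefined] h(5)[of undefined] by linarith
  have cv: "conv h h \<gamma> = h \<gamma> * h \<gamma>" for \<gamma>
  proof (cases "\<gamma> \<in> topspace G")
    case True
    show ?thesis
    proof (cases "\<gamma> = unit_arrow (rng \<gamma>)")
      case False
      then have "h \<gamma> = 0" using h(2) by blast
      then show ?thesis using conv_diagonal[OF h(1,2) True, of h] by simp
    qed (use conv_diagonal[OF h(1,2) True, of h] in simp)
  next
    case False
    then show ?thesis using Cc_outside[OF h(1)] conv_outside by fastforce
  qed
  have "0 \<le> Re (ell2_inner (L ?k \<xi>) \<xi>)"
  proof (rule diagonal_positive[OF L k _ _ _ x])
    show "?k \<gamma> = complex_of_real (r \<gamma> * (M - r \<gamma>))" for \<gamma>
      by (simp add: cv h(3) algebra_simps)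
    show "diagonal ?k" using h(2) by (simp add: cv del: split_paired_All)
    show "0 \<le> r \<gamma> * (M - r \<gamma>)" for \<gamma> using h(4,5)[of \<gamma>] by simp
  qed
  moreover have "L ?k \<xi> = (\<lambda>i. complex_of_real M * L h \<xi> i + (-1) * L (conv h h) \<xi> i)"
    using star_rep_add[OF L, of "\<lambda>\<gamma>. complex_of_real M * h \<gamma>" "\<lambda>\<gamma>. (-1) * (conv h h \<gamma>)" \<xi>]
      star_rep_scale[OF L h(1) x, of "complex_of_real M"] star_rep_scale[OF L hh x, of "-1"]
      Cc_scale[OF h(1)] Cc_scale[OF hh, of "-1"] x by simp
  moreover have "ell2_inner (\<lambda>i. complex_of_real M * L h \<xi> i + (-1) * L (conv h h) \<xi> i) \<xi>
      = complex_of_real M * ell2_inner (L h \<xi>) \<xi> + (-1) * ell2_inner (L (conv h h) \<xi>) \<xi>"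
    unfolding ell2_inner_scale_left[symmetric]
    by (rule ell2_inner_add_left[OF ell2_scale[OF star_rep_mem[OF L h(1) x]]
          ell2_scale[OF star_rep_mem[OF L hh x]] x])
  moreover have "ell2_inner (L (conv h h) \<xi>) \<xi> = (ell2_norm (L h \<xi>))\<^sup>2"
  proof -
    have hx: "L h \<xi> \<in> ell2 S" by (rule star_rep_mem[OF L h(1) x])
    have hs: "star h = h" by (rule star_diagonal_real[OF h(2)]) (simp add: h(3))
    have "ell2_inner (L (conv h h) \<xi>) \<xi> = ell2_inner (L h (L h \<xi>)) \<xi>"
      using star_rep_mult[OF L h(1) h(1) x] by simp
    also have "\<dots> = ell2_inner (L h \<xi>) (L h \<xi>)" using star_rep_star'[OF L h(1) hx x] unfolding hs .
    finally show ?thesis by (simp add: ell2_inner_self[OF hx])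
  qed
  ultimately have "(ell2_norm (L h \<xi>))\<^sup>2 \<le> M * Re (ell2_inner (L h \<xi>) \<xi>)" by simp
  also have "\<dots> \<le> M * (ell2_norm (L h \<xi>) * ell2_norm \<xi>)"
    using ell2_Cauchy_Schwarz[OF star_rep_mem[OF L h(1) x] x] complex_Re_le_cmod order_trans M0
    by (intro mult_left_mono) blast+
  finally have "ell2_norm (L h \<xi>) * ell2_norm (L h \<xi>) \<le> (M * ell2_norm \<xi>) * ell2_norm (L h \<xi>)"
    by (simp add: power2_eq_square mult_ac)
  then show ?thesis using M0
    by (cases "ell2_norm (L h \<xi>) = 0") (auto simp: mult_le_cancel_right order_less_le)
qed

text \<open>For \<open>f\<close> supported in a bisection, \<open>f\<^sup>* f\<close> is the diagonal function
  \<open>\<bar>f\<bar>\<^sup>2\<close>, moved to the sources.\<close>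

lemma bis_supported_bound:
  assumes L: "star_representation (convolution_algebra G) S L"
    and f: "bis_supported f" "\<And>\<gamma>. cmod (f \<gamma>) \<le> M" and x: "\<xi> \<in> ell2 S"
  shows "ell2_norm (L f \<xi>) \<le> M * ell2_norm \<xi>"
proof -
  obtain D K where D: "bis D" "K \<subseteq> D" "\<And>\<gamma>. f \<gamma> \<noteq> 0 \<Longrightarrow> \<gamma> \<in> K" and fC: "f \<in> Cc"
    using f(1) unfolding bis_supported_def by blast
  have fD: "f \<gamma> \<noteq> 0 \<Longrightarrow> \<gamma> \<in> D" for \<gamma> using D by blast
  have M0: "0 \<le> M" using f(2)[of undefined] norm_ge_zero order_trans by blast
  note sC = star_closed[OF fC]
  have sD: "star f \<gamma> \<noteq> 0 \<Longrightarrow> \<gamma> \<in> arrow_inv ` D" for \<gamma> using fD by (auto simp: mem_inv_image)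
  let ?h = "conv (star f) f"
  have hC: "?h \<in> Cc" by (rule conv_closed[OF sC fC])
  define r where "r \<gamma> = Re (?h \<gamma>)" for \<gamma>
  have val: "\<exists>t. ?h \<gamma> = complex_of_real t \<and> 0 \<le> t \<and> t \<le> M\<^sup>2 \<and> (t \<noteq> 0 \<longrightarrow> \<gamma> = unit_arrow (rng \<gamma>))" for \<gamma>
  proof (cases "?h \<gamma> = 0")
    case False
    then have g: "\<gamma> \<in> topspace G" using conv_outside by blast
    obtain \<alpha> where a: "star f \<alpha> \<noteq> 0" "rng \<alpha> = rng \<gamma>" using conv_bis_0[OF sC] False by blast
    let ?b = "arrow_inv \<alpha>"
    have b: "?b \<in> D" using a(1) fD by auto
    have "?h \<gamma> = cnj (f ?b) * f (arrow_mult ?b \<gamma>)"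
      using conv_bis[OF sC bis_inv[OF D(1)] sD _ g a(2), of f] sD[OF a(1)] by simp
    with False have "f (arrow_mult ?b \<gamma>) \<noteq> 0" by auto
    then have "arrow_mult ?b \<gamma> \<in> D" by (rule fD)
    then have e: "arrow_mult ?b \<gamma> = ?b" by (rule bis_rng_eq[OF D(1) _ b]) simp
    have "src \<gamma> = rng \<gamma>" "cocycle \<gamma> = 0"
      using arg_cong[OF e, of src] arg_cong[OF e, of cocycle] a(2) by simp_all
    then have u: "\<gamma> = unit_arrow (rng \<gamma>)" by (intro arrow_eqI) simp_all
    have "?h \<gamma> = complex_of_real ((cmod (f ?b))\<^sup>2)"
      unfolding complex_norm_square
      using \<open>?h \<gamma> = cnj (f ?b) * f (arrow_mult ?b \<gamma>)\<close> e by (simp add: mult.commute)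
    moreover have "(cmod (f ?b))\<^sup>2 \<le> M\<^sup>2" using f(2) by (intro power_mono) auto
    ultimately show ?thesis using u by (intro exI[of _ "(cmod (f ?b))\<^sup>2"]) simp
  qed (intro exI[of _ 0], simp add: M0)
  have r: "?h \<gamma> = complex_of_real (r \<gamma>)" "0 \<le> r \<gamma>" "r \<gamma> \<le> M\<^sup>2" "?h \<gamma> \<noteq> 0 \<longrightarrow> \<gamma> = unit_arrow (rng \<gamma>)" for \<gamma>
    using val[of \<gamma>] unfolding r_def by auto
  have fx: "L f \<xi> \<in> ell2 S" by (rule star_rep_mem[OF L fC x])
  have hx: "L ?h \<xi> \<in> ell2 S" by (rule star_rep_mem[OF L hC x])
  have "ell2_inner (L f \<xi>) (L f \<xi>) = ell2_inner (L ?h \<xi>) \<xi>"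
    using star_rep_star[OF L fC fx x] star_rep_mult[OF L sC fC x] by simp
  then have "(ell2_norm (L f \<xi>))\<^sup>2 \<le> ell2_norm (L ?h \<xi>) * ell2_norm \<xi>"
    by (rule ell2_norm_sq_le_inner[OF fx hx _ x])
  also have "\<dots> \<le> M\<^sup>2 * ell2_norm \<xi> * ell2_norm \<xi>"
    by (intro mult_right_mono ell2_norm_nonneg diagonal_bound[OF L hC _ r(1) r(2) r(3) x]) (use r(4) in blast)+
  finally have "(ell2_norm (L f \<xi>))\<^sup>2 \<le> (M * ell2_norm \<xi>)\<^sup>2" by (simp add: power2_eq_square mult_ac)
  then show ?thesis by (rule power2_le_imp_le) (simp add: M0)
qed

lemma representations_bounded:
  assumes "f \<in> Cc"
  shows "\<exists>C. \<forall>(S :: 'i set) L. star_representation (convolution_algebra G) S L \<longrightarrow>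
          (\<forall>\<xi>\<in>ell2 S. ell2_norm (L f \<xi>) \<le> C * ell2_norm \<xi>)"
  using assms
proof (induction f rule: Cc_induct)
  case (bis f)
  obtain M where "\<And>\<gamma>. cmod (f \<gamma>) \<le> M" using Cc_bounded[OF bis_supported_Cc[OF bis]] by metis
  with bis_supported_bound[OF _ bis] show ?case by blast
next
  case (add f g)
  then obtain C D where
    C: "\<And>(S :: 'i set) L \<xi>. star_representation (convolution_algebra G) S L \<Longrightarrow> \<xi> \<in> ell2 S \<Longrightarrow> ell2_norm (L f \<xi>) \<le> C * ell2_norm \<xi>" and
    D: "\<And>(S :: 'i set) L \<xi>. star_representation (convolution_algebra G) S L \<Longrightarrow> \<xi> \<in> ell2 S \<Longrightarrow> ell2_norm (L g \<xi>) \<le> D * ell2_norm \<xi>"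
    by metis
  have "ell2_norm (L (\<lambda>\<gamma>. f \<gamma> + g \<gamma>) \<xi>) \<le> (C + D) * ell2_norm \<xi>"
    if L: "star_representation (convolution_algebra G) S L" and x: "\<xi> \<in> ell2 S" for S :: "'i set" and L \<xi>
    using star_rep_add[OF L add(1,2) x] C[OF L x] D[OF L x]
      ell2_add(2)[OF star_rep_mem[OF L add(1) x] star_rep_mem[OF L add(2) x]]
    by (simp add: distrib_right)
  then show ?case by blast
qed

end

sublocale DR \<subseteq> CA: pre_cstar "convolution_algebra G"
proof
  show "Cc \<noteq> {}" using Cc_zero by blast
qed (simp_all only: convolution_algebra_simps(1,2) Cc_add Cc_scale conv_closed star_closed representations_bounded)

section \<open>The representations on orbits\<close>

lemma torus_nonzero: "z \<in> torus \<Longrightarrow> z $ i \<noteq> 0"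
  by (auto simp: torus_def dest!: spec[of _ i])

lemma character_add: "z \<in> torus \<Longrightarrow> character z (m + n) = character z m * character z n"
  by (simp add: character_def torus_nonzero power_int_add prod.distrib)

lemma character_0 [simp]: "character z 0 = 1"
  by (simp add: character_def)

lemma norm_character [simp]: "z \<in> torus \<Longrightarrow> cmod (character z n) = 1"
  by (simp add: character_def torus_def norm_power_int prod_norm[symmetric])

lemma character_minus: "z \<in> torus \<Longrightarrow> character z (- n) = cnj (character z n)"
proof -
  assume z: "z \<in> torus"
  have "character z (- n) * character z n = 1" using character_add[OF z, of "- n" n] by simp
  moreover have "cnj (character z n) * character z n = 1"
    using complex_norm_square[of "character z n"] z by (simp add: mult.commute)
  moreover have "character z n \<noteq> 0" using norm_character[OF z, of n] by force
  ultimately show ?thesis by (metis mult_right_cancel)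
qed

lemma character_mult: "character (v * w) n = character v n * character w n"
  by (simp add: character_def power_int_mult_distrib prod.distrib)

lemma torus_mult: "v \<in> torus \<Longrightarrow> w \<in> torus \<Longrightarrow> v * w \<in> torus"
  by (simp add: torus_def norm_mult)

context DR
begin

text \<open>The formula of the representation attached to \<open>z\<close>, written for arbitrary vectors at once; the
  orbit enters only through the support of the vector.\<close>

definition R :: "complex^'k \<Rightarrow> (('x, 'k) arrow \<Rightarrow> complex) \<Rightarrow> ('x \<Rightarrow> complex) \<Rightarrow> 'x \<Rightarrow> complex" where
  "R z f \<xi> w = (\<Sum>\<gamma>\<in>{\<gamma>. f \<gamma> \<noteq> 0 \<and> rng \<gamma> = w}. character z (cocycle \<gamma>) * f \<gamma> * \<xi> (src \<gamma>))"

lemma R_eq: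
  assumes "f \<in> Cc" "finite F" "{\<gamma>. f \<gamma> \<noteq> 0 \<and> rng \<gamma> = w} \<subseteq> F" "F \<subseteq> {\<gamma>. rng \<gamma> = w}"
  shows "R z f \<xi> w = (\<Sum>\<gamma>\<in>F. character z (cocycle \<gamma>) * f \<gamma> * \<xi> (src \<gamma>))"
  unfolding R_def by (rule sum.mono_neutral_left) (use assms in auto)

lemma R_add:
  assumes "f \<in> Cc" "g \<in> Cc"
  shows "R z (\<lambda>\<gamma>. f \<gamma> + g \<gamma>) \<xi> = (\<lambda>w. R z f \<xi> w + R z g \<xi> w)"
proof
  fix w
  let ?F = "{\<alpha>. f \<alpha> \<noteq> 0 \<and> rng \<alpha> = w} \<union> {\<alpha>. g \<alpha> \<noteq> 0 \<and> rng \<alpha> = w}"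
  have F: "finite ?F" using Cc_finite_rng[OF assms(1)] Cc_finite_rng[OF assms(2)] by simp
  have s: "{\<alpha>. f \<alpha> + g \<alpha> \<noteq> 0 \<and> rng \<alpha> = w} \<subseteq> ?F" "?F \<subseteq> {\<alpha>. rng \<alpha> = w}" by auto
  show "R z (\<lambda>\<gamma>. f \<gamma> + g \<gamma>) \<xi> w = R z f \<xi> w + R z g \<xi> w"
    unfolding R_eq[OF Cc_add[OF assms] F s] R_eq[OF assms(1) F Un_upper1 s(2)]
      R_eq[OF assms(2) F Un_upper2 s(2)]
    by (simp add: distrib_left distrib_right sum.distrib)
qed

lemma R_scale: "f \<in> Cc \<Longrightarrow> R z (\<lambda>\<gamma>. c * f \<gamma>) \<xi> = (\<lambda>w. c * R z f \<xi> w)"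
proof
  fix w assume f: "f \<in> Cc"
  have "R z (\<lambda>\<gamma>. c * f \<gamma>) \<xi> w
      = (\<Sum>\<gamma>\<in>{\<gamma>. f \<gamma> \<noteq> 0 \<and> rng \<gamma> = w}. character z (cocycle \<gamma>) * (c * f \<gamma>) * \<xi> (src \<gamma>))"
    by (rule R_eq[OF Cc_scale[OF f] Cc_finite_rng[OF f]]) auto
  then show "R z (\<lambda>\<gamma>. c * f \<gamma>) \<xi> w = c * R z f \<xi> w"
    by (simp add: R_def sum_distrib_left mult_ac)
qed

lemma R_bis:
  assumes "f \<in> Cc" "bis D" "\<And>\<gamma>. f \<gamma> \<noteq> 0 \<Longrightarrow> \<gamma> \<in> D" "\<alpha> \<in> D" "rng \<alpha> = w"
  shows "R z f \<xi> w = character z (cocycle \<alpha>) * f \<alpha> * \<xi> (src \<alpha>)"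
proof -
  have "{\<gamma>. f \<gamma> \<noteq> 0 \<and> rng \<gamma> = w} \<subseteq> {\<alpha>}"
  proof
    fix \<beta> assume "\<beta> \<in> {\<beta>. f \<beta> \<noteq> 0 \<and> rng \<beta> = w}"
    then have "\<beta> \<in> D" "rng \<beta> = rng \<alpha>" using assms by simp_all
    then show "\<beta> \<in> {\<alpha>}" using bis_rng_eq[OF assms(2) _ assms(4)] by simp
  qed
  from R_eq[OF assms(1) _ this] assms(5) show ?thesis by simp
qed

lemma R_0: "(\<And>\<alpha>. f \<alpha> \<noteq> 0 \<Longrightarrow> rng \<alpha> \<noteq> w) \<Longrightarrow> R z f \<xi> w = 0"
proof -
  assume "\<And>\<alpha>. f \<alpha> \<noteq> 0 \<Longrightarrow> rng \<alpha> \<noteq> w"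
  then have "{\<gamma>. f \<gamma> \<noteq> 0 \<and> rng \<gamma> = w} = {}" by blast
  then show ?thesis unfolding R_def by (simp only: sum.empty)
qed

lemma orbit_iff: "w \<in> orbit G x \<longleftrightarrow> (\<exists>p q. T p w = T q x)"
proof
  assume "w \<in> orbit G x"
  then obtain \<gamma> where g: "\<gamma> \<in> topspace G" "src \<gamma> = x" "w = rng \<gamma>" by (auto simp: orbit_def)
  then show "\<exists>p q. T p w = T q x" by (metis arrowE arrow_simps(1,3))
next
  assume "\<exists>p q. T p w = T q x"
  then obtain p q where "T p w = T q x" by blast
  then have "(w, nat_diff p q, x) \<in> topspace G" by (auto simp: arrow_iff)
  then show "w \<in> orbit G x" unfolding orbit_def by force
qed

lemma orbit_self [simp]: "x \<in> orbit G x"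
  by (auto simp: orbit_iff)

lemma orbit_arrow:
  assumes "\<gamma> \<in> topspace G" shows "rng \<gamma> \<in> orbit G x \<longleftrightarrow> src \<gamma> \<in> orbit G x"
proof
  assume "src \<gamma> \<in> orbit G x"
  then obtain \<eta> where "\<eta> \<in> topspace G" "src \<eta> = x" "src \<gamma> = rng \<eta>" by (auto simp: orbit_def)
  then have "arrow_mult \<gamma> \<eta> \<in> topspace G" "src (arrow_mult \<gamma> \<eta>) = x" "rng (arrow_mult \<gamma> \<eta>) = rng \<gamma>"
    using mult_topspace[OF assms] by auto
  then show "rng \<gamma> \<in> orbit G x" unfolding orbit_def by (metis (mono_tags, lifting) imageI mem_Collect_eq)
next
  assume "rng \<gamma> \<in> orbit G x"
  then obtain \<eta> where "\<eta> \<in> topspace G" "src \<eta> = x" "rng \<gamma> = rng \<eta>" by (auto simp: orbit_def)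
  then have "arrow_mult (arrow_inv \<gamma>) \<eta> \<in> topspace G" "src (arrow_mult (arrow_inv \<gamma>) \<eta>) = x"
    "rng (arrow_mult (arrow_inv \<gamma>) \<eta>) = src \<gamma>"
    using mult_topspace[OF inv_topspace[OF assms]] by auto
  then show "src \<gamma> \<in> orbit G x" unfolding orbit_def by (metis (mono_tags, lifting) imageI mem_Collect_eq)
qed

lemma orbit_arrowE:
  assumes "w \<in> orbit G x" "y \<in> orbit G x"
  obtains \<gamma> where "\<gamma> \<in> topspace G" "rng \<gamma> = w" "src \<gamma> = y"
proof -
  obtain \<alpha> \<beta> where a: "\<alpha> \<in> topspace G" "src \<alpha> = x" "rng \<alpha> = w" "\<beta> \<in> topspace G" "src \<beta> = x" "rng \<beta> = y"
    using assms by (auto simp: orbit_def)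
  show ?thesis
    by (rule that[of "arrow_mult \<alpha> (arrow_inv \<beta>)"]) (use a in \<open>simp_all add: mult_topspace inv_topspace\<close>)
qed

context
  fixes z :: "complex^'k" and x :: 'x
  assumes z: "z \<in> torus"
begin

abbreviation (input) O' where "O' \<equiv> orbit G x"

text \<open>On a bisection, \<open>R z f\<close> permutes coordinates along the injective map from ranges to sources and
  multiplies them by numbers of modulus at most \<open>M\<close>.\<close>

lemma R_bis_bound:
  assumes f: "bis_supported f" "\<And>\<gamma>. cmod (f \<gamma>) \<le> M" and x: "\<xi> \<in> ell2 O'"
  shows "R z f \<xi> \<in> ell2 O'" "ell2_norm (R z f \<xi>) \<le> M * ell2_norm \<xi>"
proof -
  obtain D K where D: "bis D" "K \<subseteq> D" "\<And>\<gamma>. f \<gamma> \<noteq> 0 \<Longrightarrow> \<gamma> \<in> K" and fC: "f \<in> Cc"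
    using f(1) unfolding bis_supported_def by blast
  have fD: "f \<gamma> \<noteq> 0 \<Longrightarrow> \<gamma> \<in> D" for \<gamma> using D by blast
  have M0: "0 \<le> M" using f(2)[of undefined] norm_ge_zero order_trans by blast
  have out: "R z f \<xi> w = 0" if "w \<notin> O'" for w
  proof -
    have "\<xi> (src \<gamma>) = 0" if "f \<gamma> \<noteq> 0" "rng \<gamma> = w" for \<gamma>
      using orbit_arrow[OF Cc_outside[OF fC that(1)], of x] that(2) \<open>w \<notin> O'\<close> ell2_outside[OF x] by metis
    then show ?thesis unfolding R_def by (intro sum.neutral) auto
  qed
  have b: "L2_set (\<lambda>w. cmod (R z f \<xi> w)) F \<le> M * ell2_norm \<xi>" if F: "finite F" for F
  proof -
    let ?H = "{\<gamma> \<in> D. rng \<gamma> \<in> F}"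
    have rH: "inj_on rng ?H" "inj_on src ?H" using D(1) by (auto simp: bis_def intro: inj_on_subset)
    have "finite (rng ` ?H)" using F by (rule finite_subset[rotated]) auto
    then have H: "finite ?H" using rH(1) by (rule finite_imageD)
    have "(\<Sum>w\<in>F. (cmod (R z f \<xi> w))\<^sup>2) = (\<Sum>w\<in>rng ` ?H. (cmod (R z f \<xi> w))\<^sup>2)"
    proof (rule sum.mono_neutral_right[OF F])
      show "rng ` ?H \<subseteq> F" by auto
      show "\<forall>w\<in>F - rng ` ?H. (cmod (R z f \<xi> w))\<^sup>2 = 0"
      proof
        fix w assume w: "w \<in> F - rng ` ?H"
        have "R z f \<xi> w = 0" by (rule R_0) (use w fD in blast)
        then show "(cmod (R z f \<xi> w))\<^sup>2 = 0" by simp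
      qed
    qed
    also have "\<dots> = (\<Sum>\<gamma>\<in>?H. (cmod (R z f \<xi> (rng \<gamma>)))\<^sup>2)" by (simp add: sum.reindex[OF rH(1)])
    also have "\<dots> \<le> (\<Sum>\<gamma>\<in>?H. M\<^sup>2 * (cmod (\<xi> (src \<gamma>)))\<^sup>2)"
    proof (rule sum_mono)
      fix \<gamma> assume "\<gamma> \<in> ?H"
      then have "R z f \<xi> (rng \<gamma>) = character z (cocycle \<gamma>) * f \<gamma> * \<xi> (src \<gamma>)"
        using R_bis[OF fC D(1) fD] by simp
      then have "cmod (R z f \<xi> (rng \<gamma>)) = cmod (f \<gamma>) * cmod (\<xi> (src \<gamma>))" using z by (simp add: norm_mult)
      moreover have "(cmod (f \<gamma>))\<^sup>2 \<le> M\<^sup>2" using f(2) by (intro power_mono) auto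
      ultimately show "(cmod (R z f \<xi> (rng \<gamma>)))\<^sup>2 \<le> M\<^sup>2 * (cmod (\<xi> (src \<gamma>)))\<^sup>2"
        by (simp add: power_mult_distrib mult_right_mono)
    qed
    also have "\<dots> = M\<^sup>2 * (\<Sum>y\<in>src ` ?H. (cmod (\<xi> y))\<^sup>2)"
      by (simp add: sum.reindex[OF rH(2)] sum_distrib_left)
    finally have "L2_set (\<lambda>w. cmod (R z f \<xi> w)) F \<le> sqrt (M\<^sup>2 * (\<Sum>y\<in>src ` ?H. (cmod (\<xi> y))\<^sup>2))"
      unfolding L2_set_def by (rule real_sqrt_le_mono)
    also have "\<dots> = M * L2_set (\<lambda>y. cmod (\<xi> y)) (src ` ?H)" using M0 by (simp add: L2_set_def real_sqrt_mult)
    also have "\<dots> \<le> M * ell2_norm \<xi>"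
      using M0 H by (intro mult_left_mono L2_set_le_ell2_norm[OF x]) auto
    finally show ?thesis .
  qed
  show "R z f \<xi> \<in> ell2 O'" "ell2_norm (R z f \<xi>) \<le> M * ell2_norm \<xi>"
    using ell2_normI[of O' "R z f \<xi>", OF out b] by auto
qed

lemma R_bounded:
  assumes "f \<in> Cc"
  shows "\<exists>C. \<forall>\<xi>\<in>ell2 O'. R z f \<xi> \<in> ell2 O' \<and> ell2_norm (R z f \<xi>) \<le> C * ell2_norm \<xi>"
  using assms
proof (induction f rule: Cc_induct)
  case (bis f)
  obtain M where "\<And>\<gamma>. cmod (f \<gamma>) \<le> M" using Cc_bounded[OF bis_supported_Cc[OF bis]] by metis
  with R_bis_bound[OF bis] show ?case by blast
next
  case (add f g)
  then obtain C D where
    C: "\<And>\<xi>. \<xi> \<in> ell2 O' \<Longrightarrow> R z f \<xi> \<in> ell2 O' \<and> ell2_norm (R z f \<xi>) \<le> C * ell2_norm \<xi>" and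
    D: "\<And>\<xi>. \<xi> \<in> ell2 O' \<Longrightarrow> R z g \<xi> \<in> ell2 O' \<and> ell2_norm (R z g \<xi>) \<le> D * ell2_norm \<xi>"
    by metis
  have "R z (\<lambda>\<gamma>. f \<gamma> + g \<gamma>) \<xi> \<in> ell2 O' \<and> ell2_norm (R z (\<lambda>\<gamma>. f \<gamma> + g \<gamma>) \<xi>) \<le> (C + D) * ell2_norm \<xi>"
    if "\<xi> \<in> ell2 O'" for \<xi>
    unfolding R_add[OF add(1,2)]
    using C[OF that] D[OF that] ell2_add[of "R z f \<xi>" O' "R z g \<xi>"] by (simp add: distrib_right)
  then show ?case by blast
qed

lemma R_bounded_operator: "f \<in> Cc \<Longrightarrow> bounded_operator O' (R z f)"
  using R_bounded[of f] unfolding bounded_operator_def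
  by (auto simp: R_def fun_eq_iff distrib_left sum.distrib sum_distrib_left mult_ac simp del: split_paired_All)

lemma R_mem: "f \<in> Cc \<Longrightarrow> \<xi> \<in> ell2 O' \<Longrightarrow> R z f \<xi> \<in> ell2 O'"
  using R_bounded_operator bounded_operatorD(1) by blast

text \<open>For \<open>f\<close> supported in a bisection at most one arrow \<open>\<alpha>\<close> contributes to each coordinate, and
  \<open>\<beta> \<mapsto> \<alpha> \<beta>\<close> matches the sum for the product with the sum for \<open>g\<close>.\<close>

lemma R_mult:
  assumes "f \<in> Cc" and g: "g \<in> Cc"
  shows "R z (conv f g) \<xi> = R z f (R z g \<xi>)"
  using assms(1)
proof (induction f rule: Cc_induct)
  case (add f f')
  have "R z (conv (\<lambda>\<gamma>. f \<gamma> + f' \<gamma>) g) \<xi> = (\<lambda>w. R z (conv f g) \<xi> w + R z (conv f' g) \<xi> w)"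
    unfolding conv_add_left[OF add(1,2)] by (rule R_add) (intro conv_closed add g)+
  then show ?case by (simp add: add R_add)
next
  case (bis f)
  then obtain D where D: "bis D" "\<And>\<gamma>. f \<gamma> \<noteq> 0 \<Longrightarrow> \<gamma> \<in> D" and f: "f \<in> Cc"
    unfolding bis_supported_def by blast
  show ?case
  proof
    fix w show "R z (conv f g) \<xi> w = R z f (R z g \<xi>) w"
    proof (cases "\<exists>\<alpha>. f \<alpha> \<noteq> 0 \<and> rng \<alpha> = w")
      case True
      then obtain \<alpha> where a: "f \<alpha> \<noteq> 0" "rng \<alpha> = w" by blast
      have aD: "\<alpha> \<in> D" and aG: "\<alpha> \<in> topspace G" using D(2) a Cc_outside[OF f] by blast+
      let ?B = "{\<beta>. g \<beta> \<noteq> 0 \<and> rng \<beta> = src \<alpha>}"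
      have cancel: "arrow_mult (arrow_inv \<alpha>) (arrow_mult \<alpha> \<beta>) = \<beta>" if "rng \<beta> = src \<alpha>" for \<beta>
        using that by (intro arrow_eqI) simp_all
      have inj: "inj_on (arrow_mult \<alpha>) ?B"
        by (rule inj_on_inverseI[where g="arrow_mult (arrow_inv \<alpha>)"]) (simp add: cancel)
      have val: "conv f g \<gamma> = f \<alpha> * g (arrow_mult (arrow_inv \<alpha>) \<gamma>)" if "\<gamma> \<in> topspace G" "rng \<gamma> = w" for \<gamma>
        using conv_bis[OF f D aD that(1)] a that(2) by simp
      have "R z (conv f g) \<xi> w
          = (\<Sum>\<gamma>\<in>arrow_mult \<alpha> ` ?B. character z (cocycle \<gamma>) * conv f g \<gamma> * \<xi> (src \<gamma>))"
      proof (rule R_eq[OF conv_closed[OF f g]])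
        show "finite (arrow_mult \<alpha> ` ?B)" using Cc_finite_rng[OF g] by simp
        show "{\<gamma>. conv f g \<gamma> \<noteq> 0 \<and> rng \<gamma> = w} \<subseteq> arrow_mult \<alpha> ` ?B"
        proof
          fix \<gamma> assume g: "\<gamma> \<in> {\<gamma>. conv f g \<gamma> \<noteq> 0 \<and> rng \<gamma> = w}"
          then have "\<gamma> \<in> topspace G" using conv_outside by blast
          then have "g (arrow_mult (arrow_inv \<alpha>) \<gamma>) \<noteq> 0" using val[of \<gamma>] g by auto
          then have "arrow_mult (arrow_inv \<alpha>) \<gamma> \<in> ?B" by simp
          moreover have "\<gamma> = arrow_mult \<alpha> (arrow_mult (arrow_inv \<alpha>) \<gamma>)"
            using g a by (intro arrow_eqI) simp_all
          ultimately show "\<gamma> \<in> arrow_mult \<alpha> ` ?B" by blast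
        qed
        show "arrow_mult \<alpha> ` ?B \<subseteq> {\<gamma>. rng \<gamma> = w}" using a by auto
      qed
      also have "\<dots> = (\<Sum>\<beta>\<in>?B. character z (cocycle (arrow_mult \<alpha> \<beta>)) * conv f g (arrow_mult \<alpha> \<beta>) * \<xi> (src \<beta>))"
        by (simp add: sum.reindex[OF inj])
      also have "\<dots> = (\<Sum>\<beta>\<in>?B. character z (cocycle \<alpha>) * f \<alpha> * (character z (cocycle \<beta>) * g \<beta> * \<xi> (src \<beta>)))"
      proof (rule sum.cong[OF refl])
        fix \<beta> assume b: "\<beta> \<in> ?B"
        then have "arrow_mult \<alpha> \<beta> \<in> topspace G" using mult_topspace[OF aG Cc_outside[OF g]] by simp
        then have "conv f g (arrow_mult \<alpha> \<beta>) = f \<alpha> * g \<beta>" using val[of "arrow_mult \<alpha> \<beta>"] a b cancel by simp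
        then show "character z (cocycle (arrow_mult \<alpha> \<beta>)) * conv f g (arrow_mult \<alpha> \<beta>) * \<xi> (src \<beta>)
            = character z (cocycle \<alpha>) * f \<alpha> * (character z (cocycle \<beta>) * g \<beta> * \<xi> (src \<beta>))"
          by (simp add: character_add[OF z])
      qed
      also have "\<dots> = character z (cocycle \<alpha>) * f \<alpha> * R z g \<xi> (src \<alpha>)"
        by (simp add: R_def sum_distrib_left)
      also have "\<dots> = R z f (R z g \<xi>) w" by (rule R_bis[OF f D aD a(2), symmetric])
      finally show ?thesis .
    next
      case False
      then have "conv f g \<gamma> = 0" if "rng \<gamma> = w" for \<gamma> using conv_bis_0[OF f] that by blast
      then have "R z (conv f g) \<xi> w = 0" by (intro R_0) auto
      moreover have "R z f (R z g \<xi>) w = 0" by (rule R_0) (use False in blast)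
      ultimately show ?thesis by simp
    qed
  qed
qed

lemma R_star:
  assumes "f \<in> Cc" and x: "\<xi> \<in> ell2 O'" and y: "\<eta> \<in> ell2 O'"
  shows "ell2_inner (R z (star f) \<xi>) \<eta> = ell2_inner \<xi> (R z f \<eta>)"
  using assms(1)
proof (induction f rule: Cc_induct)
  case (add f g)
  have e: "star (\<lambda>\<gamma>. f \<gamma> + g \<gamma>) = (\<lambda>\<gamma>. star f \<gamma> + star g \<gamma>)" by simp
  have "ell2_inner (R z (star (\<lambda>\<gamma>. f \<gamma> + g \<gamma>)) \<xi>) \<eta>
      = ell2_inner (\<lambda>w. R z (star f) \<xi> w + R z (star g) \<xi> w) \<eta>"
    unfolding e R_add[OF star_closed[OF add(1)] star_closed[OF add(2)]] ..
  also have "\<dots> = ell2_inner (R z (star f) \<xi>) \<eta> + ell2_inner (R z (star g) \<xi>) \<eta>"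
    by (intro ell2_inner_add_left[of _ O'] R_mem star_closed add x y)
  also have "\<dots> = ell2_inner \<xi> (\<lambda>w. R z f \<eta> w + R z g \<eta> w)"
    unfolding add by (intro ell2_inner_add_right[of _ O', symmetric] R_mem add x y)
  finally show ?case by (simp add: R_add add)
next
  case (bis f)
  then obtain D where D: "bis D" "\<And>\<gamma>. f \<gamma> \<noteq> 0 \<Longrightarrow> \<gamma> \<in> D" and f: "f \<in> Cc"
    unfolding bis_supported_def by blast
  have sD: "star f \<gamma> \<noteq> 0 \<Longrightarrow> \<gamma> \<in> arrow_inv ` D" for \<gamma> using D(2) by (auto simp: mem_inv_image)
  have inj: "inj_on rng D" "inj_on src D" using D(1) by (auto simp: bis_def)
  have "ell2_inner (R z (star f) \<xi>) \<eta> = (\<Sum>\<^sub>\<infinity>w\<in>src ` D. R z (star f) \<xi> w * cnj (\<eta> w))"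
    unfolding ell2_inner_def
  proof (rule infsum_cong_neutral)
    fix w assume "w \<in> UNIV - src ` D"
    then have "R z (star f) \<xi> w = 0" by (intro R_0) (metis sD DiffD2 arrow_inv_simps(1,2) mem_inv_image imageI)
    then show "R z (star f) \<xi> w * cnj (\<eta> w) = 0" by simp
  qed auto
  also have "\<dots> = (\<Sum>\<^sub>\<infinity>\<delta>\<in>D. R z (star f) \<xi> (src \<delta>) * cnj (\<eta> (src \<delta>)))"
    by (simp add: infsum_reindex[OF inj(2)] o_def)
  also have "\<dots> = (\<Sum>\<^sub>\<infinity>\<delta>\<in>D. \<xi> (rng \<delta>) * cnj (R z f \<eta> (rng \<delta>)))"
  proof (rule infsum_cong)
    fix \<delta> assume d: "\<delta> \<in> D"
    have "R z (star f) \<xi> (src \<delta>) = character z (cocycle (arrow_inv \<delta>)) * star f (arrow_inv \<delta>) * \<xi> (src (arrow_inv \<delta>))"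
      by (rule R_bis[OF star_closed[OF f] bis_inv[OF D(1)] sD]) (use d in \<open>simp_all add: mem_inv_image\<close>)
    moreover have "R z f \<eta> (rng \<delta>) = character z (cocycle \<delta>) * f \<delta> * \<eta> (src \<delta>)"
      by (rule R_bis[OF f D d refl])
    ultimately show "R z (star f) \<xi> (src \<delta>) * cnj (\<eta> (src \<delta>)) = \<xi> (rng \<delta>) * cnj (R z f \<eta> (rng \<delta>))"
      by (simp add: character_minus[OF z])
  qed
  also have "\<dots> = (\<Sum>\<^sub>\<infinity>w\<in>rng ` D. \<xi> w * cnj (R z f \<eta> w))"
    by (simp add: infsum_reindex[OF inj(1)] o_def)
  also have "\<dots> = ell2_inner \<xi> (R z f \<eta>)"
    unfolding ell2_inner_def
  proof (rule infsum_cong_neutral)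
    fix w assume "w \<in> UNIV - rng ` D"
    then have "R z f \<eta> w = 0" by (intro R_0) (use D(2) in blast)
    then show "\<xi> w * cnj (R z f \<eta> w) = 0" by simp
  qed auto
  finally show ?case .
qed

lemma R_representation: "star_representation (convolution_algebra G) O' (R z)"
  unfolding star_representation_def convolution_algebra_simps(1,2)
  by (intro conjI ballI allI R_bounded_operator R_add R_scale R_mult R_star)

lemma R_basis:
  assumes "f \<in> Cc"
  shows "R z f (indicator {y}) =
     (\<lambda>w. \<Sum>\<^sub>\<infinity>\<gamma> \<in> {\<gamma> \<in> topspace G. src \<gamma> = y}. character z (cocycle \<gamma>) * f \<gamma> * indicator {rng \<gamma>} w)"
proof
  fix w
  have "(\<Sum>\<^sub>\<infinity>\<gamma> \<in> {\<gamma> \<in> topspace G. src \<gamma> = y}. character z (cocycle \<gamma>) * f \<gamma> * indicator {rng \<gamma>} w)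
      = (\<Sum>\<^sub>\<infinity>\<gamma>\<in>{\<gamma>. f \<gamma> \<noteq> 0 \<and> rng \<gamma> = w}. character z (cocycle \<gamma>) * f \<gamma> * indicator {y} (src \<gamma>))"
  proof (rule infsum_cong_neutral)
    fix \<gamma> assume "\<gamma> \<in> {\<gamma>. f \<gamma> \<noteq> 0 \<and> rng \<gamma> = w} - {\<gamma> \<in> topspace G. src \<gamma> = y}"
    then show "character z (cocycle \<gamma>) * f \<gamma> * indicator {y} (src \<gamma>) = 0"
      using Cc_outside[OF assms, of \<gamma>] by auto
  qed (auto simp: indicator_def)
  then show "R z f (indicator {y}) w = (\<Sum>\<^sub>\<infinity>\<gamma> \<in> {\<gamma> \<in> topspace G. src \<gamma> = y}.
      character z (cocycle \<gamma>) * f \<gamma> * indicator {rng \<gamma>} w)"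
    by (simp add: R_def Cc_finite_rng[OF assms])
qed

text \<open>A representation as required by the choice operator exists, being the extension of \<open>R z\<close>; and
  whichever one is chosen, its matrix coefficients are those of \<open>R z\<close>.\<close>

lemma orbit_representation:
  shows "star_representation (groupoid_cstar G) O' (orbit_representation G x z)"
    and "\<And>f \<xi>. f \<in> Cc \<Longrightarrow> \<xi> \<in> ell2 O' \<Longrightarrow>
          orbit_representation G x z (to_enveloping (convolution_algebra G) f) \<xi> = R z f \<xi>"
proof -
  let ?A = "convolution_algebra G"
  let ?g = "\<lambda>(y :: 'x) (\<gamma> :: ('x, 'k) arrow). if rng \<gamma> = y then 1 else 0 :: complex"
  have g: "inj ?g"
  proof (rule injI)
    fix y y' assume "?g y = ?g y'"
    from fun_cong[OF this, of "unit_arrow y"] show "y = y'" by (auto split: if_splits)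
  qed
  obtain L where L: "star_representation (groupoid_cstar G) O' L"
    "\<And>f \<xi>. f \<in> Cc \<Longrightarrow> \<xi> \<in> ell2 O' \<Longrightarrow> L (to_enveloping ?A f) \<xi> = R z f \<xi>"
    by (rule CA.extend_representation[OF R_representation CA.universal_norm_bound_index[OF g R_representation]])
       auto
  let ?P = "\<lambda>L. star_representation (groupoid_cstar G) O' L \<and>
        (\<forall>f\<in>Cc. \<forall>y\<in>O'. L (to_enveloping ?A f) (indicator {y}) =
           (\<lambda>w. \<Sum>\<^sub>\<infinity>\<gamma> \<in> {\<gamma> \<in> topspace G. src \<gamma> = y}. character z (cocycle \<gamma>) * f \<gamma> * indicator {rng \<gamma>} w))"
  have "?P L" using L by (simp add: R_basis)
  then have P: "?P (orbit_representation G x z)"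
    unfolding orbit_representation_def by (rule someI[of ?P])
  let ?L = "orbit_representation G x z"
  show 1: "star_representation (groupoid_cstar G) O' ?L" using P by blast
  fix f \<xi> assume f: "f \<in> Cc" and xi: "\<xi> \<in> ell2 O'"
  note L1 = CA.star_rep_to_enveloping[OF 1]
  have b: "?L (to_enveloping ?A f) (indicator {y}) = R z f (indicator {y})" if "f \<in> Cc" "y \<in> O'" for f y
    using P that R_basis[OF that(1)] by simp
  show "?L (to_enveloping ?A f) \<xi> = R z f \<xi>"
  proof
    fix w show "?L (to_enveloping ?A f) \<xi> w = R z f \<xi> w"
    proof (cases "w \<in> O'")
      case True
      show ?thesis
        unfolding star_rep_coord[OF L1 f xi True] star_rep_coord[OF R_representation f xi True]
        by (simp only: b[OF star_closed[OF f] True])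
    next
      case False
      then show ?thesis using ell2_outside[OF star_rep_mem[OF L1 f xi] False] ell2_outside[OF R_mem[OF f xi] False] by simp
    qed
  qed
qed

end

text \<open>Bump functions on bisections move basis vectors along arrows.\<close>

lemma arrow_bump:
  assumes "\<gamma> \<in> topspace G"
  obtains f where "f \<in> Cc"
    "\<And>z \<xi>. R z f \<xi> (rng \<gamma>) = character z (cocycle \<gamma>) * \<xi> (src \<gamma>)"
    "\<And>z. R z f (indicator {src \<gamma>}) = (\<lambda>w. character z (cocycle \<gamma>) * indicator {rng \<gamma>} w)"
proof -
  obtain D where D: "bis D" "\<gamma> \<in> D" using bis_nhd[OF openin_topspace assms] by metis
  obtain f where f: "bis_supported f" "f \<gamma> = 1" "\<And>\<eta>. f \<eta> \<noteq> 0 \<Longrightarrow> \<eta> \<in> D"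
    using bis_bump[OF D] by metis
  have fC: "f \<in> Cc" by (rule bis_supported_Cc[OF f(1)])
  have 1: "R z f \<xi> (rng \<gamma>) = character z (cocycle \<gamma>) * \<xi> (src \<gamma>)" for z \<xi>
    using R_bis[OF fC D(1) f(3) D(2) refl, of z \<xi>] f(2) by simp
  have "R z f (indicator {src \<gamma>}) w = character z (cocycle \<gamma>) * indicator {rng \<gamma>} w" for z w
  proof (cases "w = rng \<gamma>")
    case True then show ?thesis using 1 by simp
  next
    case False
    show ?thesis
    proof (cases "\<exists>\<alpha>. f \<alpha> \<noteq> 0 \<and> rng \<alpha> = w")
      case True
      then obtain \<alpha> where a: "\<alpha> \<in> D" "rng \<alpha> = w" using f(3) by blast
      then have "src \<alpha> \<noteq> src \<gamma>" using bis_src_eq[OF D(1) a(1) D(2)] False by auto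
      then show ?thesis using R_bis[OF fC D(1) f(3) a, of z "indicator {src \<gamma>}"] False by simp
    next
      case F: False
      have "R z f (indicator {src \<gamma>}) w = 0" by (rule R_0) (use F in blast)
      then show ?thesis using False by simp
    qed
  qed
  with that[OF fC 1] show ?thesis by blast
qed

end

section \<open>Irreducibility\<close>

text \<open>Off a suitable finite set everything dominated by \<open>\<xi>\<close> is small.\<close>

lemma ell2_tail:
  assumes x: "\<xi> \<in> ell2 S" and e: "0 < e"
  obtains F where "finite F" "\<forall>\<eta>. (\<forall>i\<in>F. \<eta> i = 0) \<longrightarrow> (\<forall>i. cmod (\<eta> i) \<le> cmod (\<xi> i)) \<longrightarrow>
      \<eta> \<in> ell2 S \<and> ell2_norm \<eta> \<le> e"
proof -
  let ?s = "\<lambda>i. (cmod (\<xi> i))\<^sup>2"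
  note s = ell2_summable[OF x]
  obtain F where F: "finite F" "dist (sum ?s F) (infsum ?s UNIV) \<le> e\<^sup>2"
    using infsum_finite_approximation[OF s, of "e\<^sup>2"] e by auto
  have "\<eta> \<in> ell2 S \<and> ell2_norm \<eta> \<le> e"
    if 0: "\<And>i. i \<in> F \<Longrightarrow> \<eta> i = 0" and le: "\<And>i. cmod (\<eta> i) \<le> cmod (\<xi> i)" for \<eta>
  proof -
    have o: "\<eta> i = 0" if "i \<notin> S" for i using le[of i] ell2_outside[OF x that] by simp
    have b: "L2_set (\<lambda>i. cmod (\<eta> i)) H \<le> e" if H: "finite H" for H
    proof -
      have "(\<Sum>i\<in>H. (cmod (\<eta> i))\<^sup>2) = (\<Sum>i\<in>H - F. (cmod (\<eta> i))\<^sup>2)"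
        using 0 H by (intro sum.mono_neutral_right) auto
      also have "\<dots> \<le> (\<Sum>i\<in>H - F. ?s i)" by (intro sum_mono power_mono le) auto
      also have "\<dots> = (\<Sum>i\<in>(H - F) \<union> F. ?s i) - sum ?s F"
        using H F(1) by (subst sum.union_disjoint) auto
      also have "(\<Sum>i\<in>(H - F) \<union> F. ?s i) \<le> infsum ?s UNIV"
        by (rule finite_sum_le_infsum[OF s]) (use H F(1) in auto)
      finally have "(\<Sum>i\<in>H. (cmod (\<eta> i))\<^sup>2) \<le> e\<^sup>2" using F(2) by (simp add: dist_real_def)
      then show ?thesis unfolding L2_set_def using e by (intro real_le_lsqrt) auto
    qed
    show ?thesis using ell2_normI[of S \<eta>, OF o b] by blast
  qed
  with F(1) show ?thesis by (intro that[of F]) auto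
qed

context DR
begin

text \<open>Functions on the unit space act by multiplication; finitely many points are separated from \<open>y\<close>.\<close>

lemma diagonal_bump:
  assumes "finite F"
  obtains f where "f \<in> Cc" "\<And>\<gamma>. cmod (f \<gamma>) \<le> 1"
    "\<And>z \<xi>. R z f \<xi> = (\<lambda>w. f (unit_arrow w) * \<xi> w)" "f (unit_arrow y) = 1" "\<And>w. w \<in> F \<Longrightarrow> w \<noteq> y \<Longrightarrow> f (unit_arrow w) = 0"
proof -
  let ?U = "- (F - {y})"
  let ?D = "Z ?U 0 0 ?U"
  have oU: "open ?U" by (intro open_Compl finite_imp_closed) (use assms in simp)
  have mem: "\<gamma> \<in> ?D \<longleftrightarrow> \<gamma> = unit_arrow (rng \<gamma>) \<and> rng \<gamma> \<in> ?U" for \<gamma>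
    by (cases \<gamma>) (auto simp: mem_Z unit_arrow_def)
  have D: "bis ?D"
    unfolding bis_def
  proof (intro conjI inj_onI)
    show "openin G ?D" using oU by (simp add: openin_Z)
    show "\<gamma> = \<eta>" if "\<gamma> \<in> ?D" "\<eta> \<in> ?D" "rng \<gamma> = rng \<eta>" for \<gamma> \<eta>
      using that unfolding mem by metis
    show "\<gamma> = \<eta>" if "\<gamma> \<in> ?D" "\<eta> \<in> ?D" "src \<gamma> = src \<eta>" for \<gamma> \<eta>
      using that unfolding mem by (metis unit_arrow_simps(1,2))
  qed
  have uD: "unit_arrow y \<in> ?D" unfolding mem by simp
  obtain f where f: "bis_supported f" "f (unit_arrow y) = 1" "\<And>\<eta>. f \<eta> \<noteq> 0 \<Longrightarrow> \<eta> \<in> ?D" "\<And>\<eta>. cmod (f \<eta>) \<le> 1"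
    using bis_bump[OF D uD] by metis
  have fC: "f \<in> Cc" by (rule bis_supported_Cc[OF f(1)])
  have "R z f \<xi> w = f (unit_arrow w) * \<xi> w" for z \<xi> w
  proof (cases "unit_arrow w \<in> ?D")
    case True
    show ?thesis using R_bis[OF fC D f(3) True, of w z \<xi>] by simp
  next
    case False
    then have 0: "f (unit_arrow w) = 0" using f(3) by blast
    have "R z f \<xi> w = 0"
    proof (rule R_0)
      fix \<alpha> assume "f \<alpha> \<noteq> 0"
      then show "rng \<alpha> \<noteq> w" using f(3)[of \<alpha>] False mem[of \<alpha>] by metis
    qed
    then show ?thesis using 0 by simp
  qed
  moreover have "f (unit_arrow w) = 0" if "w \<in> F" "w \<noteq> y" for w
    using f(3)[of "unit_arrow w"] that unfolding mem by auto
  ultimately show ?thesis using that[OF fC f(4)] f(2) by blast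
qed

text \<open>If a vector of \<open>M\<close> has a nonzero coordinate at \<open>y\<close>, multiplying by functions on the unit space that
  concentrate at \<open>y\<close> cuts out a multiple of the basis vector at \<open>y\<close>. Bump functions on arrows move it to
  all other basis vectors of the orbit, and these span.\<close>

lemma invariant_subspace:
  assumes z: "z \<in> torus" and M: "closed_ell2_subspace (orbit G x) M"
    and inv: "\<And>f \<xi>. f \<in> Cc \<Longrightarrow> \<xi> \<in> M \<Longrightarrow> R z f \<xi> \<in> M" and nz: "M \<noteq> {\<lambda>i. 0}"
  shows "M = ell2 (orbit G x)"
proof -
  let ?S = "orbit G x"
  have sub: "M \<subseteq> ell2 ?S" and zero: "(\<lambda>i. 0) \<in> M"
    and addM: "\<And>\<xi> \<eta>. \<xi> \<in> M \<Longrightarrow> \<eta> \<in> M \<Longrightarrow> (\<lambda>i. \<xi> i + \<eta> i) \<in> M"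
    and scaleM: "\<And>c \<xi>. \<xi> \<in> M \<Longrightarrow> (\<lambda>i. c * \<xi> i) \<in> M"
    and closedM: "\<And>u \<xi>. \<xi> \<in> ell2 ?S \<Longrightarrow> (\<forall>n. u n \<in> M) \<Longrightarrow> (\<lambda>n. ell2_norm (\<lambda>i. u n i - \<xi> i)) \<longlonglongrightarrow> 0 \<Longrightarrow> \<xi> \<in> M"
    using M unfolding closed_ell2_subspace_def by blast+
  have approx: "\<xi> \<in> M" if x: "\<xi> \<in> ell2 ?S" and a: "\<And>e. 0 < e \<Longrightarrow> \<exists>\<eta>\<in>M. ell2_norm (\<lambda>i. \<eta> i - \<xi> i) \<le> e" for \<xi>
  proof -
    have "\<forall>n. \<exists>\<eta>\<in>M. ell2_norm (\<lambda>i. \<eta> i - \<xi> i) \<le> 1 / real (Suc n)" using a by simp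
    then obtain u where u: "\<And>n. u n \<in> M" "\<And>n. ell2_norm (\<lambda>i. u n i - \<xi> i) \<le> 1 / real (Suc n)" by metis
    have "(\<lambda>n. ell2_norm (\<lambda>i. u n i - \<xi> i)) \<longlonglongrightarrow> 0"
      by (rule Lim_null_comparison[OF always_eventually[OF allI] LIMSEQ_inverse_real_of_nat])
         (use u(2) in \<open>simp add: inverse_eq_divide\<close>)
    then show ?thesis using closedM[OF x] u(1) by blast
  qed
  obtain \<xi> where xi: "\<xi> \<in> M" "\<xi> \<noteq> (\<lambda>i. 0)" using nz zero by blast
  then obtain y where y: "\<xi> y \<noteq> 0" by blast
  have xS: "\<xi> \<in> ell2 ?S" using xi sub by blast
  have yS: "y \<in> ?S" using ell2_outside[OF xS] y by blast
  have "(\<lambda>i. \<xi> y * indicator {y} i) \<in> M"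
  proof (rule approx)
    show "(\<lambda>i. \<xi> y * indicator {y} i) \<in> ell2 ?S" using yS by simp
    fix e :: real assume e: "0 < e"
    obtain F where F: "finite F" "\<forall>\<eta>. (\<forall>i\<in>F. \<eta> i = 0) \<longrightarrow> (\<forall>i. cmod (\<eta> i) \<le> cmod (\<xi> i)) \<longrightarrow>
      \<eta> \<in> ell2 ?S \<and> ell2_norm \<eta> \<le> e" by (rule ell2_tail[OF xS e]) (rule that, assumption+)
    obtain f where f: "f \<in> Cc" "\<And>\<gamma>. cmod (f \<gamma>) \<le> 1" "\<And>z \<xi>. R z f \<xi> = (\<lambda>w. f (unit_arrow w) * \<xi> w)"
      "f (unit_arrow y) = 1" "\<And>w. w \<in> F \<Longrightarrow> w \<noteq> y \<Longrightarrow> f (unit_arrow w) = 0"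
      by (rule diagonal_bump[OF F(1), of y]) (rule that, assumption+)
    have "ell2_norm (\<lambda>i. R z f \<xi> i - \<xi> y * indicator {y} i) \<le> e"
    proof (rule F(2)[rule_format, THEN conjunct2])
      show "R z f \<xi> i - \<xi> y * indicator {y} i = 0" if "i \<in> F" for i
        using f(4) f(5)[OF that] by (cases "i = y") (auto simp: f(3))
      show "cmod (R z f \<xi> i - \<xi> y * indicator {y} i) \<le> cmod (\<xi> i)" for i
        using f(4) mult_right_mono[OF f(2), of "cmod (\<xi> i)" "unit_arrow i"]
        by (cases "i = y") (auto simp: f(3) norm_mult)
    qed
    then show "\<exists>\<eta>\<in>M. ell2_norm (\<lambda>i. \<eta> i - \<xi> y * indicator {y} i) \<le> e"
      using inv[OF f(1) xi(1)] by blast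
  qed
  from scaleM[OF this, of "1 / \<xi> y"] y have ey: "indicator {y} \<in> M" by simp
  have ew: "indicator {w} \<in> M" if w: "w \<in> ?S" for w
  proof -
    obtain \<gamma> where g: "\<gamma> \<in> topspace G" "rng \<gamma> = w" "src \<gamma> = y" using orbit_arrowE[OF w yS] by metis
    obtain f where f: "f \<in> Cc" "\<And>z. R z f (indicator {src \<gamma>}) = (\<lambda>w. character z (cocycle \<gamma>) * indicator {rng \<gamma>} w)"
      using arrow_bump[OF g(1)] by metis
    have "(\<lambda>i. character z (cocycle \<gamma>) * indicator {w} i) \<in> M"
      using inv[OF f(1) ey] f(2)[of z] g by simp
    moreover have "character z (cocycle \<gamma>) \<noteq> 0" using norm_character[OF z, of "cocycle \<gamma>"] by force
    ultimately show ?thesis using scaleM[of _ "1 / character z (cocycle \<gamma>)"] by fastforce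
  qed
  have fin: "(\<lambda>i. if i \<in> F then \<eta> i else 0) \<in> M" if "\<eta> \<in> ell2 ?S" "finite F" for \<eta> F
    using that(2)
  proof (induction F rule: finite_induct)
    case empty then show ?case using zero by simp
  next
    case (insert w F)
    have "(\<lambda>i. \<eta> w * indicator {w} i) \<in> M"
    proof (cases "w \<in> ?S")
      case True then show ?thesis using scaleM[OF ew] by blast
    next
      case False then show ?thesis using zero ell2_outside[OF that(1) False] by simp
    qed
    from addM[OF this insert.IH]
    have "(\<lambda>i. \<eta> w * indicator {w} i + (if i \<in> F then \<eta> i else 0)) \<in> M" .
    moreover have "(\<lambda>i. \<eta> w * indicator {w} i + (if i \<in> F then \<eta> i else 0))
        = (\<lambda>i. if i \<in> insert w F then \<eta> i else 0)"
      using insert.hyps by (auto simp: fun_eq_iff indicator_def)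
    ultimately show ?case by simp
  qed
  have "\<eta> \<in> M" if h: "\<eta> \<in> ell2 ?S" for \<eta>
  proof (rule approx[OF h])
    fix e :: real assume e: "0 < e"
    obtain F where F: "finite F" "\<forall>\<zeta>. (\<forall>i\<in>F. \<zeta> i = 0) \<longrightarrow> (\<forall>i. cmod (\<zeta> i) \<le> cmod (\<eta> i)) \<longrightarrow>
      \<zeta> \<in> ell2 ?S \<and> ell2_norm \<zeta> \<le> e" by (rule ell2_tail[OF h e]) (rule that, assumption+)
    have "ell2_norm (\<lambda>i. (if i \<in> F then \<eta> i else 0) - \<eta> i) \<le> e"
      by (rule F(2)[rule_format, THEN conjunct2]) auto
    then show "\<exists>\<zeta>\<in>M. ell2_norm (\<lambda>i. \<zeta> i - \<eta> i) \<le> e"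
      using fin[OF h F(1)] by (intro bexI[of _ "\<lambda>i. if i \<in> F then \<eta> i else 0"])
  qed
  then show ?thesis using sub by blast
qed

lemma orbit_representation_irreducible:
  assumes z: "z \<in> torus"
  shows "irreducible_representation (groupoid_cstar G) (orbit G x) (orbit_representation G x z)"
proof -
  let ?L = "orbit_representation G x z" and ?e = "to_enveloping (convolution_algebra G)"
  note L = orbit_representation(1)[OF z, of x] orbit_representation(2)[OF z, where x=x]
  obtain f where f: "f \<in> Cc" "R z f (indicator {x}) = indicator {x}"
    using arrow_bump[of "unit_arrow x"] by (metis (no_types, lifting) unit_topspace unit_arrow_simps(1,2,3) character_0 mult_1 ext)
  have "?e f \<in> sa_carrier (groupoid_cstar G)" using f(1) by simp
  moreover have "?e f \<notin> representation_kernel (groupoid_cstar G) (orbit G x) ?L"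
  proof
    assume "?e f \<in> representation_kernel (groupoid_cstar G) (orbit G x) ?L"
    then have "?L (?e f) (indicator {x}) = (\<lambda>i. 0)" by (simp add: representation_kernel_def)
    then have "(indicator {x} :: 'x \<Rightarrow> complex) = (\<lambda>i. 0)" using L(2)[OF f(1), of "indicator {x}"] f(2) by simp
    from fun_cong[OF this, of x] show False by simp
  qed
  moreover have "M = {\<lambda>i. 0} \<or> M = ell2 (orbit G x)"
    if M: "closed_ell2_subspace (orbit G x) M" and inv: "\<forall>a\<in>sa_carrier (groupoid_cstar G). \<forall>\<xi>\<in>M. ?L a \<xi> \<in> M" for M
  proof (cases "M = {\<lambda>i. 0}")
    case False
    have "R z g \<xi> \<in> M" if "g \<in> Cc" "\<xi> \<in> M" for g \<xi>
    proof -
      have "\<xi> \<in> ell2 (orbit G x)" using M that(2) by (auto simp: closed_ell2_subspace_def)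
      then show ?thesis using inv that L(2)[OF that(1)] CA.to_enveloping_carrier[OF that(1)] by metis
    qed
    from invariant_subspace[OF z M this False] show ?thesis by blast
  qed blast
  ultimately show ?thesis using L(1) unfolding irreducible_representation_def by blast
qed

lemma orbit_kernel_in_Prim:
  assumes "z \<in> torus"
  shows "orbit_kernel G (x, z) \<in> Prim (groupoid_cstar G)"
proof -
  let ?g = "\<lambda>y :: 'x. {\<lambda>(n :: nat) (\<gamma> :: ('x, 'k) arrow). if rng \<gamma> = y then 1 else 0 :: complex}"
  have "inj ?g"
  proof (rule injI)
    fix y y' assume "?g y = ?g y'"
    then have "(\<lambda>(n :: nat) (\<gamma> :: ('x, 'k) arrow). if rng \<gamma> = y then 1 else 0 :: complex)
        = (\<lambda>n \<gamma>. if rng \<gamma> = y' then 1 else 0)" by blast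
    from arg_cong[OF this, of "\<lambda>h. h 0 (unit_arrow y)"] show "y = y'" by (auto split: if_splits)
  qed
  from kernel_in_Prim[OF this orbit_representation_irreducible[OF assms]] show ?thesis
    by (simp add: orbit_kernel_def)
qed

end

section \<open>Almost invariant vectors\<close>

lemma polynomial_below_exponential:
  fixes \<delta> :: real and r d :: nat
  assumes "0 < \<delta>"
  shows "\<exists>J. real (2 * (J * r) + 1) ^ d < (1 + \<delta>) ^ J"
proof -
  define c where "c = ln (1 + \<delta>)"
  have c: "0 < c" using assms by (simp add: c_def)
  have e: "exp (real n * c) = (1 + \<delta>) ^ n" for n
    using assms by (simp add: c_def exp_of_nat_mult)
  have "filterlim (\<lambda>n. real n * c) at_top sequentially"
    using c by (intro filterlim_at_top_mult_tendsto_pos[OF tendsto_const] filterlim_real_sequentially)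
  from filterlim_compose[OF tendsto_power_div_exp_0 this]
  have "(\<lambda>n. (real n * c) ^ d / exp (real n * c)) \<longlonglongrightarrow> 0" .
  from tendsto_mult_right[OF this, of "(real (2 * r + 1) / c) ^ d"]
  have "(\<lambda>n. (real n * c) ^ d / exp (real n * c) * (real (2 * r + 1) / c) ^ d) \<longlonglongrightarrow> 0" by simp
  from order_tendstoD(2)[OF this zero_less_one] obtain n0 where
    n0: "\<And>n. n \<ge> n0 \<Longrightarrow> (real n * c) ^ d / exp (real n * c) * (real (2 * r + 1) / c) ^ d < 1"
    by (auto simp: eventually_sequentially)
  define n where "n = max n0 1"
  have "(real n * c) ^ d * (real (2 * r + 1) / c) ^ d = (real n * real (2 * r + 1)) ^ d"
    using c by (simp add: power_mult_distrib[symmetric])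
  then have "(real n * real (2 * r + 1)) ^ d < (1 + \<delta>) ^ n"
    using n0[of n] e[of n] assms by (simp add: n_def)
  moreover have "real (2 * (n * r) + 1) ^ d \<le> (real n * real (2 * r + 1)) ^ d"
    by (intro power_mono) (simp_all add: n_def algebra_simps)
  ultimately show ?thesis by (intro exI[of _ n]) linarith
qed

text \<open>Sets of polynomial growth have two consecutive members of comparable size, at a stage bounded
  in terms of the growth only.\<close>

lemma polynomial_growth_step:
  fixes \<delta> :: real and r d :: nat
  assumes "0 < \<delta>"
  obtains J where "\<And>s :: nat \<Rightarrow> nat. 1 \<le> s 0 \<Longrightarrow> (\<And>j. j \<le> J \<Longrightarrow> s j \<le> (2 * (j * r) + 1) ^ d) \<Longrightarrow>
      \<exists>j<J. real (s (Suc j)) \<le> (1 + \<delta>) * real (s j)"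
proof -
  obtain J where J: "real (2 * (J * r) + 1) ^ d < (1 + \<delta>) ^ J"
    using polynomial_below_exponential[OF assms] by blast
  have "\<exists>j<J. real (s (Suc j)) \<le> (1 + \<delta>) * real (s j)"
    if "1 \<le> s 0" and b: "\<And>j. j \<le> J \<Longrightarrow> s j \<le> (2 * (j * r) + 1) ^ d" for s :: "nat \<Rightarrow> nat"
  proof (rule ccontr)
    assume "\<not> ?thesis"
    then have gr: "(1 + \<delta>) * real (s j) \<le> real (s (Suc j))" if "j < J" for j using that by fastforce
    have "(1 + \<delta>) ^ j \<le> real (s j)" if "j \<le> J" for j
      using that
    proof (induction j)
      case (Suc j)
      then have "(1 + \<delta>) * (1 + \<delta>) ^ j \<le> (1 + \<delta>) * real (s j)" using assms by (intro mult_left_mono) auto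
      then show ?case using gr[of j] Suc.prems by simp
    qed (use \<open>1 \<le> s 0\<close> in simp)
    from this[of J] have "(1 + \<delta>) ^ J \<le> real ((2 * (J * r) + 1) ^ d)" using b[of J] by (meson of_nat_mono order_refl order_trans)
    with J show False by simp
  qed
  then show ?thesis by (rule that)
qed

text \<open>Balls in \<open>\<int>\<^sup>k\<close> grow polynomially; this is the amenability used below.\<close>

lemma box_card:
  "finite {m :: int^'k::finite. \<forall>i. \<bar>m $ i\<bar> \<le> int r}"
  "card {m :: int^'k::finite. \<forall>i. \<bar>m $ i\<bar> \<le> int r} \<le> (2 * r + 1) ^ CARD('k)"
proof -
  let ?P = "PiE (UNIV :: 'k set) (\<lambda>_. {- int r..int r})"
  have f: "finite ?P" by (intro finite_PiE) auto
  have "m \<in> vec_lambda ` ?P" if "\<forall>i. \<bar>m $ i\<bar> \<le> int r" for m :: "int^'k"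
  proof (rule image_eqI[of _ _ "\<lambda>i. m $ i"])
    show "(\<lambda>i. m $ i) \<in> ?P" using that by (auto simp: PiE_def abs_le_iff) (smt (verit) that)+
  qed simp
  then have s: "{m :: int^'k::finite. \<forall>i. \<bar>m $ i\<bar> \<le> int r} \<subseteq> vec_lambda ` ?P" by blast
  show "finite {m :: int^'k::finite. \<forall>i. \<bar>m $ i\<bar> \<le> int r}"
    by (rule finite_subset[OF s]) (use f in simp)
  have "card {m :: int^'k::finite. \<forall>i. \<bar>m $ i\<bar> \<le> int r} \<le> card (vec_lambda ` ?P)"
    by (rule card_mono[OF _ s]) (use f in simp)
  also have "\<dots> \<le> card ?P" by (rule card_image_le[OF f])
  also have "\<dots> = (2 * r + 1) ^ CARD('k)" by (subst card_PiE) (auto simp: nat_add_distrib nat_mult_distrib)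
  finally show "card {m :: int^'k::finite. \<forall>i. \<bar>m $ i\<bar> \<le> int r} \<le> (2 * r + 1) ^ CARD('k)" .
qed

text \<open>Finitely many conditions that hold on small neighbourhoods hold on a common one.\<close>

lemma finite_nhd:
  fixes x :: "'a::topological_space"
  assumes "finite Q" "\<And>m. m \<in> Q \<Longrightarrow> \<exists>N. open N \<and> x \<in> N \<and> P m N"
    and mono: "\<And>m N N'. P m N \<Longrightarrow> N' \<subseteq> N \<Longrightarrow> P m N'"
  shows "\<exists>N. open N \<and> x \<in> N \<and> (\<forall>m\<in>Q. P m N)"
  using assms(1,2)
proof (induction Q rule: finite_induct)
  case empty then show ?case by (intro exI[of _ UNIV]) simp
next
  case (insert a Q)
  have "\<exists>N. open N \<and> x \<in> N \<and> (\<forall>m\<in>Q. P m N)" by (rule insert.IH) (rule insert.prems, simp)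
  then obtain N where N: "open N" "x \<in> N" "\<forall>m\<in>Q. P m N" by blast
  obtain N' where N': "open N'" "x \<in> N'" "P a N'" using insert.prems by blast
  have "P m (N \<inter> N')" if "m \<in> insert a Q" for m
    using that N(3) N'(3) mono[of m N "N \<inter> N'"] mono[of a N' "N \<inter> N'"] by (cases "m = a") auto
  then show ?case using N(1,2) N'(1,2) by (intro exI[of _ "N \<inter> N'"]) auto
qed

context DR
begin

text \<open>Let \<open>rel l w' w\<close> say that an arrow of degree \<open>l\<close> runs from \<open>w\<close> to \<open>w'\<close>, and
  let \<open>mm w\<close> be the degree by which \<open>w\<close> was reached from a base point. If \<open>S\<close> is almost invariant under
  the finitely many degrees \<open>l\<close> occurring in \<open>f\<close>, the unit vector equal to
  \<open>(u / z) ^ mm w / sqrt (card S)\<close> on \<open>S\<close> sees \<open>f\<close> as a sum of the values \<open>a l\<close>,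
  weighted by \<open>z ^ l\<close>: the phase at an arrow is \<open>u ^ h * z ^ (l - h)\<close> with
  \<open>h = l + mm w - mm w'\<close>, and \<open>h\<close> is the degree of a loop at the base point, for which \<open>u ^ h\<close>
  and \<open>z ^ h\<close> are close.\<close>

lemma almost_invariant_vector:
  fixes rel :: "int^'k \<Rightarrow> 'x \<Rightarrow> 'x \<Rightarrow> bool" and mm :: "'x \<Rightarrow> int^'k" and a :: "int^'k \<Rightarrow> complex"
  assumes z: "z \<in> torus" and u: "u \<in> torus" and f: "f \<in> Cc"
    and S: "finite S" "S \<noteq> {}" "S \<subseteq> orbit G y" and \<Lambda>: "finite \<Lambda>" and \<delta>: "0 \<le> \<delta>"
    and loc: "\<And>\<gamma>. f \<gamma> \<noteq> 0 \<Longrightarrow> rng \<gamma> \<in> S \<Longrightarrow> src \<gamma> \<in> S \<Longrightarrow> cocycle \<gamma> \<in> \<Lambda> \<and> rel (cocycle \<gamma>) (rng \<gamma>) (src \<gamma>)"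
    and fn: "\<And>l w w1 w'. l \<in> \<Lambda> \<Longrightarrow> w \<in> S \<Longrightarrow> w' \<in> S \<Longrightarrow> w1 \<in> S \<Longrightarrow> rel l w' w \<Longrightarrow> rel l w1 w \<Longrightarrow> w' = w1"
    and count: "\<And>l. l \<in> \<Lambda> \<Longrightarrow> (1 - \<delta>) * real (card S) \<le> real (card {w\<in>S. \<exists>w'\<in>S. rel l w' w})"
    and phase: "\<And>l w w'. l \<in> \<Lambda> \<Longrightarrow> w \<in> S \<Longrightarrow> w' \<in> S \<Longrightarrow> rel l w' w \<Longrightarrow>
        cmod (character u (l + mm w - mm w') - character z (l + mm w - mm w')) \<le> \<delta>"
    and var: "\<And>l w w'. l \<in> \<Lambda> \<Longrightarrow> w \<in> S \<Longrightarrow> w' \<in> S \<Longrightarrow> rel l w' w \<Longrightarrow> cmod (f (w', l, w) - a l) \<le> \<delta>"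
    and M: "\<And>l. cmod (a l) \<le> M"
  shows "\<exists>\<xi>\<in>ell2 (orbit G y). ell2_norm \<xi> \<le> 1 \<and>
      cmod (ell2_inner (R u f \<xi>) \<xi> - (\<Sum>l\<in>\<Lambda>. character z l * a l)) \<le> real (card \<Lambda>) * ((1 + 2 * M) * \<delta>)"
proof -
  define n where "n = real (card S)"
  have n: "0 < n" using S(1,2) by (simp add: n_def card_gt_0_iff)
  define d where "d w = character u (mm w) * cnj (character z (mm w))" for w
  have d1: "cmod (d w) = 1" for w using z u by (simp add: d_def norm_mult)
  define \<xi> where "\<xi> w = (if w \<in> S then complex_of_real (1 / sqrt n) * d w else 0)" for w
  have out: "\<xi> w = 0" if "w \<notin> orbit G y" for w using that S(3) by (auto simp: \<xi>_def)
  have "L2_set (\<lambda>w. cmod (\<xi> w)) F \<le> 1" if F: "finite F" for F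
  proof -
    have "(\<Sum>w\<in>F. (cmod (\<xi> w))\<^sup>2) = (\<Sum>w\<in>F \<inter> S. 1 / n)"
      using F n by (intro sum.mono_neutral_cong_right) (auto simp: \<xi>_def norm_mult d1 norm_divide power_divide)
    also have "\<dots> = real (card (F \<inter> S)) / n" by simp
    also have "\<dots> \<le> 1" using n S(1) by (simp add: n_def card_mono)
    finally show ?thesis by (simp add: L2_set_def)
  qed
  from ell2_normI[of "orbit G y" \<xi>, OF out this]
  have xi: "\<xi> \<in> ell2 (orbit G y)" "ell2_norm \<xi> \<le> 1" by auto
  define \<Gamma> where "\<Gamma> = {\<gamma>. rng \<gamma> \<in> S \<and> src \<gamma> \<in> S \<and> cocycle \<gamma> \<in> \<Lambda> \<and> rel (cocycle \<gamma>) (rng \<gamma>) (src \<gamma>)}"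
  have "\<Gamma> \<subseteq> S \<times> \<Lambda> \<times> S" unfolding \<Gamma>_def by (auto simp: rng_def src_def cocycle_def)
  then have \<Gamma>: "finite \<Gamma>" using S(1) \<Lambda> by (auto intro: finite_subset)
  define t where "t \<gamma> = character u (cocycle \<gamma>) * f \<gamma> * \<xi> (src \<gamma>) * cnj (\<xi> (rng \<gamma>))" for \<gamma>
  have Rv: "R u f \<xi> w' = (\<Sum>\<gamma>\<in>{\<gamma>\<in>\<Gamma>. rng \<gamma> = w'}. character u (cocycle \<gamma>) * f \<gamma> * \<xi> (src \<gamma>))"
    if w': "w' \<in> S" for w'
    unfolding R_def
  proof (rule sum.mono_neutral_cong)
    show "finite {\<gamma>. f \<gamma> \<noteq> 0 \<and> rng \<gamma> = w'}" by (rule Cc_finite_rng[OF f])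
    show "finite {\<gamma> \<in> \<Gamma>. rng \<gamma> = w'}" using \<Gamma> by simp
    fix \<gamma> assume g: "\<gamma> \<in> {\<gamma>. f \<gamma> \<noteq> 0 \<and> rng \<gamma> = w'} - {\<gamma> \<in> \<Gamma>. rng \<gamma> = w'}"
    then have "src \<gamma> \<notin> S" using loc[of \<gamma>] w' unfolding \<Gamma>_def by auto
    then show "character u (cocycle \<gamma>) * f \<gamma> * \<xi> (src \<gamma>) = 0" by (simp add: \<xi>_def)
  qed auto
  have "ell2_inner (R u f \<xi>) \<xi> = (\<Sum>\<^sub>\<infinity>w\<in>S. R u f \<xi> w * cnj (\<xi> w))"
    unfolding ell2_inner_def by (rule infsum_cong_neutral) (auto simp: \<xi>_def)
  also have "\<dots> = (\<Sum>w\<in>S. R u f \<xi> w * cnj (\<xi> w))" using S(1) by simp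
  also have "\<dots> = (\<Sum>w\<in>S. \<Sum>\<gamma>\<in>{\<gamma>\<in>\<Gamma>. rng \<gamma> = w}. t \<gamma>)"
    by (intro sum.cong refl) (simp add: Rv t_def sum_distrib_right)
  also have "\<dots> = sum t \<Gamma>" by (rule sum.group[OF \<Gamma> S(1)]) (auto simp: \<Gamma>_def)
  also have "\<dots> = (\<Sum>l\<in>\<Lambda>. \<Sum>\<gamma>\<in>{\<gamma>\<in>\<Gamma>. cocycle \<gamma> = l}. t \<gamma>)"
    by (rule sum.group[OF \<Gamma> \<Lambda>, symmetric]) (auto simp: \<Gamma>_def)
  finally have inner: "ell2_inner (R u f \<xi>) \<xi> = (\<Sum>l\<in>\<Lambda>. \<Sum>\<gamma>\<in>{\<gamma>\<in>\<Gamma>. cocycle \<gamma> = l}. t \<gamma>)" .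
  have M0: "0 \<le> M" using M norm_ge_zero order_trans by blast
  have each: "cmod ((\<Sum>\<gamma>\<in>{\<gamma>\<in>\<Gamma>. cocycle \<gamma> = l}. t \<gamma>) - character z l * a l) \<le> (1 + 2 * M) * \<delta>"
    if l: "l \<in> \<Lambda>" for l
  proof -
    let ?\<Gamma> = "{\<gamma>\<in>\<Gamma>. cocycle \<gamma> = l}"
    let ?b = "character z l * a l"
    have one: "cmod (t \<gamma> - ?b / n) \<le> (1 + M) * \<delta> / n" if g: "\<gamma> \<in> ?\<Gamma>" for \<gamma>
    proof -
      obtain w' w where \<gamma>: "\<gamma> = (w', l, w)" and w: "w \<in> S" "w' \<in> S" "rel l w' w"
        using g by (cases \<gamma>) (auto simp: \<Gamma>_def)
      define h where "h = l + mm w - mm w'"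
      have nn: "complex_of_real (1 / sqrt n) * complex_of_real (1 / sqrt n) = 1 / complex_of_real n"
        using n by (simp flip: of_real_mult)
      have "character u h = character u l * (character u (mm w) * cnj (character u (mm w')))"
        using character_add[OF u, of "l + mm w" "- mm w'"] character_add[OF u, of l "mm w"]
        by (simp add: h_def character_minus[OF u])
      moreover have "character z (l - h) = character z (mm w') * cnj (character z (mm w))"
        using character_add[OF z, of "mm w'" "- mm w"] by (simp add: h_def character_minus[OF z])
      ultimately have "character u l * d w * cnj (d w') = character u h * character z (l - h)"
        by (simp add: d_def mult_ac)
      moreover have "t \<gamma> = f \<gamma> * (character u l * d w * cnj (d w'))
          * (complex_of_real (1 / sqrt n) * complex_of_real (1 / sqrt n))"
        using w by (simp add: t_def \<gamma> \<xi>_def mult_ac)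
      ultimately have t: "t \<gamma> = f \<gamma> * (character u h * character z (l - h)) / n"
        unfolding nn by simp
      have zl: "character z l = character z h * character z (l - h)"
        using character_add[OF z, of h "l - h"] by simp
      have "f \<gamma> * (character u h * character z (l - h)) - ?b
          = ((f \<gamma> - a l) * character u h + a l * (character u h - character z h)) * character z (l - h)"
        by (simp add: zl algebra_simps)
      also have "cmod \<dots> \<le> cmod (f \<gamma> - a l) + cmod (a l) * cmod (character u h - character z h)"
        using norm_triangle_ineq[of "(f \<gamma> - a l) * character u h" "a l * (character u h - character z h)"] z u
        by (simp add: norm_mult)
      also have "\<dots> \<le> \<delta> + M * \<delta>"
        using var[OF l w] phase[OF l w] M[of l] \<delta> M0
        by (intro add_mono mult_mono) (simp_all add: h_def \<gamma>)
      finally have "cmod (f \<gamma> * (character u h * character z (l - h)) - ?b) \<le> (1 + M) * \<delta>"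
        by (simp add: algebra_simps)
      then have "cmod (f \<gamma> * (character u h * character z (l - h)) - ?b) / n \<le> (1 + M) * \<delta> / n"
        using n by (intro divide_right_mono) auto
      moreover have "t \<gamma> - ?b / n = (f \<gamma> * (character u h * character z (l - h)) - ?b) / n"
        by (simp add: t diff_divide_distrib)
      ultimately show ?thesis using n by (simp add: norm_divide)
    qed
    define N where "N = real (card ?\<Gamma>)"
    have inj: "inj_on src ?\<Gamma>"
    proof (rule inj_onI)
      fix \<gamma> \<eta> assume g: "\<gamma> \<in> ?\<Gamma>" "\<eta> \<in> ?\<Gamma>" "src \<gamma> = src \<eta>"
      then have "rng \<gamma> = rng \<eta>" using fn[OF l, of "src \<gamma>" "rng \<gamma>" "rng \<eta>"] by (auto simp: \<Gamma>_def)
      then show "\<gamma> = \<eta>" using g by (intro arrow_eqI) auto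
    qed
    have img: "src ` ?\<Gamma> = {w\<in>S. \<exists>w'\<in>S. rel l w' w}"
    proof (intro equalityI subsetI)
      fix w assume "w \<in> {w\<in>S. \<exists>w'\<in>S. rel l w' w}"
      then obtain w' where "w \<in> S" "w' \<in> S" "rel l w' w" by blast
      then have "(w', l, w) \<in> ?\<Gamma>" using l by (simp add: \<Gamma>_def)
      then show "w \<in> src ` ?\<Gamma>" by force
    qed (auto simp: \<Gamma>_def)
    have N1: "(1 - \<delta>) * n \<le> N"
      using count[OF l] card_image[OF inj] by (simp add: img N_def n_def)
    have "card (src ` ?\<Gamma>) \<le> card S" by (rule card_mono[OF S(1)]) (auto simp: \<Gamma>_def)
    then have N2: "N \<le> n" using card_image[OF inj] by (simp add: N_def n_def)
    have "cmod (sum t ?\<Gamma> - complex_of_real (N / n) * ?b) = cmod (\<Sum>\<gamma>\<in>?\<Gamma>. t \<gamma> - ?b / n)"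
      by (simp add: sum_subtractf N_def)
    also have "\<dots> \<le> (\<Sum>\<gamma>\<in>?\<Gamma>. (1 + M) * \<delta> / n)" by (rule sum_norm_le) (rule one)
    also have "\<dots> = N / n * ((1 + M) * \<delta>)" by (simp add: N_def)
    also have "\<dots> \<le> 1 * ((1 + M) * \<delta>)"
      using N2 n M0 \<delta> by (intro mult_right_mono) auto
    finally have 1: "cmod (sum t ?\<Gamma> - complex_of_real (N / n) * ?b) \<le> (1 + M) * \<delta>" by simp
    have "\<bar>N / n - 1\<bar> \<le> \<delta>" using N1 N2 n by (auto simp: abs_le_iff field_simps)
    moreover have "cmod ?b \<le> M" using M[of l] z by (simp add: norm_mult)
    ultimately have "\<bar>N / n - 1\<bar> * cmod ?b \<le> \<delta> * M" using \<delta> by (intro mult_mono) auto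
    moreover have "complex_of_real (N / n) * ?b - ?b = complex_of_real (N / n - 1) * ?b" by (simp add: algebra_simps)
    ultimately have 2: "cmod (complex_of_real (N / n) * ?b - ?b) \<le> \<delta> * M"
      by (simp only: norm_mult norm_of_real)
    have "cmod (sum t ?\<Gamma> - ?b) \<le> cmod (sum t ?\<Gamma> - complex_of_real (N / n) * ?b) + cmod (complex_of_real (N / n) * ?b - ?b)"
      using norm_triangle_ineq[of "sum t ?\<Gamma> - complex_of_real (N / n) * ?b" "complex_of_real (N / n) * ?b - ?b"] by simp
    also have "\<dots> \<le> (1 + M) * \<delta> + \<delta> * M" by (rule add_mono[OF 1 2])
    finally show ?thesis by (simp add: algebra_simps)
  qed
  have "cmod (ell2_inner (R u f \<xi>) \<xi> - (\<Sum>l\<in>\<Lambda>. character z l * a l))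
      = cmod (\<Sum>l\<in>\<Lambda>. (\<Sum>\<gamma>\<in>{\<gamma>\<in>\<Gamma>. cocycle \<gamma> = l}. t \<gamma>) - character z l * a l)"
    unfolding inner by (simp add: sum_subtractf)
  also have "\<dots> \<le> (\<Sum>l\<in>\<Lambda>. (1 + 2 * M) * \<delta>)" by (rule sum_norm_le) (rule each)
  also have "\<dots> = real (card \<Lambda>) * ((1 + 2 * M) * \<delta>)" by simp
  finally show ?thesis using xi by blast
qed

end

section \<open>Essential isotropy\<close>

context DR
begin

text \<open>\<open>T a\<close> and \<open>T b\<close> are open and continuous, so an open set that misses the orbit is carried to one
  that misses it.\<close>

lemma orbit_closure_invariant:
  assumes "v \<in> closure (orbit G y)" "T a w = T b v"
  shows "w \<in> closure (orbit G y)"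
proof (rule ccontr)
  let ?Y = "closure (orbit G y)"
  assume "w \<notin> ?Y"
  let ?O = "T b -` (T a ` (- ?Y))"
  have "open ?O" by (intro open_vimage_T open_image_T) auto
  moreover have "v \<in> ?O" using assms(2) \<open>w \<notin> ?Y\<close> by (metis ComplI imageI vimageI2)
  ultimately have "?O \<inter> orbit G y \<noteq> {}" using assms(1) open_Int_closure_eq_empty by blast
  then obtain v' w' where v: "v' \<in> orbit G y" "T b v' = T a w'" "w' \<notin> ?Y" by blast
  then have "(w', nat_diff a b, v') \<in> topspace G" unfolding arrow_iff by metis
  from orbit_arrow[OF this, of y] have "w' \<in> orbit G y" using v(1) by simp
  then show False using v(3) closure_subset by blast
qed

text \<open>Interior isotropy is carried along an orbit: if isotropy of degree \<open>nat_diff p q\<close> is present near some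
  point of the orbit of \<open>y\<close>, within the orbit closure, then conjugating by an arrow to \<open>y\<close> gives essential isotropy
  at \<open>y\<close>.\<close>

lemma essential_isotropy_transport:
  assumes y': "y' \<in> orbit G y" and W: "open W" "y' \<in> W"
    and fixed: "\<And>v. v \<in> W \<Longrightarrow> v \<in> closure (orbit G y) \<Longrightarrow> T p v = T q v"
  shows "(y, nat_diff p q, y) \<in> essential_isotropy_at G y"
proof -
  let ?Y = "closure (orbit G y)"
  obtain a b where ab: "T a y' = T b y" using y' orbit_iff by blast
  have y'Y: "y' \<in> ?Y" and yY: "y \<in> ?Y" using y' closure_subset orbit_self by blast+
  have pq: "T p y' = T q y'" by (rule fixed[OF W(2) y'Y])
  obtain N where N: "open N" "T p y' \<in> N" "inj_on (T a) N" using T_inj_nhd by metis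
  obtain I where I: "open I" "y' \<in> I" "inj_on (T p) I" using T_inj_nhd by metis
  obtain I' where I': "open I'" "y \<in> I'" "inj_on (T b) I'" using T_inj_nhd by metis
  define W' where "W' = W \<inter> I \<inter> T p -` N \<inter> T q -` N"
  have oW': "open W'" unfolding W'_def by (intro open_Int W I open_vimage_T N)
  have y'W': "y' \<in> W'" using W I N pq by (simp add: W'_def)
  define V where "V = I' \<inter> T b -` (T a ` W')"
  have oV: "open V" unfolding V_def by (intro open_Int I' open_vimage_T open_image_T oW')
  have yV: "y \<in> V" unfolding V_def using I' ab y'W' by (auto simp flip: ab)
  have c: "T (b + r) v = T a (T r w)" if "T a w = T b v" for r v w
    using that by (metis T_add add.commute)
  have nd: "nat_diff (b + p) (b + q) = nat_diff p q" by (simp add: nat_diff_eq_iff add_ac)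
  let ?O = "Z V (b + p) (b + q) V \<inter> {\<gamma>. rng \<gamma> \<in> ?Y \<and> src \<gamma> \<in> ?Y}"
  have "openin (reduction G ?Y) ?O"
    unfolding reduction_def openin_subtopology using openin_Z[OF oV oV] by blast
  moreover have "(y, nat_diff p q, y) \<in> ?O"
    using yV yY pq c[OF ab, of p] c[OF ab, of q] by (simp add: mem_Z nd)
  moreover have "?O \<subseteq> isotropy (reduction G ?Y)"
  proof
    fix \<gamma> assume g: "\<gamma> \<in> ?O"
    then obtain v1 v2 where v: "\<gamma> = (v1, nat_diff (b + p) (b + q), v2)" "v1 \<in> V" "v2 \<in> V"
      "T (b + p) v1 = T (b + q) v2" "v1 \<in> ?Y" "v2 \<in> ?Y" by (auto simp: DR_basic_def)
    obtain w1 w2 where w: "w1 \<in> W'" "T a w1 = T b v1" "w2 \<in> W'" "T a w2 = T b v2"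
      using v(2,3) by (auto simp: V_def)
    have wY: "w1 \<in> ?Y" "w2 \<in> ?Y"
      using orbit_closure_invariant[OF v(5) w(2)] orbit_closure_invariant[OF v(6) w(4)] by blast+
    have "T a (T p w1) = T a (T q w2)" using v(4) c[OF w(2), of p] c[OF w(4), of q] by simp
    moreover have "T p w1 \<in> N" "T q w2 \<in> N" using w by (simp_all add: W'_def)
    ultimately have "T p w1 = T q w2" using N(3) by (auto dest: inj_onD)
    also have "\<dots> = T p w2" using fixed[of w2] w(3) wY(2) by (simp add: W'_def)
    finally have "w1 = w2" using I(3) w(1,3) by (auto simp: W'_def dest: inj_onD)
    then have "T b v1 = T b v2" using w by metis
    then have "v1 = v2" using I'(3) v(2,3) by (auto simp: V_def dest: inj_onD)
    moreover have "\<gamma> \<in> topspace G" using g Z_subset by blast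
    ultimately show "\<gamma> \<in> isotropy (reduction G ?Y)"
      using g v(1) by (auto simp: isotropy_def reduction_def)
  qed
  ultimately have "(y, nat_diff p q, y) \<in> interior_isotropy (reduction G ?Y)"
    unfolding interior_isotropy_def interior_of_def by blast
  moreover have "(y, nat_diff p q, y) \<in> isotropy_at G y"
    using \<open>(y, nat_diff p q, y) \<in> ?O\<close> Z_subset unfolding isotropy_at_def isotropy_def by fastforce
  ultimately show ?thesis by (simp add: essential_isotropy_at_def)
qed

text \<open>For finitely many degrees, every point has orbit points nearby at which isotropy of these degrees is
  interior: in the orbit closure the set of points fixed by a given degree is closed,
  so one passes to an open subset on which it is everything or nothing.\<close>

lemma generic_orbit_point:
  assumes "finite Q" "open W0" "y \<in> W0"
  obtains y' where "y' \<in> orbit G y" "y' \<in> W0"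
    "\<And>h. h \<in> Q \<Longrightarrow> T (p h) y' = T (q h) y' \<Longrightarrow>
      \<exists>W. open W \<and> y' \<in> W \<and> (\<forall>v\<in>W. v \<in> closure (orbit G y) \<longrightarrow> T (p h) v = T (q h) v)"
proof -
  let ?Y = "closure (orbit G y)"
  have "\<exists>W. open W \<and> W \<subseteq> W0 \<and> W \<inter> orbit G y \<noteq> {} \<and>
      (\<forall>h\<in>Q. (\<forall>v\<in>W \<inter> ?Y. T (p h) v = T (q h) v) \<or> (\<forall>v\<in>W \<inter> ?Y. T (p h) v \<noteq> T (q h) v))"
    using assms(1)
  proof (induction Q rule: finite_induct)
    case empty
    show ?case using assms(2,3) by (intro exI[of _ W0]) auto
  next
    case (insert a Q)
    then obtain W where W: "open W" "W \<subseteq> W0" "W \<inter> orbit G y \<noteq> {}"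
      "\<forall>h\<in>Q. (\<forall>v\<in>W \<inter> ?Y. T (p h) v = T (q h) v) \<or> (\<forall>v\<in>W \<inter> ?Y. T (p h) v \<noteq> T (q h) v)" by blast
    show ?case
    proof (cases "\<forall>v\<in>W \<inter> ?Y. T (p a) v = T (q a) v")
      case True
      then show ?thesis using W by (intro exI[of _ W]) simp
    next
      case False
      let ?W = "W \<inter> {v. T (p a) v \<noteq> T (q a) v}"
      have oW: "open ?W" using W(1) T_cont by (intro open_Int open_Collect_neq) auto
      have "?W \<inter> ?Y \<noteq> {}" using False by blast
      then have "?W \<inter> orbit G y \<noteq> {}" using open_Int_closure_eq_empty[OF oW] by blast
      moreover have "\<forall>h\<in>insert a Q. (\<forall>v\<in>?W \<inter> ?Y. T (p h) v = T (q h) v) \<or> (\<forall>v\<in>?W \<inter> ?Y. T (p h) v \<noteq> T (q h) v)"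
        using W(4) by auto
      ultimately show ?thesis using W(2) oW by (intro exI[of _ ?W]) blast
    qed
  qed
  then obtain W where W: "open W" "W \<subseteq> W0" "W \<inter> orbit G y \<noteq> {}"
      "\<forall>h\<in>Q. (\<forall>v\<in>W \<inter> ?Y. T (p h) v = T (q h) v) \<or> (\<forall>v\<in>W \<inter> ?Y. T (p h) v \<noteq> T (q h) v)" by blast
  then obtain y' where y': "y' \<in> W" "y' \<in> orbit G y" by blast
  have yY: "y' \<in> ?Y" using y'(2) closure_subset by blast
  show ?thesis
  proof (rule that[OF y'(2)])
    show "y' \<in> W0" using y' W by blast
    fix h assume h: "h \<in> Q" "T (p h) y' = T (q h) y'"
    then have "\<forall>v\<in>W \<inter> ?Y. T (p h) v = T (q h) v" using W(4) y'(1) yY by blast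
    then show "\<exists>W. open W \<and> y' \<in> W \<and> (\<forall>v\<in>W. v \<in> ?Y \<longrightarrow> T (p h) v = T (q h) v)"
      using W(1) y'(1) by blast
  qed
qed

lemma essential_isotropy_subset: "essential_isotropy G \<subseteq> topspace G"
  by (auto simp: essential_isotropy_def essential_isotropy_at_def isotropy_at_def isotropy_def)

lemma closed_essential_isotropy:
  "closedin G (closed_essential_isotropy G)" "essential_isotropy G \<subseteq> closed_essential_isotropy G"
proof -
  have "subgroupoid G (topspace G)"
    unfolding subgroupoid_def using inv_topspace mult_topspace by blast
  then have "topspace G \<in> {H. subgroupoid G H \<and> closedin G H \<and> essential_isotropy G \<subseteq> H}"
    using essential_isotropy_subset by blast
  then show "closedin G (closed_essential_isotropy G)"
    unfolding closed_essential_isotropy_def by (intro closedin_Inter) blast+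
  show "essential_isotropy G \<subseteq> closed_essential_isotropy G"
    unfolding closed_essential_isotropy_def by blast
qed

section \<open>Comparison of vector functionals\<close>

text \<open>By compactness, only finitely many of the bisections through the isotropy of \<open>x\<close> carry those
  arrows of the support whose ends are both close to \<open>x\<close>.\<close>

lemma support_near_point:
  assumes f: "f \<in> Cc" and D: "\<And>m. (x, m, x) \<in> topspace G \<Longrightarrow> openin G (D m) \<and> (x, m, x) \<in> D m"
  obtains \<Lambda> N where "finite \<Lambda>" "\<And>l. l \<in> \<Lambda> \<Longrightarrow> (x, l, x) \<in> topspace G" "open N" "x \<in> N"
    "\<And>\<gamma>. f \<gamma> \<noteq> 0 \<Longrightarrow> rng \<gamma> \<in> N \<Longrightarrow> src \<gamma> \<in> N \<Longrightarrow> \<exists>l\<in>\<Lambda>. \<gamma> \<in> D l"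
proof -
  obtain K where K: "compactin G K" "\<forall>\<gamma>. f \<gamma> \<noteq> 0 \<longrightarrow> \<gamma> \<in> K" using f by (auto simp: Cc_iff)
  have KG: "K \<subseteq> topspace G" using K(1) by (rule compactin_subset_topspace)
  let ?I = "{m. (x, m, x) \<in> topspace G}"
  let ?A = "{\<gamma> \<in> topspace G. rng \<gamma> \<in> - {x} \<and> src \<gamma> \<in> UNIV \<and> cocycle \<gamma> \<in> UNIV}"
  let ?B = "{\<gamma> \<in> topspace G. rng \<gamma> \<in> UNIV \<and> src \<gamma> \<in> - {x} \<and> cocycle \<gamma> \<in> UNIV}"
  define P where "P = ?A \<union> ?B"
  have O: "openin G P"
    unfolding P_def by (intro openin_Un open_rng_src_preimage open_Compl closed_singleton open_UNIV)
  have cov0: "K \<subseteq> \<Union>(insert P (D ` ?I))"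
  proof
    fix \<gamma> assume "\<gamma> \<in> K"
    then have g: "\<gamma> \<in> topspace G" using KG by blast
    show "\<gamma> \<in> \<Union>(insert P (D ` ?I))"
    proof (cases "rng \<gamma> = x \<and> src \<gamma> = x")
      case True
      then have e: "(x, cocycle \<gamma>, x) = \<gamma>" by (intro arrow_eqI) auto
      then have i: "cocycle \<gamma> \<in> ?I" using g by simp
      then have "\<gamma> \<in> D (cocycle \<gamma>)" using D[of "cocycle \<gamma>"] e by simp
      with i show ?thesis by blast
    next
      case False then show ?thesis using g by (auto simp: P_def)
    qed
  qed
  have "\<exists>\<F>. finite \<F> \<and> \<F> \<subseteq> insert P (D ` ?I) \<and> K \<subseteq> \<Union>\<F>"
    by (rule compactinD[OF K(1) _ cov0]) (use O D in blast)
  then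
  obtain \<F> where \<F>: "finite \<F>" "\<F> \<subseteq> insert P (D ` ?I)" "K \<subseteq> \<Union>\<F>"
    by (elim exE conjE) (rule that)
  have fin: "finite (\<F> - {P})" using \<F>(1) by (rule finite_Diff)
  have sub: "\<F> - {P} \<subseteq> D ` ?I" using \<F>(2) by (simp only: Diff_subset_conv insert_is_Un[symmetric])
  from finite_subset_image[OF fin sub]
  obtain \<Lambda> where \<Lambda>: "\<Lambda> \<subseteq> ?I" "finite \<Lambda>" "\<F> - {P} = D ` \<Lambda>"
    by (elim exE conjE) (rule that)
  let ?U = "\<Union>(D ` \<Lambda>)"
  have cov: "K \<subseteq> P \<union> ?U" using \<F>(3) \<Lambda>(3) by blast
  have oU: "openin G ?U" using D \<Lambda>(1) by (intro openin_Union) blast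
  have C: "compactin G (K - ?U)"
    using closed_compactin[OF K(1), of "K - ?U"] closedin_diff[OF compactin_imp_closedin[OF Hausdorff_G K(1)] oU]
    by blast
  have "continuous_map G (prod_topology euclidean euclidean) (\<lambda>\<gamma>. (rng \<gamma>, src \<gamma>))"
    unfolding continuous_map_paired using continuous_rng continuous_src by blast
  from image_compactin[OF C this] have "compact ((\<lambda>\<gamma>. (rng \<gamma>, src \<gamma>)) ` (K - ?U))" by simp
  define E where "E = (\<lambda>\<gamma>. (rng \<gamma>, src \<gamma>)) ` (K - ?U)"
  have "open (- E)" unfolding E_def by (intro open_Compl compact_imp_closed) fact
  moreover have "(x, x) \<in> - E"
  proof
    assume "(x, x) \<in> E"
    then obtain \<gamma> where "\<gamma> \<in> K - ?U" "rng \<gamma> = x" "src \<gamma> = x" unfolding E_def by force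
    then have "\<gamma> \<in> P" using cov by blast
    then show False unfolding P_def using \<open>rng \<gamma> = x\<close> \<open>src \<gamma> = x\<close> by simp
  qed
  ultimately obtain A B where AB: "open A" "open B" "(x, x) \<in> A \<times> B" "A \<times> B \<subseteq> - E"
    by (rule open_prod_elim)
  show ?thesis
  proof (rule that[OF \<Lambda>(2)])
    show "(x, l, x) \<in> topspace G" if "l \<in> \<Lambda>" for l using \<Lambda>(1) that by blast
    show "open (A \<inter> B)" "x \<in> A \<inter> B" using AB by auto
    fix \<gamma> assume "f \<gamma> \<noteq> 0" and N: "rng \<gamma> \<in> A \<inter> B" "src \<gamma> \<in> A \<inter> B"
    then have "\<gamma> \<in> K" using K(2) by blast
    moreover have "(rng \<gamma>, src \<gamma>) \<in> A \<times> B" using N by blast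
    ultimately have "\<gamma> \<in> ?U" using AB(4) unfolding E_def by blast
    then show "\<exists>l\<in>\<Lambda>. \<gamma> \<in> D l" by blast
  qed
qed

lemma continuous_on_character: "continuous_on torus (\<lambda>v. character v n)"
  unfolding character_def
  by (intro continuous_intros) (auto simp: torus_nonzero)


abbreviation J where "J \<equiv> closed_essential_isotropy G"
abbreviation J_at where "J_at \<equiv> closed_essential_isotropy_at G"

text \<open>\<open>P\<close> holds on the saturation of some neighbourhood of \<open>(x, z)\<close>. The neighbourhoods in this sense
  are directed, which is all that is needed to pass to open sets generated by a subbasis.\<close>

definition near_saturated ::
    "(('x, 'k) arrow \<Rightarrow> ('x, 'k) arrow set) \<Rightarrow> 'x \<Rightarrow> complex^'k \<Rightarrow> ('x \<Rightarrow> complex^'k \<Rightarrow> bool) \<Rightarrow> bool" where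
  "near_saturated B x z P \<longleftrightarrow> (\<exists>U V. open U \<and> x \<in> U \<and> openin (top_of_set torus) V \<and> z \<in> V \<and>
     (\<forall>y\<in>U. \<forall>v\<in>V. \<forall>w. (y, w) \<in> annihilator (family_ess G (J_at x) B) \<longrightarrow> P y (v * w)))"

lemma near_saturatedI:
  assumes "open U" "x \<in> U" "openin (top_of_set torus) V" "z \<in> V"
    and "\<And>y v w. y \<in> U \<Longrightarrow> v \<in> V \<Longrightarrow> (y, w) \<in> annihilator (family_ess G (J_at x) B) \<Longrightarrow> P y (v * w)"
  shows "near_saturated B x z P"
  using assms unfolding near_saturated_def by blast

lemma near_saturatedE:
  assumes "near_saturated B x z P"
  obtains U V where "open U" "x \<in> U" "openin (top_of_set torus) V" "z \<in> V"
    "\<And>y v w. y \<in> U \<Longrightarrow> v \<in> V \<Longrightarrow> (y, w) \<in> annihilator (family_ess G (J_at x) B) \<Longrightarrow>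
      v * w \<in> torus \<and> P y (v * w)"
proof -
  obtain U V where U: "open U" "x \<in> U" "openin (top_of_set torus) V" "z \<in> V"
    "\<forall>y\<in>U. \<forall>v\<in>V. \<forall>w. (y, w) \<in> annihilator (family_ess G (J_at x) B) \<longrightarrow> P y (v * w)"
    using assms unfolding near_saturated_def by (elim exE conjE) (rule that)
  show ?thesis
  proof (rule that[OF U(1-4)])
    fix y v w assume *: "y \<in> U" "v \<in> V" "(y, w) \<in> annihilator (family_ess G (J_at x) B)"
    then have "v * w \<in> torus"
      using openin_subset[OF U(3)] by (auto simp: annihilator_def intro!: torus_mult)
    then show "v * w \<in> torus \<and> P y (v * w)" using U(5) * by blast
  qed
qed

lemma near_saturated_mono:
  assumes "near_saturated B x z P" "\<And>y u. u \<in> torus \<Longrightarrow> P y u \<Longrightarrow> P' y u"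
  shows "near_saturated B x z P'"
  using assms(1)
proof (rule near_saturatedE)
  fix U V assume *: "open U" "x \<in> U" "openin (top_of_set torus) V" "z \<in> V"
    "\<And>y v w. y \<in> U \<Longrightarrow> v \<in> V \<Longrightarrow> (y, w) \<in> annihilator (family_ess G (J_at x) B) \<Longrightarrow>
      v * w \<in> torus \<and> P y (v * w)"
  show ?thesis by (rule near_saturatedI[OF *(1-4)]) (use *(5) assms(2) in blast)
qed

lemma near_saturated_conj:
  assumes "near_saturated B x z P" "near_saturated B x z P'"
  shows "near_saturated B x z (\<lambda>y u. P y u \<and> P' y u)"
proof -
  obtain U V where 1: "open U" "x \<in> U" "openin (top_of_set torus) V" "z \<in> V"
    "\<And>y v w. y \<in> U \<Longrightarrow> v \<in> V \<Longrightarrow> (y, w) \<in> annihilator (family_ess G (J_at x) B) \<Longrightarrow>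
      v * w \<in> torus \<and> P y (v * w)" using near_saturatedE[OF assms(1)] by metis
  obtain U' V' where 2: "open U'" "x \<in> U'" "openin (top_of_set torus) V'" "z \<in> V'"
    "\<And>y v w. y \<in> U' \<Longrightarrow> v \<in> V' \<Longrightarrow> (y, w) \<in> annihilator (family_ess G (J_at x) B) \<Longrightarrow>
      v * w \<in> torus \<and> P' y (v * w)" using near_saturatedE[OF assms(2)] by metis
  show ?thesis
    by (rule near_saturatedI[of "U \<inter> U'" x "V \<inter> V'"])
       (use 1 2 in \<open>simp_all add: open_Int openin_Int\<close>)
qed

text \<open>Write \<open>m \<cdot> w\<close> for the end of the arrow of degree \<open>m\<close> at \<open>w\<close> near the isotropy arrow
  \<open>(x, m, x)\<close>. For \<open>y\<close> close to \<open>x\<close> one picks a generic \<open>y\<^sub>0\<close> in the orbit of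
  \<open>y\<close>, close to \<open>y\<close>, and applies \<open>almost_invariant_vector\<close> to the points
  \<open>m \<cdot> y\<^sub>0\<close> with \<open>m\<close> in a box. Their number grows polynomially with the box, so some box of bounded
  size gives an almost invariant set. A loop at \<open>y\<^sub>0\<close> of bounded degree \<open>h\<close> is interior isotropy, hence
  gives essential isotropy at \<open>y\<close>. That forces \<open>(x, h, x)\<close> to be in \<open>J\<close>, as \<open>J\<close> is closed,
  and so \<open>(y, h, y)\<close> lies in the given bisection at \<open>(x, h, x)\<close>; this is where the annihilator makes
  \<open>w ^ h = 1\<close>.\<close>

lemma orbit_functional_approx:
  fixes B :: "('x, 'k) arrow \<Rightarrow> ('x, 'k) arrow set"
  assumes z: "z \<in> torus" and f: "f \<in> Cc" and \<epsilon>: "0 < \<epsilon>"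
    and B: "\<And>\<alpha>. \<alpha> \<in> J_at x \<Longrightarrow> openin G (B \<alpha>) \<and> \<alpha> \<in> B \<alpha>"
  shows "near_saturated B x z (\<lambda>y u. \<exists>\<xi>\<in>ell2 (orbit G y). ell2_norm \<xi> \<le> 1 \<and>
      cmod (ell2_inner (R u f \<xi>) \<xi> - R z f (indicator {x}) x) \<le> \<epsilon>)"
proof -
  define K where "K = {m. (x, m, x) \<in> topspace G}"
  have "\<forall>m. \<exists>p q. m \<in> K \<longrightarrow> m = nat_diff p q \<and> T p x = T q x" by (auto simp: K_def arrow_iff)
  then obtain p q where pq: "\<And>m. m \<in> K \<Longrightarrow> m = nat_diff (p m) (q m) \<and> T (p m) x = T (q m) x" by metis
  have nd: "nat_diff (p m) (q m) = m" and pqx: "T (p m) x = T (q m) x" if "m \<in> K" for m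
    using pq[OF that] by metis+
  have K0: "0 \<in> K" using unit_topspace[of x] by (simp add: K_def unit_arrow_def)
  have Kadd: "m + l \<in> K" if "m \<in> K" "l \<in> K" for m l
    using mult_topspace[of "(x, m, x)" "(x, l, x)"] that by (simp add: K_def)
  have Kminus: "- m \<in> K" if "m \<in> K" for m
    using inv_topspace[of "(x, m, x)"] that by (simp add: K_def)
  \<comment> \<open>Near an isotropy arrow of \<open>x\<close> outside \<open>J\<close>, no arrow is in \<open>J\<close>; near the others, all
    arrows are in the given bisection.\<close>
  define W where "W m = (if (x, m, x) \<in> J then B (x, m, x) else topspace G - J)" for m
  have Jat: "(x, m, x) \<in> J_at x" if "m \<in> K" "(x, m, x) \<in> J" for m
    using that by (simp add: closed_essential_isotropy_at_def isotropy_at_def isotropy_def K_def)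
  have W: "openin G (W m)" "(x, m, x) \<in> W m" if "m \<in> K" for m
    using B[OF Jat[OF that]] that closed_essential_isotropy(1)
    by (auto simp: W_def K_def openin_diff)
  have "\<exists>U. open U \<and> x \<in> U \<and> inj_on (T (p m)) U \<and> inj_on (T (q m)) U \<and> Z U (p m) (q m) U \<subseteq> W m"
    if m: "m \<in> K" for m
  proof -
    have "(x, nat_diff (p m) (q m), x) \<in> W m" using W(2)[OF m] nd[OF m] pqx[OF m] by simp
    then obtain U V where U: "open U" "open V" "x \<in> U" "x \<in> V" "Z U (p m) (q m) V \<subseteq> W m"
      "inj_on (T (p m)) U" "inj_on (T (q m)) V"
      using chart[OF W(1)[OF m]] nd[OF m] pqx[OF m] by metis
    have "Z (U \<inter> V) (p m) (q m) (U \<inter> V) \<subseteq> W m" using U(5) Z_mono[of "U \<inter> V" U "U \<inter> V" V] by blast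
    then show ?thesis using U by (intro exI[of _ "U \<inter> V"]) (auto intro: inj_on_subset)
  qed
  then obtain U where U: "\<And>m. m \<in> K \<Longrightarrow> open (U m) \<and> x \<in> U m \<and> inj_on (T (p m)) (U m) \<and>
      inj_on (T (q m)) (U m) \<and> Z (U m) (p m) (q m) (U m) \<subseteq> W m" by metis
  define rel where "rel m w y \<longleftrightarrow> T (p m) w = T (q m) y" for m w y
  define D where "D m = Z (U m) (p m) (q m) (U m)" for m
  have memD: "(w, n, y) \<in> D m \<longleftrightarrow> n = m \<and> w \<in> U m \<and> y \<in> U m \<and> rel m w y" if "m \<in> K" for m n w y
    using nd[OF that] pqx[OF that] by (simp add: D_def mem_Z rel_def)
  obtain \<Lambda> N where \<Lambda>: "finite \<Lambda>" "\<And>l. l \<in> \<Lambda> \<Longrightarrow> l \<in> K" and N: "open N" "x \<in> N"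
    "\<And>\<gamma>. f \<gamma> \<noteq> 0 \<Longrightarrow> rng \<gamma> \<in> N \<Longrightarrow> src \<gamma> \<in> N \<Longrightarrow> \<exists>l\<in>\<Lambda>. \<gamma> \<in> D l"
  proof (rule support_near_point[OF f, of x D])
    fix m assume "(x, m, x) \<in> topspace G"
    then have m: "m \<in> K" by (simp add: K_def)
    show "openin G (D m) \<and> (x, m, x) \<in> D m"
      using U[OF m] nd[OF m] pqx[OF m] memD[OF m] unfolding D_def by (simp add: openin_Z rel_def)
  qed (rule that, simp_all add: K_def)
  obtain M where M: "0 < M" "\<And>\<gamma>. cmod (f \<gamma>) \<le> M" using Cc_bounded[OF f] by metis
  \<comment> \<open>Chosen so that the total error of the almost invariant vector is at most \<open>\<epsilon>\<close>.\<close>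
  define \<delta> where "\<delta> = \<epsilon> / (real (card \<Lambda> + 1) * (1 + 2 * M))"
  have \<delta>: "0 < \<delta>" using \<epsilon> M(1) by (simp add: \<delta>_def)
  have \<delta>\<epsilon>: "real (card \<Lambda>) * ((1 + 2 * M) * \<delta>) \<le> \<epsilon>"
  proof -
    have "real (card \<Lambda>) * ((1 + 2 * M) * \<delta>) \<le> real (card \<Lambda> + 1) * ((1 + 2 * M) * \<delta>)"
      using \<delta> M(1) by (intro mult_right_mono) auto
    also have "\<dots> = \<epsilon>" using M(1) by (simp add: \<delta>_def)
    finally show ?thesis .
  qed
  define r where "r = nat (\<Sum>l\<in>\<Lambda>. \<Sum>i\<in>UNIV. \<bar>l $ i\<bar>)"
  have r: "\<bar>l $ i\<bar> \<le> int r" if "l \<in> \<Lambda>" for l i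
  proof -
    have "\<bar>l $ i\<bar> \<le> (\<Sum>i\<in>UNIV. \<bar>l $ i\<bar>)" by (rule member_le_sum) auto
    also have "\<dots> \<le> (\<Sum>l\<in>\<Lambda>. \<Sum>i\<in>UNIV. \<bar>l $ i\<bar>)"
      by (rule member_le_sum[OF that _ \<Lambda>(1)]) (simp add: sum_nonneg)
    finally have "\<bar>l $ i\<bar> \<le> (\<Sum>l\<in>\<Lambda>. \<Sum>i\<in>UNIV. \<bar>l $ i\<bar>)" .
    moreover have "0 \<le> (\<Sum>l\<in>\<Lambda>. \<Sum>i\<in>UNIV. \<bar>l $ i\<bar>)" by (simp add: sum_nonneg)
    ultimately show ?thesis by (simp add: r_def)
  qed
  obtain Jn where Jn: "\<And>s :: nat \<Rightarrow> nat. 1 \<le> s 0 \<Longrightarrow> (\<And>j. j \<le> Jn \<Longrightarrow> s j \<le> (2 * (j * r) + 1) ^ CARD('k)) \<Longrightarrow>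
      \<exists>j<Jn. real (s (Suc j)) \<le> (1 + \<delta>) * real (s j)"
    using polynomial_growth_step[OF \<delta>] by metis
  define box where "box s = {m \<in> K. \<forall>i. \<bar>m $ i\<bar> \<le> int s}" for s
  \<comment> \<open>Degrees \<open>l + m - m'\<close> with \<open>l\<close> in \<open>\<Lambda>\<close> and \<open>m, m'\<close> in boxes
    of size at most \<open>(Jn + 1) r\<close>, and all intermediate ones, are bounded by \<open>b\<close>.\<close>
  define b where "b = 3 * (Jn + 1) * r"
  define Q where "Q = box b"
  have finbox: "finite (box s)" "card (box s) \<le> (2 * s + 1) ^ CARD('k)" for s
  proof -
    have s: "box s \<subseteq> {m. \<forall>i. \<bar>m $ i\<bar> \<le> int s}" by (auto simp: box_def)
    show "finite (box s)" by (rule finite_subset[OF s box_card(1)])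
    show "card (box s) \<le> (2 * s + 1) ^ CARD('k)" using card_mono[OF box_card(1) s] box_card(2) by (rule order_trans)
  qed
  have Qfin: "finite Q" unfolding Q_def by (rule finbox)
  have QK: "m \<in> K" if "m \<in> Q" for m using that by (simp add: Q_def box_def)
  have boxQ: "m \<in> Q" if "m \<in> box s" "s \<le> b" for m s
    using that by (auto simp: Q_def box_def intro: order_trans)
  have boxadd: "m + l \<in> box (s + s')" if "m \<in> box s" "l \<in> box s'" for m l s s'
  proof -
    have "\<bar>m $ i + l $ i\<bar> \<le> int s + int s'" for i
      using that abs_triangle_ineq[of "m $ i" "l $ i"] unfolding box_def
      by (smt (verit) mem_Collect_eq)
    then show ?thesis using that Kadd by (simp add: box_def)
  qed
  have boxminus: "- m \<in> box s" if "m \<in> box s" for m s using that Kminus by (auto simp: box_def)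
  have \<Lambda>box: "l \<in> box r" if "l \<in> \<Lambda>" for l using that \<Lambda>(2) r by (simp add: box_def)
  have rb: "r \<le> b" by (simp add: b_def)
  have \<Lambda>Q: "l \<in> Q" if "l \<in> \<Lambda>" for l by (rule boxQ[OF \<Lambda>box[OF that] rb])
  have TT: "T (a + c) w = T (a' + c') v" if "T a w = T a' y" "T c y = T c' v" for a a' c c' w y v
    using that by (metis T_add add.commute)
  have "\<exists>N. open N \<and> x \<in> N \<and> (\<forall>m\<in>Q. N \<subseteq> U m)"
    by (rule finite_nhd[OF Qfin]) (use U QK in blast)+
  then obtain N1 where N1: "open N1" "x \<in> N1" "\<And>m. m \<in> Q \<Longrightarrow> N1 \<subseteq> U m" by blast
  have "\<exists>N. open N \<and> x \<in> N \<and> (\<forall>ml\<in>Q \<times> Q. \<forall>w\<in>N. \<forall>y\<in>N. \<forall>v\<in>N.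
      rel (fst ml) w y \<longrightarrow> rel (snd ml) y v \<longrightarrow> rel (fst ml + snd ml) w v)"
  proof (rule finite_nhd)
    show "finite (Q \<times> Q)" using Qfin by simp
    fix ml assume "ml \<in> Q \<times> Q"
    then obtain m l where ml: "ml = (m, l)" "m \<in> K" "l \<in> K" using QK by auto
    have e: "T (p (m + l)) x = T (q (m + l)) x"
      "nat_diff (p (m + l)) (q (m + l)) = nat_diff (p m + p l) (q m + q l)"
      using nd[OF Kadd[OF ml(2,3)]] pqx[OF Kadd[OF ml(2,3)]] nd[OF ml(2)] pqx[OF ml(2)] nd[OF ml(3)] pqx[OF ml(3)] nat_diff_add by metis+
    obtain A C where A: "open A" "open C" "x \<in> A" "x \<in> C"
      "\<And>x' y'. x' \<in> A \<Longrightarrow> y' \<in> C \<Longrightarrow> T (p m + p l) x' = T (q m + q l) y' \<Longrightarrow> T (p (m + l)) x' = T (q (m + l)) y'"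
      using exponents_comparable[OF e] by metis
    have "rel (m + l) w v" if "w \<in> A \<inter> C" "v \<in> A \<inter> C" "rel m w y" "rel l y v" for w y v
      using A(5)[of w v] TT[of "p m" w "q m" y "p l" "q l" v] that by (simp add: rel_def)
    then show "\<exists>N. open N \<and> x \<in> N \<and> (\<forall>w\<in>N. \<forall>y\<in>N. \<forall>v\<in>N.
        rel (fst ml) w y \<longrightarrow> rel (snd ml) y v \<longrightarrow> rel (fst ml + snd ml) w v)"
      unfolding ml(1) fst_conv snd_conv
      using A(1-4) by (intro exI[of _ "A \<inter> C"] conjI open_Int) auto
  qed blast
  then obtain N2 where N2: "open N2" "x \<in> N2" "\<And>m l w y v. m \<in> Q \<Longrightarrow> l \<in> Q \<Longrightarrow> w \<in> N2 \<Longrightarrow> y \<in> N2 \<Longrightarrow> v \<in> N2 \<Longrightarrow>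
      rel m w y \<Longrightarrow> rel l y v \<Longrightarrow> rel (m + l) w v" by force
  have "\<exists>N. open N \<and> x \<in> N \<and> (\<forall>m\<in>Q. \<forall>w\<in>N. \<forall>y\<in>N. rel m w y \<longrightarrow> rel (- m) y w)"
  proof (rule finite_nhd[OF Qfin])
    fix m assume "m \<in> Q"
    then have m: "m \<in> K" by (rule QK)
    have e: "T (p (- m)) x = T (q (- m)) x" "nat_diff (p (- m)) (q (- m)) = nat_diff (q m) (p m)"
      using nd[OF Kminus[OF m]] pqx[OF Kminus[OF m]] nd[OF m] pqx[OF m] nat_diff_minus by metis+
    obtain A C where A: "open A" "open C" "x \<in> A" "x \<in> C"
      "\<And>x' y'. x' \<in> A \<Longrightarrow> y' \<in> C \<Longrightarrow> T (q m) x' = T (p m) y' \<Longrightarrow> T (p (- m)) x' = T (q (- m)) y'"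
      using exponents_comparable[OF e] by metis
    have "rel (- m) y w" if "w \<in> A \<inter> C" "y \<in> A \<inter> C" "rel m w y" for w y
      using A(5)[of y w] that by (simp add: rel_def)
    then show "\<exists>N. open N \<and> x \<in> N \<and> (\<forall>w\<in>N. \<forall>y\<in>N. rel m w y \<longrightarrow> rel (- m) y w)"
      using A(1-4) by (intro exI[of _ "A \<inter> C"] conjI open_Int) auto
  qed blast
  then obtain N3 where N3: "open N3" "x \<in> N3" "\<And>m w y. m \<in> Q \<Longrightarrow> w \<in> N3 \<Longrightarrow> y \<in> N3 \<Longrightarrow> rel m w y \<Longrightarrow> rel (- m) y w"
    by blast
  have "\<exists>N. open N \<and> x \<in> N \<and> (\<forall>l\<in>\<Lambda>. \<forall>\<gamma>\<in>Z N (p l) (q l) N. cmod (f \<gamma> - f (x, l, x)) \<le> \<delta>)"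
  proof (rule finite_nhd[OF \<Lambda>(1)])
    fix l assume "l \<in> \<Lambda>"
    then have l: "l \<in> K" by (rule \<Lambda>(2))
    let ?P = "{\<gamma> \<in> topspace G. f \<gamma> \<in> ball (f (x, l, x)) \<delta>}"
    have o: "openin G ?P"
      by (rule openin_continuous_map_preimage[OF Cc_continuous[OF f]]) (simp flip: open_openin)
    have xP: "(x, nat_diff (p l) (q l), x) \<in> ?P" using l \<delta> by (simp add: K_def nd)
    from basic_nhd[OF o xP pqx[OF l]]
    obtain A C where A: "open A" "open C" "x \<in> A" "x \<in> C" "Z A (p l) (q l) C \<subseteq> ?P"
      by (elim exE conjE) (rule that)
    have s: "Z (A \<inter> C) (p l) (q l) (A \<inter> C) \<subseteq> ?P" using A(5) Z_mono[of "A \<inter> C" A "A \<inter> C" C] by blast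
    have "cmod (f \<gamma> - f (x, l, x)) \<le> \<delta>" if "\<gamma> \<in> Z (A \<inter> C) (p l) (q l) (A \<inter> C)" for \<gamma>
      using subsetD[OF s that] by (simp add: dist_norm norm_minus_commute)
    then show "\<exists>N. open N \<and> x \<in> N \<and> (\<forall>\<gamma>\<in>Z N (p l) (q l) N. cmod (f \<gamma> - f (x, l, x)) \<le> \<delta>)"
      using A by (intro exI[of _ "A \<inter> C"]) (simp add: open_Int)
  next
    fix m N N' assume "\<forall>\<gamma>\<in>Z N (p m) (q m) N. cmod (f \<gamma> - f (x, m, x)) \<le> \<delta>" "N' \<subseteq> N"
    then show "\<forall>\<gamma>\<in>Z N' (p m) (q m) N'. cmod (f \<gamma> - f (x, m, x)) \<le> \<delta>" using Z_mono[of N' N N' N] by blast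
  qed
  then obtain N4 where N4: "open N4" "x \<in> N4"
    "\<And>l \<gamma>. l \<in> \<Lambda> \<Longrightarrow> \<gamma> \<in> Z N4 (p l) (q l) N4 \<Longrightarrow> cmod (f \<gamma> - f (x, l, x)) \<le> \<delta>" by blast
  define N0 where "N0 = N \<inter> N1 \<inter> N2 \<inter> N3 \<inter> N4"
  have N0: "open N0" "x \<in> N0" using N N1 N2 N3 N4 by (simp_all add: N0_def open_Int)
  \<comment> \<open>The points to which every degree in \<open>Q\<close> can be applied without leaving \<open>N0\<close>.\<close>
  define Y where "Y = N0 \<inter> (\<Inter>m\<in>Q. T (q m) -` (T (p m) ` N0))"
  have oY: "open Y" unfolding Y_def by (intro open_Int N0(1) open_INT Qfin ballI open_vimage_T open_image_T)
  have xY: "x \<in> Y" unfolding Y_def using N0(2) nd[OF QK] pqx[OF QK] by force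
  define V where "V = (\<Inter>h\<in>Q. {v \<in> torus. character v h \<in> ball (character z h) \<delta>}) \<inter> topspace (top_of_set torus)"
  have oV: "openin (top_of_set torus) V"
    unfolding V_def
  proof (rule openin_INT[OF Qfin])
    fix h
    have "openin (top_of_set torus) (torus \<inter> (\<lambda>v. character v h) -` ball (character z h) \<delta>)"
      by (rule continuous_openin_preimage_gen[OF continuous_on_character]) simp
    moreover have "torus \<inter> (\<lambda>v. character v h) -` ball (character z h) \<delta> = {v \<in> torus. character v h \<in> ball (character z h) \<delta>}"
      by auto
    ultimately show "openin (top_of_set torus) {v \<in> torus. character v h \<in> ball (character z h) \<delta>}" by simp
  qed
  have zV: "z \<in> V" using z \<delta> by (simp add: V_def)
  have "\<exists>\<xi>\<in>ell2 (orbit G y). ell2_norm \<xi> \<le> 1 \<and>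
          cmod (ell2_inner (R (v * w) f \<xi>) \<xi> - R z f (indicator {x}) x) \<le> \<epsilon>"
    if y: "y \<in> Y" and v: "v \<in> V" and w: "(y, w) \<in> annihilator (family_ess G (J_at x) B)" for y v w
  proof -
    have wt: "w \<in> torus" using w by (simp add: annihilator_def)
    have vt: "v \<in> torus" using v by (simp add: V_def)
    note ut = torus_mult[OF vt wt]
    let ?F = "{h \<in> Q. \<not> rel h y y}"
    \<comment> \<open>Near \<open>y\<close>, a loop of degree \<open>h\<close> can only occur if there is one at \<open>y\<close> itself.\<close>
    define W0 where "W0 = Y \<inter> (\<Inter>h\<in>?F. {v. T (p h) v \<noteq> T (q h) v})"
    have oW0: "open W0"
      unfolding W0_def using Qfin T_cont by (intro open_Int oY open_INT ballI open_Collect_neq) auto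
    have yW0: "y \<in> W0" using y by (auto simp: W0_def rel_def)
    obtain y0 where y0: "y0 \<in> orbit G y" "y0 \<in> W0"
      "\<And>h. h \<in> Q \<Longrightarrow> T (p h) y0 = T (q h) y0 \<Longrightarrow>
        \<exists>W. open W \<and> y0 \<in> W \<and> (\<forall>v\<in>W. v \<in> closure (orbit G y) \<longrightarrow> T (p h) v = T (q h) v)"
      by (rule generic_orbit_point[OF Qfin oW0 yW0, of p q]) (rule that, assumption+)
    have y0Y: "y0 \<in> Y" using y0(2) by (simp add: W0_def)
    then have y0N: "y0 \<in> N0" by (simp add: Y_def)
    have key: "character w h = 1" if h: "h \<in> Q" and fx: "rel h y0 y0" for h
    proof -
      have hK: "h \<in> K" by (rule QK[OF h])
      have ry: "rel h y y" using y0(2) fx h by (auto simp: W0_def rel_def)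
      obtain W' where W': "open W'" "y0 \<in> W'" "\<And>v. v \<in> W' \<Longrightarrow> v \<in> closure (orbit G y) \<Longrightarrow> T (p h) v = T (q h) v"
        using y0(3)[OF h] fx unfolding rel_def by blast
      from essential_isotropy_transport[OF y0(1) W'(1,2,3)]
      have "(y, h, y) \<in> essential_isotropy_at G y" using nd[OF hK] pqx[OF hK] by simp
      then have ess: "(y, h, y) \<in> essential_isotropy G" by (auto simp: essential_isotropy_def)
      then have inJ: "(y, h, y) \<in> J" using closed_essential_isotropy(2) by blast
      have "y \<in> U h" using y N1(3)[OF h] by (auto simp: Y_def N0_def)
      then have "(y, h, y) \<in> D h" using memD[OF hK] ry by simp
      then have inW: "(y, h, y) \<in> W h" using U[OF hK] unfolding D_def by blast
      then have xJ: "(x, h, x) \<in> J" using inJ by (auto simp: W_def split: if_splits)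
      then have "(y, h, y) \<in> B (x, h, x)" using inW by (simp add: W_def)
      then have "(y, h, y) \<in> family_ess G (J_at x) B"
        using ess Jat[OF hK xJ] unfolding family_ess_def by blast
      moreover have "\<forall>\<gamma>\<in>family_ess G (J_at x) B. src \<gamma> = y \<longrightarrow> character w (cocycle \<gamma>) = 1"
        using w unfolding annihilator_def by blast
      ultimately have "src (y, h, y) = y \<longrightarrow> character w (cocycle (y, h, y)) = 1" by (rule bspec[rotated])
      then show ?thesis by simp
    qed
    have "\<exists>w'\<in>N0. rel m w' y0" if "m \<in> Q" for m
    proof -
      have "T (q m) y0 \<in> T (p m) ` N0" using y0Y that unfolding Y_def by blast
      then obtain w' where "w' \<in> N0" "T (q m) y0 = T (p m) w'" by blast
      then show ?thesis unfolding rel_def by metis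
    qed
    then obtain g where g: "\<And>m. m \<in> Q \<Longrightarrow> g m \<in> N0 \<and> rel m (g m) y0" by metis
    have uniq: "w1 = w2" if "m \<in> Q" "w1 \<in> N0" "w2 \<in> N0" "rel m w1 v" "rel m w2 v" for m w1 w2 v
    proof -
      have "inj_on (T (p m)) (U m)" using U[OF QK[OF that(1)]] by blast
      moreover have "w1 \<in> U m" "w2 \<in> U m" using N1(3)[OF that(1)] that(2,3) by (auto simp: N0_def)
      moreover have "T (p m) w1 = T (p m) w2" using that(4,5) by (simp add: rel_def)
      ultimately show ?thesis by (auto dest: inj_onD)
    qed
    have uniq': "v1 = v2" if "m \<in> Q" "v1 \<in> N0" "v2 \<in> N0" "rel m w v1" "rel m w v2" for m v1 v2 w
    proof -
      have "inj_on (T (q m)) (U m)" using U[OF QK[OF that(1)]] by blast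
      moreover have "v1 \<in> U m" "v2 \<in> U m" using N1(3)[OF that(1)] that(2,3) by (auto simp: N0_def)
      moreover have "T (q m) v1 = T (q m) v2" using that(4,5) by (simp add: rel_def)
      ultimately show ?thesis by (auto dest: inj_onD)
    qed
    have comp: "rel (m + l) w1 w3" if "m \<in> Q" "l \<in> Q" "w1 \<in> N0" "w2 \<in> N0" "w3 \<in> N0" "rel m w1 w2" "rel l w2 w3" for m l w1 w2 w3
      using N2(3)[OF that(1,2) _ _ _ that(6,7)] that by (simp add: N0_def)
    have neg: "rel (- m) w2 w1" if "m \<in> Q" "w1 \<in> N0" "w2 \<in> N0" "rel m w1 w2" for m w1 w2
      using N3(3)[OF that(1) _ _ that(4)] that by (simp add: N0_def)
    define S where "S j = {w' \<in> N0. \<exists>m\<in>box (j * r). rel m w' y0}" for j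
    have jb: "j * r \<le> b" if "j \<le> Suc Jn" for j
    proof -
      have "j * r \<le> 3 * (Jn + 1) * r" using that by (intro mult_right_mono) auto
      then show ?thesis unfolding b_def .
    qed
    have Sg: "S j \<subseteq> g ` box (j * r)" if "j \<le> Suc Jn" for j
    proof
      fix w' assume "w' \<in> S j"
      then obtain m where m: "w' \<in> N0" "m \<in> box (j * r)" "rel m w' y0" by (auto simp: S_def)
      have mQ: "m \<in> Q" by (rule boxQ[OF m(2) jb[OF that]])
      have "w' = g m" using uniq[OF mQ m(1) _ m(3)] g[OF mQ] by blast
      then show "w' \<in> g ` box (j * r)" using m(2) by blast
    qed
    have Sfin: "finite (S j)" if "j \<le> Suc Jn" for j
      by (rule finite_subset[OF Sg[OF that]]) (simp add: finbox)
    have Scard: "card (S j) \<le> (2 * (j * r) + 1) ^ CARD('k)" if "j \<le> Jn" for j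
    proof -
      have "card (S j) \<le> card (g ` box (j * r))" using Sg[of j] that finbox by (intro card_mono) auto
      also have "\<dots> \<le> card (box (j * r))" by (rule card_image_le[OF finbox(1)])
      also have "\<dots> \<le> (2 * (j * r) + 1) ^ CARD('k)" by (rule finbox(2))
      finally show ?thesis .
    qed
    have "p 0 = q 0" using nd[OF K0] pqx[OF K0] nat_diff_eq_iff[of 0 0 "p 0" "q 0"] by simp
    then have r0: "rel 0 y0 y0" by (simp add: rel_def)
    have y0S: "y0 \<in> S j" for j using r0 y0N K0 by (auto simp: S_def box_def intro!: bexI[of _ 0])
    have S0: "1 \<le> card (S 0)"
    proof -
      have "card {y0} \<le> card (S 0)" by (rule card_mono[OF Sfin]) (use y0S[of 0] in simp_all)
      then show ?thesis by simp
    qed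
    have "\<exists>j<Jn. real (card (S (Suc j))) \<le> (1 + \<delta>) * real (card (S j))" by (rule Jn[OF S0 Scard])
    then obtain j where j: "j < Jn" "real (card (S (Suc j))) \<le> (1 + \<delta>) * real (card (S j))" by blast
    have fS: "finite (S j)" "finite (S (Suc j))" using Sfin j by auto
    have SN: "S j \<subseteq> N0" for j by (auto simp: S_def)
    have "box (j * r) \<subseteq> box (Suc j * r)" by (auto simp: box_def intro: order_trans)
    then have SS: "S j \<subseteq> S (Suc j)" unfolding S_def by blast
    have Sorb: "S j \<subseteq> orbit G y"
    proof
      fix w' assume "w' \<in> S j"
      then obtain m where "rel m w' y0" by (auto simp: S_def)
      then have "(w', nat_diff (p m) (q m), y0) \<in> topspace G" unfolding rel_def arrow_iff by metis
      from orbit_arrow[OF this, of y] show "w' \<in> orbit G y" using y0(1) by simp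
    qed
    have "\<forall>w'. \<exists>m. w' \<in> S j \<longrightarrow> m \<in> box (j * r) \<and> rel m w' y0" by (auto simp: S_def)
    then obtain mm where mm: "\<And>w'. w' \<in> S j \<Longrightarrow> mm w' \<in> box (j * r) \<and> rel (mm w') w' y0" by metis
    have mmQ: "mm w' \<in> Q" if "w' \<in> S j" for w' by (rule boxQ[OF conjunct1[OF mm[OF that]] jb]) (use j(1) in simp)
    have lmbox: "l + mm w' \<in> box (Suc j * r)" if "l \<in> \<Lambda>" "w' \<in> S j" for l w'
      using boxadd[OF \<Lambda>box[OF that(1)], of "mm w'" "j * r"] mm[OF that(2)] by simp
    have lmQ: "l + mm w' \<in> Q" if "l \<in> \<Lambda>" "w' \<in> S j" for l w'
      by (rule boxQ[OF lmbox[OF that] jb]) (use j(1) in simp)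
    have step: "rel (l + mm w1) w2 y0" if "l \<in> \<Lambda>" "w1 \<in> S j" "w2 \<in> N0" "rel l w2 w1" for l w1 w2
      using comp[OF \<Lambda>Q[OF that(1)] mmQ[OF that(2)] that(3) _ y0N that(4)] mm[OF that(2)] that(2) SN by blast
    have count: "(1 - \<delta>) * real (card (S j)) \<le> real (card {w1\<in>S j. \<exists>w2\<in>S j. rel l w2 w1})" if l: "l \<in> \<Lambda>" for l
    proof -
      \<comment> \<open>Degree \<open>l\<close> maps \<open>S j\<close> injectively into \<open>S (Suc j)\<close>, so it leaves
        \<open>S j\<close> at most \<open>card (S (Suc j)) - card (S j)\<close> times.\<close>
      define act where "act w1 = g (l + mm w1)" for w1
      have act: "act w1 \<in> N0" "rel l (act w1) w1" "act w1 \<in> S (Suc j)" if w1: "w1 \<in> S j" for w1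
      proof -
        have a: "act w1 \<in> N0" "rel (l + mm w1) (act w1) y0" using g[OF lmQ[OF l w1]] by (simp_all add: act_def)
        then show "act w1 \<in> N0" by blast
        show "act w1 \<in> S (Suc j)" using a lmbox[OF l w1] by (auto simp: S_def)
        have w1N: "w1 \<in> N0" using w1 SN by blast
        have "rel (- mm w1) y0 w1" using neg[OF mmQ[OF w1] w1N y0N] mm[OF w1] by blast
        moreover have "- mm w1 \<in> Q" using boxminus mmQ[OF w1] by (simp add: Q_def)
        ultimately have "rel ((l + mm w1) + (- mm w1)) (act w1) w1"
          using comp[OF lmQ[OF l w1] _ a(1) y0N w1N a(2)] by blast
        then show "rel l (act w1) w1" by simp
      qed
      have inj: "inj_on act (S j)"
      proof (rule inj_onI)
        fix w1 w2 assume w: "w1 \<in> S j" "w2 \<in> S j" "act w1 = act w2"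
        then have "rel l (act w1) w1" "rel l (act w1) w2" using act(2)[OF w(1)] act(2)[OF w(2)] by simp_all
        then show "w1 = w2" using uniq'[OF \<Lambda>Q[OF l]] w SN by blast
      qed
      let ?A = "{w1\<in>S j. \<exists>w2\<in>S j. rel l w2 w1}"
      have "act ` (S j - ?A) \<subseteq> S (Suc j) - S j" using act by blast
      then have "card (act ` (S j - ?A)) \<le> card (S (Suc j) - S j)" using fS by (intro card_mono) auto
      moreover have "card (act ` (S j - ?A)) = card (S j - ?A)"
        by (rule card_image) (rule inj_on_subset[OF inj], blast)
      moreover have "card (S (Suc j) - S j) = card (S (Suc j)) - card (S j)" using SS fS by (simp add: card_Diff_subset)
      moreover have "card (S j - ?A) = card (S j) - card ?A" using fS by (intro card_Diff_subset) auto
      moreover have "card ?A \<le> card (S j)" "card (S j) \<le> card (S (Suc j))" using fS SS by (auto intro!: card_mono)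
      ultimately have "real (card (S j)) - real (card ?A) \<le> real (card (S (Suc j))) - real (card (S j))" by linarith
      then show ?thesis using j(2) by (simp add: algebra_simps)
    qed
    have phase: "cmod (character (v * w) (l + mm w1 - mm w2) - character z (l + mm w1 - mm w2)) \<le> \<delta>"
      if l: "l \<in> \<Lambda>" and w1: "w1 \<in> S j" and w2: "w2 \<in> S j" and rl: "rel l w2 w1" for l w1 w2
    proof -
      let ?h = "l + mm w1 - mm w2"
      have w2N: "w2 \<in> N0" using w2 SN by blast
      have m2: "- mm w2 \<in> box (j * r)" using boxminus mm[OF w2] by blast
      have m2Q: "- mm w2 \<in> Q" using boxminus mmQ[OF w2] by (simp add: Q_def)
      have "?h = (- mm w2) + (l + mm w1)" by simp
      moreover have "rel ((- mm w2) + (l + mm w1)) y0 y0"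
        using comp[OF m2Q lmQ[OF l w1] y0N w2N y0N] neg[OF mmQ[OF w2] w2N y0N] mm[OF w2] step[OF l w1 w2N rl] by blast
      moreover have "(- mm w2) + (l + mm w1) \<in> Q"
      proof (rule boxQ[OF boxadd[OF m2 lmbox[OF l w1]]])
        have "j * r + Suc j * r \<le> 3 * (Jn + 1) * r"
          unfolding add_mult_distrib[symmetric] using j(1) by (intro mult_right_mono) auto
        then show "j * r + Suc j * r \<le> b" unfolding b_def .
      qed
      ultimately have "character w ?h = 1" "?h \<in> Q" using key[of "(- mm w2) + (l + mm w1)"] by simp_all
      moreover have "cmod (character v ?h - character z ?h) \<le> \<delta>"
        using v \<open>?h \<in> Q\<close> by (auto simp: V_def dist_norm norm_minus_commute intro: less_imp_le)
      ultimately show ?thesis by (simp add: character_mult)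
    qed
    have loc: "cocycle \<gamma> \<in> \<Lambda> \<and> rel (cocycle \<gamma>) (rng \<gamma>) (src \<gamma>)"
      if nz: "f \<gamma> \<noteq> 0" and rs: "rng \<gamma> \<in> N0" "src \<gamma> \<in> N0" for \<gamma>
    proof -
      obtain l where l: "l \<in> \<Lambda>" "\<gamma> \<in> D l" using N(3)[OF nz] rs unfolding N0_def by blast
      then show ?thesis using memD[OF \<Lambda>(2)[OF l(1)]] by (cases \<gamma>) auto
    qed
    have var: "cmod (f (w2, l, w1) - f (x, l, x)) \<le> \<delta>"
      if l: "l \<in> \<Lambda>" and "w1 \<in> S j" "w2 \<in> S j" "rel l w2 w1" for l w1 w2
    proof (rule N4(3)[OF l])
      show "(w2, l, w1) \<in> Z N4 (p l) (q l) N4"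
        using that SN[of j] nd[OF \<Lambda>(2)[OF l]] pqx[OF \<Lambda>(2)[OF l]] by (auto simp: mem_Z rel_def N0_def)
    qed
    obtain \<xi> where \<xi>: "\<xi> \<in> ell2 (orbit G y)" "ell2_norm \<xi> \<le> 1"
      "cmod (ell2_inner (R (v * w) f \<xi>) \<xi> - (\<Sum>l\<in>\<Lambda>. character z l * f (x, l, x))) \<le> real (card \<Lambda>) * ((1 + 2 * M) * \<delta>)"
    proof -
      have "\<exists>\<xi>\<in>ell2 (orbit G y). ell2_norm \<xi> \<le> 1 \<and>
        cmod (ell2_inner (R (v * w) f \<xi>) \<xi> - (\<Sum>l\<in>\<Lambda>. character z l * f (x, l, x))) \<le> real (card \<Lambda>) * ((1 + 2 * M) * \<delta>)"
      proof (rule almost_invariant_vector[OF z ut f fS(1) _ Sorb \<Lambda>(1) less_imp_le[OF \<delta>],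
            where rel=rel and mm=mm and a="\<lambda>l. f (x, l, x)"])
        show "S j \<noteq> {}" using y0S by blast
        show "cocycle \<gamma> \<in> \<Lambda> \<and> rel (cocycle \<gamma>) (rng \<gamma>) (src \<gamma>)" if "f \<gamma> \<noteq> 0" "rng \<gamma> \<in> S j" "src \<gamma> \<in> S j" for \<gamma>
          using loc[OF that(1)] that(2,3) SN by blast
        show "w' = w1" if "l \<in> \<Lambda>" "w \<in> S j" "w' \<in> S j" "w1 \<in> S j" "rel l w' w" "rel l w1 w" for l w w1 w'
          using uniq[OF \<Lambda>Q[OF that(1)] _ _ that(5,6)] that(3,4) SN by blast
      qed (use count phase var M(2) in blast)+
      then show ?thesis using that by blast
    qed
    have "R z f (indicator {x}) x = (\<Sum>\<gamma>\<in>(\<lambda>l. (x, l, x)) ` \<Lambda>. character z (cocycle \<gamma>) * f \<gamma>)"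
      unfolding R_def
    proof (rule sum.mono_neutral_cong)
      show "finite {\<gamma>. f \<gamma> \<noteq> 0 \<and> rng \<gamma> = x}" by (rule Cc_finite_rng[OF f])
      show "finite ((\<lambda>l. (x, l, x)) ` \<Lambda>)" using \<Lambda>(1) by simp
      fix \<gamma> assume g: "\<gamma> \<in> {\<gamma>. f \<gamma> \<noteq> 0 \<and> rng \<gamma> = x} - (\<lambda>l. (x, l, x)) ` \<Lambda>"
      have "src \<gamma> \<noteq> x"
      proof
        assume s: "src \<gamma> = x"
        then have "cocycle \<gamma> \<in> \<Lambda>" using loc[of \<gamma>] g N0(2) by auto
        moreover have "\<gamma> = (x, cocycle \<gamma>, x)" using g s by (intro arrow_eqI) auto
        ultimately show False using g by blast
      qed
      then show "character z (cocycle \<gamma>) * f \<gamma> * indicator {x} (src \<gamma>) = 0" by simp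
    qed auto
    also have "\<dots> = (\<Sum>l\<in>\<Lambda>. character z l * f (x, l, x))"
      by (subst sum.reindex) (auto intro: inj_onI)
    finally show ?thesis using \<xi> \<delta>\<epsilon> by (intro bexI[of _ \<xi>]) auto
  qed
  then show ?thesis by (rule near_saturatedI[OF oY xY oV zV])
qed

end

section \<open>The hull-kernel topology\<close>

context DR
begin

text \<open>Some matrix coefficient of an element of \<open>I\<close> is nonzero. Multiplying on both sides by functions
  that move the base point to the two indices brings it to position \<open>(x, x)\<close>.\<close>

lemma diagonal_coefficient_nonzero:
  assumes z: "z \<in> torus" and I: "closed_ideal (groupoid_cstar G) I" and nI: "\<not> I \<subseteq> orbit_kernel G (x, z)"
  obtains a where "a \<in> I" "orbit_representation G x z a (indicator {x}) x \<noteq> 0"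
proof -
  let ?A = "groupoid_cstar G" and ?L = "orbit_representation G x z" and ?O = "orbit G x"
    and ?e = "to_enveloping (convolution_algebra G)"
  note L = orbit_representation(1)[OF z, of x]
  note L2 = orbit_representation(2)[OF z, where x=x]
  obtain a where aI: "a \<in> I" and ak: "a \<notin> representation_kernel ?A ?O ?L"
    using nI by (auto simp: orbit_kernel_def)
  have a: "a \<in> sa_carrier ?A" using I aI by (auto simp: closed_ideal_def)
  have sa: "sa_star ?A a \<in> sa_carrier ?A" by (rule CA.B_closed(4)[OF a])
  obtain \<xi> where xi: "\<xi> \<in> ell2 ?O" "?L a \<xi> \<noteq> (\<lambda>i. 0)"
    using ak a by (auto simp: representation_kernel_def)
  obtain w where w: "?L a \<xi> w \<noteq> 0" using xi(2) by blast
  have wO: "w \<in> ?O" using ell2_outside[OF star_rep_mem[OF L a xi(1)], of w] w by blast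
  let ?\<eta> = "?L (sa_star ?A a) (indicator {w})"
  have eta: "?\<eta> \<in> ell2 ?O" by (rule star_rep_mem[OF L sa ell2_basis[OF wO]])
  have "?\<eta> \<noteq> (\<lambda>i. 0)"
  proof
    assume "?\<eta> = (\<lambda>i. 0)"
    then show False using star_rep_coord[OF L a xi(1) wO] w by (simp add: ell2_inner_def)
  qed
  then obtain y where y: "?\<eta> y \<noteq> 0" by blast
  have yO: "y \<in> ?O" using ell2_outside[OF eta, of y] y by blast
  have "?L a (indicator {y}) w = cnj (?\<eta> y)"
    using star_rep_coord[OF L a ell2_basis[OF yO] wO] ell2_inner_cnj[of "indicator {y}" ?\<eta>] by simp
  then have nz: "?L a (indicator {y}) w \<noteq> 0" using y by simp
  obtain \<gamma>0 where g0: "\<gamma>0 \<in> topspace G" "rng \<gamma>0 = y" "src \<gamma>0 = x" using orbit_arrowE[OF yO orbit_self] by metis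
  obtain \<gamma>1 where g1: "\<gamma>1 \<in> topspace G" "rng \<gamma>1 = x" "src \<gamma>1 = w" using orbit_arrowE[OF orbit_self wO] by metis
  obtain f0 where f0: "f0 \<in> Cc" "\<And>z. R z f0 (indicator {src \<gamma>0}) = (\<lambda>w. character z (cocycle \<gamma>0) * indicator {rng \<gamma>0} w)"
    using arrow_bump[OF g0(1)] by metis
  obtain f1 where f1: "f1 \<in> Cc" "\<And>z \<xi>. R z f1 \<xi> (rng \<gamma>1) = character z (cocycle \<gamma>1) * \<xi> (src \<gamma>1)"
    using arrow_bump[OF g1(1)] by metis
  have e0: "?e f0 \<in> sa_carrier ?A" and e1: "?e f1 \<in> sa_carrier ?A" using f0(1) f1(1) by simp_all
  let ?a = "sa_mult ?A (?e f1) (sa_mult ?A a (?e f0))"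
  have mI: "sa_mult ?A a (?e f0) \<in> I" using I aI e0 by (simp add: closed_ideal_def)
  have aI': "?a \<in> I" using I mI e1 by (simp add: closed_ideal_def)
  have m: "sa_mult ?A a (?e f0) \<in> sa_carrier ?A" by (rule CA.B_closed(2)[OF a e0])
  have ex: "indicator {x} \<in> ell2 ?O" and ey: "indicator {y} \<in> ell2 ?O" using yO by simp_all
  have "?L (?e f0) (indicator {x}) = (\<lambda>i. character z (cocycle \<gamma>0) * indicator {y} i)"
    using L2[OF f0(1) ex] f0(2)[of z] g0 by simp
  then have 1: "?L (sa_mult ?A a (?e f0)) (indicator {x}) = (\<lambda>i. character z (cocycle \<gamma>0) * ?L a (indicator {y}) i)"
    using star_rep_mult[OF L a e0 ex] bounded_operatorD(3)[OF star_rep_bounded[OF L a] ey] by simp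
  have mem: "?L (sa_mult ?A a (?e f0)) (indicator {x}) \<in> ell2 ?O" by (rule star_rep_mem[OF L m ex])
  have "?L ?a (indicator {x}) x = R z f1 (?L (sa_mult ?A a (?e f0)) (indicator {x})) x"
    using star_rep_mult[OF L e1 m ex] L2[OF f1(1) mem] by simp
  also have "\<dots> = character z (cocycle \<gamma>1) * (character z (cocycle \<gamma>0) * ?L a (indicator {y}) w)"
    using f1(2)[of z "?L (sa_mult ?A a (?e f0)) (indicator {x})"] g1 1 by simp
  finally have "cmod (?L ?a (indicator {x}) x) = cmod (?L a (indicator {y}) w)" using z by (simp add: norm_mult)
  then have "?L ?a (indicator {x}) x \<noteq> 0" using nz by auto
  then show ?thesis by (rule that[OF aI'])
qed

text \<open>A coefficient of size \<open>\<kappa>\<close> at \<open>x\<close> survives an error of \<open>\<kappa> / 4\<close> in each of three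
  places: replacing the element by \<open>f \<in> C\<^sub>c(G)\<close> at \<open>x\<close>, comparing the functionals of \<open>f\<close>, and
  returning from \<open>f\<close> to the element at \<open>y\<close>.\<close>

lemma ideal_not_in_kernel_nearby:
  fixes B :: "('x, 'k) arrow \<Rightarrow> ('x, 'k) arrow set"
  assumes z: "z \<in> torus" and I: "closed_ideal (groupoid_cstar G) I" and nI: "\<not> I \<subseteq> orbit_kernel G (x, z)"
    and B: "\<And>\<alpha>. \<alpha> \<in> J_at x \<Longrightarrow> openin G (B \<alpha>) \<and> \<alpha> \<in> B \<alpha>"
  shows "near_saturated B x z (\<lambda>y u. \<not> I \<subseteq> orbit_kernel G (y, u))"
proof -
  let ?A = "groupoid_cstar G" and ?e = "to_enveloping (convolution_algebra G)"
  obtain a where aI: "a \<in> I" and nz: "orbit_representation G x z a (indicator {x}) x \<noteq> 0"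
    using diagonal_coefficient_nonzero[OF z I nI] by blast
  have a: "a \<in> sa_carrier ?A" using I aI by (auto simp: closed_ideal_def)
  define \<kappa> where "\<kappa> = cmod (orbit_representation G x z a (indicator {x}) x)"
  define \<epsilon> where "\<epsilon> = \<kappa> / 4"
  have \<kappa>: "0 < \<kappa>" "0 < \<epsilon>" using nz by (simp_all add: \<kappa>_def \<epsilon>_def)
  obtain u where u: "u \<in> universal_Cauchy (convolution_algebra G)" "a = universal_class (convolution_algebra G) u"
    using CA.carrier_BE[OF a] by metis
  obtain k where k: "\<forall>m\<ge>k. \<forall>n\<ge>k. universal_norm (convolution_algebra G) (sa_diff (convolution_algebra G) (u m) (u n)) < \<epsilon>"
    using CA.CauD[OF u(1) \<kappa>(2)] by blast
  define f where "f = u k"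
  have f: "f \<in> Cc" unfolding f_def by (rule CA.Cau_carrier[OF u(1)])
  have near: "ell2_norm (\<lambda>i. orbit_representation G y v a \<xi> i - R v f \<xi> i) \<le> \<epsilon> * ell2_norm \<xi>"
    if v: "v \<in> torus" and xi: "\<xi> \<in> ell2 (orbit G y)" for y v \<xi>
    using CA.enveloping_approx[OF orbit_representation(1)[OF v] u(1) xi f, of k \<epsilon>] k
      orbit_representation(2)[OF v f xi] by (simp add: u(2) f_def less_imp_le)
  have ex: "indicator {x} \<in> ell2 (orbit G x)" by simp
  have "cmod (orbit_representation G x z a (indicator {x}) x - R z f (indicator {x}) x) \<le> \<epsilon>"
  proof -
    have m: "(\<lambda>i. orbit_representation G x z a (indicator {x}) i - R z f (indicator {x}) i) \<in> ell2 (orbit G x)"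
      by (rule ell2_diff(1)[OF star_rep_mem[OF orbit_representation(1)[OF z] a ex] R_mem[OF z f ex]])
    show ?thesis using cmod_le_ell2_norm[OF m, of x] near[OF z ex] by simp
  qed
  then have c: "\<kappa> - \<epsilon> \<le> cmod (R z f (indicator {x}) x)"
    unfolding \<kappa>_def using norm_triangle_ineq2[of "orbit_representation G x z a (indicator {x}) x" "R z f (indicator {x}) x"]
    by linarith
  have "near_saturated B x z (\<lambda>y u. \<exists>\<xi>\<in>ell2 (orbit G y). ell2_norm \<xi> \<le> 1 \<and>
      cmod (ell2_inner (R u f \<xi>) \<xi> - R z f (indicator {x}) x) \<le> \<epsilon>)"
    by (rule orbit_functional_approx[OF z f \<kappa>(2)]) (rule B)
  then show ?thesis
  proof (rule near_saturated_mono, intro notI)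
    fix y u
    assume u: "u \<in> torus" and sub: "I \<subseteq> orbit_kernel G (y, u)"
      and ex: "\<exists>\<xi>\<in>ell2 (orbit G y). ell2_norm \<xi> \<le> 1 \<and>
        cmod (ell2_inner (R u f \<xi>) \<xi> - R z f (indicator {x}) x) \<le> \<epsilon>"
    let ?L = "orbit_representation G y u"
    obtain \<xi> where xi: "\<xi> \<in> ell2 (orbit G y)" "ell2_norm \<xi> \<le> 1"
      "cmod (ell2_inner (R u f \<xi>) \<xi> - R z f (indicator {x}) x) \<le> \<epsilon>" using ex by blast
    have "?L a \<xi> = (\<lambda>i. 0)"
      using sub aI xi(1) by (auto simp: orbit_kernel_def representation_kernel_def)
    then have "ell2_norm (\<lambda>i. - R u f \<xi> i) \<le> \<epsilon> * ell2_norm \<xi>" using near[OF u xi(1)] by simp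
    then have "ell2_norm (R u f \<xi>) \<le> \<epsilon> * ell2_norm \<xi>" by (simp add: ell2_norm_minus)
    also have "\<dots> \<le> \<epsilon> * 1" using xi(2) \<kappa>(2) by (intro mult_left_mono) auto
    finally have "ell2_norm (R u f \<xi>) \<le> \<epsilon>" by simp
    then have "ell2_norm (R u f \<xi>) * ell2_norm \<xi> \<le> \<epsilon> * 1"
      using xi(2) \<kappa>(2) by (intro mult_mono) auto
    then have "cmod (ell2_inner (R u f \<xi>) \<xi>) \<le> \<epsilon>"
      using ell2_Cauchy_Schwarz[OF R_mem[OF u f xi(1)] xi(1)] by simp
    moreover have "cmod (R z f (indicator {x}) x) \<le> cmod (ell2_inner (R u f \<xi>) \<xi>) + \<epsilon>"
      using xi(3) norm_triangle_ineq2[of "R z f (indicator {x}) x" "ell2_inner (R u f \<xi>) \<xi>"]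
      by (simp add: norm_minus_commute)
    ultimately show False using c \<kappa>(1) by (simp add: \<epsilon>_def)
  qed
qed

lemma open_set_of_primitive_ideals_nearby:
  fixes B :: "('x, 'k) arrow \<Rightarrow> ('x, 'k) arrow set"
  assumes z: "z \<in> torus"
    and A: "openin (hull_kernel_topology (groupoid_cstar G)) A" and xA: "orbit_kernel G (x, z) \<in> A"
    and B: "\<And>\<alpha>. \<alpha> \<in> J_at x \<Longrightarrow> openin G (B \<alpha>) \<and> \<alpha> \<in> B \<alpha>"
  shows "near_saturated B x z (\<lambda>y u. orbit_kernel G (y, u) \<in> A)"
proof -
  have "generate_topology_on {{P \<in> Prim (groupoid_cstar G). \<not> I \<subseteq> P} | I. closed_ideal (groupoid_cstar G) I} A"
    using A unfolding hull_kernel_topology_def by (rule openin_topology_generated_by)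
  then show ?thesis using xA
  proof (induction A rule: generate_topology_on.induct)
    case Empty then show ?case by simp
  next
    case (Int a b)
    then show ?case using near_saturated_conj[OF Int.IH] by simp
  next
    case (UN K)
    then obtain k where k: "k \<in> K" "orbit_kernel G (x, z) \<in> k" by blast
    from UN.IH[OF this] show ?case by (rule near_saturated_mono) (use k(1) in blast)
  next
    case (Basis s)
    then obtain I where s: "s = {P \<in> Prim (groupoid_cstar G). \<not> I \<subseteq> P}" and I: "closed_ideal (groupoid_cstar G) I" by blast
    have nI: "\<not> I \<subseteq> orbit_kernel G (x, z)" using Basis.prems s by blast
    have "near_saturated B x z (\<lambda>y u. \<not> I \<subseteq> orbit_kernel G (y, u))"
      by (rule ideal_not_in_kernel_nearby[OF z I nI]) (rule B)
    then show ?case by (rule near_saturated_mono) (use orbit_kernel_in_Prim s in blast)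
  qed
qed

text \<open>Units are essential isotropy, since near a unit all arrows of the form used in the transport
  are loops.\<close>

lemma unit_in_J_at: "unit_arrow x \<in> J_at x"
proof -
  have "(x, nat_diff 0 0, x) \<in> essential_isotropy_at G x"
    by (rule essential_isotropy_transport[OF orbit_self open_UNIV]) auto
  then have u: "unit_arrow x \<in> essential_isotropy_at G x" by (simp add: unit_arrow_def)
  then have "unit_arrow x \<in> J"
    using closed_essential_isotropy(2) by (auto simp: essential_isotropy_def)
  then show ?thesis using u by (simp add: closed_essential_isotropy_at_def essential_isotropy_at_def)
qed

end

theorem theorem4p2:
  fixes T :: "nat^'k \<Rightarrow> 'x::{t2_space, second_countable_topology} \<Rightarrow> 'x"
    and A :: "(nat \<Rightarrow> ('x, 'k) arrow \<Rightarrow> complex) set set set"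
    and x :: 'x and z :: "complex^'k"
    and B :: "('x, 'k) arrow \<Rightarrow> ('x, 'k) arrow set"
  assumes "locally_compact_space (euclidean :: 'x topology)"
    and "local_homeo_action T"
    and "openin (hull_kernel_topology (groupoid_cstar (DR_groupoid T))) A"
    and "(x, z) \<in> orbit_kernel_preimage (DR_groupoid T) A"
    and "\<And>\<alpha>. \<alpha> \<in> closed_essential_isotropy_at (DR_groupoid T) x \<Longrightarrow>
           open_bisection (DR_groupoid T) (B \<alpha>) \<and> \<alpha> \<in> B \<alpha> \<and>
           (\<forall>\<gamma>\<in>B \<alpha>. cocycle \<gamma> = cocycle \<alpha>)"
  shows "\<exists>U V. open U \<and> x \<in> U \<and> (\<forall>y\<in>U. unit_arrow y \<in> B (unit_arrow x)) \<and>
           openin (top_of_set torus) V \<and> z \<in> V \<and>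
           saturation (U \<times> V)
             (family_ess (DR_groupoid T) (closed_essential_isotropy_at (DR_groupoid T) x) B)
           \<subseteq> orbit_kernel_preimage (DR_groupoid T) A"
proof -
  interpret DR T by unfold_locales (fact assms)+
  have B: "openin G (B \<alpha>) \<and> \<alpha> \<in> B \<alpha>" if "\<alpha> \<in> J_at x" for \<alpha>
    using assms(5)[OF that] by (simp add: open_bisection_def)
  have z: "z \<in> torus" and xA: "orbit_kernel G (x, z) \<in> A"
    using assms(4) by (simp_all add: orbit_kernel_preimage_def)
  have "near_saturated B x z (\<lambda>y u. orbit_kernel G (y, u) \<in> A)"
    by (rule open_set_of_primitive_ideals_nearby[OF z assms(3) xA]) (rule B)
  from near_saturatedE[OF this] obtain U V where U: "open U" "x \<in> U" "openin (top_of_set torus) V" "z \<in> V" and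
    UV: "\<And>y v w. y \<in> U \<Longrightarrow> v \<in> V \<Longrightarrow> (y, w) \<in> annihilator (family_ess G (J_at x) B) \<Longrightarrow>
      v * w \<in> torus \<and> orbit_kernel G (y, v * w) \<in> A"
    by metis
  have oB: "openin G (B (unit_arrow x))" and uB: "(x, nat_diff 0 0, x) \<in> B (unit_arrow x)"
    using B[OF unit_in_J_at] by (simp_all add: unit_arrow_def)
  obtain P Q where P: "open P" "open Q" "x \<in> P" "x \<in> Q" "Z P 0 0 Q \<subseteq> B (unit_arrow x)"
    using basic_nhd[OF oB uB] by auto
  have "unit_arrow y \<in> B (unit_arrow x)" if "y \<in> P" "y \<in> Q" for y
  proof -
    have "unit_arrow y \<in> Z P 0 0 Q" using that by (simp add: unit_arrow_def mem_Z)
    then show ?thesis using P(5) by blast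
  qed
  moreover have "saturation ((U \<inter> P \<inter> Q) \<times> V) (family_ess G (J_at x) B) \<subseteq> orbit_kernel_preimage G A"
  proof
    fix \<theta> assume "\<theta> \<in> saturation ((U \<inter> P \<inter> Q) \<times> V) (family_ess G (J_at x) B)"
    then obtain y v w where t: "\<theta> = (y, v * w)" "y \<in> U" "v \<in> V" "(y, w) \<in> annihilator (family_ess G (J_at x) B)"
      by (auto simp: saturation_def)
    then show "\<theta> \<in> orbit_kernel_preimage G A" using UV[OF t(2-4)] by (simp add: orbit_kernel_preimage_def)
  qed
  ultimately show ?thesis
    using U P by (intro exI[of _ "U \<inter> P \<inter> Q"] exI[of _ V]) (simp add: open_Int)
qed

end
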